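(* Let $L$ be a cylindrical Lévy process in $U$, $A$ the generator of a strongly continuous semigroup $(T(t))_{t\ge0}$ on $V$, $B\in\mathcal L(U,V)$ and $y_0\in V$. If the mapping $s\mapsto T(s)B$ is stochastically integrable on $[0,T]$ with respect to $L$, then (a progressively measurable modification of) the process $$Y(t)=T(t)y_0+\int_0^tT(t-s)B\,\mathrm dL(s),\qquad t\in[0,T],$$ is a weak solution of the stochastic Cauchy problem $\mathrm dY(t)=AY(t)\,\mathrm dt+B\,\mathrm dL(t)$, $Y(0)=y_0$, on $[0,T]$.
   Context: Let $(\Omega,\mathcal F,P)$ be a probability space and $U,V$ separable real Hilbert spaces (identified with their duals). A cylindrical Lévy process $L$ in $U$ is a family $(L(t))_{t\ge0}$ of linear continuous maps $U\to L^0_P(\Omega;\mathbb R)$ such that for all $u_1,\dots,u_n\in U$ the process $((L(t)u_1,\dots,L(t)u_n))_{t\ge0}$ is a Lévy process in $\mathbb R^n$. A function is regulated if it has only discontinuities of the first kind; $R([0,T];U)$ is the space of regulated functions with sup norm. For $g\in R([0,T];U)$, $\int_0^Tg\,\mathrm dL$ is the real random variable defined for step functions $\sum_k u_k\mathbb 1_{(t_k,t_{k+1}]}$ by $\sum_k(L(t_{k+1})-L(t_k))u_k$ and in general as limit in probability along uniformly convergent step functions; $\int_Ag\,\mathrm dL:=\int_0^T\mathbb 1_Ag\,\mathrm dL$ for Borel $A$. A function $f\colon[0,T]\to\mathcal L(U,V)$ is stochastically integrable w.r.t. $L$ if $f^*(\cdot)v\in R([0,T];U)$ for all $v\in V$ and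 for every Borel $A\subseteq[0,T]$ there is a $V$-valued random variable $I_A=:\int_Af\,\mathrm dL$ with $\langle I_A,v\rangle=\int_Af^*(s)v\,\mathrm dL(s)$ a.s. for all $v\in V$; $\int_0^tT(t-s)B\,\mathrm dL(s)$ means $\int_{[0,t]}$ of $s\mapsto \mathbb 1_{[0,t]}(s)T(t-s)B$. A $V$-valued process $Y$ is weakly Bochner regular if $t\mapsto\langle Y(t),g(t)\rangle$ is integrable on $[0,T]$ a.s. for each $g\in C([0,T];V)$ and for every sequence $(g_n)\subseteq C([0,T];V)$ with $\|g_n\|_\infty\to0$ one has $\int_0^T\langle Y(s),g_n(s)\rangle\,\mathrm ds\to0$ in probability. A $V$-valued progressively measurable process $(Y(t))_{t\in[0,T]}$ is a weak solution of $\mathrm dY=AY\,\mathrm dt+B\,\mathrm dL$, $Y(0)=y_0$, if it is weakly Bochner regular and for every $v\in\mathcal D(A^* )$ and $t\in[0,T]$, almost surely, $\langle Y(t),v\rangle=\langle y_0,v\rangle+\int_0^t\langle Y(s),A^*v\rangle\,\mathrm ds+L(t)(B^*v)$. *)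

theory Defs
  imports "HOL-Probability.Probability"
begin

definition conv_in_prob :: "'w measure \<Rightarrow> (nat \<Rightarrow> 'w \<Rightarrow> real) \<Rightarrow> ('w \<Rightarrow> real) \<Rightarrow> bool" where
  "conv_in_prob M X Y \<longleftrightarrow>
     (\<forall>e>0. (\<lambda>n. measure M {\<omega> \<in> space M. e < \<bar>X n \<omega> - Y \<omega>\<bar>}) \<longlonglongrightarrow> 0)"

definition vec_incr :: "nat \<Rightarrow> (real \<Rightarrow> 'w \<Rightarrow> nat \<Rightarrow> real) \<Rightarrow> real \<Rightarrow> real \<Rightarrow> 'w \<Rightarrow> nat \<Rightarrow> real" where
  "vec_incr n X a b = (\<lambda>\<omega>. \<lambda>i\<in>{..<n}. X b \<omega> i - X a \<omega> i)"

definition levy_process_fin :: "'w measure \<Rightarrow> nat \<Rightarrow> (real \<Rightarrow> 'w \<Rightarrow> nat \<Rightarrow> real) \<Rightarrow> bool" where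
  "levy_process_fin M n X \<longleftrightarrow>
     (\<forall>t\<ge>0. X t \<in> measurable M (PiM {..<n} (\<lambda>_. borel))) \<and>
     (AE \<omega> in M. X 0 \<omega> = (\<lambda>i\<in>{..<n}. 0)) \<and>
     (\<forall>m (t::nat \<Rightarrow> real). 0 \<le> t 0 \<and> (\<forall>k<m. t k \<le> t (Suc k)) \<longrightarrow>
        prob_space.indep_vars M (\<lambda>_. PiM {..<n} (\<lambda>_. borel))
          (\<lambda>k. vec_incr n X (t k) (t (Suc k))) {..<m}) \<and>
     (\<forall>s h. 0 \<le> s \<and> 0 \<le> h \<longrightarrow>
        distr M (PiM {..<n} (\<lambda>_. borel)) (vec_incr n X s (s + h)) =
        distr M (PiM {..<n} (\<lambda>_. borel)) (vec_incr n X 0 h)) \<and>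
     (\<forall>t\<ge>0. \<forall>e>0.
        ((\<lambda>h. measure M {\<omega> \<in> space M.
             e < sqrt (\<Sum>i<n. (X (t + h) \<omega> i - X t \<omega> i)\<^sup>2)}) \<longlongrightarrow> 0)
        (at 0 within {h. 0 \<le> t + h}))"

text \<open>L t u is a representative of the random variable L(t)u; linearity and continuity are
  those of a map into L^0 (a.s. equality, convergence in probability).\<close>

definition cyl_levy :: "'w measure \<Rightarrow> (real \<Rightarrow> 'u::real_normed_vector \<Rightarrow> 'w \<Rightarrow> real) \<Rightarrow> bool" where
  "cyl_levy M L \<longleftrightarrow>
     (\<forall>t u. L t u \<in> borel_measurable M) \<and>
     (\<forall>t a b u w. AE \<omega> in M. L t (a *\<^sub>R u + b *\<^sub>R w) \<omega> = a * L t u \<omega> + b * L t w \<omega>) \<and>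
     (\<forall>t u us. us \<longlonglongrightarrow> u \<longrightarrow> conv_in_prob M (\<lambda>k. L t (us k)) (L t u)) \<and>
     (\<forall>n (us :: nat \<Rightarrow> 'u). levy_process_fin M n (\<lambda>t \<omega>. \<lambda>i\<in>{..<n}. L t (us i) \<omega>))"

definition regulated :: "real \<Rightarrow> (real \<Rightarrow> 'a::topological_space) \<Rightarrow> bool" where
  "regulated T g \<longleftrightarrow>
     (\<forall>t\<in>{0..<T}. \<exists>l. (g \<longlongrightarrow> l) (at t within {t<..T})) \<and>
     (\<forall>t\<in>{0<..T}. \<exists>l. (g \<longlongrightarrow> l) (at t within {0..<t}))"

definition levy_random_measure ::
  "'w measure \<Rightarrow> real \<Rightarrow> (real \<Rightarrow> 'w \<Rightarrow> real) \<Rightarrow> (real set \<Rightarrow> 'w \<Rightarrow> real) \<Rightarrow> bool" where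
  "levy_random_measure M T l \<mu> \<longleftrightarrow>
     (\<forall>A. A \<in> sets borel \<and> A \<subseteq> {0..T} \<longrightarrow> \<mu> A \<in> borel_measurable M) \<and>
     (\<forall>a b. 0 \<le> a \<and> a \<le> b \<and> b \<le> T \<longrightarrow> (AE \<omega> in M. \<mu> {a<..b} \<omega> = l b \<omega> - l a \<omega>)) \<and>
     (AE \<omega> in M. \<mu> {0} \<omega> = 0) \<and>
     (\<forall>A :: nat \<Rightarrow> real set. (\<forall>k. A k \<in> sets borel \<and> A k \<subseteq> {0..T}) \<and> disjoint_family A \<longrightarrow>
        conv_in_prob M (\<lambda>n \<omega>. \<Sum>k<n. \<mu> (A k) \<omega>) (\<mu> (\<Union>k. A k)))"

definition levy_set_int :: "'w measure \<Rightarrow> real \<Rightarrow> (real \<Rightarrow> 'w \<Rightarrow> real) \<Rightarrow> real set \<Rightarrow> ('w \<Rightarrow> real) \<Rightarrow> bool" where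
  "levy_set_int M T l A X \<longleftrightarrow> X \<in> borel_measurable M \<and>
     (\<exists>\<mu>. levy_random_measure M T l \<mu> \<and> (AE \<omega> in M. X \<omega> = \<mu> A \<omega>))"

text \<open>Step functions  sum_k 1_(a_k,b_k] u_k  with 0 <= a_k <= b_k <= T; the integral over a Borel
  set A of a regulated g is the limit in probability of the integrals of 1_A times step functions
  converging uniformly to g on (0,T].\<close>

definition cyl_int :: "'w measure \<Rightarrow> (real \<Rightarrow> 'u::real_normed_vector \<Rightarrow> 'w \<Rightarrow> real) \<Rightarrow> real \<Rightarrow>
    (real \<Rightarrow> 'u) \<Rightarrow> real set \<Rightarrow> ('w \<Rightarrow> real) \<Rightarrow> bool" where
  "cyl_int M L T g A X \<longleftrightarrow> X \<in> borel_measurable M \<and>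
     (\<exists>(n :: nat \<Rightarrow> nat) (a :: nat \<Rightarrow> nat \<Rightarrow> real) (b :: nat \<Rightarrow> nat \<Rightarrow> real) (u :: nat \<Rightarrow> nat \<Rightarrow> 'u)
        (Z :: nat \<Rightarrow> nat \<Rightarrow> 'w \<Rightarrow> real).
        (\<forall>j. \<forall>k<n j. 0 \<le> a j k \<and> a j k \<le> b j k \<and> b j k \<le> T) \<and>
        (\<forall>e>0. \<exists>N. \<forall>j\<ge>N. \<forall>s\<in>{0<..T}.
            norm (g s - (\<Sum>k<n j. indicator {a j k<..b j k} s *\<^sub>R u j k)) < e) \<and>
        (\<forall>j. \<forall>k<n j. levy_set_int M T (\<lambda>t. L t (u j k)) (A \<inter> {a j k<..b j k}) (Z j k)) \<and>
        conv_in_prob M (\<lambda>j \<omega>. \<Sum>k<n j. Z j k \<omega>) X)"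

definition adj :: "('u::real_inner \<Rightarrow>\<^sub>L 'v::real_inner) \<Rightarrow> 'v \<Rightarrow> 'u" where
  "adj F v = (THE u. \<forall>x. inner (blinfun_apply F x) v = inner x u)"

definition adj_dom :: "'v::real_inner set \<Rightarrow> ('v \<Rightarrow> 'v) \<Rightarrow> 'v set" where
  "adj_dom D A = {v. \<exists>w. \<forall>x\<in>D. inner (A x) v = inner x w}"

definition adj_op :: "'v::real_inner set \<Rightarrow> ('v \<Rightarrow> 'v) \<Rightarrow> 'v \<Rightarrow> 'v" where
  "adj_op D A v = (THE w. \<forall>x\<in>D. inner (A x) v = inner x w)"

definition stoch_int_set :: "'w measure \<Rightarrow> (real \<Rightarrow> 'u::real_inner \<Rightarrow> 'w \<Rightarrow> real) \<Rightarrow> real \<Rightarrow>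
    (real \<Rightarrow> ('u \<Rightarrow>\<^sub>L 'v::{real_inner,second_countable_topology})) \<Rightarrow> real set \<Rightarrow> ('w \<Rightarrow> 'v) \<Rightarrow> bool" where
  "stoch_int_set M L T f A I \<longleftrightarrow> I \<in> borel_measurable M \<and>
     (\<forall>v. cyl_int M L T (\<lambda>s. adj (f s) v) A (\<lambda>\<omega>. inner (I \<omega>) v))"

definition stoch_integrable :: "'w measure \<Rightarrow> (real \<Rightarrow> 'u::real_inner \<Rightarrow> 'w \<Rightarrow> real) \<Rightarrow> real \<Rightarrow>
    (real \<Rightarrow> ('u \<Rightarrow>\<^sub>L 'v::{real_inner,second_countable_topology})) \<Rightarrow> bool" where
  "stoch_integrable M L T f \<longleftrightarrow>
     (\<forall>v. regulated T (\<lambda>s. adj (f s) v)) \<and>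
     (\<forall>A. A \<in> sets borel \<and> A \<subseteq> {0..T} \<longrightarrow> (\<exists>I. stoch_int_set M L T f A I))"

definition c0_semigroup :: "(real \<Rightarrow> ('v::real_normed_vector \<Rightarrow>\<^sub>L 'v)) \<Rightarrow> bool" where
  "c0_semigroup S \<longleftrightarrow> S 0 = id_blinfun \<and>
     (\<forall>s t. 0 \<le> s \<and> 0 \<le> t \<longrightarrow> S (s + t) = S s o\<^sub>L S t) \<and>
     (\<forall>x. ((\<lambda>t. blinfun_apply (S t) x) \<longlongrightarrow> x) (at_right 0))"

definition is_generator :: "(real \<Rightarrow> ('v::real_normed_vector \<Rightarrow>\<^sub>L 'v)) \<Rightarrow> 'v set \<Rightarrow> ('v \<Rightarrow> 'v) \<Rightarrow> bool" where
  "is_generator S D A \<longleftrightarrow>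
     D = {x. \<exists>y. ((\<lambda>h. (1 / h) *\<^sub>R (S h x - x)) \<longlongrightarrow> y) (at_right 0)} \<and>
     (\<forall>x\<in>D. ((\<lambda>h. (1 / h) *\<^sub>R (S h x - x)) \<longlongrightarrow> A x) (at_right 0))"

definition nat_filtration :: "'w measure \<Rightarrow> (real \<Rightarrow> 'u \<Rightarrow> 'w \<Rightarrow> real) \<Rightarrow> real \<Rightarrow> 'w measure" where
  "nat_filtration M L t = sigma (space M)
     ({L s u -` B \<inter> space M | s u B. s \<in> {0..t} \<and> B \<in> sets borel} \<union> null_sets M)"

definition prog_measurable :: "'w measure \<Rightarrow> (real \<Rightarrow> 'w measure) \<Rightarrow> real \<Rightarrow>
    (real \<Rightarrow> 'w \<Rightarrow> 'v::topological_space) \<Rightarrow> bool" where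
  "prog_measurable M F T Y \<longleftrightarrow>
     (\<forall>t\<in>{0..T}. (\<lambda>(s, \<omega>). Y s \<omega>) \<in> measurable (restrict_space borel {0..t} \<Otimes>\<^sub>M F t) borel)"

definition weakly_bochner_regular :: "'w measure \<Rightarrow> real \<Rightarrow> (real \<Rightarrow> 'w \<Rightarrow> 'v::real_inner) \<Rightarrow> bool" where
  "weakly_bochner_regular M T Y \<longleftrightarrow>
     (\<forall>g. continuous_on {0..T} g \<longrightarrow>
        (AE \<omega> in M. set_integrable lborel {0..T} (\<lambda>s. inner (Y s \<omega>) (g s)))) \<and>
     (\<forall>gs :: nat \<Rightarrow> real \<Rightarrow> 'v.
        (\<forall>n. continuous_on {0..T} (gs n)) \<and>
        (\<forall>e>0. \<exists>N. \<forall>n\<ge>N. \<forall>s\<in>{0..T}. norm (gs n s) \<le> e) \<longrightarrow>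
        conv_in_prob M (\<lambda>n \<omega>. LINT s:{0..T}|lborel. inner (Y s \<omega>) (gs n s)) (\<lambda>_. 0))"

definition weak_solution :: "'w measure \<Rightarrow> (real \<Rightarrow> 'u::real_inner \<Rightarrow> 'w \<Rightarrow> real) \<Rightarrow> real \<Rightarrow>
    'v::{real_inner,second_countable_topology} set \<Rightarrow> ('v \<Rightarrow> 'v) \<Rightarrow> ('u \<Rightarrow>\<^sub>L 'v) \<Rightarrow> 'v \<Rightarrow>
    (real \<Rightarrow> 'w \<Rightarrow> 'v) \<Rightarrow> bool" where
  "weak_solution M L T D A B y0 Y \<longleftrightarrow>
     prog_measurable M (nat_filtration M L) T Y \<and>
     weakly_bochner_regular M T Y \<and>
     (\<forall>v\<in>adj_dom D A. \<forall>t\<in>{0..T}. AE \<omega> in M.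
        inner (Y t \<omega>) v = inner y0 v + (LINT s:{0..t}|lborel. inner (Y s \<omega>) (adj_op D A v))
                           + L t (adj B v) \<omega>)"

end

theory Submission
  imports Defs
begin

text \<open>Multiplicativity in time of the characteristic functions of \<open>L\<close> shows that the integrals of step
  functions are bounded in probability on the unit ball of \<open>L\<^sup>2([0,T];U)\<close>. By a Nikishin-type argument
  there are then events of probability arbitrarily close to 1 on which the integral is a bounded
  operator from \<open>L\<^sup>2([0,T];U)\<close> to \<open>L\<^sup>1\<close>. Since \<open>L\<close> has stationary independent increments, the
  convolution at time \<open>t\<close> has the same finite-dimensional laws as the integral of \<open>s \<mapsto> T(s)B\<close> over
  \<open>[0,t]\<close>; hence it inherits from the latter that its coordinates assemble to a \<open>V\<close>-valued random
  variable. The \<open>L\<^sup>1\<close> bounds give continuity in probability of the coordinates, and thus a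
  progressively measurable modification and weak Bochner regularity. They also justify the stochastic
  Fubini theorem through Riemann sums, which reduces the weak equation to
  \<open>\<integral>\<^sub>0\<^sup>t T(s)\<^sup>*A\<^sup>*v ds = T(t)\<^sup>*v - v\<close>.\<close>

section \<open>Separable Hilbert spaces\<close>

text \<open>The integrals live in L^0, without moments and without local convexity, so neither a
  Bochner integral in time nor Fubini's theorem applies to them; that is what forces the detour
  through large events. An L^2 norm appears because |1 - E exp(i X)| grows at most quadratically
  when X is multiplied by an integer, and because random signs preserve quadratic forms on average.
  Signs are used a second time to compare the convolution with the forward integral: each signed sum
  of coordinates of the convolution has the law of the corresponding sum for the forward integral,
  and this controls the square sum of all coordinates although only one-dimensional laws are
  compared. A further obstacle lies in the definition of the integral, which accepts only step
  values \<open>u\<close> for which \<open>L\<close> induces a random measure. Such values are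
  extracted from the hypothesis, whose own approximating step functions consist of them; this works
  at positive arguments of \<open>g v\<close> only, and the grids are laid out accordingly.\<close>

fun gram_schmidt :: "(nat \<Rightarrow> 'a::real_inner) \<Rightarrow> nat \<Rightarrow> 'a" where
  "gram_schmidt d n = sgn (d n - (\<Sum>i<n. inner (d n) (gram_schmidt d i) *\<^sub>R gram_schmidt d i))"

declare gram_schmidt.simps [simp del]

text \<open>Zero vectors are allowed, so that finite-dimensional spaces need no separate treatment.\<close>

definition onsys :: "(nat \<Rightarrow> 'a::real_inner) \<Rightarrow> bool" where
  "onsys e \<longleftrightarrow> (\<forall>i j. i \<noteq> j \<longrightarrow> inner (e i) (e j) = 0) \<and> (\<forall>i. e i = 0 \<or> norm (e i) = 1)"

definition onbasis :: "(nat \<Rightarrow> 'a::real_inner) \<Rightarrow> bool" where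
  "onbasis e \<longleftrightarrow> onsys e \<and> (\<forall>x. (\<lambda>n. \<Sum>i<n. inner x (e i) *\<^sub>R e i) \<longlonglongrightarrow> x)"

text \<open>\<open>sgn\<close> maps a vanishing remainder to 0, so a vector that depends linearly on
  its predecessors yields a zero entry instead of an invalid normalisation.\<close>

lemma gram_schmidt_unit: "gram_schmidt d n = 0 \<or> norm (gram_schmidt d n) = 1"
  by (subst (1 2) gram_schmidt.simps) (simp add: norm_sgn)

text \<open>On a unit vector the extra factor is 1, on the zero vector both sides vanish; with this
  identity projections need no case split on zero entries.\<close>

lemma inner_unit_or_zero: "x = 0 \<or> norm x = 1 \<Longrightarrow> inner y x * inner x x = inner y x"
  for x :: "'a::real_inner"
  by (auto simp: dot_square_norm)

text \<open>Strong induction on the larger index: all earlier pairs are orthogonal, so only the i-th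
  term of the subtracted projection meets \<open>gram_schmidt d i\<close>, and it cancels
  \<open>inner (d n) (gram_schmidt d i)\<close>.\<close>

lemma gram_schmidt_orthogonal: "i < n \<Longrightarrow> inner (gram_schmidt d i) (gram_schmidt d n) = 0"
proof (induction n arbitrary: i rule: less_induct)
  case (less n)
  let ?e = "gram_schmidt d"
  have orth: "inner (?e i) (?e j) = 0" if "j < n" "j \<noteq> i" for j
  proof (cases "i < j")
    case True then show ?thesis using less.IH[OF that(1)] by blast
  next
    case False
    then have "j < i" using that by simp
    from less.IH[OF less.prems this] show ?thesis by (simp add: inner_commute)
  qed
  have "inner (?e i) (\<Sum>j<n. inner (d n) (?e j) *\<^sub>R ?e j) = (\<Sum>j<n. if j = i then inner (d n) (?e i) * inner (?e i) (?e i) else 0)"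
    unfolding inner_sum_right by (rule sum.cong) (auto simp: orth)
  also have "\<dots> = inner (d n) (?e i)"
    using less.prems inner_unit_or_zero[OF gram_schmidt_unit] by simp
  finally have "inner (?e i) (d n - (\<Sum>j<n. inner (d n) (?e j) *\<^sub>R ?e j)) = 0"
    by (simp add: inner_diff_right inner_commute)
  then show ?case
    by (subst (2) gram_schmidt.simps) (simp add: sgn_div_norm)
qed

lemma onsys_gram_schmidt: "onsys (gram_schmidt d)"
  unfolding onsys_def using gram_schmidt_unit gram_schmidt_orthogonal
  by (metis inner_commute linorder_neqE_nat)

lemma onsys_inner_sum:
  assumes "onsys e" "finite F"
  shows "inner (\<Sum>i\<in>F. a i *\<^sub>R e i) (e k) = (if k \<in> F then a k * inner (e k) (e k) else 0)"
proof -
  have "inner (\<Sum>i\<in>F. a i *\<^sub>R e i) (e k) = (\<Sum>i\<in>F. if i = k then a k * inner (e k) (e k) else 0)"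
    unfolding inner_sum_left using assms(1) by (intro sum.cong) (auto simp: onsys_def)
  then show ?thesis using assms(2) by simp
qed

lemma onsys_norm_sum:
  assumes "onsys e" "finite F"
  shows "(norm (\<Sum>i\<in>F. a i *\<^sub>R e i))\<^sup>2 = (\<Sum>i\<in>F. (a i)\<^sup>2 * inner (e i) (e i))"
proof -
  have "(norm (\<Sum>i\<in>F. a i *\<^sub>R e i))\<^sup>2 = (\<Sum>i\<in>F. a i * inner (\<Sum>i\<in>F. a i *\<^sub>R e i) (e i))"
    by (simp only: power2_norm_eq_inner inner_sum_right[of "\<Sum>i\<in>F. a i *\<^sub>R e i"] inner_scaleR_right)
  also have "\<dots> = (\<Sum>i\<in>F. (a i)\<^sup>2 * inner (e i) (e i))"
    by (intro sum.cong refl) (simp add: onsys_inner_sum[OF assms] power2_eq_square)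
  finally show ?thesis .
qed

lemma onsys_inner_le: "onsys e \<Longrightarrow> inner (e i) (e i) \<le> 1"
  by (metis onsys_def dot_square_norm inner_zero_left le_numeral_extra(4) one_power2 zero_le_one)

lemma onsys_proj_orth:
  assumes "onsys e"
  shows "inner (x - (\<Sum>i<n. inner x (e i) *\<^sub>R e i)) (\<Sum>i<n. a i *\<^sub>R e i) = 0"
proof -
  have "inner (x - (\<Sum>i<n. inner x (e i) *\<^sub>R e i)) (e k) = 0" if "k < n" for k
    using that assms inner_unit_or_zero[of "e k" x]
    by (auto simp: inner_diff_left onsys_inner_sum[OF assms] onsys_def)
  then show ?thesis by (simp add: inner_sum_right)
qed

lemma onsys_proj_Pythagoras:
  assumes "onsys e"
  shows "(norm x)\<^sup>2 = (norm (x - (\<Sum>i<n. inner x (e i) *\<^sub>R e i)))\<^sup>2 + (norm (\<Sum>i<n. inner x (e i) *\<^sub>R e i))\<^sup>2"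
  (is "_ = (norm (x - ?p))\<^sup>2 + _")
proof -
  have "(norm x)\<^sup>2 = (norm ((x - ?p) + ?p))\<^sup>2" by simp
  also have "\<dots> = (norm (x - ?p))\<^sup>2 + 2 * inner (x - ?p) ?p + (norm ?p)\<^sup>2"
    unfolding power2_norm_eq_inner by (simp only: inner_add_left inner_add_right inner_commute)
  finally show ?thesis using onsys_proj_orth[OF assms] by simp
qed

lemma onsys_norm_sum_proj:
  assumes "onsys e"
  shows "(norm (\<Sum>i<n. inner x (e i) *\<^sub>R e i))\<^sup>2 = (\<Sum>i<n. (inner x (e i))\<^sup>2)"
proof -
  have "(inner x (e i))\<^sup>2 * inner (e i) (e i) = (inner x (e i))\<^sup>2" for i
    using assms inner_unit_or_zero[of "e i" x] by (auto simp: onsys_def power2_eq_square)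
  then show ?thesis
    unfolding onsys_norm_sum[OF assms finite_lessThan] by (intro sum.cong) auto
qed

lemma onsys_Bessel:
  assumes "onsys e"
  shows "(\<Sum>i<n. (inner x (e i))\<^sup>2) \<le> (norm x)\<^sup>2"
  using onsys_proj_Pythagoras[OF assms, of x n] onsys_norm_sum_proj[OF assms, of x n]
  by simp

lemma inner_sgn_self: "inner x (sgn x) = norm x" for x :: "'a::real_inner"
  by (cases "x = 0") (simp_all add: sgn_div_norm dot_square_norm power2_eq_square)

text \<open>\<open>inner x (sgn x) = norm x\<close> makes the last coefficient the norm of the
  remainder, so the last term restores exactly what the projection removed, also when the remainder
  is 0.\<close>

lemma gram_schmidt_span:
  "d n = (\<Sum>i<Suc n. inner (d n) (gram_schmidt d i) *\<^sub>R gram_schmidt d i)"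
proof -
  let ?e = "gram_schmidt d"
  let ?p = "\<Sum>i<n. inner (d n) (?e i) *\<^sub>R ?e i"
  have s: "?e n = sgn (d n - ?p)" by (rule gram_schmidt.simps)
  have "inner ?p (?e n) = 0"
    using onsys_inner_sum[OF onsys_gram_schmidt, of "{..<n}" "\<lambda>i. inner (d n) (?e i)" d n] by simp
  then have "inner (d n) (?e n) = inner (d n - ?p) (?e n)" by (simp add: inner_diff_left)
  also have "\<dots> = norm (d n - ?p)"
    unfolding s by (rule inner_sgn_self)
  finally have "inner (d n) (?e n) *\<^sub>R ?e n = d n - ?p"
    unfolding s sgn_div_norm by (cases "norm (d n - ?p) = 0") simp_all
  then show ?thesis by simp
qed

text \<open>Gram-Schmidt is run on a countable dense set. If d m is close to x, then for n > m the
  projection error of x equals that of x - d m, since d m is reproduced exactly, and a projection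
  error is at most the norm.\<close>

lemma onbasis_exists: "\<exists>e :: nat \<Rightarrow> 'a::{real_inner,second_countable_topology}. onbasis e"
proof -
  obtain C :: "'a set" where C: "countable C" "\<And>X. open X \<Longrightarrow> X \<noteq> {} \<Longrightarrow> \<exists>d\<in>C. d \<in> X"
    using countable_dense_setE by blast
  have "C \<noteq> {}" using C(2)[of UNIV] by auto
  define d where "d = from_nat_into C"
  let ?e = "gram_schmidt d"
  note ons = onsys_gram_schmidt[of d]
  have "(\<lambda>n. \<Sum>i<n. inner x (?e i) *\<^sub>R ?e i) \<longlonglongrightarrow> x" for x
  proof (rule LIMSEQ_I)
    fix r :: real assume "0 < r"
    then obtain y where "y \<in> C" "y \<in> ball x r" using C(2)[of "ball x r"] by auto
    then obtain m where m: "d m \<in> ball x r"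
      unfolding d_def using from_nat_into_surj[OF C(1)] by metis
    have "norm ((\<Sum>i<n. inner x (?e i) *\<^sub>R ?e i) - x) < r" if "n \<ge> Suc m" for n
    proof -
      have "inner (d m) (?e i) = 0" if "i \<ge> Suc m" for i
        using that onsys_inner_sum[OF ons, of "{..<Suc m}" "\<lambda>i. inner (d m) (?e i)" i]
        by (subst gram_schmidt_span) (simp del: sum.lessThan_Suc)
      then have "(\<Sum>i<n. inner (d m) (?e i) *\<^sub>R ?e i) = (\<Sum>i<Suc m. inner (d m) (?e i) *\<^sub>R ?e i)"
        using that by (intro sum.mono_neutral_right) auto
      also have "\<dots> = d m" by (rule gram_schmidt_span[symmetric])
      finally have eq: "x - (\<Sum>i<n. inner x (?e i) *\<^sub>R ?e i)
        = (x - d m) - (\<Sum>i<n. inner (x - d m) (?e i) *\<^sub>R ?e i)"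
        by (simp add: inner_diff_left scaleR_diff_left sum_subtractf)
      have "norm ((x - d m) - (\<Sum>i<n. inner (x - d m) (?e i) *\<^sub>R ?e i)) \<le> norm (x - d m)"
        using onsys_proj_Pythagoras[OF ons, of "x - d m" n]
        by (intro power2_le_imp_le[OF _ norm_ge_zero]) simp
      moreover have "norm (x - d m) < r" using m by (simp add: dist_norm)
      ultimately show ?thesis unfolding norm_minus_commute[of _ x] eq by linarith
    qed
    then show "\<exists>no. \<forall>n\<ge>no. norm ((\<Sum>i<n. inner x (?e i) *\<^sub>R ?e i) - x) < r" by blast
  qed
  then show ?thesis using ons unfolding onbasis_def by blast
qed

lemma onbasis_eqI:
  assumes "onbasis e" "\<And>i. inner x (e i) = inner y (e i)"
  shows "x = y"
proof -
  have "(\<lambda>n. \<Sum>i<n. inner x (e i) *\<^sub>R e i) \<longlonglongrightarrow> x" "(\<lambda>n. \<Sum>i<n. inner x (e i) *\<^sub>R e i) \<longlonglongrightarrow> y"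
    using assms(1) unfolding onbasis_def assms(2)[symmetric] apply simp
    using assms(1) unfolding onbasis_def assms(2) by simp
  then show ?thesis by (rule LIMSEQ_unique)
qed

text \<open>The squared coefficients form a convergent series, and by Pythagoras their Cauchy
  property carries over to the vectors. Zero entries of \<open>e\<close> only turn the equality into
  an inequality.\<close>

lemma onsys_convergent:
  fixes e :: "nat \<Rightarrow> 'a::{real_inner,complete_space}"
  assumes "onsys e" and bd: "\<And>n. (\<Sum>i<n. (a i)\<^sup>2) \<le> K"
  shows "convergent (\<lambda>n. \<Sum>i<n. a i *\<^sub>R e i)"
proof -
  have "incseq (\<lambda>n. \<Sum>i<n. (a i)\<^sup>2)" by (intro incseq_SucI) simp
  then have "convergent (\<lambda>n. \<Sum>i<n. (a i)\<^sup>2)"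
    using incseq_convergent[of "\<lambda>n. \<Sum>i<n. (a i)\<^sup>2" K] bd unfolding convergent_def by metis
  then have C: "Cauchy (\<lambda>n. \<Sum>i<n. (a i)\<^sup>2)" by (rule convergent_Cauchy)
  have main: "(norm ((\<Sum>i<n. a i *\<^sub>R e i) - (\<Sum>i<m. a i *\<^sub>R e i)))\<^sup>2 \<le> \<bar>(\<Sum>i<n. (a i)\<^sup>2) - (\<Sum>i<m. (a i)\<^sup>2)\<bar>"
    if "m \<le> n" for m n
  proof -
    have *: "(\<Sum>i<n. f i) - (\<Sum>i<m. f i) = (\<Sum>i\<in>{m..<n}. f i)" for f :: "nat \<Rightarrow> 'c::ab_group_add"
      using sum_diff_nat_ivl[of 0 m n f] that by (simp add: lessThan_atLeast0)
    have "(norm (\<Sum>i\<in>{m..<n}. a i *\<^sub>R e i))\<^sup>2 = (\<Sum>i\<in>{m..<n}. (a i)\<^sup>2 * inner (e i) (e i))"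
      by (rule onsys_norm_sum[OF assms(1)]) simp
    also have "\<dots> \<le> (\<Sum>i\<in>{m..<n}. (a i)\<^sup>2)"
      by (intro sum_mono mult_left_le) (auto simp: onsys_inner_le[OF assms(1)])
    finally show ?thesis unfolding * by linarith
  qed
  have "Cauchy (\<lambda>n. \<Sum>i<n. a i *\<^sub>R e i)"
  proof (rule CauchyI)
    fix r :: real assume r: "0 < r"
    then obtain N where N: "\<And>m n. m \<ge> N \<Longrightarrow> n \<ge> N \<Longrightarrow> \<bar>(\<Sum>i<m. (a i)\<^sup>2) - (\<Sum>i<n. (a i)\<^sup>2)\<bar> < r\<^sup>2"
      using CauchyD[OF C, of "r\<^sup>2"] by auto
    have "norm ((\<Sum>i<n. a i *\<^sub>R e i) - (\<Sum>i<m. a i *\<^sub>R e i)) < r" if "m \<ge> N" "n \<ge> N" for m n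
    proof -
      have "(norm ((\<Sum>i<n. a i *\<^sub>R e i) - (\<Sum>i<m. a i *\<^sub>R e i)))\<^sup>2 < r\<^sup>2"
        using main[of m n] main[of n m] N[OF that] N[OF that(2,1)]
        by (cases "m \<le> n") (auto simp: norm_minus_commute)
      then show ?thesis using r by (simp add: power2_less_imp_less)
    qed
    then show "\<exists>K. \<forall>m\<ge>K. \<forall>n\<ge>K. norm ((\<Sum>i<m. a i *\<^sub>R e i) - (\<Sum>i<n. a i *\<^sub>R e i)) < r" by blast
  qed
  then show ?thesis by (rule Cauchy_convergent)
qed

lemma Riesz_representation:
  fixes f :: "'a::{real_inner,complete_space,second_countable_topology} \<Rightarrow> real"
  assumes "bounded_linear f"
  shows "\<exists>u. \<forall>x. f x = inner x u"
proof -
  interpret bounded_linear f by fact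
  obtain e :: "nat \<Rightarrow> 'a" where e: "onbasis e" using onbasis_exists by blast
  then have ons: "onsys e" by (simp add: onbasis_def)
  obtain K where K: "K > 0" "\<And>x. norm (f x) \<le> norm x * K" using pos_bounded by blast
  \<comment> \<open>Testing \<open>f\<close> on the truncated candidate for the representing vector
    gives q = f x \<le> K norm x with (norm x)^2 \<le> q, hence q \<le> K^2.\<close>
  have bd: "(\<Sum>i<n. (f (e i))\<^sup>2) \<le> K\<^sup>2" for n
  proof -
    let ?q = "\<Sum>i<n. (f (e i))\<^sup>2" and ?x = "\<Sum>i<n. f (e i) *\<^sub>R e i"
    have q0: "?q \<ge> 0" by (simp add: sum_nonneg)
    have "?q = f ?x" by (simp add: sum scaleR power2_eq_square)
    then have "?q \<le> norm ?x * K" using K(2)[of ?x] by simp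
    then have "?q\<^sup>2 \<le> (norm ?x)\<^sup>2 * K\<^sup>2"
      using q0 by (metis power_mono power_mult_distrib)
    also have "(norm ?x)\<^sup>2 \<le> ?q"
      unfolding onsys_norm_sum[OF ons finite_lessThan]
      by (intro sum_mono mult_left_le) (auto simp: onsys_inner_le[OF ons])
    finally have "?q * ?q \<le> ?q * K\<^sup>2" by (simp add: power2_eq_square mult_right_mono)
    then show ?thesis using q0 by (cases "?q = 0") auto
  qed
  obtain u where u: "(\<lambda>n. \<Sum>i<n. f (e i) *\<^sub>R e i) \<longlonglongrightarrow> u"
    using onsys_convergent[OF ons bd] by (auto simp: convergent_def)
  have "f x = inner x u" for x
  proof (rule LIMSEQ_unique)
    have "(\<lambda>n. f (\<Sum>i<n. inner x (e i) *\<^sub>R e i)) \<longlonglongrightarrow> f x"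
      using e unfolding onbasis_def by (intro tendsto) auto
    then show "(\<lambda>n. \<Sum>i<n. inner x (e i) * f (e i)) \<longlonglongrightarrow> f x" by (simp add: sum scaleR)
    have "(\<lambda>n. inner x (\<Sum>i<n. f (e i) *\<^sub>R e i)) \<longlonglongrightarrow> inner x u" by (intro tendsto_intros u)
    then show "(\<lambda>n. \<Sum>i<n. inner x (e i) * f (e i)) \<longlonglongrightarrow> inner x u"
      by (simp add: inner_sum_right mult.commute)
  qed
  then show ?thesis by blast
qed

section \<open>Adjoints of bounded operators\<close>

lemma inner_adj:
  fixes F :: "'a::{real_inner,complete_space,second_countable_topology} \<Rightarrow>\<^sub>L 'b::real_inner"
  shows "inner (blinfun_apply F x) v = inner x (adj F v)"
proof -
  have "bounded_linear (\<lambda>x. inner (blinfun_apply F x) v)"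
    by (intro bounded_linear_intros)
  from Riesz_representation[OF this] obtain u where u: "\<And>x. inner (F x) v = inner x u" by blast
  \<comment> \<open>\<open>adj\<close> is a definite description: Riesz provides existence, and
    testing with u - u' provides uniqueness.\<close>
  have "adj F v = u"
    unfolding adj_def
  proof (rule the_equality)
    fix u' assume "\<forall>x. inner (F x) v = inner x u'"
    then have "inner (u - u') (u - u') = 0" using u[of "u - u'"] by (simp add: inner_diff_right)
    then show "u' = u" by simp
  qed (simp add: u)
  then show ?thesis using u by simp
qed

lemma inner_eqI:
  fixes x y :: "'a::real_inner"
  assumes "\<And>z. inner z x = inner z y"
  shows "x = y"
  using assms[of "x - y"] by (metis eq_iff_diff_eq_0 inner_diff_right inner_eq_zero_iff)

text \<open>Take z = x. The lemma turns scalar estimates that are uniform in the test vector into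
  norm estimates and thereby replaces vector-valued integration in time.\<close>

lemma norm_le_innerI:
  fixes x :: "'a::real_inner"
  assumes "0 \<le> K" "\<And>z. inner z x \<le> norm z * K"
  shows "norm x \<le> K"
  using assms(2)[of x] assms(1) by (cases "x = 0") (auto simp: dot_square_norm power2_eq_square)

lemma norm_adj_le:
  fixes F :: "'a::{real_inner,complete_space,second_countable_topology} \<Rightarrow>\<^sub>L 'b::real_inner"
  shows "norm (adj F v) \<le> norm F * norm v"
proof (rule norm_le_innerI)
  fix z
  have "inner z (adj F v) \<le> norm (F z) * norm v"
    unfolding inner_adj[symmetric] by (rule norm_cauchy_schwarz)
  also have "\<dots> \<le> (norm F * norm z) * norm v" by (intro mult_right_mono norm_blinfun) simp
  finally show "inner z (adj F v) \<le> norm z * (norm F * norm v)" by (simp add: mult_ac)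
qed simp

lemma adj_linear:
  fixes F :: "'a::{real_inner,complete_space,second_countable_topology} \<Rightarrow>\<^sub>L 'b::real_inner"
  shows "adj F (a *\<^sub>R v + b *\<^sub>R w) = a *\<^sub>R adj F v + b *\<^sub>R adj F w"
  by (rule inner_eqI) (simp add: inner_adj[symmetric] inner_add_right)

lemma adj_scaleR:
  fixes F :: "'a::{real_inner,complete_space,second_countable_topology} \<Rightarrow>\<^sub>L 'b::real_inner"
  shows "adj (c *\<^sub>R F) v = c *\<^sub>R adj F v"
  by (rule inner_eqI) (simp add: inner_adj[symmetric] scaleR_blinfun.rep_eq)

section \<open>Strongly continuous semigroups\<close>

lemma blinfun_almost_norming:
  fixes A :: "'a::real_normed_vector \<Rightarrow>\<^sub>L 'b::real_normed_vector"
  assumes "0 < r"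
  shows "\<exists>x'. norm (x' - x) \<le> r \<and> 2 / 3 * r * norm A \<le> norm (A x')"
proof -
  have "\<exists>y. norm y \<le> r \<and> 2 / 3 * r * norm A \<le> norm (A y)"
  proof (cases "norm A = 0")
    case True then show ?thesis using assms by (intro exI[of _ 0]) auto
  next
    case False
    have "\<exists>y. \<not> norm (A y) \<le> 2 / 3 * norm A * norm y"
    proof (rule ccontr)
      assume "\<nexists>y. \<not> norm (A y) \<le> 2 / 3 * norm A * norm y"
      then have "norm A \<le> 2 / 3 * norm A" by (intro norm_blinfun_bound) auto
      with False show False by simp
    qed
    then obtain y where y: "norm (A y) > 2 / 3 * norm A * norm y"
      unfolding not_le by blast
    then have "y \<noteq> 0" by auto
    let ?z = "(r / norm y) *\<^sub>R y"
    have "norm ?z = r" using \<open>y \<noteq> 0\<close> assms by simp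
    moreover have "norm (A ?z) = r / norm y * norm (A y)" using assms by (simp add: blinfun.scaleR_right)
    moreover have "2 / 3 * r * norm A \<le> r / norm y * norm (A y)"
      using y \<open>y \<noteq> 0\<close> assms by (simp add: field_simps)
    ultimately show ?thesis by (intro exI[of _ ?z]) auto
  qed
  then obtain y where y: "norm y \<le> r" "2 / 3 * r * norm A \<le> norm (A y)" by blast
  \<comment> \<open>A vector y that nearly norms A need not help at the centre x, but one of x + y
    and x - y does at least as well as y. The constant 2/3 has only to exceed 1/2, the relative size
    of the tail of the later steps (1/3)^n.\<close>
  have "A (x + y) - A (x - y) = 2 *\<^sub>R A y"
    by (simp add: blinfun.add_right blinfun.diff_right scaleR_2)
  then have "2 * norm (A y) = norm (A (x + y) - A (x - y))" by simp
  then have "2 * norm (A y) \<le> norm (A (x + y)) + norm (A (x - y))"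
    using norm_triangle_ineq4 by metis
  then have "norm (A y) \<le> norm (A (x + y)) \<or> norm (A y) \<le> norm (A (x - y))" by linarith
  then show ?thesis
  proof
    assume "norm (A y) \<le> norm (A (x + y))"
    then show ?thesis using y by (intro exI[of _ "x + y"]) auto
  next
    assume "norm (A y) \<le> norm (A (x - y))"
    then show ?thesis using y by (intro exI[of _ "x - y"]) auto
  qed
qed

text \<open>Sokal's gliding-hump argument, which avoids the Baire category theorem.\<close>

lemma uniform_boundedness:
  fixes A :: "nat \<Rightarrow> 'a::{real_normed_vector,complete_space} \<Rightarrow>\<^sub>L 'b::real_normed_vector"
  assumes "\<And>x. \<exists>K. \<forall>n. norm (A n x) \<le> K"
  shows "\<exists>K. \<forall>n. norm (A n) \<le> K"
proof (rule ccontr)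
  assume "\<nexists>K. \<forall>n. norm (A n) \<le> K"
  \<comment> \<open>The steps will shrink like 3^-k while the chosen norms grow at least like 4^k,
    so that the products diverge.\<close>
  then have "\<forall>k. \<exists>n. norm (A n) > 4 ^ k" by (meson not_le)
  then obtain f where f: "\<And>k. norm (A (f k)) > 4 ^ k" by metis
  define B where "B k = A (f k)" for k
  have "\<forall>n x. \<exists>x'. norm (x' - x) \<le> (1/3) ^ n \<and> 2 / 3 * (1/3) ^ n * norm (B n) \<le> norm (B n x')"
    using blinfun_almost_norming[of "(1/3) ^ n" for n] by auto
  then obtain g where g: "\<And>n x. norm (g n x - x) \<le> (1/3) ^ n"
      "\<And>n x. 2 / 3 * (1/3) ^ n * norm (B n) \<le> norm (B n (g n x))" by metis
  define X where "X = rec_nat (g 0 0) (\<lambda>n. g (Suc n))"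
  have X_Suc: "X (Suc n) = g (Suc n) (X n)" for n by (simp add: X_def)
  have X1: "norm (X (Suc n) - X n) \<le> (1/3) ^ Suc n" for n unfolding X_Suc by (rule g)
  have X2: "2 / 3 * (1/3) ^ n * norm (B n) \<le> norm (B n (X n))" for n
    using g(2)[of 0 0] g(2)[of n "X (n - 1)"] by (cases n) (auto simp: X_def)
  have X3: "norm (X (n + m) - X n) \<le> 1/2 * (1/3) ^ n - 1/2 * (1/3) ^ (n + m)" for n m
  proof (induction m)
    case (Suc m)
    have "norm (X (n + Suc m) - X n) \<le> norm (X (n + Suc m) - X (n + m)) + norm (X (n + m) - X n)"
      using norm_triangle_ineq[of "X (n + Suc m) - X (n + m)" "X (n + m) - X n"] by simp
    also have "\<dots> \<le> (1/3) ^ Suc (n + m) + (1/2 * (1/3) ^ n - 1/2 * (1/3) ^ (n + m))"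
      using X1[of "n + m"] Suc by (intro add_mono) auto
    finally show ?case by (simp add: field_simps)
  qed simp
  have X4: "norm (X k - X n) \<le> 1/2 * (1/3) ^ n" if "k \<ge> n" for k n
  proof -
    have "norm (X k - X n) \<le> 1/2 * (1/3) ^ n - 1/2 * (1/3) ^ k" using X3[of n "k - n"] that by simp
    moreover have "(1/3) ^ k \<ge> (0::real)" by simp
    ultimately show ?thesis by linarith
  qed
  have "Cauchy X"
  proof (rule CauchyI)
    fix e :: real assume "0 < e"
    then obtain N where N: "(1/3) ^ N < e" using real_arch_pow_inv[of e "1/3"] by auto
    have "norm (X m - X n) < e" if "m \<ge> N" "n \<ge> N" for m n
    proof -
      have "norm (X m - X n) \<le> norm (X m - X N) + norm (X n - X N)"
        using norm_triangle_ineq4[of "X m - X N" "X n - X N"] by simp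
      then show ?thesis using X4[OF that(1)] X4[OF that(2)] N by simp
    qed
    then show "\<exists>M. \<forall>m\<ge>M. \<forall>n\<ge>M. norm (X m - X n) < e" by blast
  qed
  then obtain x where x: "X \<longlonglongrightarrow> x" using Cauchy_convergent by (auto simp: convergent_def)
  obtain K where K: "\<And>n. norm (A n x) \<le> K" using assms by blast
  \<comment> \<open>X n lies within 1/2 (1/3)^n of the limit, whereas the value of B n at X n has
    norm at least 2/3 (1/3)^n norm (B n); the difference 2/3 - 1/2 = 1/6 is left at the limit
    itself.\<close>
  have "1/6 * (4/3) ^ n \<le> K" for n
  proof -
    have "norm (x - X n) \<le> 1/2 * (1/3) ^ n"
    proof (rule LIMSEQ_le_const2)
      show "(\<lambda>k. norm (X k - X n)) \<longlonglongrightarrow> norm (x - X n)" by (intro tendsto_intros x)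
      show "\<exists>N. \<forall>k\<ge>N. norm (X k - X n) \<le> 1/2 * (1/3) ^ n" using X4 by blast
    qed
    then have "norm (B n) * norm (x - X n) \<le> norm (B n) * (1/2 * (1/3) ^ n)"
      by (intro mult_left_mono) auto
    moreover have "norm (B n (X n)) \<le> norm (B n x) + norm (B n) * norm (x - X n)"
    proof -
      have "norm (B n (X n)) \<le> norm (B n x) + norm (B n x - B n (X n))"
        by (rule norm_triangle_sub[of "B n (X n)" "B n x", unfolded norm_minus_commute[of "B n (X n)"]])
      also have "norm (B n x - B n (X n)) \<le> norm (B n) * norm (x - X n)"
        unfolding blinfun.diff_right[symmetric] by (rule norm_blinfun)
      finally show ?thesis by simp
    qed
    moreover have "norm (B n x) \<le> K" unfolding B_def by (rule K)
    ultimately have "1/6 * ((1/3) ^ n * norm (B n)) \<le> K" using X2[of n]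
      unfolding mult.assoc mult.left_commute[of _ "1/2"] mult.commute[of "norm (B n)"] by linarith
    then have "1/6 * (1/3) ^ n * norm (B n) \<le> K" by (simp only: mult.assoc)
    moreover have "1/6 * (1/3) ^ n * 4 ^ n \<le> 1/6 * (1/3) ^ n * norm (B n)"
      using f[of n] unfolding B_def by (intro mult_left_mono) auto
    ultimately show ?thesis by (simp add: power_mult_distrib[symmetric] mult.assoc power_divide)
  qed
  moreover obtain n where "6 * K < (4/3) ^ n" using real_arch_pow[of "4/3" "6 * K"] by auto
  ultimately have "1/6 * (4/3) ^ n \<le> K" "6 * K < (4/3) ^ n" by blast+
  then show False by linarith
qed

section \<open>Local boundedness and continuity of semigroups\<close>

lemma c0_semigroupD:
  assumes "c0_semigroup S"
  shows "S 0 = id_blinfun" "0 \<le> s \<Longrightarrow> 0 \<le> t \<Longrightarrow> S (s + t) = S s o\<^sub>L S t"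
    "((\<lambda>t. S t x) \<longlongrightarrow> x) (at_right 0)"
  using assms unfolding c0_semigroup_def by blast+

lemma c0_semigroup_near_0:
  assumes "c0_semigroup S" "0 < e"
  shows "\<exists>d>0. \<forall>h. 0 \<le> h \<and> h < d \<longrightarrow> norm (S h x - x) < e"
proof -
  from c0_semigroupD(3)[OF assms(1), of x] assms(2)
  have "eventually (\<lambda>h. norm (S h x - x) < e) (at_right 0)" by (auto simp: tendsto_iff dist_norm)
  then obtain d where d: "d > 0" "\<And>h. 0 < h \<Longrightarrow> h < d \<Longrightarrow> norm (S h x - x) < e"
    by (auto simp: eventually_at_right_field)
  then have "norm (S h x - x) < e" if "0 \<le> h" "h < d" for h
    using that assms(2) c0_semigroupD(1)[OF assms(1)] by (cases "h = 0") auto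
  then show ?thesis using d(1) by blast
qed

text \<open>Were the norms unbounded near 0, some t n tending to 0 would have norm (S (t n)) > n
  although all orbits along t n converge, against uniform boundedness. The semigroup law extends the
  bound from [0,d] to every multiple of d.\<close>

lemma c0_semigroup_bounded:
  fixes S :: "real \<Rightarrow> ('v::{real_normed_vector,complete_space} \<Rightarrow>\<^sub>L 'v)"
  assumes S: "c0_semigroup S"
  shows "\<exists>K>0. \<forall>t\<in>{0..T}. norm (S t) \<le> K"
proof -
  have "\<exists>d>0. \<exists>K. \<forall>t. 0 \<le> t \<and> t \<le> d \<longrightarrow> norm (S t) \<le> K"
  proof (rule ccontr)
    assume *: "\<not> (\<exists>d>0. \<exists>K. \<forall>t. 0 \<le> t \<and> t \<le> d \<longrightarrow> norm (S t) \<le> K)"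
    have "\<forall>n. \<exists>t. 0 \<le> t \<and> t \<le> inverse (real (Suc n)) \<and> norm (S t) > real n"
    proof
      fix n
      have "inverse (real (Suc n)) > 0" by simp
      with * show "\<exists>t. 0 \<le> t \<and> t \<le> inverse (real (Suc n)) \<and> norm (S t) > real n"
        by (meson not_le)
    qed
    then obtain t where t: "\<And>n. 0 \<le> t n" "\<And>n. t n \<le> inverse (real (Suc n))" "\<And>n. norm (S (t n)) > real n"
      by metis
    have t0: "t \<longlonglongrightarrow> 0"
      by (rule tendsto_sandwich[OF _ _ tendsto_const LIMSEQ_inverse_real_of_nat]) (use t in auto)
    have "\<exists>K. \<forall>n. norm (S (t n) x) \<le> K" for x
    proof -
      have "(\<lambda>n. S (t n) x) \<longlonglongrightarrow> x"
      proof (rule LIMSEQ_I)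
        fix r :: real assume "0 < r"
        from c0_semigroup_near_0[OF S this, of x] obtain d
          where d: "d > 0" "\<And>h. 0 \<le> h \<Longrightarrow> h < d \<Longrightarrow> norm (S h x - x) < r" by blast
        from LIMSEQ_D[OF t0 d(1)] show "\<exists>no. \<forall>n\<ge>no. norm (S (t n) x - x) < r"
          using d t(1) by auto
      qed
      then have "Bseq (\<lambda>n. S (t n) x)" using convergent_imp_Bseq convergent_def by blast
      then show ?thesis by (auto simp: Bseq_def)
    qed
    from uniform_boundedness[OF this] obtain K where K: "\<And>n. norm (S (t n)) \<le> K" by blast
    obtain n where "real n > K" using reals_Archimedean2 by blast
    then show False using K[of n] t(3)[of n] by linarith
  qed
  then obtain d K where d: "d > 0" and K: "\<And>t. 0 \<le> t \<Longrightarrow> t \<le> d \<Longrightarrow> norm (S t) \<le> K" by blast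
  have "\<exists>K. \<forall>t. 0 \<le> t \<and> t \<le> real n * d \<longrightarrow> norm (S t) \<le> K" for n
  proof (induction n)
    case 0 then show ?case by (intro exI[of _ "norm (S 0)"]) (auto simp: order_antisym_conv)
  next
    case (Suc n)
    then obtain K' where K': "\<And>t. 0 \<le> t \<Longrightarrow> t \<le> real n * d \<Longrightarrow> norm (S t) \<le> K'" by blast
    have K'0: "K' \<ge> 0" using order_trans[OF norm_ge_zero K'[of 0]] d by simp
    have "norm (S t) \<le> max K' (K' * K)" if "0 \<le> t" "t \<le> real (Suc n) * d" for t
    proof (cases "t \<le> real n * d")
      case True then show ?thesis using K'[of t] that by simp
    next
      case False
      then have t: "t = real n * d + (t - real n * d)" "0 \<le> t - real n * d" "t - real n * d \<le> d"
        using that by (auto simp: algebra_simps)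
      have "S t = S (real n * d) o\<^sub>L S (t - real n * d)"
        using c0_semigroupD(2)[OF S, of "real n * d" "t - real n * d"] t d by simp
      then have "norm (S t) \<le> norm (S (real n * d)) * norm (S (t - real n * d))"
        by (simp add: norm_blinfun_compose)
      also have "\<dots> \<le> K' * K"
        using K'[of "real n * d"] K[of "t - real n * d"] d t K'0 by (intro mult_mono) auto
      finally show ?thesis by simp
    qed
    then show ?case by blast
  qed
  moreover obtain n where "T / d \<le> real n" using real_arch_simple by blast
  ultimately obtain K' where "\<And>t. 0 \<le> t \<Longrightarrow> t \<le> real n * d \<Longrightarrow> norm (S t) \<le> K'" by blast
  then have "norm (S t) \<le> max K' 1" if "t \<in> {0..T}" for t
  proof -
    have "T \<le> real n * d" using d \<open>T / d \<le> real n\<close> by (simp add: field_simps)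
    then have "norm (S t) \<le> K'" using that \<open>\<And>t. 0 \<le> t \<Longrightarrow> t \<le> real n * d \<Longrightarrow> norm (S t) \<le> K'\<close>[of t] by auto
    then show ?thesis by simp
  qed
  then show ?thesis by (intro exI[of _ "max K' 1"]) auto
qed

text \<open>Strong continuity is assumed only from the right at 0. Factoring out the operator at the
  smaller time reduces any increment to one at 0, and the local bound of the norms makes this work
  from the left as well.\<close>

lemma c0_semigroup_continuous:
  fixes S :: "real \<Rightarrow> ('v::{real_normed_vector,complete_space} \<Rightarrow>\<^sub>L 'v)"
  assumes S: "c0_semigroup S"
  shows "continuous_on {0..} (\<lambda>t. S t x)"
proof (rule continuous_on_iff[THEN iffD2], intro ballI allI impI)
  fix t e :: real assume t: "t \<in> {0..}" and e: "0 < e"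
  obtain K where K: "K > 0" "\<And>s. s \<in> {0..t+1} \<Longrightarrow> norm (S s) \<le> K"
    using c0_semigroup_bounded[OF S] by blast
  obtain d where d: "d > 0" "\<And>h. 0 \<le> h \<Longrightarrow> h < d \<Longrightarrow> norm (S h x - x) < e / K"
    using c0_semigroup_near_0[OF S, of "e / K" x] e K by auto
  have main: "norm (S b x - S a x) < e" if "0 \<le> a" "a \<le> b" "a \<le> t + 1" "b - a < d" for a b
  proof -
    have "S b x - S a x = S a (S (b - a) x - x)"
      using c0_semigroupD(2)[OF S, of a "b - a"] that by (simp add: blinfun.diff_right)
    then have "norm (S b x - S a x) \<le> norm (S a) * norm (S (b - a) x - x)"
      by (simp add: norm_blinfun)
    also have "\<dots> \<le> K * norm (S (b - a) x - x)" using K(2)[of a] that by (intro mult_right_mono) auto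
    also have "\<dots> < e" using d(2)[of "b - a"] that K(1) by (simp add: field_simps)
    finally show ?thesis .
  qed
  show "\<exists>d>0. \<forall>x'\<in>{0..}. dist x' t < d \<longrightarrow> dist (S x' x) (S t x) < e"
  proof (intro exI[of _ "min d 1"] conjI ballI impI)
    fix s assume "s \<in> {0..}" "dist s t < min d 1"
    then show "dist (S s x) (S t x) < e"
      using main[of s t] main[of t s] t
      by (cases "s \<le> t") (auto simp: dist_norm norm_minus_commute abs_if split: if_splits)
  qed (use d in auto)
qed

section \<open>Orbit integrals, the generator and its adjoint\<close>

lemma integral_translate:
  fixes f :: "real \<Rightarrow> 'a::banach"
  assumes "continuous_on {0..} f" "0 \<le> a" "0 \<le> c"
  shows "integral {a..b} (\<lambda>s. f (s + c)) = integral {a + c..b + c} f"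
proof -
  have "f integrable_on {a + c..b + c}"
    by (intro integrable_continuous_real continuous_on_subset[OF assms(1)]) (use assms in auto)
  from has_integral_affinity[OF integrable_integral[OF this[folded box_real(2)]], of 1 c]
  show ?thesis by (auto simp: integral_unique image_add_atLeastAtMost simp del: add_uminus_conv_diff)
qed

text \<open>Only the two boundary windows survive a shift. The difference quotient of orbit
  integrals and the linear bound for \<open>\<phi>\<close> both start from this
  cancellation.\<close>

lemma integral_translate_diff:
  fixes f :: "real \<Rightarrow> 'a::banach"
  assumes "continuous_on {0..} f" "0 \<le> a" "a \<le> b" "0 \<le> h"
  shows "integral {a..b} (\<lambda>s. f (s + h)) - integral {a..b} f = integral {b..b + h} f - integral {a..a + h} f"
proof -
  have i: "f integrable_on {x..y}" if "0 \<le> x" for x y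
    by (intro integrable_continuous_real continuous_on_subset[OF assms(1)]) (use that in auto)
  have "integral {a..a+h} f + integral {a+h..b+h} f = integral {a..b+h} f"
    by (rule Henstock_Kurzweil_Integration.integral_combine) (use assms i in auto)
  moreover have "integral {a..b} f + integral {b..b+h} f = integral {a..b+h} f"
    by (rule Henstock_Kurzweil_Integration.integral_combine) (use assms i in auto)
  ultimately show ?thesis using integral_translate[OF assms(1,2,4), of b] by (simp add: algebra_simps)
qed

text \<open>A quantitative fundamental theorem of calculus; it stands in for differentiation
  wherever an integrand is nearly constant on a short interval.\<close>

lemma integral_near_const:
  fixes f :: "real \<Rightarrow> real"
  assumes "continuous_on {0..} f" "0 \<le> a" "0 \<le> h" "\<And>s. s \<in> {a..a+h} \<Longrightarrow> \<bar>f s - c\<bar> \<le> e"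
  shows "\<bar>integral {a..a+h} f - h * c\<bar> \<le> e * h"
proof -
  have i: "f integrable_on {a..a+h}"
    by (intro integrable_continuous_real continuous_on_subset[OF assms(1)]) (use assms in auto)
  then have "integral {a..a+h} (\<lambda>s. f s - c) = integral {a..a+h} f - h * c"
    using assms by (subst integral_diff) (auto)
  moreover have "norm (integral {a..a+h} (\<lambda>s. f s - c)) \<le> e * (a + h - a)"
    by (rule integral_bound) (use assms in \<open>auto intro!: continuous_intros continuous_on_subset[OF assms(1)]\<close>)
  ultimately show ?thesis by simp
qed

text \<open>The integral of an orbit is defined weakly, by Riesz representation.\<close>

lemma generator_orbit_integral:
  fixes S :: "real \<Rightarrow> ('v::{real_inner,complete_space,second_countable_topology} \<Rightarrow>\<^sub>L 'v)"
  assumes S: "c0_semigroup S" and gen: "is_generator S D A" and ab: "0 \<le> a" "a \<le> b"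
  shows "\<exists>z\<in>D. A z = S b y - S a y \<and> (\<forall>x. inner z x = integral {a..b} (\<lambda>s. inner (S s y) x))"
proof -
  have cont: "continuous_on {0..} (\<lambda>s. inner (S s y) x)" for x
    by (intro continuous_intros c0_semigroup_continuous[OF S])
  have int: "(\<lambda>s. inner (S s y) x) integrable_on {a..b}" for x
    by (intro integrable_continuous_real continuous_on_subset[OF cont]) (use ab in auto)
  obtain K where K: "K > 0" "\<And>t. t \<in> {0..b} \<Longrightarrow> norm (S t) \<le> K"
    using c0_semigroup_bounded[OF S] by blast
  have bl: "bounded_linear (\<lambda>x. integral {a..b} (\<lambda>s. inner (S s y) x))"
  proof (rule bounded_linear_intro)
    fix x x' show "integral {a..b} (\<lambda>s. inner (S s y) (x + x')) =
        integral {a..b} (\<lambda>s. inner (S s y) x) + integral {a..b} (\<lambda>s. inner (S s y) x')"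
      by (simp add: inner_add_right integral_add int)
  next
    fix r x show "integral {a..b} (\<lambda>s. inner (S s y) (r *\<^sub>R x)) = r *\<^sub>R integral {a..b} (\<lambda>s. inner (S s y) x)"
      by simp
  next
    fix x
    have "norm (integral {a..b} (\<lambda>s. inner (S s y) x)) \<le> (K * norm y * norm x) * (b - a)"
    proof (rule integral_bound[OF ab(2)])
      show "continuous_on {a..b} (\<lambda>s. inner (S s y) x)" by (rule continuous_on_subset[OF cont]) (use ab in auto)
      fix t assume "t \<in> {a..b}"
      then have "norm (S t) \<le> K" using K ab by auto
      then have "norm (S t y) \<le> K * norm y" by (meson mult_right_mono norm_blinfun norm_ge_zero order_trans)
      then show "norm (inner (S t y) x) \<le> K * norm y * norm x"
        by (metis Cauchy_Schwarz_ineq2 mult_right_mono norm_ge_zero order_trans real_norm_def)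
    qed
    then show "norm (integral {a..b} (\<lambda>s. inner (S s y) x)) \<le> norm x * (K * norm y * (b - a))"
      by (simp add: mult_ac)
  qed
  from Riesz_representation[OF bl] obtain z where
    z: "\<And>x. inner z x = integral {a..b} (\<lambda>s. inner (S s y) x)" by (metis inner_commute)
  \<comment> \<open>Applying S h shifts the window of the weak integral z, so the difference
    quotient is the mean over [b,b+h] minus the mean over [a,a+h]. Each mean is within e/3 of its
    limit, uniformly in the test vector, whence 2 e/3 in norm.\<close>
  have lim: "((\<lambda>h. (1 / h) *\<^sub>R (S h z - z)) \<longlongrightarrow> S b y - S a y) (at_right 0)"
  proof (rule tendstoI)
    fix e :: real assume e: "0 < e"
    have near: "\<exists>d>0. \<forall>s. c \<le> s \<and> s < c + d \<longrightarrow> norm (S s y - S c y) \<le> e / 3" if "0 \<le> c" for c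
      using c0_semigroup_continuous[OF S, of y, unfolded continuous_on_iff, rule_format, of c "e / 3"] that e
      by (force simp: dist_norm intro: less_imp_le)
    obtain d1 where d1: "d1 > 0" "\<And>s. a \<le> s \<Longrightarrow> s < a + d1 \<Longrightarrow> norm (S s y - S a y) \<le> e / 3"
      using near[of a] ab by blast
    obtain d2 where d2: "d2 > 0" "\<And>s. b \<le> s \<Longrightarrow> s < b + d2 \<Longrightarrow> norm (S s y - S b y) \<le> e / 3"
      using near[of b] ab by auto
    have "norm ((1 / h) *\<^sub>R (S h z - z) - (S b y - S a y)) \<le> 2 * e / 3" if h: "0 < h" "h < min d1 d2" for h
    proof (rule norm_le_innerI)
      fix x
      let ?f = "\<lambda>s. inner (S s y) x"
      have "inner (S h z) x = integral {a..b} (\<lambda>s. ?f (s + h))"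
      proof -
        have "inner (S h z) x = integral {a..b} (\<lambda>s. inner (S s y) (adj (S h) x))"
          unfolding inner_adj z ..
        also have "\<dots> = integral {a..b} (\<lambda>s. ?f (s + h))"
        proof (rule integral_cong)
          fix s assume "s \<in> {a..b}"
          then show "inner (S s y) (adj (S h) x) = inner (S (s + h) y) x"
            using c0_semigroupD(2)[OF S, of h s] ab h by (simp add: inner_adj[symmetric] add.commute)
        qed
        finally show ?thesis .
      qed
      then have eq: "inner (S h z - z) x = integral {b..b+h} ?f - integral {a..a+h} ?f"
        using integral_translate_diff[OF cont, of a b h x] ab h by (simp add: inner_diff_left z)
      have bd: "\<bar>inner (S s y) x - inner (S c y) x\<bar> \<le> e / 3 * norm x" if "norm (S s y - S c y) \<le> e / 3" for s c
        unfolding inner_diff_left[symmetric]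
        by (rule order_trans[OF Cauchy_Schwarz_ineq2]) (use mult_right_mono[OF that norm_ge_zero] in simp)
      have "\<bar>integral {b..b+h} ?f - h * ?f b\<bar> \<le> e / 3 * norm x * h"
        by (rule integral_near_const[OF cont]) (use ab h d2 bd in auto)
      moreover have "\<bar>integral {a..a+h} ?f - h * ?f a\<bar> \<le> e / 3 * norm x * h"
        by (rule integral_near_const[OF cont]) (use ab h d1 bd in auto)
      ultimately have "inner (S h z - z) x - h * (?f b - ?f a) \<le> 2 * (e / 3 * norm x * h)"
        unfolding eq right_diff_distrib by linarith
      moreover have "inner x ((1 / h) *\<^sub>R (S h z - z) - (S b y - S a y))
          = (inner (S h z - z) x - h * (?f b - ?f a)) / h"
        using h by (simp only: inner_diff_right inner_diff_left inner_scaleR_right inner_commute[of x])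
          (simp add: field_simps)
      ultimately show "inner x ((1 / h) *\<^sub>R (S h z - z) - (S b y - S a y)) \<le> norm x * (2 * e / 3)"
        using h by (simp add: divide_le_eq mult_ac)
    qed (use e in auto)
    then have "\<forall>h>0. h < min d1 d2 \<longrightarrow> dist ((1 / h) *\<^sub>R (S h z - z)) (S b y - S a y) < e"
      using e by (fastforce simp: dist_norm)
    then show "\<forall>\<^sub>F h in at_right 0. dist ((1 / h) *\<^sub>R (S h z - z)) (S b y - S a y) < e"
      unfolding eventually_at_right_field using d1 d2 by (intro exI[of _ "min d1 d2"]) auto
  qed
  have zD: "z \<in> D" using gen lim unfolding is_generator_def by auto
  then have "((\<lambda>h. (1 / h) *\<^sub>R (S h z - z)) \<longlongrightarrow> A z) (at_right 0)"
    using gen unfolding is_generator_def by blast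
  then have "A z = S b y - S a y" using lim by (rule tendsto_unique[OF trivial_limit_at_right_real])
  then show ?thesis using zD z by blast
qed

text \<open>\<open>adj_op\<close> is a definite description, and uniqueness amounts to density of D:
  a y not orthogonal to w' - w would give an orbit integral over a short interval that lies in D and
  is not orthogonal either.\<close>

lemma adj_op_inner:
  fixes S :: "real \<Rightarrow> ('v::{real_inner,complete_space,second_countable_topology} \<Rightarrow>\<^sub>L 'v)"
  assumes S: "c0_semigroup S" and gen: "is_generator S D A" and v: "v \<in> adj_dom D A" and x: "x \<in> D"
  shows "inner (A x) v = inner x (adj_op D A v)"
proof -
  from v obtain w where w: "\<forall>x\<in>D. inner (A x) v = inner x w" unfolding adj_dom_def by blast
  have "adj_op D A v = w"
    unfolding adj_op_def
  proof (rule the_equality[where P = "\<lambda>w. \<forall>x\<in>D. inner (A x) v = inner x w", OF w])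
    fix w' assume w': "\<forall>x\<in>D. inner (A x) v = inner x w'"
    have "inner y (w' - w) = 0" for y
    proof (rule ccontr)
      assume ne: "inner y (w' - w) \<noteq> 0"
      let ?f = "\<lambda>s. inner (S s y) (w' - w)"
      have cont: "continuous_on {0..} ?f" by (intro continuous_intros c0_semigroup_continuous[OF S])
      \<comment> \<open>Up to time d the integrand stays within half of its initial value, so its
        integral over [0,d/2] cannot vanish.\<close>
      then obtain d where d: "d > 0" "\<And>s. 0 \<le> s \<Longrightarrow> s < d \<Longrightarrow> \<bar>?f s - ?f 0\<bar> < \<bar>?f 0\<bar> / 2"
        using cont[unfolded continuous_on_iff, rule_format, of 0 "\<bar>?f 0\<bar> / 2"] ne c0_semigroupD(1)[OF S]
        by (auto simp: dist_real_def)
      obtain z where z: "z \<in> D" "\<And>x. inner z x = integral {0..d/2} (\<lambda>s. inner (S s y) x)"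
        using generator_orbit_integral[OF S gen, of 0 "d/2" y] d by auto
      have "integral {0..0+d/2} ?f = 0" using w w' z(1) z(2)[of "w' - w"] by (auto simp: inner_diff_right)
      moreover have "\<bar>integral {0..0+d/2} ?f - d/2 * ?f 0\<bar> \<le> (\<bar>?f 0\<bar> / 2) * (d/2)"
        by (rule integral_near_const[OF cont]) (use d in \<open>auto intro: less_imp_le\<close>)
      ultimately have "d/2 * \<bar>?f 0\<bar> \<le> (\<bar>?f 0\<bar> / 2) * (d/2)" using d by (simp add: abs_mult)
      then show False using ne d c0_semigroupD(1)[OF S] by (simp add: field_simps)
    qed
    then show "w' = w" by (metis eq_iff_diff_eq_0 inner_eq_zero_iff)
  qed
  then show ?thesis using w x by simp
qed

text \<open>The orbit integral lies in D and \<open>A\<close> maps it to the increment of the orbit;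
  moving \<open>A\<close> to the other side gives the identity. The generator enters the stochastic
  part only in this form.\<close>

lemma semigroup_weak_integral:
  fixes S :: "real \<Rightarrow> ('v::{real_inner,complete_space,second_countable_topology} \<Rightarrow>\<^sub>L 'v)"
  assumes S: "c0_semigroup S" and gen: "is_generator S D A" and v: "v \<in> adj_dom D A"
    and ab: "0 \<le> a" "a \<le> b"
  shows "inner (S b y) v - inner (S a y) v = integral {a..b} (\<lambda>s. inner (S s y) (adj_op D A v))"
  using generator_orbit_integral[OF S gen ab, of y] adj_op_inner[OF S gen v]
  by (metis inner_diff_left)

section \<open>Convergence in probability\<close>

context prob_space
begin

definition ptail :: "('a \<Rightarrow> real) \<Rightarrow> real \<Rightarrow> real" where
  "ptail X c = prob {\<omega> \<in> space M. c < \<bar>X \<omega>\<bar>}"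

lemma ptail_nonneg: "0 \<le> ptail X c" by (simp add: ptail_def)
lemma conv_in_prob_ptail: "conv_in_prob M X Y \<longleftrightarrow> (\<forall>e>0. (\<lambda>n. ptail (\<lambda>\<omega>. X n \<omega> - Y \<omega>) e) \<longlonglongrightarrow> 0)"
  by (simp add: conv_in_prob_def ptail_def)

lemma ptail_cong_AE:
  assumes "AE \<omega> in M. X \<omega> = Y \<omega>" "X \<in> borel_measurable M" "Y \<in> borel_measurable M"
  shows "ptail X c = ptail Y c"
  unfolding ptail_def using assms by (intro finite_measure_eq_AE) auto

lemma ptail_mono:
  assumes "X \<in> borel_measurable M" "c \<le> d"
  shows "ptail X d \<le> ptail X c"
  unfolding ptail_def using assms by (intro finite_measure_mono) auto

lemma ptail_add:
  assumes [measurable]: "X \<in> borel_measurable M" "Y \<in> borel_measurable M"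
  shows "ptail (\<lambda>\<omega>. X \<omega> + Y \<omega>) (c + d) \<le> ptail X c + ptail Y d"
proof -
  have "ptail (\<lambda>\<omega>. X \<omega> + Y \<omega>) (c + d) \<le> prob ({\<omega> \<in> space M. c < \<bar>X \<omega>\<bar>} \<union> {\<omega> \<in> space M. d < \<bar>Y \<omega>\<bar>})"
    unfolding ptail_def by (intro finite_measure_mono) auto
  also have "\<dots> \<le> ptail X c + ptail Y d"
    unfolding ptail_def by (intro measure_Un_le) auto
  finally show ?thesis .
qed

lemma ptail_diff_triangle:
  assumes [measurable]: "X \<in> borel_measurable M" "Y \<in> borel_measurable M" "Z \<in> borel_measurable M"
  shows "ptail (\<lambda>\<omega>. X \<omega> - Z \<omega>) (c + d) \<le> ptail (\<lambda>\<omega>. X \<omega> - Y \<omega>) c + ptail (\<lambda>\<omega>. Y \<omega> - Z \<omega>) d"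
  using ptail_add[of "\<lambda>\<omega>. X \<omega> - Y \<omega>" "\<lambda>\<omega>. Y \<omega> - Z \<omega>" c d] by simp

lemma ptail_eq_0_AE:
  assumes [measurable]: "X \<in> borel_measurable M" and "\<And>e. e > 0 \<Longrightarrow> ptail X e = 0"
  shows "AE \<omega> in M. X \<omega> = 0"
proof -
  have "AE \<omega> in M. \<not> inverse (real (Suc n)) < \<bar>X \<omega>\<bar>" for n
    using assms(2)[of "inverse (real (Suc n))"] prob_Collect_eq_0[of "\<lambda>\<omega>. inverse (real (Suc n)) < \<bar>X \<omega>\<bar>"]
    unfolding ptail_def by simp
  then have "AE \<omega> in M. \<forall>n. \<not> inverse (real (Suc n)) < \<bar>X \<omega>\<bar>" by (simp add: AE_all_countable)
  then show ?thesis
  proof eventually_elim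
    case (elim \<omega>)
    show ?case
    proof (rule ccontr)
      assume "X \<omega> \<noteq> 0"
      then obtain n where "inverse (real (Suc n)) < \<bar>X \<omega>\<bar>" using reals_Archimedean[of "\<bar>X \<omega>\<bar>"] by auto
      with elim show False by blast
    qed
  qed
qed

text \<open>One parameter serves both as threshold and as probability: tails decrease in the
  threshold, so min e (r/2) covers an arbitrary pair.\<close>

lemma conv_in_probI:
  assumes "\<And>e. e > 0 \<Longrightarrow> \<exists>N. \<forall>n\<ge>N. ptail (\<lambda>\<omega>. X n \<omega> - Y \<omega>) e \<le> e"
    and [measurable]: "\<And>n. X n \<in> borel_measurable M" "Y \<in> borel_measurable M"
  shows "conv_in_prob M X Y"
  unfolding conv_in_prob_ptail
proof (intro allI impI LIMSEQ_I)
  fix e r :: real assume e: "0 < e" "0 < r"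
  let ?d = "min e (r / 2)"
  obtain N where N: "\<And>n. n \<ge> N \<Longrightarrow> ptail (\<lambda>\<omega>. X n \<omega> - Y \<omega>) ?d \<le> ?d"
    using assms(1)[of ?d] e by auto
  have "norm (ptail (\<lambda>\<omega>. X n \<omega> - Y \<omega>) e - 0) < r" if "n \<ge> N" for n
    using ptail_mono[of "\<lambda>\<omega>. X n \<omega> - Y \<omega>" ?d e] N[OF that] e ptail_nonneg[of "\<lambda>\<omega>. X n \<omega> - Y \<omega>" e] by simp
  then show "\<exists>N. \<forall>n\<ge>N. norm (ptail (\<lambda>\<omega>. X n \<omega> - Y \<omega>) e - 0) < r" by blast
qed

lemma conv_in_probD:
  assumes "conv_in_prob M X Y" "e > 0" "r > 0"
  shows "\<exists>N. \<forall>n\<ge>N. ptail (\<lambda>\<omega>. X n \<omega> - Y \<omega>) e < r"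
proof -
  have "(\<lambda>n. ptail (\<lambda>\<omega>. X n \<omega> - Y \<omega>) e) \<longlonglongrightarrow> 0" using assms by (simp add: conv_in_prob_ptail)
  from LIMSEQ_D[OF this assms(3)] show ?thesis by (simp add: abs_of_nonneg[OF ptail_nonneg])
qed

lemma conv_in_prob_cong_AE:
  assumes "conv_in_prob M X Y" "\<And>n. AE \<omega> in M. X n \<omega> = X' n \<omega>" "AE \<omega> in M. Y \<omega> = Y' \<omega>"
    and [measurable]: "\<And>n. X n \<in> borel_measurable M" "Y \<in> borel_measurable M"
      "\<And>n. X' n \<in> borel_measurable M" "Y' \<in> borel_measurable M"
  shows "conv_in_prob M X' Y'"
proof -
  have "ptail (\<lambda>\<omega>. X n \<omega> - Y \<omega>) e = ptail (\<lambda>\<omega>. X' n \<omega> - Y' \<omega>) e" for n e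
    by (rule ptail_cong_AE) (use assms(2)[of n] assms(3) in auto)
  then show ?thesis using assms(1) by (simp add: conv_in_prob_ptail)
qed

lemma conv_in_prob_add:
  assumes "conv_in_prob M X Y" "conv_in_prob M X' Y'"
    and [measurable]: "\<And>n. X n \<in> borel_measurable M" "Y \<in> borel_measurable M"
      "\<And>n. X' n \<in> borel_measurable M" "Y' \<in> borel_measurable M"
  shows "conv_in_prob M (\<lambda>n \<omega>. X n \<omega> + X' n \<omega>) (\<lambda>\<omega>. Y \<omega> + Y' \<omega>)"
  unfolding conv_in_prob_ptail
proof (intro allI impI)
  fix e :: real assume e: "0 < e"
  have "(\<lambda>n. ptail (\<lambda>\<omega>. X n \<omega> - Y \<omega>) (e/2) + ptail (\<lambda>\<omega>. X' n \<omega> - Y' \<omega>) (e/2)) \<longlonglongrightarrow> 0 + 0"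
    using assms(1,2) e unfolding conv_in_prob_ptail by (intro tendsto_add) auto
  then have L: "(\<lambda>n. ptail (\<lambda>\<omega>. X n \<omega> - Y \<omega>) (e/2) + ptail (\<lambda>\<omega>. X' n \<omega> - Y' \<omega>) (e/2)) \<longlonglongrightarrow> 0" by simp
  have le: "ptail (\<lambda>\<omega>. X n \<omega> + X' n \<omega> - (Y \<omega> + Y' \<omega>)) e
      \<le> ptail (\<lambda>\<omega>. X n \<omega> - Y \<omega>) (e/2) + ptail (\<lambda>\<omega>. X' n \<omega> - Y' \<omega>) (e/2)" for n
    using ptail_add[of "\<lambda>\<omega>. X n \<omega> - Y \<omega>" "\<lambda>\<omega>. X' n \<omega> - Y' \<omega>" "e/2" "e/2"]
    by (simp add: algebra_simps)
  show "(\<lambda>n. ptail (\<lambda>\<omega>. X n \<omega> + X' n \<omega> - (Y \<omega> + Y' \<omega>)) e) \<longlonglongrightarrow> 0"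
    by (rule tendsto_sandwich[OF _ _ tendsto_const L]) (auto simp: ptail_nonneg le)
qed

lemma ptail_scale: "c \<noteq> 0 \<Longrightarrow> ptail (\<lambda>\<omega>. c * X \<omega>) e = ptail X (e / \<bar>c\<bar>)"
  by (simp add: ptail_def abs_mult divide_less_eq mult.commute)

lemma conv_in_prob_cmult:
  assumes "conv_in_prob M X Y"
  shows "conv_in_prob M (\<lambda>n \<omega>. c * X n \<omega>) (\<lambda>\<omega>. c * Y \<omega>)"
proof (cases "c = 0")
  case True then show ?thesis by (simp add: conv_in_prob_def)
next
  case False
  then show ?thesis
    using assms unfolding conv_in_prob_ptail right_diff_distrib[symmetric]
    by (auto simp: ptail_scale)
qed

lemma conv_in_prob_unique:
  assumes "conv_in_prob M X Y" "conv_in_prob M X Y'"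
    and [measurable]: "\<And>n. X n \<in> borel_measurable M" "Y \<in> borel_measurable M" "Y' \<in> borel_measurable M"
  shows "AE \<omega> in M. Y \<omega> = Y' \<omega>"
proof -
  have "conv_in_prob M (\<lambda>n \<omega>. X n \<omega> + (-1) * X n \<omega>) (\<lambda>\<omega>. Y \<omega> + (-1) * Y' \<omega>)"
    by (intro conv_in_prob_add conv_in_prob_cmult assms) auto
  then have "ptail (\<lambda>\<omega>. Y \<omega> - Y' \<omega>) e = 0" if "e > 0" for e
    using that unfolding conv_in_prob_ptail by (simp add: LIMSEQ_const_iff ptail_def abs_minus_commute)
  then have "AE \<omega> in M. Y \<omega> - Y' \<omega> = 0" by (intro ptail_eq_0_AE) auto
  then show ?thesis by eventually_elim simp
qed

text \<open>Borel-Cantelli with a geometric series; the same rate bounds the probability and the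
  deviation.\<close>

lemma summable_ptail_fast:
  assumes [measurable]: "\<And>n. X n \<in> borel_measurable M" and "\<And>n. ptail (X n) ((1/2) ^ n) \<le> (1/2) ^ n"
  shows "AE \<omega> in M. \<exists>N. \<forall>n\<ge>N. \<bar>X n \<omega>\<bar> \<le> (1/2) ^ n"
proof -
  have "AE \<omega> in M. eventually (\<lambda>n. \<omega> \<in> space M - {\<omega> \<in> space M. (1/2) ^ n < \<bar>X n \<omega>\<bar>}) sequentially"
  proof (rule borel_cantelli_AE1)
    show "summable (\<lambda>n. prob {\<omega> \<in> space M. (1/2) ^ n < \<bar>X n \<omega>\<bar>})"
      by (rule summable_comparison_test'[of "\<lambda>n. (1/2) ^ n"])
        (use assms(2) in \<open>auto simp: ptail_def intro: summable_geometric\<close>)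
  qed (auto simp: less_top[symmetric])
  then show ?thesis
    by eventually_elim (auto simp: eventually_sequentially not_less)
qed

lemma AE_tendsto_fast:
  assumes [measurable]: "\<And>n. X n \<in> borel_measurable M" "Y \<in> borel_measurable M"
    and "\<And>n. ptail (\<lambda>\<omega>. X n \<omega> - Y \<omega>) ((1/2) ^ n) \<le> (1/2) ^ n"
  shows "AE \<omega> in M. (\<lambda>n. X n \<omega>) \<longlonglongrightarrow> Y \<omega>"
proof -
  have "AE \<omega> in M. \<exists>N. \<forall>n\<ge>N. \<bar>X n \<omega> - Y \<omega>\<bar> \<le> (1/2) ^ n"
    by (rule summable_ptail_fast) (use assms(3) in auto)
  then show ?thesis
  proof eventually_elim
    case (elim \<omega>)
    then obtain N where N: "\<And>n. n \<ge> N \<Longrightarrow> \<bar>X n \<omega> - Y \<omega>\<bar> \<le> (1/2) ^ n" by blast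
    have "(\<lambda>n. X n \<omega> - Y \<omega>) \<longlonglongrightarrow> 0"
      by (rule tendsto_norm_zero_cancel, rule tendsto_sandwich[OF _ _ tendsto_const LIMSEQ_realpow_zero[of "1/2"]])
        (use N in \<open>auto simp: eventually_sequentially\<close>)
    then show ?case by (rule LIM_zero_cancel)
  qed
qed

lemma conv_in_prob_subseq_AE:
  assumes "conv_in_prob M X Y" and [measurable]: "\<And>n. X n \<in> borel_measurable M" "Y \<in> borel_measurable M"
  shows "\<exists>r. AE \<omega> in M. (\<lambda>n. X (r n) \<omega>) \<longlonglongrightarrow> Y \<omega>"
proof -
  have "\<forall>n. \<exists>k. ptail (\<lambda>\<omega>. X k \<omega> - Y \<omega>) ((1/2) ^ n) \<le> (1/2) ^ n"
  proof
    fix n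
    obtain N where "\<forall>k\<ge>N. ptail (\<lambda>\<omega>. X k \<omega> - Y \<omega>) ((1/2) ^ n) < (1/2) ^ n"
      using conv_in_probD[OF assms(1), of "(1/2) ^ n" "(1/2) ^ n"] by auto
    then show "\<exists>k. ptail (\<lambda>\<omega>. X k \<omega> - Y \<omega>) ((1/2) ^ n) \<le> (1/2) ^ n" by (meson less_imp_le order_refl)
  qed
  then obtain r where "\<And>n. ptail (\<lambda>\<omega>. X (r n) \<omega> - Y \<omega>) ((1/2) ^ n) \<le> (1/2) ^ n" by metis
  then have "AE \<omega> in M. (\<lambda>n. X (r n) \<omega>) \<longlonglongrightarrow> Y \<omega>" by (intro AE_tendsto_fast) auto
  then show ?thesis by blast
qed

lemma AE_tendsto_conv_in_prob:
  assumes [measurable]: "\<And>n. X n \<in> borel_measurable M" "Y \<in> borel_measurable M"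
    and lim: "AE \<omega> in M. (\<lambda>n. X n \<omega>) \<longlonglongrightarrow> Y \<omega>"
  shows "conv_in_prob M X Y"
  unfolding conv_in_prob_def
proof (intro allI impI)
  fix e :: real assume e: "0 < e"
  let ?A = "\<lambda>n. {\<omega> \<in> space M. e < \<bar>X n \<omega> - Y \<omega>\<bar>}"
  have "(\<lambda>n. expectation (indicator (?A n) :: 'a \<Rightarrow> real)) \<longlonglongrightarrow> expectation (\<lambda>_. 0)"
  proof (rule integral_dominated_convergence[where w = "\<lambda>_. 1"])
    show "AE \<omega> in M. (\<lambda>n. indicator (?A n) \<omega> :: real) \<longlonglongrightarrow> 0"
      using lim
    proof eventually_elim
      case (elim \<omega>)
      from LIMSEQ_D[OF elim e] obtain N where "\<And>n. n \<ge> N \<Longrightarrow> \<bar>X n \<omega> - Y \<omega>\<bar> < e" by auto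
      then have "\<forall>n\<ge>N. indicator (?A n) \<omega> = (0::real)" by (force simp: indicator_def)
      then show ?case by (intro tendsto_eventually) (auto simp: eventually_sequentially)
    qed
  qed (auto simp: indicator_def)
  then show "(\<lambda>n. prob (?A n)) \<longlonglongrightarrow> 0" by simp
qed

text \<open>Completeness of L^0: increments along a fast subsequence are almost surely summable,
  which produces the limit; the Cauchy property extends convergence to the whole sequence.\<close>

lemma Cauchy_in_prob_convergent:
  assumes [measurable]: "\<And>n. X n \<in> borel_measurable M"
    and C: "\<And>e. e > 0 \<Longrightarrow> \<exists>N. \<forall>m\<ge>N. \<forall>n\<ge>N. ptail (\<lambda>\<omega>. X m \<omega> - X n \<omega>) e \<le> e"
  shows "\<exists>Y. Y \<in> borel_measurable M \<and> conv_in_prob M X Y"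
proof -
  have "\<forall>k. \<exists>N. \<forall>m\<ge>N. \<forall>n\<ge>N. ptail (\<lambda>\<omega>. X m \<omega> - X n \<omega>) ((1/2) ^ k) \<le> (1/2) ^ k"
    using C by auto
  then obtain r0 where r0: "\<And>k m n. m \<ge> r0 k \<Longrightarrow> n \<ge> r0 k \<Longrightarrow> ptail (\<lambda>\<omega>. X m \<omega> - X n \<omega>) ((1/2) ^ k) \<le> (1/2) ^ k"
    by metis
  \<comment> \<open>The sum makes r j at least every threshold r0 k with k \<le> j, and the summand
    k forces r k \<ge> k.\<close>
  define r where "r k = k + (\<Sum>i\<le>k. r0 i)" for k
  have r_ge: "r j \<ge> r0 k" if "j \<ge> k" for j k
  proof -
    have "r0 k \<le> (\<Sum>i\<le>j. r0 i)" using that by (intro member_le_sum) auto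
    then show ?thesis by (simp add: r_def)
  qed
  have r_id: "r k \<ge> k" for k by (simp add: r_def)
  have "AE \<omega> in M. \<exists>N. \<forall>n\<ge>N. \<bar>X (r (Suc n)) \<omega> - X (r n) \<omega>\<bar> \<le> (1/2) ^ n"
    by (rule summable_ptail_fast) (auto intro!: r0 r_ge)
  then have conv: "AE \<omega> in M. convergent (\<lambda>n. X (r n) \<omega>)"
  proof eventually_elim
    case (elim \<omega>)
    then have "summable (\<lambda>n. X (r (Suc n)) \<omega> - X (r n) \<omega>)"
      by (intro summable_comparison_test[OF _ summable_geometric[of "1/2"]]) auto
    then have "convergent (\<lambda>n. \<Sum>i<n. X (r (Suc i)) \<omega> - X (r i) \<omega>)" by (simp add: summable_iff_convergent)
    then have "convergent (\<lambda>n. X (r n) \<omega> - X (r 0) \<omega>)" by (simp only: sum_lessThan_telescope[of "\<lambda>n. X (r n) \<omega>"])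
    then show ?case using convergent_diff_const_right_iff by blast
  qed
  define Y where "Y \<omega> = lim (\<lambda>n. X (r n) \<omega>)" for \<omega>
  have [measurable]: "Y \<in> borel_measurable M" unfolding Y_def by measurable
  have "AE \<omega> in M. (\<lambda>n. X (r n) \<omega>) \<longlonglongrightarrow> Y \<omega>"
    using conv by eventually_elim (simp add: Y_def convergent_LIMSEQ_iff)
  then have cp: "conv_in_prob M (\<lambda>n. X (r n)) Y" by (intro AE_tendsto_conv_in_prob) auto
  have "conv_in_prob M X Y"
  proof (rule conv_in_probI)
    fix e :: real assume e: "0 < e"
    obtain N1 where N1: "\<And>m n. m \<ge> N1 \<Longrightarrow> n \<ge> N1 \<Longrightarrow> ptail (\<lambda>\<omega>. X m \<omega> - X n \<omega>) (e/2) \<le> e/2"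
      using C[of "e/2"] e by auto
    obtain N2 where N2: "\<And>n. n \<ge> N2 \<Longrightarrow> ptail (\<lambda>\<omega>. X (r n) \<omega> - Y \<omega>) (e/2) < e/2"
      using conv_in_probD[OF cp, of "e/2" "e/2"] e by auto
    have "ptail (\<lambda>\<omega>. X n \<omega> - Y \<omega>) e \<le> e" if "n \<ge> max N1 N2" for n
      using ptail_diff_triangle[of "X n" "X (r n)" Y "e/2" "e/2"] N1[of n "r n"] N2[of n] that r_id[of n]
      by simp
    then show "\<exists>N. \<forall>n\<ge>N. ptail (\<lambda>\<omega>. X n \<omega> - Y \<omega>) e \<le> e" by blast
  qed auto
  then show ?thesis using \<open>Y \<in> borel_measurable M\<close> by blast
qed

section \<open>Subalgebras that contain all null sets\<close>

lemma measurable_subalgebra_AE_eq: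
  fixes X Y :: "'a \<Rightarrow> real"
  assumes F: "space F = space M" "sets F \<subseteq> sets M" "null_sets M \<subseteq> sets F"
    and X: "X \<in> borel_measurable M" and Y: "Y \<in> borel_measurable F" and eq: "AE \<omega> in M. X \<omega> = Y \<omega>"
  shows "X \<in> borel_measurable F"
proof (rule measurableI)
  fix B :: "real set" assume B: "B \<in> sets borel"
  \<comment> \<open>What happens inside N is an event because X is measurable for \<open>M\<close>,
    hence it is a null set and belongs to F; outside N the preimage is that of Y.\<close>
  from eq obtain N where N: "N \<in> null_sets M" "{\<omega> \<in> space M. X \<omega> \<noteq> Y \<omega>} \<subseteq> N" by (auto elim!: AE_E simp: null_sets_def)
  have NF: "N \<in> sets F" using N F by auto
  have "X -` B \<inter> N \<in> null_sets M"
  proof -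
    have "X -` B \<inter> space M \<in> sets M" using X B by measurable
    then have "(X -` B \<inter> space M) \<inter> N \<in> null_sets M" using N(1) by (intro null_set_Int1)
    moreover have "(X -` B \<inter> space M) \<inter> N = X -` B \<inter> N" using sets.sets_into_space[of N M] N(1) by auto
    ultimately show ?thesis by simp
  qed
  then have 1: "X -` B \<inter> N \<in> sets F" using F by auto
  have 2: "Y -` B \<inter> space F \<in> sets F" using Y B by measurable
  have "X -` B \<inter> space F = ((Y -` B \<inter> space F) - N) \<union> (X -` B \<inter> N)"
    using N sets.sets_into_space[OF NF] F(1) by auto
  then show "X -` B \<inter> space F \<in> sets F" using 1 2 NF by auto
qed simp

text \<open>Along an almost surely convergent subsequence \<open>lim\<close> defines a function that
  is measurable for F everywhere, and it differs from Y on a null set only.\<close>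

lemma measurable_subalgebra_limit:
  assumes F: "space F = space M" "sets F \<subseteq> sets M" "null_sets M \<subseteq> sets F"
    and Xn: "\<And>n. X n \<in> borel_measurable F" and Y: "Y \<in> borel_measurable M" and lim: "conv_in_prob M X Y"
  shows "Y \<in> borel_measurable F"
proof -
  have XM: "X n \<in> borel_measurable M" for n
    using Xn[of n] measurable_mono[of borel borel F M] F by auto
  obtain r where r: "AE \<omega> in M. (\<lambda>n. X (r n) \<omega>) \<longlonglongrightarrow> Y \<omega>"
    using conv_in_prob_subseq_AE[OF lim XM Y] by blast
  have "(\<lambda>\<omega>. lim (\<lambda>n. X (r n) \<omega>)) \<in> borel_measurable F" using Xn by measurable
  moreover have "AE \<omega> in M. Y \<omega> = lim (\<lambda>n. X (r n) \<omega>)" using r by eventually_elim (simp add: limI)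
  ultimately show ?thesis by (rule measurable_subalgebra_AE_eq[OF F Y])
qed

text \<open>Dyadic decomposition of the range.\<close>

lemma weak_L2_imp_L1:
  assumes [measurable]: "X \<in> borel_measurable M" "E \<in> events" and q: "0 \<le> q"
    and tail: "\<And>c. c > 0 \<Longrightarrow> prob (E \<inter> {\<omega> \<in> space M. c < \<bar>X \<omega>\<bar>}) \<le> q / c\<^sup>2"
  shows "(\<integral>\<^sup>+\<omega>. indicator E \<omega> * ennreal \<bar>X \<omega>\<bar> \<partial>M) \<le> ennreal (3 * sqrt q)"
proof -
  \<comment> \<open>s replaces the square root of q and is kept positive; q = 0 is reached by
    letting s decrease. Values below s contribute at most s, the level s 2^k contributes at most s
    2^-k, and 1 + 2 = 3.\<close>
  have main: "(\<integral>\<^sup>+\<omega>. indicator E \<omega> * ennreal \<bar>X \<omega>\<bar> \<partial>M) \<le> ennreal (3 * s)" if s: "s > 0" "q \<le> s\<^sup>2" for s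
  proof -
    let ?A = "\<lambda>k. E \<inter> {\<omega> \<in> space M. s * 2 ^ k < \<bar>X \<omega>\<bar>}"
    have pw: "indicator E \<omega> * ennreal \<bar>X \<omega>\<bar> \<le> ennreal s + (\<Sum>k. ennreal (s * 2 ^ k) * indicator (?A k) \<omega>)"
      if "\<omega> \<in> space M" for \<omega>
    proof (cases "\<omega> \<in> E")
      case True
      have ex: "\<exists>k. \<bar>X \<omega>\<bar> \<le> s * 2 ^ k"
      proof -
        obtain k where "\<bar>X \<omega>\<bar> / s < 2 ^ k" using real_arch_pow[of 2] by auto
        then show ?thesis using s by (intro exI[of _ k]) (simp add: field_simps)
      qed
      \<comment> \<open>k is the dyadic level of the value: all levels below k are exceeded, and
        they sum to s (2^k - 1).\<close>
      define k where "k = (LEAST k. \<bar>X \<omega>\<bar> \<le> s * 2 ^ k)"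
      have k: "\<bar>X \<omega>\<bar> \<le> s * 2 ^ k" unfolding k_def using ex by (rule LeastI_ex)
      have less: "s * 2 ^ j < \<bar>X \<omega>\<bar>" if "j < k" for j
        using not_less_Least[of j] that unfolding k_def by (meson not_le)
      have "\<bar>X \<omega>\<bar> \<le> s + (\<Sum>j<k. s * 2 ^ j)"
      proof -
        have "(\<Sum>j<k. 2 ^ j) = 2 ^ k - (1::real)" by (induction k) auto
        then show ?thesis using k by (simp only: sum_distrib_left[symmetric]) (simp add: algebra_simps)
      qed
      then have "ennreal \<bar>X \<omega>\<bar> \<le> ennreal (s + (\<Sum>j<k. s * 2 ^ j))" by (rule ennreal_leI)
      also have "\<dots> = ennreal s + (\<Sum>j<k. ennreal (s * 2 ^ j))"
        using s by (subst ennreal_plus) (auto intro!: sum_nonneg simp: sum_ennreal)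
      also have "(\<Sum>j<k. ennreal (s * 2 ^ j)) = (\<Sum>j<k. ennreal (s * 2 ^ j) * indicator (?A j) \<omega>)"
        using less True that by (intro sum.cong) auto
      also have "ennreal s + \<dots> \<le> ennreal s + (\<Sum>k. ennreal (s * 2 ^ k) * indicator (?A k) \<omega>)"
        by (intro add_left_mono sum_le_suminf) auto
      finally show ?thesis using True by simp
    qed simp
    have bnd: "(\<integral>\<^sup>+\<omega>. ennreal (s * 2 ^ k) * indicator (?A k) \<omega> \<partial>M) \<le> ennreal (s * (1/2) ^ k)" for k
    proof -
      have "(\<integral>\<^sup>+\<omega>. ennreal (s * 2 ^ k) * indicator (?A k) \<omega> \<partial>M) = ennreal (s * 2 ^ k) * emeasure M (?A k)"
        by (rule nn_integral_cmult_indicator) measurable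
      also have "\<dots> = ennreal (s * 2 ^ k * prob (?A k))"
        using s by (simp add: emeasure_eq_measure ennreal_mult)
      also have "s * 2 ^ k * prob (?A k) \<le> s * 2 ^ k * (q / (s * 2 ^ k)\<^sup>2)"
        using s by (intro mult_left_mono tail) auto
      also have "\<dots> \<le> s * 2 ^ k * (s\<^sup>2 / (s * 2 ^ k)\<^sup>2)"
        using s by (intro mult_left_mono divide_right_mono) auto
      also have "\<dots> = s * (1/2) ^ k"
        using s by (simp add: power_mult_distrib power2_eq_square power_divide)
      finally show ?thesis by (auto intro: ennreal_leI)
    qed
    have "(\<integral>\<^sup>+\<omega>. indicator E \<omega> * ennreal \<bar>X \<omega>\<bar> \<partial>M)
        \<le> (\<integral>\<^sup>+\<omega>. ennreal s + (\<Sum>k. ennreal (s * 2 ^ k) * indicator (?A k) \<omega>) \<partial>M)"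
      by (intro nn_integral_mono pw) auto
    also have "\<dots> = ennreal s + (\<Sum>k. \<integral>\<^sup>+\<omega>. ennreal (s * 2 ^ k) * indicator (?A k) \<omega> \<partial>M)"
      by (subst nn_integral_add) (auto simp: nn_integral_suminf emeasure_space_1)
    also have "\<dots> \<le> ennreal s + (\<Sum>k. ennreal (s * (1/2) ^ k))"
      by (intro add_left_mono suminf_le bnd) auto
    also have "(\<Sum>k. ennreal (s * (1/2) ^ k)) = ennreal (s * 2)"
    proof -
      have "(\<lambda>k. (1/2::real) ^ k) sums 2" using geometric_sums[of "1/2::real"] by simp
      then have "(\<lambda>k. s * (1/2) ^ k) sums (s * 2)" by (rule sums_mult)
      then show ?thesis using s by (intro suminf_ennreal_eq) auto
    qed
    also have "ennreal s + ennreal (s * 2) = ennreal (3 * s)" using s by (simp flip: ennreal_plus)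
    finally show ?thesis .
  qed
  show ?thesis
  proof (rule ennreal_le_epsilon)
    fix e :: real assume e: "0 < e"
    have "(\<integral>\<^sup>+\<omega>. indicator E \<omega> * ennreal \<bar>X \<omega>\<bar> \<partial>M) \<le> ennreal (3 * (sqrt q + e / 3))"
    proof (rule main)
      have "(sqrt q)\<^sup>2 \<le> (sqrt q + e / 3)\<^sup>2" using e q by (intro power_mono) auto
      then show "q \<le> (sqrt q + e / 3)\<^sup>2" using q by simp
    qed (use e q in \<open>auto intro: add_nonneg_pos\<close>)
    also have "\<dots> = ennreal (3 * sqrt q) + ennreal e" using e q by (simp add: algebra_simps flip: ennreal_plus)
    finally show "(\<integral>\<^sup>+\<omega>. indicator E \<omega> * ennreal \<bar>X \<omega>\<bar> \<partial>M) \<le> ennreal (3 * sqrt q) + ennreal e" .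
  qed
qed

end

section \<open>Random signs\<close>

text \<open>A subset S of {..<m} encodes a sign vector; summing over \<open>Pow {..<m}\<close> is
  2^m times the expectation under independent fair signs, so no auxiliary probability space
  appears.\<close>

definition rsign :: "nat set \<Rightarrow> nat \<Rightarrow> real" where
  "rsign S k = (if k \<in> S then 1 else -1)"

lemma sum_Pow_lessThan_Suc:
  fixes F :: "nat set \<Rightarrow> 'a::comm_monoid_add"
  shows "(\<Sum>S\<in>Pow {..<Suc m}. F S) = (\<Sum>S\<in>Pow {..<m}. F S + F (insert m S))"
proof -
  have "Pow {..<Suc m} = Pow {..<m} \<union> insert m ` Pow {..<m}"
    unfolding lessThan_Suc Pow_insert by auto
  moreover have "Pow {..<m} \<inter> insert m ` Pow {..<m} = {}" by auto
  moreover have "inj_on (insert m) (Pow {..<m})" unfolding inj_on_def by (auto dest: insert_ident[THEN iffD1, rotated 2])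
  ultimately show ?thesis
    by (simp add: sum.union_disjoint sum.reindex sum.distrib finite_Pow_iff)
qed

lemma rsign_sum_step:
  fixes x :: "nat \<Rightarrow> 'a::real_vector"
  assumes "S \<in> Pow {..<m}"
  shows "(\<Sum>k<Suc m. rsign S k *\<^sub>R x k) = (\<Sum>k<m. rsign S k *\<^sub>R x k) - x m"
    "(\<Sum>k<Suc m. rsign (insert m S) k *\<^sub>R x k) = (\<Sum>k<m. rsign S k *\<^sub>R x k) + x m"
proof -
  have "m \<notin> S" using assms by auto
  then show "(\<Sum>k<Suc m. rsign S k *\<^sub>R x k) = (\<Sum>k<m. rsign S k *\<^sub>R x k) - x m"
    by (simp add: rsign_def)
  have "(\<Sum>k<m. rsign (insert m S) k *\<^sub>R x k) = (\<Sum>k<m. rsign S k *\<^sub>R x k)"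
    by (intro sum.cong) (auto simp: rsign_def)
  then show "(\<Sum>k<Suc m. rsign (insert m S) k *\<^sub>R x k) = (\<Sum>k<m. rsign S k *\<^sub>R x k) + x m"
    by (simp add: rsign_def)
qed

text \<open>Pairing the two values of the last sign, the parallelogram law removes the cross
  terms.\<close>

lemma rsign_second_moment:
  fixes x :: "nat \<Rightarrow> 'a::real_inner"
  shows "(\<Sum>S\<in>Pow {..<m}. (norm (\<Sum>k<m. rsign S k *\<^sub>R x k))\<^sup>2) = 2 ^ m * (\<Sum>k<m. (norm (x k))\<^sup>2)"
proof (induction m)
  case (Suc m)
  have "(norm (a - b))\<^sup>2 + (norm (a + b))\<^sup>2 = 2 * (norm a)\<^sup>2 + 2 * (norm b)\<^sup>2" for a b :: 'a
    unfolding power2_norm_eq_inner by (simp add: inner_diff_left inner_diff_right inner_add_left inner_add_right)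
  then have "(\<Sum>S\<in>Pow {..<Suc m}. (norm (\<Sum>k<Suc m. rsign S k *\<^sub>R x k))\<^sup>2)
      = (\<Sum>S\<in>Pow {..<m}. 2 * (norm (\<Sum>k<m. rsign S k *\<^sub>R x k))\<^sup>2 + 2 * (norm (x m))\<^sup>2)"
    unfolding sum_Pow_lessThan_Suc by (intro sum.cong refl) (simp only: rsign_sum_step)
  also have "\<dots> = 2 * (2 ^ m * (\<Sum>k<m. (norm (x k))\<^sup>2)) + 2 ^ m * (2 * (norm (x m))\<^sup>2)"
    unfolding sum.distrib sum_distrib_left[symmetric] Suc.IH by (simp add: card_Pow)
  finally show ?case by (simp add: algebra_simps)
qed simp

lemma rsign_fourth_moment:
  fixes x :: "nat \<Rightarrow> real"
  shows "(\<Sum>S\<in>Pow {..<m}. (\<Sum>k<m. rsign S k *\<^sub>R x k) ^ 4) \<le> 3 * 2 ^ m * (\<Sum>k<m. (x k)\<^sup>2)\<^sup>2"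
proof (induction m)
  case (Suc m)
  let ?s = "\<Sum>k<m. (x k)\<^sup>2"
  have "(a - b) ^ 4 + (a + b) ^ 4 = 2 * a ^ 4 + 12 * b\<^sup>2 * a\<^sup>2 + 2 * b ^ 4" for a b :: real
    by (simp add: power4_eq_xxxx power2_eq_square algebra_simps)
  then have "(\<Sum>S\<in>Pow {..<Suc m}. (\<Sum>k<Suc m. rsign S k *\<^sub>R x k) ^ 4)
      = (\<Sum>S\<in>Pow {..<m}. 2 * (\<Sum>k<m. rsign S k *\<^sub>R x k) ^ 4 + 12 * (x m)\<^sup>2 * (\<Sum>k<m. rsign S k *\<^sub>R x k)\<^sup>2 + 2 * (x m) ^ 4)"
    unfolding sum_Pow_lessThan_Suc by (intro sum.cong refl) (simp only: rsign_sum_step)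
  also have "\<dots> = 2 * (\<Sum>S\<in>Pow {..<m}. (\<Sum>k<m. rsign S k *\<^sub>R x k) ^ 4)
      + 12 * (x m)\<^sup>2 * (\<Sum>S\<in>Pow {..<m}. (\<Sum>k<m. rsign S k *\<^sub>R x k)\<^sup>2) + 2 ^ m * (2 * (x m) ^ 4)"
    unfolding sum.distrib sum_distrib_left[symmetric] by (simp add: card_Pow)
  also have "(\<Sum>S\<in>Pow {..<m}. (\<Sum>k<m. rsign S k *\<^sub>R x k)\<^sup>2) = 2 ^ m * ?s"
    using rsign_second_moment[where m = m and x = x] by simp
  \<comment> \<open>The term 2 (x m)^4 is enlarged to 6 (x m)^4 in order to complete the square of
    the sum that includes (x m)^2.\<close>
  also have "2 * (\<Sum>S\<in>Pow {..<m}. (\<Sum>k<m. rsign S k *\<^sub>R x k) ^ 4)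
      + 12 * (x m)\<^sup>2 * (2 ^ m * ?s) + 2 ^ m * (2 * (x m) ^ 4)
    \<le> 2 * (3 * 2 ^ m * ?s\<^sup>2) + 12 * (x m)\<^sup>2 * (2 ^ m * ?s) + 2 ^ m * (6 * (x m) ^ 4)"
    using Suc.IH by (intro add_mono mult_left_mono) auto
  also have "\<dots> = 3 * 2 ^ Suc m * (\<Sum>k<Suc m. (x k)\<^sup>2)\<^sup>2"
    by (simp add: power2_eq_square power4_eq_xxxx algebra_simps)
  finally show ?case .
qed simp

text \<open>The second moment s cannot be carried by small values, which give at most s/4, nor, the
  fourth moment being at most 3 s^2, by few large ones: averaging s \<le> s/4 + 3 s/8 + 2 s p leaves
  p \<ge> 3/16 for the fraction p of good signs.\<close>

lemma rsign_Paley_Zygmund: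
  fixes x :: "nat \<Rightarrow> real"
  assumes R: "0 \<le> R" "R\<^sup>2 < (\<Sum>k<m. (x k)\<^sup>2)"
  shows "3 * 2 ^ m \<le> 16 * (\<Sum>S\<in>Pow {..<m}. if R / 2 \<le> \<bar>\<Sum>k<m. rsign S k *\<^sub>R x k\<bar> then 1 else 0 :: real)"
    (is "_ \<le> 16 * ?N")
proof -
  let ?s = "\<Sum>k<m. (x k)\<^sup>2"
  let ?y = "\<lambda>S. \<Sum>k<m. rsign S k *\<^sub>R x k"
  have s: "0 < ?s" using R(2) zero_le_power2[of R] by linarith
  \<comment> \<open>For large y this is y^2 \<le> y^4/(8 s) + 2 s, the nonnegativity of a square;
    the weights are tuned so that the averaged fourth moment costs only 3 s/8.\<close>
  have pw: "(y::real)\<^sup>2 \<le> ?s / 4 + y ^ 4 / (8 * ?s) + 2 * ?s * (if R / 2 \<le> \<bar>y\<bar> then 1 else 0)" for y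
  proof (cases "R / 2 \<le> \<bar>y\<bar>")
    case True
    have "0 \<le> (y\<^sup>2 - 4 * ?s)\<^sup>2 / (8 * ?s)" using s by simp
    also have "\<dots> = y ^ 4 / (8 * ?s) - y\<^sup>2 + 2 * ?s"
      using s by (simp add: power2_diff field_simps) (simp add: power2_eq_square power4_eq_xxxx algebra_simps)
    finally show ?thesis using True s by simp
  next
    case False
    then have "\<bar>y\<bar> ^ 2 \<le> (R / 2)\<^sup>2" by (intro power_mono) auto
    then have "y\<^sup>2 \<le> ?s / 4" using R by (simp add: power_divide)
    moreover have "0 \<le> y ^ 4 / (8 * ?s)" using s by (simp add: zero_le_even_power')
    ultimately show ?thesis using False by simp
  qed
  have "2 ^ m * ?s = (\<Sum>S\<in>Pow {..<m}. (?y S)\<^sup>2)" using rsign_second_moment[where m = m and x = x] by simp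
  also have "\<dots> \<le> (\<Sum>S\<in>Pow {..<m}. ?s / 4 + (?y S) ^ 4 / (8 * ?s) + 2 * ?s * (if R / 2 \<le> \<bar>?y S\<bar> then 1 else 0))"
    by (intro sum_mono pw)
  also have "\<dots> = 2 ^ m * (?s / 4) + (\<Sum>S\<in>Pow {..<m}. (?y S) ^ 4) / (8 * ?s) + 2 * ?s * ?N"
    unfolding sum.distrib sum_distrib_left[symmetric] sum_divide_distrib[symmetric] by (simp add: card_Pow)
  also have "\<dots> \<le> 2 ^ m * (?s / 4) + (3 * 2 ^ m * ?s\<^sup>2) / (8 * ?s) + 2 * ?s * ?N"
    using s rsign_fourth_moment[where m = m and x = x] by (intro add_mono divide_right_mono) auto
  also have "\<dots> = ?s * (2 ^ m * (5 / 8) + 2 * ?N)"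
    using s by (simp add: power2_eq_square field_simps)
  finally have "?s * 2 ^ m \<le> ?s * (2 ^ m * (5 / 8) + 2 * ?N)" by (simp add: mult.commute)
  then have "2 ^ m \<le> 2 ^ m * (5 / 8) + 2 * ?N" using s by (simp only: mult_le_cancel_left_pos)
  then show ?thesis by simp
qed

text \<open>The pointwise sign estimate is averaged over the probability space. A sum of squares is
  thereby controlled by tails of linear combinations, whose laws are accessible.\<close>

lemma (in prob_space) prob_sum_squares_le:
  fixes x :: "nat \<Rightarrow> 'a \<Rightarrow> real"
  assumes [measurable]: "\<And>k. k < m \<Longrightarrow> x k \<in> borel_measurable M" and R: "0 \<le> R"
  shows "3 * 2 ^ m * prob {\<omega> \<in> space M. R\<^sup>2 < (\<Sum>k<m. (x k \<omega>)\<^sup>2)}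
    \<le> 16 * (\<Sum>S\<in>Pow {..<m}. prob {\<omega> \<in> space M. R / 2 \<le> \<bar>\<Sum>k<m. rsign S k *\<^sub>R x k \<omega>\<bar>})"
proof -
  let ?A = "{\<omega> \<in> space M. R\<^sup>2 < (\<Sum>k<m. (x k \<omega>)\<^sup>2)}"
  let ?B = "\<lambda>S. {\<omega> \<in> space M. R / 2 \<le> \<bar>\<Sum>k<m. rsign S k *\<^sub>R x k \<omega>\<bar>}"
  have A: "?A \<in> events" and B: "?B S \<in> events" for S by measurable
  have "expectation (\<lambda>\<omega>. 3 * 2 ^ m * indicator ?A \<omega> :: real) \<le> expectation (\<lambda>\<omega>. 16 * (\<Sum>S\<in>Pow {..<m}. indicator (?B S) \<omega>))"
  proof (rule integral_mono)
    fix \<omega> assume \<omega>: "\<omega> \<in> space M"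
    show "3 * 2 ^ m * indicator ?A \<omega> \<le> 16 * (\<Sum>S\<in>Pow {..<m}. indicator (?B S) \<omega> :: real)"
    proof (cases "\<omega> \<in> ?A")
      case True
      have "(\<Sum>S\<in>Pow {..<m}. if R / 2 \<le> \<bar>\<Sum>k<m. rsign S k *\<^sub>R x k \<omega>\<bar> then 1 else 0 :: real)
          = (\<Sum>S\<in>Pow {..<m}. indicator (?B S) \<omega>)"
        using \<omega> by (intro sum.cong) (auto simp: indicator_def)
      then show ?thesis using rsign_Paley_Zygmund[OF R, of "\<lambda>k. x k \<omega>" m] True by simp
    qed (auto intro: sum_nonneg)
  next
    show "integrable M (\<lambda>\<omega>. 3 * 2 ^ m * indicator ?A \<omega> :: real)"
      using A by (intro integrable_mult_right integrable_real_indicator) (auto simp: less_top[symmetric])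
    show "integrable M (\<lambda>\<omega>. 16 * (\<Sum>S\<in>Pow {..<m}. indicator (?B S) \<omega>) :: real)"
      using B by (intro integrable_mult_right Bochner_Integration.integrable_sum integrable_real_indicator) (auto simp: less_top[symmetric])
  qed
  moreover have "expectation (\<lambda>\<omega>. 16 * (\<Sum>S\<in>Pow {..<m}. indicator (?B S) \<omega>) :: real)
      = 16 * (\<Sum>S\<in>Pow {..<m}. expectation (indicator (?B S)))"
    unfolding integral_mult_right_zero using B
    by (subst Bochner_Integration.integral_sum) (auto simp: less_top[symmetric] intro!: integrable_real_indicator)
  moreover have "expectation (indicator (?B S)) = prob (?B S)" for S
    using B[of S] sets.sets_into_space[OF B[of S]] by (simp only: Bochner_Integration.integral_indicator Int_absorb2)
  moreover have "expectation (\<lambda>\<omega>. 3 * 2 ^ m * indicator ?A \<omega> :: real) = 3 * 2 ^ m * prob ?A"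
    using sets.sets_into_space[OF A] by (simp only: integral_mult_right_zero Bochner_Integration.integral_indicator Int_absorb2)
  ultimately show ?thesis by (simp only:)
qed

section \<open>Nikishin's theorem for quadratic forms\<close>

text \<open>Outside a small set, a family of random variables that is bounded in probability on the unit
  ball of a quadratic form \<open>Q\<close> satisfies a weak \<open>L\<^sup>2\<close> bound: a maximal disjoint family of sets on which
  the bound fails has small total measure, because a random-sign combination of the corresponding
  elements is large on the whole union while its \<open>Q\<close>-value stays bounded on average.\<close>

lemma (in prob_space) Nikishin:
  fixes X :: "'h \<Rightarrow> 'a \<Rightarrow> real" and Q :: "'h \<Rightarrow> real" and V :: "'h set"
  assumes X [measurable]: "\<And>h. h \<in> V \<Longrightarrow> X h \<in> borel_measurable M" and Q: "\<And>h. h \<in> V \<Longrightarrow> 0 \<le> Q h"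
    and bdd: "\<And>\<eta> K. \<eta> > 0 \<Longrightarrow> \<exists>R>0. \<forall>h\<in>V. Q h \<le> K \<longrightarrow> ptail (X h) R \<le> \<eta>"
    and comb: "\<And>m h (a::nat \<Rightarrow> real). (\<And>k. k < m \<Longrightarrow> h k \<in> V) \<Longrightarrow>
      \<exists>g. (\<forall>S\<in>Pow {..<m}. g S \<in> V \<and> (AE \<omega> in M. X (g S) \<omega> = (\<Sum>k<m. rsign S k *\<^sub>R (a k * X (h k) \<omega>)))) \<and>
          (\<Sum>S\<in>Pow {..<m}. Q (g S)) \<le> 2 ^ m * (\<Sum>k<m. (a k)\<^sup>2 * Q (h k))"
    and \<eta>: "0 < \<eta>"
  shows "\<exists>E\<in>events. \<exists>R\<ge>0. prob (space M - E) \<le> \<eta> \<and>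
    (\<forall>h\<in>V. \<forall>c>0. prob (E \<inter> {\<omega> \<in> space M. c < \<bar>X h \<omega>\<bar>}) \<le> R * Q h / c\<^sup>2)"
proof -
  \<comment> \<open>With these levels the average over the signs comes out as \<eta>/16 plus
    \<eta>/16 times the mean of Q, which is at most 1; the factor 16/3 then leaves 2
    \<eta>/3.\<close>
  obtain R0 where R0: "R0 > 0" "\<And>h. h \<in> V \<Longrightarrow> Q h \<le> 16 / \<eta> \<Longrightarrow> ptail (X h) R0 \<le> \<eta> / 16"
    using bdd[of "\<eta> / 16" "16 / \<eta>"] \<eta> by auto
  define \<rho> where "\<rho> = 2 * R0 + 2"
  have \<rho>: "\<rho> > 0" "\<rho> / 2 > R0" using R0 by (auto simp: \<rho>_def)
  \<comment> \<open>The slack q > 0 stands in for Q h, which may vanish, so that it can be divided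
    by. On a bad set F the square of X h exceeds \<rho>^2 q / prob F.\<close>
  define bad where "bad F \<longleftrightarrow> F \<in> events \<and> (\<exists>h\<in>V. \<exists>c>0. \<exists>q>0. Q h \<le> q \<and> (\<forall>\<omega>\<in>F. c < \<bar>X h \<omega>\<bar>) \<and> \<rho>\<^sup>2 * q < c\<^sup>2 * prob F)" for F
  have bad_pos: "prob F > 0" if bF: "bad F" for F
  proof -
    obtain h c q where "c > 0" "q > 0" "\<rho>\<^sup>2 * q < c\<^sup>2 * prob F" "h \<in> V" using bF unfolding bad_def by blast
    then have "0 < c\<^sup>2 * prob F" using \<rho>(1) by (metis less_trans mult_pos_pos zero_less_power)
    then show ?thesis using \<open>c > 0\<close> by (simp add: zero_less_mult_iff)
  qed
  have fin: "prob (\<Union>\<F>) \<le> \<eta>" if \<F>: "finite \<F>" "disjoint \<F>" "\<And>F. F \<in> \<F> \<Longrightarrow> bad F" for \<F>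
  proof -
    define m where "m = card \<F>"
    obtain f where f: "bij_betw f {..<m} \<F>"
      using ex_bij_betw_nat_finite[OF \<F>(1)] unfolding m_def lessThan_atLeast0 by blast
    have fb: "bad (f k)" if "k < m" for k using f \<F>(3) that by (auto simp: bij_betw_def)
    have "\<forall>k. \<exists>h c q. k < m \<longrightarrow> h \<in> V \<and> 0 < c \<and> 0 < q \<and> Q h \<le> q \<and> (\<forall>\<omega>\<in>f k. c < \<bar>X h \<omega>\<bar>) \<and> \<rho>\<^sup>2 * q < c\<^sup>2 * prob (f k)"
      using fb unfolding bad_def by blast
    then obtain h c q where "\<forall>k. k < m \<longrightarrow> h k \<in> V \<and> 0 < c k \<and> 0 < q k \<and> Q (h k) \<le> q k \<and>
        (\<forall>\<omega>\<in>f k. c k < \<bar>X (h k) \<omega>\<bar>) \<and> \<rho>\<^sup>2 * q k < (c k)\<^sup>2 * prob (f k)"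
      unfolding choice_iff by (elim exE) (rule that)
    then have hcq: "\<And>k. k < m \<Longrightarrow> h k \<in> V" "\<And>k. k < m \<Longrightarrow> 0 < c k" "\<And>k. k < m \<Longrightarrow> 0 < q k"
      "\<And>k. k < m \<Longrightarrow> Q (h k) \<le> q k" "\<And>k \<omega>. k < m \<Longrightarrow> \<omega> \<in> f k \<Longrightarrow> c k < \<bar>X (h k) \<omega>\<bar>"
      "\<And>k. k < m \<Longrightarrow> \<rho>\<^sup>2 * q k < (c k)\<^sup>2 * prob (f k)" by blast+
    \<comment> \<open>The weights balance two requirements: (a k)^2 Q (h k) is at most prob (f k),
      which sums to at most 1 by disjointness, while the square of a k X (h k) exceeds \<rho>^2 on f
      k.\<close>
    define a where "a k = sqrt (prob (f k) / q k)" for k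
    have a2: "(a k)\<^sup>2 = prob (f k) / q k" if "k < m" for k
      unfolding a_def using hcq(3)[OF that] by simp
    obtain g where g: "\<And>S. S \<in> Pow {..<m} \<Longrightarrow> g S \<in> V"
      "\<And>S. S \<in> Pow {..<m} \<Longrightarrow> AE \<omega> in M. X (g S) \<omega> = (\<Sum>k<m. rsign S k *\<^sub>R (a k * X (h k) \<omega>))"
      "(\<Sum>S\<in>Pow {..<m}. Q (g S)) \<le> 2 ^ m * (\<Sum>k<m. (a k)\<^sup>2 * Q (h k))"
      using comb[of m h a] hcq(1) by blast
    have Xh [measurable]: "(\<lambda>\<omega>. a k * X (h k) \<omega>) \<in> borel_measurable M" if "k < m" for k
      using X[OF hcq(1)[OF that]] by measurable
    have sumP: "(\<Sum>k<m. prob (f k)) \<le> 1"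
    proof -
      have "(\<Sum>k<m. prob (f k)) = (\<Sum>F\<in>\<F>. prob F)" using f by (rule sum.reindex_bij_betw)
      also have "\<dots> = prob (\<Union>\<F>)"
      proof -
        have "\<F> \<subseteq> events" using \<F>(3) by (auto simp: bad_def)
        then show ?thesis using finite_measure_finite_Union[of \<F> "\<lambda>x. x"] \<F>(1,2)
          by (simp add: disjoint_family_on_def disjoint_def)
      qed
      finally show ?thesis by simp
    qed
    have sumQ: "(\<Sum>k<m. (a k)\<^sup>2 * Q (h k)) \<le> 1"
    proof -
      have "(\<Sum>k<m. (a k)\<^sup>2 * Q (h k)) \<le> (\<Sum>k<m. prob (f k))"
      proof (rule sum_mono)
        fix k assume "k \<in> {..<m}" then have k: "k < m" by simp
        have "(a k)\<^sup>2 * Q (h k) \<le> (a k)\<^sup>2 * q k" by (intro mult_left_mono hcq k) simp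
        then show "(a k)\<^sup>2 * Q (h k) \<le> prob (f k)" using a2[OF k] hcq(3)[OF k] by simp
      qed
      then show ?thesis using sumP by simp
    qed
    have sub: "\<Union>\<F> \<subseteq> {\<omega> \<in> space M. \<rho>\<^sup>2 < (\<Sum>k<m. (a k * X (h k) \<omega>)\<^sup>2)}"
    proof
      fix \<omega> assume "\<omega> \<in> \<Union>\<F>"
      then obtain k where k: "k < m" "\<omega> \<in> f k" using f by (auto simp: bij_betw_def)
      have "f k \<in> events" using fb[OF k(1)] by (simp add: bad_def)
      then have sp: "\<omega> \<in> space M" using k(2) sets.sets_into_space by blast
      have "\<rho>\<^sup>2 < (c k)\<^sup>2 * prob (f k) / q k" using hcq(6)[OF k(1)] hcq(3)[OF k(1)] by (simp add: pos_less_divide_eq)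
      also have "\<dots> = (a k)\<^sup>2 * (c k)\<^sup>2" using a2[OF k(1)] by simp
      also have "\<dots> \<le> (a k)\<^sup>2 * (X (h k) \<omega>)\<^sup>2"
        using hcq(5)[OF k] hcq(2)[OF k(1)] by (intro mult_left_mono) (auto simp: abs_le_square_iff[symmetric])
      also have "\<dots> = (a k * X (h k) \<omega>)\<^sup>2" by (simp add: power_mult_distrib)
      also have "\<dots> \<le> (\<Sum>k<m. (a k * X (h k) \<omega>)\<^sup>2)" using k by (intro member_le_sum) auto
      finally show "\<omega> \<in> {\<omega> \<in> space M. \<rho>\<^sup>2 < (\<Sum>k<m. (a k * X (h k) \<omega>)\<^sup>2)}" using sp by simp
    qed
    \<comment> \<open>Markov's inequality in disguise: Q (g S) is controlled only on average over S,
      and beyond 16/\<eta> the right-hand side exceeds 1 anyway.\<close>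
    have bnd: "prob {\<omega> \<in> space M. \<rho> / 2 \<le> \<bar>\<Sum>k<m. rsign S k *\<^sub>R (a k * X (h k) \<omega>)\<bar>} \<le> \<eta> / 16 + \<eta> / 16 * Q (g S)"
      if S: "S \<in> Pow {..<m}" for S
    proof (cases "Q (g S) \<le> 16 / \<eta>")
      case True
      have gm [measurable]: "X (g S) \<in> borel_measurable M" using g(1)[OF S] by (rule X)
      have "prob {\<omega> \<in> space M. \<rho> / 2 \<le> \<bar>\<Sum>k<m. rsign S k *\<^sub>R (a k * X (h k) \<omega>)\<bar>}
          = prob {\<omega> \<in> space M. \<rho> / 2 \<le> \<bar>X (g S) \<omega>\<bar>}"
        using g(2)[OF S] by (intro finite_measure_eq_AE) auto
      also have "\<dots> \<le> ptail (X (g S)) R0"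
        unfolding ptail_def using \<rho> by (intro finite_measure_mono) auto
      also have "\<dots> \<le> \<eta> / 16" by (rule R0(2)[OF g(1)[OF S] True])
      finally show ?thesis using Q[OF g(1)[OF S]] \<eta> by (simp add: add_increasing2)
    next
      case False
      then have "1 \<le> \<eta> / 16 * Q (g S)" using \<eta> by (simp add: field_simps)
      then show ?thesis using \<eta> by (smt (verit) prob_le_1 divide_pos_pos)
    qed
    have "3 * 2 ^ m * prob (\<Union>\<F>) \<le> 3 * 2 ^ m * prob {\<omega> \<in> space M. \<rho>\<^sup>2 < (\<Sum>k<m. (a k * X (h k) \<omega>)\<^sup>2)}"
      by (intro mult_left_mono finite_measure_mono sub) auto
    also have "\<dots> \<le> 16 * (\<Sum>S\<in>Pow {..<m}. prob {\<omega> \<in> space M. \<rho> / 2 \<le> \<bar>\<Sum>k<m. rsign S k *\<^sub>R (a k * X (h k) \<omega>)\<bar>})"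
      using \<rho>(1) by (intro prob_sum_squares_le) auto
    also have "\<dots> \<le> 16 * (\<Sum>S\<in>Pow {..<m}. \<eta> / 16 + \<eta> / 16 * Q (g S))"
      by (intro mult_left_mono sum_mono bnd) auto
    also have "\<dots> = \<eta> * 2 ^ m + \<eta> * (\<Sum>S\<in>Pow {..<m}. Q (g S))"
      unfolding sum.distrib sum_distrib_left[symmetric] by (simp add: card_Pow algebra_simps)
    also have "\<dots> \<le> \<eta> * 2 ^ m + \<eta> * (2 ^ m * 1)"
      using \<eta> order_trans[OF g(3) mult_left_mono[OF sumQ, of "2 ^ m"]] by (intro add_left_mono mult_left_mono) auto
    finally have "2 ^ m * (3 * prob (\<Union>\<F>)) \<le> 2 ^ m * (2 * \<eta>)" by (simp add: algebra_simps)
    then have "3 * prob (\<Union>\<F>) \<le> 2 * \<eta>" by (subst (asm) mult_le_cancel_left_pos) auto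
    then show ?thesis using \<eta> by simp
  qed
  define \<A> where "\<A> = {\<F>. (\<forall>F\<in>\<F>. bad F) \<and> disjoint \<F>}"
  \<comment> \<open>Zorn's lemma yields a maximal disjoint family of bad sets; each has positive
    probability, so the family is countable and the bound for finite families passes to its
    union.\<close>
  have "\<exists>\<M>\<in>\<A>. \<forall>\<F>\<in>\<A>. \<M> \<subseteq> \<F> \<longrightarrow> \<F> = \<M>"
  proof (rule subset_Zorn')
    fix \<C> assume C: "subset.chain \<A> \<C>"
    have "disjoint (\<Union>\<C>)"
      unfolding disjoint_def
    proof (intro ballI impI)
      fix F G assume "F \<in> \<Union>\<C>" "G \<in> \<Union>\<C>" and ne: "F \<noteq> G"
      then obtain A B where AB: "A \<in> \<C>" "B \<in> \<C>" "F \<in> A" "G \<in> B" by blast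
      then have "A \<subseteq> B \<or> B \<subseteq> A" using C unfolding subset.chain_def by blast
      then obtain D where "D \<in> \<C>" "F \<in> D" "G \<in> D" using AB by blast
      moreover have "disjoint D" using C \<open>D \<in> \<C>\<close> unfolding subset.chain_def \<A>_def by blast
      ultimately show "F \<inter> G = {}" using ne by (auto dest: disjointD)
    qed
    then show "\<Union>\<C> \<in> \<A>" using C unfolding subset.chain_def \<A>_def by blast
  qed
  then obtain \<M> where \<M>A: "\<M> \<in> \<A>" and max: "\<And>\<F>. \<F> \<in> \<A> \<Longrightarrow> \<M> \<subseteq> \<F> \<Longrightarrow> \<F> = \<M>" by metis
  have \<M>: "\<And>F. F \<in> \<M> \<Longrightarrow> bad F" "disjoint \<M>" using \<M>A by (simp_all add: \<A>_def)
  have \<M>e: "F \<in> events" if "F \<in> \<M>" for F using \<M>(1)[OF that] by (simp add: bad_def)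
  have "countable \<M>"
  proof -
    have "finite {F \<in> \<M>. inverse (real (Suc n)) < prob F}" for n
    proof (rule ccontr)
      assume "infinite {F \<in> \<M>. inverse (real (Suc n)) < prob F}"
      then obtain \<G> where G: "\<G> \<subseteq> {F \<in> \<M>. inverse (real (Suc n)) < prob F}" "finite \<G>" "card \<G> = Suc (Suc n)"
        using infinite_arbitrarily_large by blast
      have "real (card \<G>) * inverse (real (Suc n)) \<le> (\<Sum>F\<in>\<G>. prob F)"
        using G by (intro sum_bounded_below) (auto intro: less_imp_le)
      also have "\<dots> = prob (\<Union>\<G>)"
      proof -
        have "\<G> \<subseteq> events" using G(1) \<M>e by auto
        moreover have "disjoint_family_on (\<lambda>x. x) \<G>"
          using G(1) \<M>(2) by (auto simp: disjoint_family_on_def disjoint_def)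
        ultimately show ?thesis using finite_measure_finite_Union[of \<G> "\<lambda>x. x"] G(2) by simp
      qed
      also have "\<dots> \<le> 1" by simp
      finally show False using G(3) by (simp add: field_simps)
    qed
    then have "countable (\<Union>n. {F \<in> \<M>. inverse (real (Suc n)) < prob F})" by (intro countable_UN) (auto intro: countable_finite)
    moreover have "\<M> \<subseteq> (\<Union>n. {F \<in> \<M>. inverse (real (Suc n)) < prob F})"
    proof
      fix F assume F: "F \<in> \<M>"
      then obtain n where "inverse (real (Suc n)) < prob F" using reals_Archimedean[OF bad_pos[OF \<M>(1)]] by blast
      then show "F \<in> (\<Union>n. {F \<in> \<M>. inverse (real (Suc n)) < prob F})" using F by blast
    qed
    ultimately show ?thesis by (rule countable_subset[rotated])
  qed
  define U where "U = \<Union>\<M>"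
  have U: "U \<in> events" unfolding U_def using \<open>countable \<M>\<close> \<M>e by (intro sets.countable_Union) auto
  have "prob U \<le> \<eta>"
  proof (cases "\<M> = {}")
    case True then show ?thesis using \<eta> by (simp add: U_def)
  next
    case False
    let ?f = "from_nat_into \<M>"
    have rf: "range ?f = \<M>" using False \<open>countable \<M>\<close> by (rule range_from_nat_into)
    have "(\<lambda>n. prob (\<Union>i\<le>n. ?f i)) \<longlonglongrightarrow> prob (\<Union>n. \<Union>i\<le>n. ?f i)"
    proof (rule finite_Lim_measure_incseq)
      show "range (\<lambda>n. \<Union>i\<le>n. ?f i) \<subseteq> events" using rf \<M>e by (auto intro!: sets.finite_UN)
      show "incseq (\<lambda>n. \<Union>i\<le>n. ?f i)" by (intro incseq_SucI UN_mono) auto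
    qed
    moreover have "(\<Union>n. \<Union>i\<le>n. ?f i) = \<Union>(range ?f)" by auto
    then have "(\<Union>n. \<Union>i\<le>n. ?f i) = U" unfolding rf U_def .
    moreover have "prob (\<Union>i\<le>n. ?f i) \<le> \<eta>" for n
    proof (rule fin)
      have "?f ` {..n} \<subseteq> \<M>" using rf by blast
      then show "disjoint (?f ` {..n})" using \<M>(2) by (meson disjoint_def subsetD)
      show "bad F" if "F \<in> ?f ` {..n}" for F using that \<open>?f ` {..n} \<subseteq> \<M>\<close> \<M>(1) by blast
    qed simp
    ultimately show ?thesis using LIMSEQ_le_const2[of "\<lambda>n. prob (\<Union>i\<le>n. ?f i)" "prob U" \<eta>] by simp
  qed
  \<comment> \<open>A failure of the bound outside U would exhibit a further bad set, disjoint from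
    the whole family, against maximality.\<close>
  moreover have "prob ((space M - U) \<inter> {\<omega> \<in> space M. c < \<bar>X h \<omega>\<bar>}) \<le> \<rho>\<^sup>2 * Q h / c\<^sup>2" if h: "h \<in> V" and c: "c > 0" for h c
  proof (rule ccontr)
    let ?F = "(space M - U) \<inter> {\<omega> \<in> space M. c < \<bar>X h \<omega>\<bar>}"
    assume "\<not> prob ?F \<le> \<rho>\<^sup>2 * Q h / c\<^sup>2"
    then have lt: "\<rho>\<^sup>2 * Q h < c\<^sup>2 * prob ?F" using c by (simp add: field_simps)
    have "Q h < c\<^sup>2 * prob ?F / \<rho>\<^sup>2" using lt \<rho>(1) by (simp add: pos_less_divide_eq mult.commute)
    then obtain q where q: "Q h < q" "q < c\<^sup>2 * prob ?F / \<rho>\<^sup>2" using dense by blast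
    then have q': "\<rho>\<^sup>2 * q < c\<^sup>2 * prob ?F" using \<rho>(1) by (simp add: pos_less_divide_eq mult.commute)
    have "?F \<in> events" using U X[OF h] by measurable
    then have badF: "bad ?F" unfolding bad_def using h c q q' Q[OF h] by (intro conjI bexI[of _ h] exI[of _ c] exI[of _ q]) auto
    have disjF: "F \<inter> ?F = {}" if "F \<in> \<M>" for F using that by (auto simp: U_def)
    have "insert ?F \<M> \<in> \<A>"
    proof -
      have "disjoint (insert G \<M>)" if "\<And>F. F \<in> \<M> \<Longrightarrow> F \<inter> G = {}" for G
        using \<M>(2) that by (auto simp: disjoint_def)
      then show ?thesis unfolding \<A>_def using badF \<M>(1) disjF by blast
    qed
    then have "insert ?F \<M> = \<M>" by (rule max) auto
    then have "?F \<in> \<M>" by blast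
    then have "?F = {}" using disjF[of ?F] by blast
    then show False using bad_pos[OF badF] by (metis less_irrefl measure_empty)
  qed
  moreover have "space M - (space M - U) = U" using sets.sets_into_space[OF U] by blast
  ultimately show ?thesis using U \<rho>(1) by (intro bexI[of _ "space M - U"] exI[of _ "\<rho>\<^sup>2"]) auto
qed

section \<open>Characteristic functions\<close>

lemma cmod_iexp_minus_1: "cmod (iexp x - 1) \<le> \<bar>x\<bar>"
  using iexp_approx1[of x 0] by simp

lemma cmod_iexp_diff: "cmod (iexp x - iexp y) \<le> \<bar>x - y\<bar>"
proof -
  have "iexp x - iexp y = iexp y * (iexp (x - y) - 1)"
    by (simp add: algebra_simps flip: exp_add)
  then have "cmod (iexp x - iexp y) = cmod (iexp (x - y) - 1)"
    by (simp add: norm_mult)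
  then show ?thesis using cmod_iexp_minus_1[of "x - y"] by simp
qed

lemma cmod_iexp_minus_1_sq: "(cmod (iexp x - 1))\<^sup>2 = 2 * (1 - cos x)"
proof -
  have "iexp x = Complex (cos x) (sin x)" by (simp add: cis_conv_exp[symmetric] cis.ctr)
  then have "(cmod (iexp x - 1))\<^sup>2 = (cos x - 1)\<^sup>2 + (sin x)\<^sup>2" by (simp add: cmod_power2)
  also have "\<dots> = 1 - 2 * cos x + ((sin x)\<^sup>2 + (cos x)\<^sup>2)" by (simp only: power2_eq_square) (simp add: algebra_simps)
  also have "\<dots> = 2 * (1 - cos x)" by simp
  finally show ?thesis .
qed

lemma cmod_iexp_mult_le: "cmod (iexp (real n * x) - 1) \<le> real n * cmod (iexp x - 1)"
proof (induction n)
  case (Suc n)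
  have "iexp (real (Suc n) * x) - 1 = iexp x * (iexp (real n * x) - 1) + (iexp x - 1)"
    by (simp add: algebra_simps flip: exp_add)
  then have "cmod (iexp (real (Suc n) * x) - 1) \<le> cmod (iexp x * (iexp (real n * x) - 1)) + cmod (iexp x - 1)"
    by (metis norm_triangle_ineq)
  also have "\<dots> = cmod (iexp (real n * x) - 1) + cmod (iexp x - 1)" by (simp add: norm_mult)
  finally show ?case using Suc by (simp add: algebra_simps)
qed simp

text \<open>At each step the remainder gains the product (exp(inx) - 1)(exp(ix) - 1), of modulus at
  most n |exp(ix) - 1|^2 = 2 n (1 - cos x). The mean of 1 - cos is the real part of 1 - cf, so the
  bound closes up after integration.\<close>

lemma cmod_iexp_multiple:
  "cmod (iexp (real n * x) - 1 - of_nat n * (iexp x - 1)) \<le> real n * (real n - 1) * (1 - cos x)"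
proof (induction n)
  case (Suc n)
  let ?A = "iexp (real n * x) - 1 - of_nat n * (iexp x - 1)"
  have "iexp (real (Suc n) * x) - 1 - of_nat (Suc n) * (iexp x - 1)
      = ?A + (iexp (real n * x) - 1) * (iexp x - 1)"
    by (simp add: algebra_simps flip: exp_add)
  then have "cmod (iexp (real (Suc n) * x) - 1 - of_nat (Suc n) * (iexp x - 1))
      \<le> cmod ?A + cmod (iexp (real n * x) - 1) * cmod (iexp x - 1)"
    by (metis norm_triangle_ineq norm_mult)
  also have "\<dots> \<le> real n * (real n - 1) * (1 - cos x) + (real n * cmod (iexp x - 1)) * cmod (iexp x - 1)"
    by (intro add_mono Suc.IH mult_right_mono cmod_iexp_mult_le) simp
  also have "(real n * cmod (iexp x - 1)) * cmod (iexp x - 1) = real n * (2 * (1 - cos x))"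
    unfolding cmod_iexp_minus_1_sq[symmetric] by (simp add: power2_eq_square)
  finally show ?case by (simp add: algebra_simps)
qed simp

context prob_space
begin

definition cf :: "('a \<Rightarrow> real) \<Rightarrow> complex" where
  "cf X = (CLINT \<omega>|M. iexp (X \<omega>))"

lemma integrable_iexp_rv: "X \<in> borel_measurable M \<Longrightarrow> integrable M (\<lambda>\<omega>. iexp (X \<omega>))"
  by (intro integrable_const_bound[of _ 1]) auto

lemma char_distr_cf: "X \<in> borel_measurable M \<Longrightarrow> char (distr M borel X) x = cf (\<lambda>\<omega>. x * X \<omega>)"
  unfolding char_def cf_def by (subst integral_distr) auto

lemma cf_cong_AE:
  assumes "AE \<omega> in M. X \<omega> = Y \<omega>" "X \<in> borel_measurable M" "Y \<in> borel_measurable M"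
  shows "cf X = cf Y"
  unfolding cf_def by (rule integral_cong_AE) (use assms in auto)

lemma cmod_cf_le_1: "X \<in> borel_measurable M \<Longrightarrow> cmod (cf X) \<le> 1"
  unfolding cf_def
  by (rule order_trans[OF integral_norm_bound]) (simp add: prob_space)

lemma cf_zero: "cf (\<lambda>_. 0) = 1"
  by (simp add: cf_def prob_space)

lemma cf_diff_le:
  assumes [measurable]: "X \<in> borel_measurable M" "Y \<in> borel_measurable M" and e: "0 \<le> e"
  shows "cmod (cf X - cf Y) \<le> e + 2 * ptail (\<lambda>\<omega>. X \<omega> - Y \<omega>) e"
proof -
  let ?A = "{\<omega> \<in> space M. e < \<bar>X \<omega> - Y \<omega>\<bar>}"
  have "cf X - cf Y = (CLINT \<omega>|M. iexp (X \<omega>) - iexp (Y \<omega>))"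
    unfolding cf_def by (rule Bochner_Integration.integral_diff[symmetric]) (auto intro!: integrable_iexp_rv)
  also have "cmod \<dots> \<le> expectation (\<lambda>\<omega>. cmod (iexp (X \<omega>) - iexp (Y \<omega>)))" by (rule integral_norm_bound)
  also have "\<dots> \<le> expectation (\<lambda>\<omega>. e + 2 * indicator ?A \<omega>)"
  proof (rule integral_mono)
    show "integrable M (\<lambda>\<omega>. cmod (iexp (X \<omega>) - iexp (Y \<omega>)))"
      by (intro integrable_norm Bochner_Integration.integrable_diff integrable_iexp_rv) auto
    show "integrable M (\<lambda>\<omega>. e + 2 * indicator ?A \<omega>)"
      by (intro Bochner_Integration.integrable_add integrable_mult_right integrable_real_indicator) (auto simp: less_top[symmetric])
    fix \<omega> assume \<omega>: "\<omega> \<in> space M"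
    have "cmod (iexp (X \<omega>) - iexp (Y \<omega>)) \<le> 2"
      using norm_triangle_ineq4[of "iexp (X \<omega>)" "iexp (Y \<omega>)"] by simp
    then show "cmod (iexp (X \<omega>) - iexp (Y \<omega>)) \<le> e + 2 * indicator ?A \<omega>"
      using cmod_iexp_diff[of "X \<omega>" "Y \<omega>"] e \<omega> by (auto simp: indicator_def)
  qed
  also have "\<dots> = e + 2 * prob ?A"
    by (subst Bochner_Integration.integral_add) (auto simp: less_top[symmetric] prob_space intro!: integrable_real_indicator)
  finally show ?thesis by (simp add: ptail_def)
qed

lemma cf_tendsto:
  assumes "conv_in_prob M X Y" and [measurable]: "\<And>n. X n \<in> borel_measurable M" "Y \<in> borel_measurable M"
  shows "(\<lambda>n. cf (X n)) \<longlonglongrightarrow> cf Y"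
proof (rule LIMSEQ_I)
  fix r :: real assume r: "0 < r"
  obtain N where N: "\<And>n. n \<ge> N \<Longrightarrow> ptail (\<lambda>\<omega>. X n \<omega> - Y \<omega>) (r/4) < r/4"
    using conv_in_probD[OF assms(1), of "r/4" "r/4"] r by auto
  have "norm (cf (X n) - cf Y) < r" if "n \<ge> N" for n
    using cf_diff_le[of "X n" Y "r/4"] N[OF that] r by simp
  then show "\<exists>N. \<forall>n\<ge>N. norm (cf (X n) - cf Y) < r" by blast
qed

lemma Re_one_minus_cf:
  assumes [measurable]: "X \<in> borel_measurable M"
  shows "Re (1 - cf X) = expectation (\<lambda>\<omega>. 1 - cos (X \<omega>))"
proof -
  have "Re (cf X) = expectation (\<lambda>\<omega>. Re (iexp (X \<omega>)))"
    unfolding cf_def by (rule integral_Re[symmetric, OF integrable_iexp_rv]) auto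
  also have "\<dots> = expectation (\<lambda>\<omega>. cos (X \<omega>))" by (simp add: Re_exp)
  finally have "Re (cf X) = expectation (\<lambda>\<omega>. cos (X \<omega>))" .
  moreover have "integrable M (\<lambda>\<omega>. cos (X \<omega>))" by (intro integrable_const_bound[of _ 1]) auto
  ultimately show ?thesis by (simp add: prob_space)
qed

text \<open>The remainder contributes n (n - 1) and the linear term n, together n^2: the deviation
  from 1 grows quadratically, as it would under a finite second moment.\<close>

lemma cf_multiple:
  assumes [measurable]: "X \<in> borel_measurable M"
  shows "cmod (1 - cf (\<lambda>\<omega>. real n * X \<omega>)) \<le> (real n)\<^sup>2 * cmod (1 - cf X)"
proof (cases "n = 0")
  case True then show ?thesis by (simp add: cf_zero)
next
  case False
  let ?D = "\<lambda>\<omega>. iexp (real n * X \<omega>) - 1 - of_nat n * (iexp (X \<omega>) - 1)"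
  have i1: "integrable M (\<lambda>\<omega>. iexp (real n * X \<omega>))" "integrable M (\<lambda>\<omega>. iexp (X \<omega>))"
    by (intro integrable_iexp_rv; measurable)+
  have i2: "integrable M (\<lambda>\<omega>. 1 - cos (X \<omega>))"
    by (intro Bochner_Integration.integrable_diff integrable_const integrable_const_bound[of _ 1]) auto
  have eq: "cf (\<lambda>\<omega>. real n * X \<omega>) - 1 - of_nat n * (cf X - 1) = (CLINT \<omega>|M. ?D \<omega>)"
  proof -
    have "(CLINT \<omega>|M. ?D \<omega>) = (CLINT \<omega>|M. iexp (real n * X \<omega>) - 1) - (CLINT \<omega>|M. of_nat n * (iexp (X \<omega>) - 1))"
      using i1 by (intro Bochner_Integration.integral_diff integrable_mult_right Bochner_Integration.integrable_diff) auto
    also have "(CLINT \<omega>|M. iexp (real n * X \<omega>) - 1) = cf (\<lambda>\<omega>. real n * X \<omega>) - 1"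
      unfolding cf_def using i1 by (subst Bochner_Integration.integral_diff) (auto simp: prob_space)
    also have "(CLINT \<omega>|M. of_nat n * (iexp (X \<omega>) - 1)) = of_nat n * (cf X - 1)"
      unfolding cf_def integral_mult_right_zero using i1 by (subst Bochner_Integration.integral_diff) (auto simp: prob_space)
    finally show ?thesis by simp
  qed
  have "cmod (cf (\<lambda>\<omega>. real n * X \<omega>) - 1 - of_nat n * (cf X - 1)) \<le> expectation (\<lambda>\<omega>. cmod (?D \<omega>))"
    unfolding eq by (rule integral_norm_bound)
  also have "\<dots> \<le> expectation (\<lambda>\<omega>. real n * (real n - 1) * (1 - cos (X \<omega>)))"
  proof (rule integral_mono)
    show "integrable M (\<lambda>\<omega>. cmod (?D \<omega>))"
      using i1 by (intro integrable_norm integrable_mult_right Bochner_Integration.integrable_diff) auto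
    show "integrable M (\<lambda>\<omega>. real n * (real n - 1) * (1 - cos (X \<omega>)))" by (rule integrable_mult_right[OF i2])
  qed (rule cmod_iexp_multiple)
  also have "\<dots> = real n * (real n - 1) * Re (1 - cf X)"
    unfolding integral_mult_right_zero Re_one_minus_cf[OF assms] ..
  also have "\<dots> \<le> real n * (real n - 1) * cmod (1 - cf X)"
    using False by (intro mult_left_mono complex_Re_le_cmod) auto
  finally have 1: "cmod (cf (\<lambda>\<omega>. real n * X \<omega>) - 1 - of_nat n * (cf X - 1)) \<le> real n * (real n - 1) * cmod (1 - cf X)" .
  have "cmod (1 - cf (\<lambda>\<omega>. real n * X \<omega>)) = cmod ((cf (\<lambda>\<omega>. real n * X \<omega>) - 1 - of_nat n * (cf X - 1)) + of_nat n * (cf X - 1))"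
    by (simp add: norm_minus_commute)
  also have "\<dots> \<le> real n * (real n - 1) * cmod (1 - cf X) + cmod (of_nat n * (cf X - 1))"
    by (rule order_trans[OF norm_triangle_ineq]) (use 1 in simp)
  also have "cmod (of_nat n * (cf X - 1)) = real n * cmod (1 - cf X)" by (simp add: norm_mult norm_minus_commute)
  finally show ?thesis by (simp add: power2_eq_square algebra_simps)
qed

text \<open>Integrating 1 - cos(x X) over x in [0,K] gives K - sin(K X)/X, which is at least K/2
  once |X| > 2/K; Tonelli exchanges this integral with the expectation.\<close>

lemma ptail_le_cf:
  assumes [measurable]: "X \<in> borel_measurable M" and K: "0 < K" and \<beta>: "0 \<le> \<beta>"
    and bd: "\<And>x. 0 \<le> x \<Longrightarrow> x \<le> K \<Longrightarrow> cmod (1 - cf (\<lambda>\<omega>. x * X \<omega>)) \<le> \<beta>"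
  shows "ptail X (2 / K) \<le> 2 * \<beta>"
proof -
  let ?f = "\<lambda>x \<omega>. ennreal (1 - cos (x * X \<omega>)) * indicator {0..K} x"
  interpret P: pair_sigma_finite lborel M ..
  have inner: "(\<integral>\<^sup>+\<omega>. ?f x \<omega> \<partial>M) \<le> ennreal \<beta> * indicator {0..K} x" for x
  proof (cases "x \<in> {0..K}")
    case True
    have "(\<integral>\<^sup>+\<omega>. ?f x \<omega> \<partial>M) = (\<integral>\<^sup>+\<omega>. ennreal (1 - cos (x * X \<omega>)) \<partial>M)" using True by simp
    also have "\<dots> = ennreal (expectation (\<lambda>\<omega>. 1 - cos (x * X \<omega>)))"
      by (intro nn_integral_eq_integral Bochner_Integration.integrable_diff integrable_const integrable_const_bound[of _ 1]) auto
    also have "expectation (\<lambda>\<omega>. 1 - cos (x * X \<omega>)) = Re (1 - cf (\<lambda>\<omega>. x * X \<omega>))"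
      by (rule Re_one_minus_cf[symmetric]) measurable
    also have "\<dots> \<le> \<beta>" using bd[of x] True complex_Re_le_cmod order_trans by fastforce
    finally show ?thesis using True by (simp add: ennreal_leI)
  qed simp
  have outer: "ennreal (K / 2) * indicator {\<omega> \<in> space M. 2 / K < \<bar>X \<omega>\<bar>} \<omega> \<le> (\<integral>\<^sup>+x. ?f x \<omega> \<partial>lborel)" for \<omega>
  proof (cases "2 / K < \<bar>X \<omega>\<bar>")
    case True
    define y where "y = X \<omega>"
    have y: "y \<noteq> 0" "2 < K * \<bar>y\<bar>" using True K by (auto simp: y_def field_simps)
    have "(\<integral>\<^sup>+x. ?f x \<omega> \<partial>lborel) = ennreal ((K - sin (K * y) / y) - (0 - sin (0 * y) / y))"
      unfolding y_def[symmetric]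
      by (rule nn_integral_FTC_Icc) (use y K in \<open>auto intro!: derivative_eq_intros simp: field_simps\<close>)
    moreover have "sin (K * y) / y \<le> K / 2"
    proof -
      have "sin (K * y) / y \<le> \<bar>sin (K * y)\<bar> / \<bar>y\<bar>" by (metis abs_divide abs_ge_self)
      also have "\<dots> \<le> 1 / \<bar>y\<bar>" by (intro divide_right_mono) auto
      also have "\<dots> \<le> K / 2" using y by (simp add: field_simps)
      finally show ?thesis .
    qed
    ultimately show ?thesis by (auto simp: indicator_def intro!: ennreal_leI)
  qed simp
  have "ennreal (K / 2) * emeasure M {\<omega> \<in> space M. 2 / K < \<bar>X \<omega>\<bar>}
      = (\<integral>\<^sup>+\<omega>. ennreal (K / 2) * indicator {\<omega> \<in> space M. 2 / K < \<bar>X \<omega>\<bar>} \<omega> \<partial>M)"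
    by (rule nn_integral_cmult_indicator[symmetric]) measurable
  also have "\<dots> \<le> (\<integral>\<^sup>+\<omega>. (\<integral>\<^sup>+x. ?f x \<omega> \<partial>lborel) \<partial>M)" by (intro nn_integral_mono outer)
  also have "\<dots> = (\<integral>\<^sup>+x. (\<integral>\<^sup>+\<omega>. ?f x \<omega> \<partial>M) \<partial>lborel)"
    by (rule P.Fubini') measurable
  also have "\<dots> \<le> (\<integral>\<^sup>+x. ennreal \<beta> * indicator {0..K} x \<partial>lborel)" by (intro nn_integral_mono inner)
  also have "\<dots> = ennreal (\<beta> * K)"
    using K \<beta> by (subst nn_integral_cmult_indicator) (auto simp: ennreal_mult)
  finally have "ennreal (K / 2 * ptail X (2 / K)) \<le> ennreal (\<beta> * K)"
    using K by (subst ennreal_mult) (auto simp: ptail_def emeasure_eq_measure)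
  then have "K / 2 * ptail X (2 / K) \<le> \<beta> * K" using K \<beta> by simp
  then show ?thesis using K by (simp add: field_simps)
qed

end

section \<open>Step functions\<close>

text \<open>Overlaps and repetitions of intervals are allowed: addition is concatenation, and no
  normal form has to be maintained.\<close>

type_synonym 'u stepfun = "(real \<times> real \<times> 'u) list"

definition sf :: "'u::real_vector stepfun \<Rightarrow> real \<Rightarrow> 'u" where
  "sf H s = (\<Sum>(a, b, u)\<leftarrow>H. indicator {a<..b} s *\<^sub>R u)"

definition vstep :: "real \<Rightarrow> 'u stepfun \<Rightarrow> bool" where
  "vstep T H \<longleftrightarrow> (\<forall>(a, b, u)\<in>set H. 0 \<le> a \<and> a \<le> b \<and> b \<le> T)"

definition sscale :: "real \<Rightarrow> 'u::real_vector stepfun \<Rightarrow> 'u stepfun" where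
  "sscale c H = map (\<lambda>(a, b, u). (a, b, c *\<^sub>R u)) H"

text \<open>The squared norm of L^2((0,T];U), which plays the role of the quadratic form in the
  Nikishin argument.\<close>

definition sQ :: "real \<Rightarrow> 'u::real_normed_vector stepfun \<Rightarrow> real" where
  "sQ T H = (LINT s:{0<..T}|lborel. (norm (sf H s))\<^sup>2)"

lemma sf_Nil [simp]: "sf [] s = 0" by (simp add: sf_def)
lemma sf_Cons: "sf ((a, b, u) # H) s = indicator {a<..b} s *\<^sub>R u + sf H s" by (simp add: sf_def)
lemma sf_append: "sf (H @ H') s = sf H s + sf H' s" by (simp add: sf_def)
lemma sf_sscale: "sf (sscale c H) s = c *\<^sub>R sf H s"
  by (induction H) (auto simp: sf_Cons sscale_def scaleR_add_right)
lemma sf_concat_map: "sf (concat (map F [0..<m])) s = (\<Sum>k<m. sf (F k) s)"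
  by (induction m) (auto simp: sf_append)

lemma vstep_simps [simp]: "vstep T []" "vstep T ((a, b, u) # H) \<longleftrightarrow> 0 \<le> a \<and> a \<le> b \<and> b \<le> T \<and> vstep T H"
  "vstep T (H @ H') \<longleftrightarrow> vstep T H \<and> vstep T H'" "vstep T (sscale c H) \<longleftrightarrow> vstep T H"
  by (auto simp: vstep_def sscale_def split: prod.splits)

lemma vstep_concat_map: "(\<And>k. k < m \<Longrightarrow> vstep T (F k)) \<Longrightarrow> vstep T (concat (map F [0..<m]))"
  by (auto simp: vstep_def)

lemma sf_measurable [measurable]:
  fixes H :: "'u::{real_normed_vector,second_countable_topology} stepfun"
  shows "sf H \<in> borel_measurable borel"
proof (induction H)
  case (Cons x H)
  obtain a b u where "x = (a, b, u)" by (cases x)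
  then have "sf (x # H) = (\<lambda>s. indicator {a<..b} s *\<^sub>R u + sf H s)" by (auto simp: sf_Cons)
  then show ?case using Cons by simp
qed (simp add: sf_def)

lemma norm_sf_le: "norm (sf H s) \<le> (\<Sum>(a, b, u)\<leftarrow>H. norm u)"
proof (induction H)
  case (Cons x H)
  obtain a b u where "x = (a, b, u)" by (cases x)
  moreover have "norm (indicator {a<..b} s *\<^sub>R u) \<le> norm u" by (simp add: indicator_def)
  ultimately show ?case using Cons norm_triangle_ineq[of "indicator {a<..b} s *\<^sub>R u" "sf H s"]
    by (simp add: sf_Cons)
qed simp

lemma emeasure_Ioc_finite: "emeasure lborel {a<..b::real} < \<infinity>"
  by (cases "a \<le> b") auto

lemma sf_integrable:
  fixes H :: "'u::{real_normed_vector,second_countable_topology} stepfun"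
  assumes [measurable]: "S \<in> sets borel" and S: "emeasure lborel S < \<infinity>"
  shows "set_integrable lborel S (\<lambda>s. (norm (sf H s))\<^sup>2)"
  unfolding set_integrable_def
proof (rule integrableI_bounded_set_indicator[where B = "(\<Sum>(a, b, u)\<leftarrow>H. norm u)\<^sup>2"])
  show "AE s in lborel. s \<in> S \<longrightarrow> norm ((norm (sf H s))\<^sup>2) \<le> (\<Sum>(a, b, u)\<leftarrow>H. norm u)\<^sup>2"
    using norm_sf_le[of H] by (auto intro!: power_mono)
qed (use S in auto)

lemma sQ_nonneg: "0 \<le> sQ T H"
  unfolding sQ_def by (simp add: set_lebesgue_integral_def)

text \<open>The cross terms cancel pointwise in s by the second moment identity, and integration
  over s preserves this.\<close>

lemma sQ_rsign:
  fixes h :: "nat \<Rightarrow> 'u::{real_inner,second_countable_topology} stepfun"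
  shows "(\<Sum>S\<in>Pow {..<m}. sQ T (concat (map (\<lambda>k. sscale (rsign S k * a k) (h k)) [0..<m])))
    = 2 ^ m * (\<Sum>k<m. (a k)\<^sup>2 * sQ T (h k))"
proof -
  let ?g = "\<lambda>S. concat (map (\<lambda>k. sscale (rsign S k * a k) (h k)) [0..<m])"
  have int: "set_integrable lborel {0<..T} (\<lambda>s. (norm (sf H s))\<^sup>2)" for H :: "'u stepfun"
    by (rule sf_integrable[OF _ emeasure_Ioc_finite]) simp
  have "(\<Sum>S\<in>Pow {..<m}. sQ T (?g S)) = (LINT s:{0<..T}|lborel. (\<Sum>S\<in>Pow {..<m}. (norm (sf (?g S) s))\<^sup>2))"
    unfolding sQ_def set_lebesgue_integral_def scaleR_sum_right
    using int by (subst Bochner_Integration.integral_sum) (auto simp: set_integrable_def)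
  also have "\<dots> = (LINT s:{0<..T}|lborel. 2 ^ m * (\<Sum>k<m. (a k)\<^sup>2 * (norm (sf (h k) s))\<^sup>2))"
  proof -
    have "(\<Sum>S\<in>Pow {..<m}. (norm (sf (?g S) s))\<^sup>2) = 2 ^ m * (\<Sum>k<m. (a k)\<^sup>2 * (norm (sf (h k) s))\<^sup>2)" for s
      using rsign_second_moment[where m = m and x = "\<lambda>k. a k *\<^sub>R sf (h k) s"]
      by (simp add: sf_concat_map sf_sscale power_mult_distrib)
    then show ?thesis by simp
  qed
  also have "\<dots> = 2 ^ m * (\<Sum>k<m. (a k)\<^sup>2 * sQ T (h k))"
  proof -
    have "(LINT s:{0<..T}|lborel. (\<Sum>k<m. (a k)\<^sup>2 * (norm (sf (h k) s))\<^sup>2)) = (\<Sum>k<m. LINT s:{0<..T}|lborel. (a k)\<^sup>2 * (norm (sf (h k) s))\<^sup>2)"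
      unfolding set_lebesgue_integral_def scaleR_sum_right
      using int[THEN set_integrable_mult_right, unfolded set_integrable_def]
      by (subst Bochner_Integration.integral_sum) auto
    then show ?thesis unfolding sQ_def set_integral_mult_right by simp
  qed
  finally show ?thesis .
qed

text \<open>The partition consists of the end points of all intervals, with 0 and T added, sorted
  and without duplicates; T = 0 leaves a single point and m = 0.\<close>

lemma step_partition:
  fixes H :: "'u stepfun"
  assumes "vstep T H" "0 \<le> T"
  obtains m :: nat and p where "p 0 = 0" "p m = T" "strict_mono_on {..m} p"
    "\<forall>(a, b, u)\<in>set H. a \<in> p ` {..m} \<and> b \<in> p ` {..m}"
proof -
  define P where "P = {0, T} \<union> (\<lambda>(a, b, u). a) ` set H \<union> (\<lambda>(a, b, u). b) ` set H"
  have P: "finite P" "0 \<in> P" "T \<in> P" "\<And>x. x \<in> P \<Longrightarrow> 0 \<le> x \<and> x \<le> T"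
    using assms by (auto simp: P_def vstep_def)
  define l where "l = sorted_list_of_set P"
  define m where "m = length l - 1"
  have l: "set l = P" "sorted l" "distinct l" using P(1) by (auto simp: l_def)
  have len: "length l = Suc m" using l(1) P(2) by (cases l) (auto simp: m_def)
  have sm: "strict_mono_on {..m} (\<lambda>k. l ! k)"
    using l(2,3) len by (intro strict_mono_onI) (simp add: sorted_nth_mono nth_eq_iff_index_eq order_less_le)
  have img: "(\<lambda>k. l ! k) ` {..m} = P"
    using len unfolding l(1)[symmetric] set_conv_nth by (auto simp: less_Suc_eq_le)
  have "l ! 0 = 0"
  proof -
    obtain i where i: "i \<le> m" "l ! i = 0" using img P(2) by (metis atMost_iff imageE)
    have "l ! 0 \<le> l ! i" using l(2) len i by (intro sorted_nth_mono) auto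
    moreover have "l ! 0 \<in> P" using img by blast
    ultimately show ?thesis using i P(4) by fastforce
  qed
  moreover have "l ! m = T"
  proof -
    obtain i where i: "i \<le> m" "l ! i = T" using img P(3) by (metis atMost_iff imageE)
    have "l ! i \<le> l ! m" using l(2) len i by (intro sorted_nth_mono) auto
    moreover have "l ! m \<in> P" using img by blast
    ultimately show ?thesis using i P(4) by fastforce
  qed
  moreover have "\<forall>(a, b, u)\<in>set H. a \<in> P \<and> b \<in> P" by (force simp: P_def)
  ultimately show ?thesis using sm img that[of "\<lambda>k. l ! k" m] by simp
qed

text \<open>All intervals are open on the left and closed on the right, so a cell is represented by
  its right end point.\<close>

lemma sf_const_on_partition:
  assumes p: "strict_mono_on {..m} p" and H: "\<forall>(a, b, u)\<in>set H. a \<in> p ` {..m} \<and> b \<in> p ` {..m}"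
    and k: "k < m" and s: "p k < s" "s \<le> p (Suc k)"
  shows "sf H s = sf H (p (Suc k))"
proof -
  have less_iff: "p i < p j \<longleftrightarrow> i < j" if "i \<le> m" "j \<le> m" for i j
    using p that by (metis atMost_iff linorder_neqE_nat order_less_asym order_less_irrefl strict_mono_onD)
  have "indicator {p i<..p j} s = (indicator {p i<..p j} (p (Suc k)) :: real)" if ij: "i \<le> m" "j \<le> m" for i j
  proof -
    have 1: "p i < s \<longleftrightarrow> p i < p (Suc k)"
    proof
      assume "p i < p (Suc k)"
      then have "i \<le> k" using less_iff[of i "Suc k"] ij k by simp
      then have "p i \<le> p k" using less_iff[of i k] ij k by (cases "i = k") auto
      then show "p i < s" using s by simp
    qed (use s in simp)
    have 2: "s \<le> p j \<longleftrightarrow> p (Suc k) \<le> p j"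
    proof
      assume "s \<le> p j"
      then have "p k < p j" using s by simp
      then have "Suc k \<le> j" using less_iff[of k j] ij k by simp
      then show "p (Suc k) \<le> p j" using less_iff[of "Suc k" j] ij k by (cases "Suc k = j") auto
    qed (use s in simp)
    show ?thesis using 1 2 by (simp add: indicator_def)
  qed
  then have "\<forall>(a, b, u)\<in>set H. indicator {a<..b} s = (indicator {a<..b} (p (Suc k)) :: real)"
    using H by fastforce
  then show ?thesis
    unfolding sf_def by (intro arg_cong[where f = sum_list] map_cong) (auto split: prod.splits)
qed

lemma telescope_on_partition:
  fixes l :: "real \<Rightarrow> real"
  assumes p: "strict_mono_on {..m} p" and a: "a \<in> p ` {..m}" and b: "b \<in> p ` {..m}" and ab: "a \<le> b"
  shows "l b - l a = (\<Sum>k<m. indicator {a<..b} (p (Suc k)) * (l (p (Suc k)) - l (p k)))"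
proof -
  obtain i j where ij: "i \<le> m" "j \<le> m" "a = p i" "b = p j" using a b by auto
  have less_iff: "p i < p j \<longleftrightarrow> i < j" if "i \<le> m" "j \<le> m" for i j
    using p that by (metis atMost_iff linorder_neqE_nat order_less_asym order_less_irrefl strict_mono_onD)
  have ij': "i \<le> j" using less_iff[of j i] ab ij by (meson leD not_le_imp_less)
  have "(\<Sum>k<m. indicator {a<..b} (p (Suc k)) * (l (p (Suc k)) - l (p k))) = (\<Sum>k\<in>{i..<j}. l (p (Suc k)) - l (p k))"
  proof (rule sum.mono_neutral_cong_right)
    show "\<forall>k\<in>{..<m} - {i..<j}. indicator {a<..b} (p (Suc k)) * (l (p (Suc k)) - l (p k)) = 0"
    proof
      fix k assume k: "k \<in> {..<m} - {i..<j}"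
      then have "\<not> (p i < p (Suc k) \<and> p (Suc k) \<le> p j)"
        using less_iff[of i "Suc k"] less_iff[of j "Suc k"] ij by auto
      then show "indicator {a<..b} (p (Suc k)) * (l (p (Suc k)) - l (p k)) = 0" using ij by (auto simp: indicator_def)
    qed
    fix k assume k: "k \<in> {i..<j}"
    then have "p i < p (Suc k) \<and> p (Suc k) \<le> p j"
      using less_iff[of i "Suc k"] less_iff[of j "Suc k"] ij by auto
    then show "indicator {a<..b} (p (Suc k)) * (l (p (Suc k)) - l (p k)) = l (p (Suc k)) - l (p k)"
      using ij by (auto simp: indicator_def)
  qed (use ij in auto)
  also have "\<dots> = l (p j) - l (p i)"
    by (rule sum_Suc_diff'[OF ij', of "\<lambda>k. l (p k)"])
  finally show ?thesis using ij by simp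
qed

lemma sQ_partition:
  fixes H :: "'u::{real_normed_vector,second_countable_topology} stepfun"
  assumes p: "strict_mono_on {..m} p" "p 0 = 0" "p m = T" and H: "\<forall>(a, b, u)\<in>set H. a \<in> p ` {..m} \<and> b \<in> p ` {..m}"
  shows "sQ T H = (\<Sum>k<m. (p (Suc k) - p k) * (norm (sf H (p (Suc k))))\<^sup>2)"
proof -
  have int: "set_integrable lborel {a<..b} (\<lambda>s. (norm (sf H s))\<^sup>2)" for a b
    by (rule sf_integrable[OF _ emeasure_Ioc_finite]) simp
  have "n \<le> m \<Longrightarrow> (LINT s:{0<..p n}|lborel. (norm (sf H s))\<^sup>2) = (\<Sum>k<n. (p (Suc k) - p k) * (norm (sf H (p (Suc k))))\<^sup>2)" for n
  proof (induction n)
    case 0 then show ?case by (simp add: p(2) set_lebesgue_integral_def)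
  next
    case (Suc n)
    have le: "p n \<le> p (Suc n)" using p(1) Suc.prems by (intro less_imp_le strict_mono_onD[OF p(1)]) auto
    have "p 0 \<le> p n" using p(1) Suc.prems by (cases n) (auto intro!: less_imp_le strict_mono_onD[OF p(1)])
    then have "{0<..p (Suc n)} = {0<..p n} \<union> {p n<..p (Suc n)}" using le p(2) by auto
    then have "(LINT s:{0<..p (Suc n)}|lborel. (norm (sf H s))\<^sup>2)
        = (LINT s:{0<..p n}|lborel. (norm (sf H s))\<^sup>2) + (LINT s:{p n<..p (Suc n)}|lborel. (norm (sf H s))\<^sup>2)"
      by (simp only:) (rule set_integral_Un[OF _ int int], auto)
    also have "(LINT s:{p n<..p (Suc n)}|lborel. (norm (sf H s))\<^sup>2)
        = (LINT s:{p n<..p (Suc n)}|lborel. (norm (sf H (p (Suc n))))\<^sup>2)"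
    proof (rule set_lebesgue_integral_cong)
      have "n < m" using Suc.prems by simp
      then show "\<forall>s. s \<in> {p n<..p (Suc n)} \<longrightarrow> (norm (sf H s))\<^sup>2 = (norm (sf H (p (Suc n))))\<^sup>2"
        using sf_const_on_partition[OF p(1) H \<open>n < m\<close>] by (metis greaterThanAtMost_iff)
    qed simp
    also have "\<dots> = (p (Suc n) - p n) * (norm (sf H (p (Suc n))))\<^sup>2"
      using le by (simp add: set_lebesgue_integral_def)
    finally show ?case using Suc by simp
  qed
  from this[of m] show ?thesis using p(3) by (simp add: sQ_def)
qed

section \<open>Cylindrical Levy processes\<close>

locale cylindrical_levy = prob_space M
  for M :: "'w measure" +
  fixes L :: "real \<Rightarrow> 'u::{real_inner,second_countable_topology} \<Rightarrow> 'w \<Rightarrow> real"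
  assumes cyl: "cyl_levy M L"
begin

lemma L_measurable [measurable]: "L t u \<in> borel_measurable M"
  using cyl by (simp add: cyl_levy_def)

lemma L_linear: "AE \<omega> in M. L t (a *\<^sub>R u + b *\<^sub>R w) \<omega> = a * L t u \<omega> + b * L t w \<omega>"
  using cyl by (simp add: cyl_levy_def)

lemma L_conv: "us \<longlonglongrightarrow> u \<Longrightarrow> conv_in_prob M (\<lambda>k. L t (us k)) (L t u)"
  using cyl by (simp add: cyl_levy_def)

lemma L_levy: "levy_process_fin M n (\<lambda>t \<omega>. \<lambda>i\<in>{..<n}. L t (us i) \<omega>)"
  using cyl by (simp add: cyl_levy_def)

lemma L_add: "AE \<omega> in M. L t (u + w) \<omega> = L t u \<omega> + L t w \<omega>"
  using L_linear[of t 1 u 1 w] by simp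

lemma L_scale: "AE \<omega> in M. L t (a *\<^sub>R u) \<omega> = a * L t u \<omega>"
  using L_linear[of t a u 0 0] by simp

lemma L_zero: "AE \<omega> in M. L t 0 \<omega> = 0"
  using L_scale[of t 0 0] by simp

lemma L_0: "AE \<omega> in M. L 0 u \<omega> = 0"
proof -
  have "AE \<omega> in M. (\<lambda>i\<in>{..<1::nat}. L 0 u \<omega>) = (\<lambda>i\<in>{..<1}. 0)"
    using L_levy[of 1 "\<lambda>_. u"] by (simp add: levy_process_fin_def)
  then show ?thesis
    by eventually_elim (metis lessThan_iff less_one restrict_apply')
qed

lemma L_sf: "AE \<omega> in M. L t (sf H s) \<omega> = (\<Sum>(a, b, u)\<leftarrow>H. indicator {a<..b} s * L t u \<omega>)"
proof (induction H)
  case Nil then show ?case using L_zero by simp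
next
  case (Cons x H)
  obtain a b u where x: "x = (a, b, u)" by (cases x)
  have "AE \<omega> in M. L t (indicator {a<..b} s *\<^sub>R u + sf H s) \<omega> = L t (indicator {a<..b} s *\<^sub>R u) \<omega> + L t (sf H s) \<omega>"
    by (rule L_add)
  moreover have "AE \<omega> in M. L t (indicator {a<..b} s *\<^sub>R u) \<omega> = indicator {a<..b} s * L t u \<omega>" by (rule L_scale)
  ultimately show ?case using Cons unfolding x sf_Cons by eventually_elim simp
qed

text \<open>Independence is assumed for the increments of one vector process. Taking all of c as the
  components of a single process and reading component k off increment k permits a different vector
  in each time interval.\<close>

lemma increments_indep:
  assumes "0 \<le> p 0" "\<And>k. k < m \<Longrightarrow> p k \<le> p (Suc k)"
  shows "indep_vars (\<lambda>_. borel) (\<lambda>k \<omega>. L (p (Suc k)) (c k) \<omega> - L (p k) (c k) \<omega>) {..<m}"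
proof -
  let ?X = "\<lambda>t \<omega>. \<lambda>i\<in>{..<m}. L t (c i) \<omega>"
  have "indep_vars (\<lambda>_. PiM {..<m} (\<lambda>_. borel)) (\<lambda>k. vec_incr m ?X (p k) (p (Suc k))) {..<m}"
    using L_levy[of m c] assms unfolding levy_process_fin_def by blast
  then have "indep_vars (\<lambda>_. borel) (\<lambda>k \<omega>. vec_incr m ?X (p k) (p (Suc k)) \<omega> k) {..<m}"
    by (rule indep_vars_compose2[where Y = "\<lambda>k x. x k"]) auto
  then show ?thesis
    by (rule indep_vars_cong[THEN iffD1, rotated -1]) (auto simp: vec_incr_def)
qed

lemma increment_distr:
  assumes "0 \<le> s" "0 \<le> h"
  shows "distr M borel (\<lambda>\<omega>. L (s + h) u \<omega> - L s u \<omega>) = distr M borel (\<lambda>\<omega>. L h u \<omega> - L 0 u \<omega>)"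
proof -
  let ?X = "\<lambda>t \<omega>. \<lambda>i\<in>{..<1::nat}. L t u \<omega>"
  let ?P = "PiM {..<1::nat} (\<lambda>_. borel :: real measure)"
  have eq: "distr M ?P (vec_incr 1 ?X s (s + h)) = distr M ?P (vec_incr 1 ?X 0 h)"
    using L_levy[of 1 "\<lambda>_. u"] assms unfolding levy_process_fin_def by blast
  have m: "vec_incr 1 ?X a b \<in> measurable M ?P" for a b
    unfolding vec_incr_def by (rule measurable_restrict) auto
  have c: "(\<lambda>x. x 0) \<in> borel_measurable ?P" by (rule measurable_component_singleton) simp
  have *: "distr (distr M ?P (vec_incr 1 ?X a b)) borel (\<lambda>x. x 0) = distr M borel (\<lambda>\<omega>. L b u \<omega> - L a u \<omega>)" for a b
    unfolding distr_distr[OF c m] by (simp add: comp_def vec_incr_def)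
  show ?thesis using *[of s "s + h"] *[of 0 h] unfolding eq by (simp only:)
qed

section \<open>Characteristic functions of the increments\<close>

definition \<phi> :: "'u \<Rightarrow> real \<Rightarrow> complex" where "\<phi> u h = cf (L h u)"

lemma cmod_\<phi>_le_1: "cmod (\<phi> u h) \<le> 1"
  unfolding \<phi>_def by (rule cmod_cf_le_1) simp

lemma cf_increment:
  assumes "0 \<le> a" "a \<le> b"
  shows "cf (\<lambda>\<omega>. L b u \<omega> - L a u \<omega>) = \<phi> u (b - a)"
proof -
  have "cf (\<lambda>\<omega>. L b u \<omega> - L a u \<omega>) = char (distr M borel (\<lambda>\<omega>. L (a + (b - a)) u \<omega> - L a u \<omega>)) 1"
    by (subst char_distr_cf) auto
  also have "\<dots> = char (distr M borel (\<lambda>\<omega>. L (b - a) u \<omega> - L 0 u \<omega>)) 1"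
    by (subst increment_distr) (use assms in auto)
  also have "\<dots> = cf (\<lambda>\<omega>. L (b - a) u \<omega> - L 0 u \<omega>)" by (subst char_distr_cf) auto
  also have "\<dots> = \<phi> u (b - a)" unfolding \<phi>_def by (rule cf_cong_AE) (use L_0[of u] in auto)
  finally show ?thesis .
qed

lemma cf_increments:
  assumes "0 \<le> p 0" "\<And>k. k < m \<Longrightarrow> p k \<le> p (Suc k)"
  shows "cf (\<lambda>\<omega>. \<Sum>k<m. L (p (Suc k)) (c k) \<omega> - L (p k) (c k) \<omega>) = (\<Prod>k<m. \<phi> (c k) (p (Suc k) - p k))"
proof -
  have p0: "0 \<le> p k" if "k \<le> m" for k
    using that by (induction k) (use assms in \<open>auto intro: order_trans\<close>)
  have "cf (\<lambda>\<omega>. \<Sum>k<m. L (p (Suc k)) (c k) \<omega> - L (p k) (c k) \<omega>)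
      = char (distr M borel (\<lambda>\<omega>. \<Sum>k<m. L (p (Suc k)) (c k) \<omega> - L (p k) (c k) \<omega>)) 1"
    by (subst char_distr_cf) auto
  also have "\<dots> = (\<Prod>k<m. char (distr M borel (\<lambda>\<omega>. L (p (Suc k)) (c k) \<omega> - L (p k) (c k) \<omega>)) 1)"
    by (rule char_distr_sum[OF increments_indep]) (use assms in auto)
  also have "\<dots> = (\<Prod>k<m. \<phi> (c k) (p (Suc k) - p k))"
  proof (rule prod.cong[OF refl])
    fix k assume k: "k \<in> {..<m}"
    have "char (distr M borel (\<lambda>\<omega>. L (p (Suc k)) (c k) \<omega> - L (p k) (c k) \<omega>)) 1
        = cf (\<lambda>\<omega>. L (p (Suc k)) (c k) \<omega> - L (p k) (c k) \<omega>)" by (subst char_distr_cf) auto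
    also have "\<dots> = \<phi> (c k) (p (Suc k) - p k)" by (rule cf_increment) (use k assms p0 in auto)
    finally show "char (distr M borel (\<lambda>\<omega>. L (p (Suc k)) (c k) \<omega> - L (p k) (c k) \<omega>)) 1 = \<phi> (c k) (p (Suc k) - p k)" .
  qed
  finally show ?thesis .
qed

lemma \<phi>_add:
  assumes "0 \<le> a" "0 \<le> b"
  shows "\<phi> u (a + b) = \<phi> u a * \<phi> u b"
proof -
  define p where "p k = (if k = 0 then 0 else if k = 1 then a else a + b)" for k :: nat
  have "cf (\<lambda>\<omega>. \<Sum>k<2. L (p (Suc k)) u \<omega> - L (p k) u \<omega>) = (\<Prod>k<2. \<phi> u (p (Suc k) - p k))"
    by (rule cf_increments) (use assms in \<open>auto simp: p_def\<close>)
  moreover have "(\<lambda>\<omega>. \<Sum>k<2. L (p (Suc k)) u \<omega> - L (p k) u \<omega>) = (\<lambda>\<omega>. L (a + b) u \<omega> - L 0 u \<omega>)"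
    by (auto simp: p_def numeral_2_eq_2)
  ultimately show ?thesis
    using cf_increment[of 0 "a + b" u] assms by (simp add: p_def numeral_2_eq_2)
qed

lemma \<phi>_continuous: "continuous_on {0..} (\<phi> u)"
  unfolding continuous_on_def
proof
  fix t :: real assume t: "t \<in> {0..}"
  show "(\<phi> u \<longlongrightarrow> \<phi> u t) (at t within {0..})"
  proof (rule tendstoI)
    fix e :: real assume e: "0 < e"
    let ?P = "\<lambda>h. prob {\<omega> \<in> space M. e / 4 < \<bar>L (t + h) u \<omega> - L t u \<omega>\<bar>}"
    have "(?P \<longlongrightarrow> 0) (at 0 within {h. 0 \<le> t + h})"
    proof -
      have "\<forall>t\<ge>0. \<forall>e>0. ((\<lambda>h. prob {\<omega> \<in> space M. e < \<bar>L (t + h) u \<omega> - L t u \<omega>\<bar>}) \<longlongrightarrow> 0) (at 0 within {h. 0 \<le> t + h})"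
        using L_levy[of 1 "\<lambda>_. u"] unfolding levy_process_fin_def by simp
      from this[rule_format, of t "e / 4"] show ?thesis using t e by simp
    qed
    then have "eventually (\<lambda>h. ?P h < e / 4) (at 0 within {h. 0 \<le> t + h})"
      using e by (intro order_tendstoD(2)) auto
    then obtain d where d: "d > 0" "\<And>h. 0 \<le> t + h \<Longrightarrow> h \<noteq> 0 \<Longrightarrow> dist h 0 < d \<Longrightarrow> ?P h < e / 4"
      by (auto simp: eventually_at)
    have "dist (\<phi> u s) (\<phi> u t) < e" if "s \<in> {0..}" "s \<noteq> t" "dist s t < d" for s
    proof -
      have "?P (s - t) < e / 4" using that by (intro d(2)) (auto simp: dist_real_def)
      then have "ptail (\<lambda>\<omega>. L s u \<omega> - L t u \<omega>) (e / 4) < e / 4" by (simp add: ptail_def)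
      then show ?thesis
        using cf_diff_le[of "L s u" "L t u" "e / 4"] e by (simp add: \<phi>_def dist_norm)
    qed
    then show "\<forall>\<^sub>F s in at t within {0..}. dist (\<phi> u s) (\<phi> u t) < e"
      unfolding eventually_at using d(1) by blast
  qed
qed

lemma \<phi>_tendsto_1: "us \<longlonglongrightarrow> 0 \<Longrightarrow> (\<lambda>n. \<phi> (us n) t) \<longlonglongrightarrow> 1"
proof -
  assume "us \<longlonglongrightarrow> 0"
  then have "(\<lambda>n. cf (L t (us n))) \<longlonglongrightarrow> cf (L t 0)" by (intro cf_tendsto L_conv) auto
  moreover have "cf (L t 0) = cf (\<lambda>_. 0)" by (rule cf_cong_AE) (use L_zero in auto)
  ultimately show ?thesis by (simp add: \<phi>_def cf_zero)
qed

text \<open>Multiplicativity in time replaces the Levy--Khintchine exponent: integrating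
  \<open>\<phi> u (s + h) = \<phi> u s * \<phi> u h\<close> over \<open>s \<in> [0, 1]\<close> yields a bound that is linear in \<open>h\<close>.\<close>

lemma \<phi>_linear_bound:
  assumes h: "0 \<le> h"
  shows "cmod (1 - \<phi> u h) * cmod (integral {0..1} (\<phi> u)) \<le> cmod (1 - \<phi> u 1) * h"
proof -
  note c = \<phi>_continuous[of u]
  \<comment> \<open>By multiplicativity the shift by h is the factor \<open>\<phi> u h\<close>; it
    leaves two boundary windows of length h, which differ by the factor \<open>\<phi> u 1\<close>.
    The length of the windows is the origin of the factor h.\<close>
  have "integral {0..1} (\<lambda>s. \<phi> u (s + h)) = integral {0..1} (\<lambda>s. \<phi> u s * \<phi> u h)"
    by (rule integral_cong) (use h in \<open>auto simp: \<phi>_add\<close>)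
  then have "integral {0..1} (\<phi> u) * \<phi> u h - integral {0..1} (\<phi> u) = integral {1..1+h} (\<phi> u) - integral {0..0+h} (\<phi> u)"
    using integral_translate_diff[OF c, of 0 1 h] h by simp
  also have "integral {1..1+h} (\<phi> u) = integral {0..h} (\<lambda>s. \<phi> u (s + 1))"
    using integral_translate[OF c, of 0 1 h] by (simp add: add.commute)
  also have "\<dots> = integral {0..h} (\<lambda>s. \<phi> u s * \<phi> u 1)" by (rule integral_cong) (auto simp: \<phi>_add)
  finally have "integral {0..1} (\<phi> u) * (\<phi> u h - 1) = integral {0..h} (\<phi> u) * (\<phi> u 1 - 1)"
    by (simp add: algebra_simps)
  then have "cmod (integral {0..1} (\<phi> u)) * cmod (1 - \<phi> u h) = cmod (integral {0..h} (\<phi> u)) * cmod (1 - \<phi> u 1)"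
    by (metis norm_minus_commute norm_mult)
  also have "\<dots> \<le> h * cmod (1 - \<phi> u 1)"
  proof (intro mult_right_mono)
    have "cmod (integral {0..h} (\<phi> u)) \<le> 1 * (h - 0)"
      by (rule integral_bound) (use h cmod_\<phi>_le_1 in \<open>auto intro: continuous_on_subset[OF c]\<close>)
    then show "cmod (integral {0..h} (\<phi> u)) \<le> h" by simp
  qed simp
  finally show ?thesis by (simp add: mult.commute)
qed

text \<open>As u tends to 0, \<open>\<phi> u 1\<close> tends to 1, and so does the integral over
  [0,1] by dominated convergence. The linear bound then has arbitrarily small slope, uniformly in
  h.\<close>

lemma \<phi>_near_0:
  assumes \<delta>: "0 < \<delta>"
  shows "\<exists>r>0. \<forall>u h. norm u \<le> r \<longrightarrow> 0 \<le> h \<longrightarrow> cmod (1 - \<phi> u h) \<le> \<delta> * h"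
proof (rule ccontr)
  assume neg: "\<not> ?thesis"
  have "\<forall>n. \<exists>u h. norm u \<le> inverse (real (Suc n)) \<and> 0 \<le> h \<and> cmod (1 - \<phi> u h) > \<delta> * h"
  proof
    fix n
    have "inverse (real (Suc n)) > 0" by simp
    with neg show "\<exists>u h. norm u \<le> inverse (real (Suc n)) \<and> 0 \<le> h \<and> cmod (1 - \<phi> u h) > \<delta> * h"
      by (meson not_le)
  qed
  then obtain u h where uh: "\<And>n. norm (u n) \<le> inverse (real (Suc n))" "\<And>n. 0 \<le> h n"
    "\<And>n. cmod (1 - \<phi> (u n) (h n)) > \<delta> * h n" by metis
  have u0: "u \<longlonglongrightarrow> 0"
    by (rule tendsto_norm_zero_cancel, rule tendsto_sandwich[OF _ _ tendsto_const LIMSEQ_inverse_real_of_nat])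
      (use uh(1) in auto)
  have "(\<lambda>n. integral {0..1} (\<phi> (u n))) \<longlonglongrightarrow> integral {0..1::real} (\<lambda>_. 1)"
  proof (rule Equivalence_Lebesgue_Henstock_Integration.dominated_convergence(2)[of "\<lambda>n. \<phi> (u n)" "{0..1}" "\<lambda>_. 1" "\<lambda>_. 1"])
    show "\<phi> (u n) integrable_on {0..1}" for n
      by (intro integrable_continuous_real continuous_on_subset[OF \<phi>_continuous]) auto
  qed (use cmod_\<phi>_le_1 \<phi>_tendsto_1[OF u0] in auto)
  then have "(\<lambda>n. cmod (integral {0..1} (\<phi> (u n)))) \<longlonglongrightarrow> 1" using tendsto_norm by fastforce
  then have "eventually (\<lambda>n. 1 / 2 < cmod (integral {0..1} (\<phi> (u n)))) sequentially"
    by (rule order_tendstoD) simp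
  moreover have "(\<lambda>n. cmod (1 - \<phi> (u n) 1)) \<longlonglongrightarrow> cmod (1 - 1)"
    by (intro tendsto_intros \<phi>_tendsto_1 u0)
  then have "eventually (\<lambda>n. cmod (1 - \<phi> (u n) 1) < \<delta> / 2) sequentially"
    using \<delta> by (intro order_tendstoD) auto
  ultimately have "eventually (\<lambda>n. False) sequentially"
  proof eventually_elim
    case (elim n)
    have "cmod (1 - \<phi> (u n) (h n)) * (1 / 2) \<le> cmod (1 - \<phi> (u n) (h n)) * cmod (integral {0..1} (\<phi> (u n)))"
      using elim by (intro mult_left_mono) auto
    also have "\<dots> \<le> cmod (1 - \<phi> (u n) 1) * h n" by (rule \<phi>_linear_bound[OF uh(2)])
    also have "\<dots> \<le> \<delta> / 2 * h n" using elim uh(2)[of n] by (intro mult_right_mono) auto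
    finally show False using uh(3)[of n] by simp
  qed
  then show False by simp
qed

text \<open>u is n times a vector of norm at most r with n = 1 + floor(norm u / r), and
  multiplication by n costs n^2 \<le> 2 (1 + (norm u)^2 / r^2). This is where the L^2 norm of
  integrands originates.\<close>

lemma \<phi>_quadratic:
  assumes r: "0 < r" and near: "\<And>u h. norm u \<le> r \<Longrightarrow> 0 \<le> h \<Longrightarrow> cmod (1 - \<phi> u h) \<le> \<delta> * h"
    and h: "0 \<le> h" and \<delta>: "0 < \<delta>"
  shows "cmod (1 - \<phi> u h) \<le> 2 * \<delta> * h * (1 + (norm u)\<^sup>2 / r\<^sup>2)"
proof -
  define n where "n = Suc (nat \<lfloor>norm u / r\<rfloor>)"
  have fl: "real n = 1 + of_int \<lfloor>norm u / r\<rfloor>" using r by (simp add: n_def)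
  then have n: "norm u / r \<le> real n" "real n \<le> 1 + norm u / r" "real n > 0" by (linarith | simp add: n_def)+
  let ?w = "(1 / real n) *\<^sub>R u"
  have w: "norm ?w \<le> r" using n r by (simp add: field_simps)
  have "\<phi> u h = cf (\<lambda>\<omega>. real n * L h ?w \<omega>)"
    unfolding \<phi>_def using L_scale[of h "real n" ?w] n by (intro cf_cong_AE) auto
  then have "cmod (1 - \<phi> u h) \<le> (real n)\<^sup>2 * cmod (1 - \<phi> ?w h)"
    using cf_multiple[of "L h ?w" n] by (simp add: \<phi>_def)
  also have "\<dots> \<le> (real n)\<^sup>2 * (\<delta> * h)" by (intro mult_left_mono near w h) simp
  also have "\<dots> \<le> (2 * (1 + (norm u)\<^sup>2 / r\<^sup>2)) * (\<delta> * h)"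
  proof (intro mult_right_mono)
    have "(real n)\<^sup>2 \<le> (1 + norm u / r)\<^sup>2" using n by (intro power_mono) auto
    also have "\<dots> = 1 + (norm u / r)\<^sup>2 + 2 * (norm u / r)" by (simp add: power2_eq_square algebra_simps)
    also have "\<dots> \<le> 2 * (1 + (norm u / r)\<^sup>2)"
    proof -
      have "0 \<le> (1 - norm u / r)\<^sup>2" by simp
      also have "\<dots> = 1 + (norm u / r)\<^sup>2 - 2 * (norm u / r)" by (simp only: power2_diff) simp
      finally show ?thesis by simp
    qed
    finally show "(real n)\<^sup>2 \<le> 2 * (1 + (norm u)\<^sup>2 / r\<^sup>2)" by (simp only: power_divide)
  qed (use \<delta> h in auto)
  finally show ?thesis by (simp add: mult_ac)
qed

text \<open>The value depends on the list and not only on the function it represents; that valid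
  lists for the same function give almost surely the same variable follows later from
  \<open>isint_unique\<close>.\<close>

definition sI :: "'u stepfun \<Rightarrow> 'w \<Rightarrow> real" where
  "sI H \<omega> = (\<Sum>(a, b, u)\<leftarrow>H. L b u \<omega> - L a u \<omega>)"

lemma sI_Nil: "sI [] = (\<lambda>\<omega>. 0)" by (simp add: sI_def fun_eq_iff)
lemma sI_Cons: "sI ((a, b, u) # H) = (\<lambda>\<omega>. L b u \<omega> - L a u \<omega> + sI H \<omega>)" by (simp add: sI_def fun_eq_iff)
lemma sI_append: "sI (H @ H') = (\<lambda>\<omega>. sI H \<omega> + sI H' \<omega>)" by (simp add: sI_def fun_eq_iff)
lemma sI_concat_map: "sI (concat (map F [0..<m])) = (\<lambda>\<omega>. \<Sum>k<m. sI (F k) \<omega>)"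
  by (induction m) (auto simp: sI_Nil sI_append)

lemma sI_measurable [measurable]: "sI H \<in> borel_measurable M"
proof (induction H)
  case Nil then show ?case by (simp add: sI_Nil)
next
  case (Cons x H)
  obtain a b u where "x = (a, b, u)" by (cases x)
  then show ?case using Cons by (simp add: sI_Cons)
qed

lemma sI_sscale: "AE \<omega> in M. sI (sscale c H) \<omega> = c * sI H \<omega>"
proof (induction H)
  case Nil then show ?case by (simp add: sI_Nil sscale_def)
next
  case (Cons x H)
  obtain a b u where x: "x = (a, b, u)" by (cases x)
  have "sscale c ((a, b, u) # H) = (a, b, c *\<^sub>R u) # sscale c H" by (simp add: sscale_def)
  then have "sI (sscale c (x # H)) = (\<lambda>\<omega>. L b (c *\<^sub>R u) \<omega> - L a (c *\<^sub>R u) \<omega> + sI (sscale c H) \<omega>)"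
    by (simp add: x sI_Cons)
  moreover have "AE \<omega> in M. L b (c *\<^sub>R u) \<omega> - L a (c *\<^sub>R u) \<omega> + sI (sscale c H) \<omega> = c * sI (x # H) \<omega>"
    using Cons L_scale[of b c u] L_scale[of a c u] by eventually_elim (simp add: x sI_Cons algebra_simps)
  ultimately show ?case by simp
qed

text \<open>Overlapping intervals are resolved into the cells of a common partition, where the
  increments are independent. Linearity of \<open>L\<close> holds only almost surely, but only
  countably many exceptional sets occur.\<close>

lemma sI_partition:
  assumes p: "strict_mono_on {..m} p" and H: "\<forall>(a, b, u)\<in>set H. a \<in> p ` {..m} \<and> b \<in> p ` {..m}" and v: "vstep T H"
  shows "AE \<omega> in M. sI H \<omega> = (\<Sum>k<m. L (p (Suc k)) (sf H (p (Suc k))) \<omega> - L (p k) (sf H (p (Suc k))) \<omega>)"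
proof -
  have eq: "sI H \<omega> = (\<Sum>k<m. (\<Sum>(a, b, u)\<leftarrow>H. indicator {a<..b} (p (Suc k)) * L (p (Suc k)) u \<omega>)
      - (\<Sum>(a, b, u)\<leftarrow>H. indicator {a<..b} (p (Suc k)) * L (p k) u \<omega>))" for \<omega>
    using H v
  proof (induction H)
    case Nil then show ?case by (simp add: sI_Nil)
  next
    case (Cons x H)
    obtain a b u where x: "x = (a, b, u)" by (cases x)
    have "L b u \<omega> - L a u \<omega> = (\<Sum>k<m. indicator {a<..b} (p (Suc k)) * (L (p (Suc k)) u \<omega> - L (p k) u \<omega>))"
      using Cons.prems by (intro telescope_on_partition[OF p, of a b "\<lambda>t. L t u \<omega>"]) (auto simp: x)
    then show ?case using Cons by (simp add: x sI_Cons sum.distrib[symmetric] algebra_simps)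
  qed
  have "AE \<omega> in M. (\<forall>k. L (p (Suc k)) (sf H (p (Suc k))) \<omega> = (\<Sum>(a, b, u)\<leftarrow>H. indicator {a<..b} (p (Suc k)) * L (p (Suc k)) u \<omega>))
      \<and> (\<forall>k. L (p k) (sf H (p (Suc k))) \<omega> = (\<Sum>(a, b, u)\<leftarrow>H. indicator {a<..b} (p (Suc k)) * L (p k) u \<omega>))"
    unfolding AE_conj_iff AE_all_countable by (intro conjI allI L_sf)
  then show ?thesis by eventually_elim (simp add: eq)
qed

text \<open>Independence turns the characteristic function into a product over the cells, and
  products in the unit disc differ by at most the sum of the differences of their factors. The
  quadratic bounds add up to T and the squared L^2 norm.\<close>

lemma sI_cf_bound:
  assumes r: "0 < r" and near: "\<And>u h. norm u \<le> r \<Longrightarrow> 0 \<le> h \<Longrightarrow> cmod (1 - \<phi> u h) \<le> \<delta> * h"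
    and \<delta>: "0 < \<delta>" and v: "vstep T H" and T: "0 \<le> T"
  shows "cmod (1 - cf (\<lambda>\<omega>. x * sI H \<omega>)) \<le> 2 * \<delta> * (T + x\<^sup>2 * sQ T H / r\<^sup>2)"
proof -
  obtain p and m :: nat where p: "p 0 = 0" "p m = T" "strict_mono_on {..m} p"
    "\<forall>(a, b, u)\<in>set H. a \<in> p ` {..m} \<and> b \<in> p ` {..m}"
    by (rule step_partition[OF v T])
  let ?c = "\<lambda>k. sf H (p (Suc k))"
  have mono: "p k \<le> p (Suc k)" if "k < m" for k
    using that by (intro less_imp_le strict_mono_onD[OF p(3)]) auto
  have "AE \<omega> in M. x * sI H \<omega> = (\<Sum>k<m. L (p (Suc k)) (x *\<^sub>R ?c k) \<omega> - L (p k) (x *\<^sub>R ?c k) \<omega>)"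
  proof -
    have "AE \<omega> in M. \<forall>k. L (p (Suc k)) (x *\<^sub>R ?c k) \<omega> = x * L (p (Suc k)) (?c k) \<omega>"
      unfolding AE_all_countable by (intro allI L_scale)
    moreover have "AE \<omega> in M. \<forall>k. L (p k) (x *\<^sub>R ?c k) \<omega> = x * L (p k) (?c k) \<omega>"
      unfolding AE_all_countable by (intro allI L_scale)
    ultimately show ?thesis using sI_partition[OF p(3,4) v]
      by eventually_elim (simp add: sum_distrib_left right_diff_distrib)
  qed
  then have "cf (\<lambda>\<omega>. x * sI H \<omega>) = cf (\<lambda>\<omega>. \<Sum>k<m. L (p (Suc k)) (x *\<^sub>R ?c k) \<omega> - L (p k) (x *\<^sub>R ?c k) \<omega>)"
    by (rule cf_cong_AE) auto
  also have "\<dots> = (\<Prod>k<m. \<phi> (x *\<^sub>R ?c k) (p (Suc k) - p k))"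
    by (rule cf_increments) (use p(1) mono in auto)
  finally have "cmod (1 - cf (\<lambda>\<omega>. x * sI H \<omega>)) = cmod ((\<Prod>k<m. 1) - (\<Prod>k<m. \<phi> (x *\<^sub>R ?c k) (p (Suc k) - p k)))" by simp
  also have "\<dots> \<le> (\<Sum>k<m. cmod (1 - \<phi> (x *\<^sub>R ?c k) (p (Suc k) - p k)))"
    by (rule norm_prod_diff) (auto simp: cmod_\<phi>_le_1)
  also have "\<dots> \<le> (\<Sum>k<m. 2 * \<delta> * (p (Suc k) - p k) * (1 + (norm (x *\<^sub>R ?c k))\<^sup>2 / r\<^sup>2))"
    by (intro sum_mono \<phi>_quadratic[OF r near _ \<delta>]) (use mono in auto)
  also have "\<dots> = (\<Sum>k<m. 2 * \<delta> * (p (Suc k) - p k) + 2 * \<delta> * x\<^sup>2 / r\<^sup>2 * ((p (Suc k) - p k) * (norm (?c k))\<^sup>2))"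
  proof -
    have "2 * \<delta> * d * (1 + (norm (x *\<^sub>R c))\<^sup>2 / r\<^sup>2) = 2 * \<delta> * d + 2 * \<delta> * x\<^sup>2 / r\<^sup>2 * (d * (norm c)\<^sup>2)" for d and c :: 'u
      by (simp add: power_mult_distrib algebra_simps)
    then show ?thesis by (intro sum.cong refl) blast
  qed
  also have "\<dots> = 2 * \<delta> * (\<Sum>k<m. p (Suc k) - p k) + 2 * \<delta> * x\<^sup>2 / r\<^sup>2 * sQ T H"
    unfolding sum.distrib sum_distrib_left[symmetric] sQ_partition[OF p(3,1,2,4)] ..
  also have "(\<Sum>k<m. p (Suc k) - p k) = T" using p by (simp add: sum_lessThan_telescope)
  finally show ?thesis by (simp add: algebra_simps)
qed

lemma sI_bounded_in_prob:
  assumes T: "0 \<le> T" and \<eta>: "0 < \<eta>"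
  shows "\<exists>R>0. \<forall>H. vstep T H \<longrightarrow> sQ T H \<le> K \<longrightarrow> ptail (sI H) R \<le> \<eta>"
proof -
  \<comment> \<open>\<delta> is fixed first, to make the part 4 \<delta> T at most \<eta>/2; it
    determines r, and only then X is chosen so that the quadratic part uses the other half. The
    summands 1 keep the denominators positive.\<close>
  define \<delta> where "\<delta> = \<eta> / (8 * (T + 1))"
  have \<delta>: "0 < \<delta>" using T \<eta> by (simp add: \<delta>_def)
  have \<delta>T: "4 * \<delta> * T \<le> \<eta> / 2" using T \<eta> by (simp add: \<delta>_def field_simps)
  from \<phi>_near_0[OF \<delta>] obtain r where r1: "r > 0"
    and r2: "\<forall>u h. norm u \<le> r \<longrightarrow> 0 \<le> h \<longrightarrow> cmod (1 - \<phi> u h) \<le> \<delta> * h"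
    by (elim exE conjE) (rule that)
  note r = r1 r2[rule_format]
  define X where "X = sqrt (\<eta> * r\<^sup>2 / (8 * \<delta> * (\<bar>K\<bar> + 1)))"
  have X: "X > 0" "X\<^sup>2 = \<eta> * r\<^sup>2 / (8 * \<delta> * (\<bar>K\<bar> + 1))"
    using \<eta> r \<delta> by (auto simp: X_def intro!: divide_pos_pos mult_pos_pos)
  have "ptail (sI H) (2 / X) \<le> \<eta>" if v: "vstep T H" and q: "sQ T H \<le> K" for H
  proof -
    have "ptail (sI H) (2 / X) \<le> 2 * (2 * \<delta> * (T + X\<^sup>2 * (\<bar>K\<bar> + 1) / r\<^sup>2))"
    proof (rule ptail_le_cf)
      fix x assume x: "0 \<le> x" "x \<le> X"
      have "cmod (1 - cf (\<lambda>\<omega>. x * sI H \<omega>)) \<le> 2 * \<delta> * (T + x\<^sup>2 * sQ T H / r\<^sup>2)"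
        by (rule sI_cf_bound[OF r \<delta> v T])
      also have "\<dots> \<le> 2 * \<delta> * (T + X\<^sup>2 * (\<bar>K\<bar> + 1) / r\<^sup>2)"
        using x q \<delta> sQ_nonneg[of T H] by (intro mult_left_mono add_left_mono divide_right_mono mult_mono power_mono) auto
      finally show "cmod (1 - cf (\<lambda>\<omega>. x * sI H \<omega>)) \<le> 2 * \<delta> * (T + X\<^sup>2 * (\<bar>K\<bar> + 1) / r\<^sup>2)" .
    next
      show "0 \<le> 2 * \<delta> * (T + X\<^sup>2 * (\<bar>K\<bar> + 1) / r\<^sup>2)"
        using \<delta> T by (intro mult_nonneg_nonneg add_nonneg_nonneg divide_nonneg_nonneg) auto
    qed (use X in auto)
    also have "X\<^sup>2 * (\<bar>K\<bar> + 1) / r\<^sup>2 = \<eta> / (8 * \<delta>)"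
    proof -
      have "\<bar>K\<bar> + 1 \<noteq> 0" by linarith
      then show ?thesis using r(1) by (simp add: X(2))
    qed
    also have "2 * (2 * \<delta> * (T + \<eta> / (8 * \<delta>))) = 4 * \<delta> * T + \<eta> / 2" using \<delta> by (simp add: field_simps)
    finally show ?thesis using \<delta>T by simp
  qed
  then show ?thesis using X by (intro exI[of _ "2 / X"]) auto
qed

text \<open>Nikishin's argument on lists of steps: signed combinations are concatenations of scaled
  lists, whose integrals are almost surely the signed combinations of the integrals.\<close>

lemma sI_weak_L2:
  assumes T: "0 \<le> T" and \<eta>: "0 < \<eta>"
  shows "\<exists>E\<in>events. \<exists>R\<ge>0. prob (space M - E) \<le> \<eta> \<and>
    (\<forall>H\<in>{H. vstep T H}. \<forall>c>0. prob (E \<inter> {\<omega> \<in> space M. c < \<bar>sI H \<omega>\<bar>}) \<le> R * sQ T H / c\<^sup>2)"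
proof (rule Nikishin[OF _ _ _ _ \<eta>])
  fix \<eta> K :: real assume "0 < \<eta>"
  then show "\<exists>R>0. \<forall>H\<in>{H. vstep T H}. sQ T H \<le> K \<longrightarrow> ptail (sI H) R \<le> \<eta>"
    using sI_bounded_in_prob[OF T, of \<eta> K] by simp
next
  fix m :: nat and h :: "nat \<Rightarrow> 'u stepfun" and a :: "nat \<Rightarrow> real"
  assume h: "\<And>k. k < m \<Longrightarrow> h k \<in> {H. vstep T H}"
  let ?g = "\<lambda>S. concat (map (\<lambda>k. sscale (rsign S k * a k) (h k)) [0..<m])"
  have "vstep T (?g S)" for S using h by (intro vstep_concat_map) auto
  moreover have "AE \<omega> in M. sI (?g S) \<omega> = (\<Sum>k<m. rsign S k *\<^sub>R (a k * sI (h k) \<omega>))" for S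
  proof -
    have "AE \<omega> in M. \<forall>k. sI (sscale (rsign S k * a k) (h k)) \<omega> = (rsign S k * a k) * sI (h k) \<omega>"
      unfolding AE_all_countable by (intro allI sI_sscale)
    then show ?thesis unfolding sI_concat_map by eventually_elim (simp add: mult.assoc)
  qed
  ultimately show "\<exists>g. (\<forall>S\<in>Pow {..<m}. g S \<in> {H. vstep T H} \<and> (AE \<omega> in M. sI (g S) \<omega> = (\<Sum>k<m. rsign S k *\<^sub>R (a k * sI (h k) \<omega>)))) \<and>
      (\<Sum>S\<in>Pow {..<m}. sQ T (g S)) \<le> 2 ^ m * (\<Sum>k<m. (a k)\<^sup>2 * sQ T (h k))"
    using sQ_rsign[of T a h m] by (intro exI[of _ ?g]) auto
qed (auto simp: sQ_nonneg)

end

section \<open>The stochastic integral of uniform limits of step functions\<close>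

text \<open>The localisation principle behind all L^1 estimates: the events for \<eta> = 1/(n+1)
  together cover almost the whole space.\<close>

lemma (in prob_space) AE_from_large_events:
  assumes "\<And>\<eta>. \<eta> > 0 \<Longrightarrow> \<exists>E\<in>events. prob (space M - E) \<le> \<eta> \<and> (AE \<omega> in M. \<omega> \<in> E \<longrightarrow> P \<omega>)"
  shows "AE \<omega> in M. P \<omega>"
proof -
  have "\<forall>n. \<exists>E\<in>events. prob (space M - E) \<le> inverse (real (Suc n)) \<and> (AE \<omega> in M. \<omega> \<in> E \<longrightarrow> P \<omega>)"
    using assms by simp
  then obtain E where E: "\<And>n. E n \<in> events" "\<And>n. prob (space M - E n) \<le> inverse (real (Suc n))"
    "\<And>n. AE \<omega> in M. \<omega> \<in> E n \<longrightarrow> P \<omega>" by metis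
  let ?N = "space M - (\<Union>n. E n)"
  have N: "?N \<in> events" using E(1) by auto
  have "prob ?N \<le> 0"
  proof (rule LIMSEQ_le_const[OF LIMSEQ_inverse_real_of_nat])
    have "prob ?N \<le> inverse (real (Suc n))" for n
      by (rule order_trans[OF finite_measure_mono E(2)[of n]]) (use E(1) in auto)
    then show "\<exists>N. \<forall>n\<ge>N. prob ?N \<le> inverse (real (Suc n))" by blast
  qed
  then have "?N \<in> null_sets M" using N by (simp add: measure_le_0_iff emeasure_eq_measure null_setsI)
  then have "AE \<omega> in M. \<omega> \<notin> ?N" by (rule AE_not_in)
  moreover have "AE \<omega> in M. \<forall>n. \<omega> \<in> E n \<longrightarrow> P \<omega>" unfolding AE_all_countable using E(3) by blast
  ultimately show ?thesis using AE_space by eventually_elim auto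
qed

text \<open>Two levels are distinguished because the difference of two convolution kernels is small
  except between the two times, where it is merely bounded.\<close>

lemma sQ_le:
  fixes H :: "'u::{real_normed_vector,second_countable_topology} stepfun"
  assumes T: "0 \<le> T" and pq: "p \<le> q" and \<alpha>: "\<And>s. s \<in> {0<..T} \<Longrightarrow> norm (sf H s) \<le> \<alpha>"
    and \<beta>: "\<And>s. s \<in> {0<..T} \<Longrightarrow> s \<notin> {p<..q} \<Longrightarrow> norm (sf H s) \<le> \<beta>"
  shows "sQ T H \<le> \<beta>\<^sup>2 * T + \<alpha>\<^sup>2 * (q - p)"
proof -
  let ?f = "\<lambda>s. indicator {0<..T} s *\<^sub>R (norm (sf H s))\<^sup>2" and ?g = "\<lambda>s. \<beta>\<^sup>2 * indicator {0<..T} s + \<alpha>\<^sup>2 * indicator {p<..q} s"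
  have i: "integrable lborel (indicator {a<..b} :: real \<Rightarrow> real)" for a b
    by (intro integrable_real_indicator emeasure_Ioc_finite) simp
  have "sQ T H = (LINT s|lborel. ?f s)" by (simp add: sQ_def set_lebesgue_integral_def)
  also have "\<dots> \<le> (LINT s|lborel. ?g s)"
  proof (rule integral_mono)
    show "integrable lborel ?f"
      using sf_integrable[OF _ emeasure_Ioc_finite, of 0 T H] by (simp add: set_integrable_def)
    show "integrable lborel ?g" by (intro Bochner_Integration.integrable_add integrable_mult_right i)
    fix s
    have "(norm (sf H s))\<^sup>2 \<le> \<beta>\<^sup>2" if "s \<in> {0<..T}" "s \<notin> {p<..q}" using \<beta>[OF that] by (intro power_mono) auto
    moreover have "(norm (sf H s))\<^sup>2 \<le> \<alpha>\<^sup>2" if "s \<in> {0<..T}" using \<alpha>[OF that] by (intro power_mono) auto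
    ultimately show "?f s \<le> ?g s" by (auto simp: indicator_def add_increasing)
  qed
  also have "\<dots> = \<beta>\<^sup>2 * T + \<alpha>\<^sup>2 * (q - p)"
    using T pq by (subst Bochner_Integration.integral_add) (auto intro!: integrable_mult_right i)
  finally show ?thesis .
qed

text \<open>Uniformity is asked on (0,T] only, since step functions over left-open intervals in
  [0,T] vanish at 0.\<close>

definition step_unif :: "real \<Rightarrow> (nat \<Rightarrow> 'u::real_normed_vector stepfun) \<Rightarrow> (real \<Rightarrow> 'u) \<Rightarrow> bool" where
  "step_unif T H G \<longleftrightarrow> (\<forall>n. vstep T (H n)) \<and>
    (\<forall>e>0. \<exists>N. \<forall>n\<ge>N. \<forall>s\<in>{0<..T}. norm (G s - sf (H n) s) < e)"

lemma step_unifD: "step_unif T H G \<Longrightarrow> vstep T (H n)"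
  "step_unif T H G \<Longrightarrow> e > 0 \<Longrightarrow> \<exists>N. \<forall>n\<ge>N. \<forall>s\<in>{0<..T}. norm (G s - sf (H n) s) < e"
  by (auto simp: step_unif_def)

lemma step_unifE:
  assumes "step_unif T H G" "e > 0"
  obtains N where "\<And>n s. n \<ge> N \<Longrightarrow> s \<in> {0<..T} \<Longrightarrow> norm (G s - sf (H n) s) < e"
  using step_unifD(2)[OF assms] by blast

lemma step_unif_scale:
  assumes "step_unif T H G"
  shows "step_unif T (\<lambda>n. sscale c (H n)) (\<lambda>s. c *\<^sub>R G s)"
proof -
  have "\<exists>N. \<forall>n\<ge>N. \<forall>s\<in>{0<..T}. norm (c *\<^sub>R G s - sf (sscale c (H n)) s) < e" if e: "e > 0" for e
  proof -
    obtain N where N: "\<And>n s. n \<ge> N \<Longrightarrow> s \<in> {0<..T} \<Longrightarrow> norm (G s - sf (H n) s) < e / (\<bar>c\<bar> + 1)"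
    proof -
      have "e / (\<bar>c\<bar> + 1) > 0" using e by (intro divide_pos_pos add_nonneg_pos) auto
      from step_unifE[OF assms this] that show thesis by blast
    qed
    have "norm (c *\<^sub>R G s - sf (sscale c (H n)) s) < e" if "n \<ge> N" "s \<in> {0<..T}" for n s
    proof -
      have "norm (c *\<^sub>R G s - sf (sscale c (H n)) s) = \<bar>c\<bar> * norm (G s - sf (H n) s)"
        by (simp add: sf_sscale scaleR_diff_right[symmetric])
      also have "\<dots> \<le> \<bar>c\<bar> * (e / (\<bar>c\<bar> + 1))" using N[OF that] by (intro mult_left_mono) auto
      also have "\<dots> < e"
      proof -
        have "0 < \<bar>c\<bar> + 1" by linarith
        then have "\<bar>c\<bar> * e < e * (\<bar>c\<bar> + 1)" using e by (simp add: algebra_simps)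
        then show ?thesis using \<open>0 < \<bar>c\<bar> + 1\<close> by (simp add: pos_divide_less_eq)
      qed
      finally show ?thesis .
    qed
    then show ?thesis by blast
  qed
  then show ?thesis using assms by (simp add: step_unif_def)
qed

lemma step_unif_add:
  assumes "step_unif T H G" "step_unif T H' G'"
  shows "step_unif T (\<lambda>n. H n @ H' n) (\<lambda>s. G s + G' s)"
proof -
  have "\<exists>N. \<forall>n\<ge>N. \<forall>s\<in>{0<..T}. norm (G s + G' s - sf (H n @ H' n) s) < e" if e: "e > 0" for e
  proof -
    obtain N where N: "\<And>n s. n \<ge> N \<Longrightarrow> s \<in> {0<..T} \<Longrightarrow> norm (G s - sf (H n) s) < e / 2"
      by (rule step_unifE[OF assms(1) half_gt_zero[OF e]]) blast
    obtain N' where N': "\<And>n s. n \<ge> N' \<Longrightarrow> s \<in> {0<..T} \<Longrightarrow> norm (G' s - sf (H' n) s) < e / 2"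
      by (rule step_unifE[OF assms(2) half_gt_zero[OF e]]) blast
    have "norm (G s + G' s - sf (H n @ H' n) s) < e" if "n \<ge> max N N'" "s \<in> {0<..T}" for n s
    proof -
      have eq: "G s + G' s - sf (H n @ H' n) s = (G s - sf (H n) s) + (G' s - sf (H' n) s)" by (simp add: sf_append)
      show ?thesis
        unfolding eq using norm_triangle_ineq[of "G s - sf (H n) s" "G' s - sf (H' n) s"] N[of n s] N'[of n s] that by simp
    qed
    then show ?thesis by blast
  qed
  then show ?thesis using assms by (simp add: step_unif_def)
qed

lemma step_unif_cong:
  assumes "step_unif T H G" and eq: "\<And>s. s \<in> {0<..T} \<Longrightarrow> G s = G' s"
  shows "step_unif T H G'"
  unfolding step_unif_def
proof (intro conjI allI impI)
  fix e :: real assume "e > 0"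
  then obtain N where "\<And>n s. n \<ge> N \<Longrightarrow> s \<in> {0<..T} \<Longrightarrow> norm (G s - sf (H n) s) < e"
    using step_unifE[OF assms(1)] by blast
  then have "norm (G' s - sf (H n) s) < e" if "n \<ge> N" "s \<in> {0<..T}" for n s
    using that eq[of s] by metis
  then show "\<exists>N. \<forall>n\<ge>N. \<forall>s\<in>{0<..T}. norm (G' s - sf (H n) s) < e" by blast
qed (rule step_unifD(1)[OF assms(1)])

text \<open>With n + 1 cells the division is always meaningful, and t = 0 degenerates to empty
  cells.\<close>

definition grid :: "real \<Rightarrow> (nat \<Rightarrow> nat \<Rightarrow> 'u) \<Rightarrow> nat \<Rightarrow> 'u stepfun" where
  "grid t u n = map (\<lambda>j. (t * real j / real (Suc n), t * real (Suc j) / real (Suc n), u n j)) [0..<Suc n]"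

lemma sf_map_upt: "sf (map F [0..<m]) s = (\<Sum>j<m. case F j of (a, b, u) \<Rightarrow> indicator {a<..b} s *\<^sub>R u)"
  by (induction m) (auto simp: sf_append sf_def)

lemma sf_grid:
  "sf (grid t u n) s = (\<Sum>j<Suc n. indicator {t * real j / real (Suc n)<..t * real (Suc j) / real (Suc n)} s *\<^sub>R u n j)"
  unfolding grid_def sf_map_upt by simp

lemma vstep_grid: "0 \<le> t \<Longrightarrow> t \<le> T \<Longrightarrow> vstep T (grid t u n)"
proof -
  assume t: "0 \<le> t" "t \<le> T"
  have "t * real (Suc j) / real (Suc n) \<le> T" if "j < Suc n" for j
  proof -
    have "t * real (Suc j) / real (Suc n) \<le> t * 1"
      unfolding times_divide_eq_right[symmetric] using that t(1) by (intro mult_left_mono) auto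
    then show ?thesis using t by simp
  qed
  moreover have "t * real j / real (Suc n) \<le> t * real (Suc j) / real (Suc n)" for j
    using t by (intro divide_right_mono mult_left_mono) auto
  moreover have "0 \<le> t * real j / real (Suc n)" for j using t by simp
  ultimately show ?thesis unfolding vstep_def grid_def by (auto simp del: of_nat_Suc upt_Suc)
qed

lemma grid_cell_exists:
  assumes "0 < s" "s \<le> t"
  shows "\<exists>j<Suc n. s \<in> {t * real j / real (Suc n)<..t * real (Suc j) / real (Suc n)}"
proof -
  let ?P = "\<lambda>i. s \<le> t * real i / real (Suc n)"
  have "?P (Suc n)" using assms by simp
  define i where "i = (LEAST i. ?P i)"
  have i: "?P i" unfolding i_def by (rule LeastI[of ?P, OF \<open>?P (Suc n)\<close>])
  have "i \<le> Suc n" unfolding i_def by (rule Least_le[of ?P, OF \<open>?P (Suc n)\<close>])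
  have "i \<noteq> 0" using i assms by (intro notI) auto
  then obtain j where j: "i = Suc j" using not0_implies_Suc by blast
  have "\<not> ?P j" using not_less_Least[of j ?P] j unfolding i_def by auto
  then show ?thesis using i j \<open>i \<le> Suc n\<close> by (intro exI[of _ j]) auto
qed

lemma sf_grid_cell:
  assumes s: "s \<in> {t * real j / real (Suc n)<..t * real (Suc j) / real (Suc n)}" and j: "j < Suc n" and t: "0 \<le> t"
  shows "sf (grid t u n) s = u n j"
proof -
  have "indicator {t * real k / real (Suc n)<..t * real (Suc k) / real (Suc n)} s = (if k = j then 1 else 0 :: real)" for k
  proof (cases k j rule: linorder_cases)
    case less
    then have "t * real (Suc k) / real (Suc n) \<le> t * real j / real (Suc n)"
      using t by (intro divide_right_mono mult_left_mono) auto
    then show ?thesis using s less by auto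
  next
    case equal then show ?thesis using s by auto
  next
    case greater
    then have "t * real (Suc j) / real (Suc n) \<le> t * real k / real (Suc n)"
      using t by (intro divide_right_mono mult_left_mono) auto
    then show ?thesis using s greater by auto
  qed
  then have "sf (grid t u n) s = (\<Sum>k<Suc n. if k = j then u n j else 0)"
    unfolding sf_grid by (intro sum.cong) auto
  then show ?thesis using j by (simp del: sum.lessThan_Suc)
qed

lemma sf_grid_outside:
  assumes "t < s" "0 \<le> t"
  shows "sf (grid t u n) s = 0"
  unfolding sf_grid
proof (intro sum.neutral ballI)
  fix j assume "j \<in> {..<Suc n}"
  then have "t * real (Suc j) / real (Suc n) \<le> t * 1"
    unfolding times_divide_eq_right[symmetric] using assms by (intro mult_left_mono) auto
  then show "indicator {t * real j / real (Suc n)<..t * real (Suc j) / real (Suc n)} s *\<^sub>R u n j = 0"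
    using assms by (auto simp: indicator_def)
qed

lemma step_unif_grid:
  assumes t: "0 \<le> t" "t \<le> T" and F0: "\<And>s. t < s \<Longrightarrow> s \<le> T \<Longrightarrow> F s = 0"
    and conv: "\<And>e. e > 0 \<Longrightarrow> \<exists>N. \<forall>n\<ge>N. \<forall>j<Suc n. \<forall>s\<in>{t * real j / real (Suc n)<..t * real (Suc j) / real (Suc n)}. norm (F s - u n j) < e"
  shows "step_unif T (grid t u) F"
  unfolding step_unif_def
proof (intro conjI allI impI)
  fix e :: real assume e: "e > 0"
  obtain N where N: "\<And>n j s. n \<ge> N \<Longrightarrow> j < Suc n \<Longrightarrow> s \<in> {t * real j / real (Suc n)<..t * real (Suc j) / real (Suc n)} \<Longrightarrow> norm (F s - u n j) < e"
    using conv[OF e] by blast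
  have "norm (F s - sf (grid t u n) s) < e" if "n \<ge> N" "s \<in> {0<..T}" for n s
  proof (cases "s \<le> t")
    case True
    have "0 < s" using that by simp
    from grid_cell_exists[OF this True, of n] obtain j
      where "j < Suc n" "s \<in> {t * real j / real (Suc n)<..t * real (Suc j) / real (Suc n)}" by blast
    then show ?thesis using N[OF that(1)] sf_grid_cell[OF _ _ t(1)] by metis
  next
    case False
    then show ?thesis using F0[of s] sf_grid_outside[of t s u n] t that e by simp
  qed
  then show "\<exists>N. \<forall>n\<ge>N. \<forall>s\<in>{0<..T}. norm (F s - sf (grid t u n) s) < e" by blast
qed (rule vstep_grid[OF t])

context cylindrical_levy
begin

text \<open>A relation and not a function, since the integral is determined only up to null sets. It
  uses increments of \<open>L\<close> alone, whereas \<open>cyl_int\<close> goes through random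
  measures.\<close>

definition isint :: "real \<Rightarrow> (real \<Rightarrow> 'u) \<Rightarrow> ('w \<Rightarrow> real) \<Rightarrow> bool" where
  "isint T G X \<longleftrightarrow> X \<in> borel_measurable M \<and>
    (\<exists>H. step_unif T H G \<and> conv_in_prob M (\<lambda>n. sI (H n)) X)"

lemma isint_measurable: "isint T G X \<Longrightarrow> X \<in> borel_measurable M"
  by (simp add: isint_def)

lemma isint_cong:
  assumes "isint T G X" "\<And>s. s \<in> {0<..T} \<Longrightarrow> G s = G' s" "AE \<omega> in M. X \<omega> = X' \<omega>" "X' \<in> borel_measurable M"
  shows "isint T G' X'"
proof -
  obtain H where H: "step_unif T H G" "conv_in_prob M (\<lambda>n. sI (H n)) X" and X: "X \<in> borel_measurable M"
    using assms(1) by (auto simp: isint_def)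
  have "step_unif T H G'" by (rule step_unif_cong[OF H(1) assms(2)])
  moreover have "conv_in_prob M (\<lambda>n. sI (H n)) X'"
    by (rule conv_in_prob_cong_AE[OF H(2) _ assms(3)]) (use X assms(4) in auto)
  ultimately show ?thesis using assms(4) unfolding isint_def by blast
qed

lemma isint_linear:
  assumes "isint T G X" "isint T G' X'"
  shows "isint T (\<lambda>s. a *\<^sub>R G s + b *\<^sub>R G' s) (\<lambda>\<omega>. a * X \<omega> + b * X' \<omega>)"
proof -
  have [measurable]: "X \<in> borel_measurable M" "X' \<in> borel_measurable M" using assms by (auto dest: isint_measurable)
  obtain H where H: "step_unif T H G" "conv_in_prob M (\<lambda>n. sI (H n)) X" using assms(1) by (auto simp: isint_def)
  obtain H' where H': "step_unif T H' G'" "conv_in_prob M (\<lambda>n. sI (H' n)) X'" using assms(2) by (auto simp: isint_def)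
  have "conv_in_prob M (\<lambda>n. sI (sscale a (H n) @ sscale b (H' n))) (\<lambda>\<omega>. a * X \<omega> + b * X' \<omega>)"
  proof (rule conv_in_prob_cong_AE)
    show "conv_in_prob M (\<lambda>n \<omega>. a * sI (H n) \<omega> + b * sI (H' n) \<omega>) (\<lambda>\<omega>. a * X \<omega> + b * X' \<omega>)"
      by (intro conv_in_prob_add conv_in_prob_cmult H H') auto
    show "AE \<omega> in M. a * sI (H n) \<omega> + b * sI (H' n) \<omega> = sI (sscale a (H n) @ sscale b (H' n)) \<omega>" for n
      using sI_sscale[of a "H n"] sI_sscale[of b "H' n"] unfolding sI_append by eventually_elim simp
  qed auto
  moreover have "step_unif T (\<lambda>n. sscale a (H n) @ sscale b (H' n)) (\<lambda>s. a *\<^sub>R G s + b *\<^sub>R G' s)"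
    by (intro step_unif_add step_unif_scale H H')
  ultimately show ?thesis unfolding isint_def by (intro conjI exI[of _ "\<lambda>n. sscale a (H n) @ sscale b (H' n)"]) auto
qed

lemma isint_sum:
  assumes "finite F" "\<And>i. i \<in> F \<Longrightarrow> isint T (G i) (X i)" "T \<ge> 0"
  shows "isint T (\<lambda>s. \<Sum>i\<in>F. c i *\<^sub>R G i s) (\<lambda>\<omega>. \<Sum>i\<in>F. c i * X i \<omega>)"
  using assms(1,2)
proof (induction F)
  case empty
  have "step_unif T (\<lambda>_. []) (\<lambda>s. 0)" by (simp add: step_unif_def)
  moreover have "conv_in_prob M (\<lambda>n. sI []) (\<lambda>\<omega>. 0)" by (simp add: conv_in_prob_def sI_Nil)
  ultimately show ?case unfolding isint_def by auto
next
  case (insert i F)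
  then have "isint T (\<lambda>s. c i *\<^sub>R G i s + 1 *\<^sub>R (\<Sum>i\<in>F. c i *\<^sub>R G i s)) (\<lambda>\<omega>. c i * X i \<omega> + 1 * (\<Sum>i\<in>F. c i * X i \<omega>))"
    by (intro isint_linear) auto
  then show ?case using insert by simp
qed

text \<open>The weak bound for steps passes to the limit with an error e in the integrand, in the
  level and in the probability; finally e decreases to 0. Sup bounds on two sets survive this
  approximation as they stand.\<close>

lemma isint_weak_L2:
  assumes T: "0 \<le> T" and int: "isint T G X" and E: "E \<in> events" "0 \<le> R"
    and weak: "\<And>H c. vstep T H \<Longrightarrow> c > 0 \<Longrightarrow> prob (E \<inter> {\<omega> \<in> space M. c < \<bar>sI H \<omega>\<bar>}) \<le> R * sQ T H / c\<^sup>2"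
    and pq: "p \<le> q" and \<alpha>: "0 \<le> \<alpha>" "\<And>s. s \<in> {0<..T} \<Longrightarrow> norm (G s) \<le> \<alpha>"
    and \<beta>: "0 \<le> \<beta>" "\<And>s. s \<in> {0<..T} \<Longrightarrow> s \<notin> {p<..q} \<Longrightarrow> norm (G s) \<le> \<beta>" and c: "0 < c"
  shows "prob (E \<inter> {\<omega> \<in> space M. c < \<bar>X \<omega>\<bar>}) \<le> R * (\<beta>\<^sup>2 * T + \<alpha>\<^sup>2 * (q - p)) / c\<^sup>2"
proof -
  have [measurable]: "X \<in> borel_measurable M" "E \<in> events" using int E by (auto dest: isint_measurable)
  obtain H where H: "step_unif T H G" "conv_in_prob M (\<lambda>n. sI (H n)) X" using int by (auto simp: isint_def)
  let ?f = "\<lambda>e. R * ((\<beta> + e)\<^sup>2 * T + (\<alpha> + e)\<^sup>2 * (q - p)) / (c - e)\<^sup>2 + e"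
  have le: "prob (E \<inter> {\<omega> \<in> space M. c < \<bar>X \<omega>\<bar>}) \<le> ?f e" if e: "0 < e" "e < c" for e
  proof -
    obtain N1 where N1: "\<And>n s. n \<ge> N1 \<Longrightarrow> s \<in> {0<..T} \<Longrightarrow> norm (G s - sf (H n) s) < e"
      by (rule step_unifE[OF H(1) e(1)]) blast
    obtain N2 where N2: "\<And>n. n \<ge> N2 \<Longrightarrow> ptail (\<lambda>\<omega>. sI (H n) \<omega> - X \<omega>) e < e"
      using conv_in_probD[OF H(2) e(1) e(1)] by blast
    define n where "n = max N1 N2"
    have nle: "norm (sf (H n) s) \<le> norm (G s) + e" if "s \<in> {0<..T}" for s
    proof -
      have "norm (G s - sf (H n) s) < e" using that by (intro N1) (auto simp: n_def)
      then show ?thesis using norm_triangle_ineq4[of "G s" "G s - sf (H n) s"] by simp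
    qed
    have "prob (E \<inter> {\<omega> \<in> space M. c < \<bar>X \<omega>\<bar>})
        \<le> prob ((E \<inter> {\<omega> \<in> space M. c - e < \<bar>sI (H n) \<omega>\<bar>}) \<union> {\<omega> \<in> space M. e < \<bar>sI (H n) \<omega> - X \<omega>\<bar>})"
      by (intro finite_measure_mono) auto
    also have "\<dots> \<le> prob (E \<inter> {\<omega> \<in> space M. c - e < \<bar>sI (H n) \<omega>\<bar>}) + prob {\<omega> \<in> space M. e < \<bar>sI (H n) \<omega> - X \<omega>\<bar>}"
      by (intro measure_Un_le) measurable
    also have "\<dots> \<le> R * sQ T (H n) / (c - e)\<^sup>2 + e"
      using weak[of "H n" "c - e"] step_unifD(1)[OF H(1)] e N2[of n] by (intro add_mono) (auto simp: ptail_def n_def)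
    also have "\<dots> \<le> ?f e"
    proof (intro add_right_mono divide_right_mono mult_left_mono)
      show "sQ T (H n) \<le> (\<beta> + e)\<^sup>2 * T + (\<alpha> + e)\<^sup>2 * (q - p)"
      proof (rule sQ_le[OF T pq])
        fix s assume s: "s \<in> {0<..T}"
        show "norm (sf (H n) s) \<le> \<alpha> + e" using nle[OF s] \<alpha>(2)[OF s] by simp
        show "norm (sf (H n) s) \<le> \<beta> + e" if "s \<notin> {p<..q}" using nle[OF s] \<beta>(2)[OF s that] by simp
      qed
    qed (use E in auto)
    finally show ?thesis .
  qed
  have "(?f \<longlongrightarrow> R * ((\<beta> + 0)\<^sup>2 * T + (\<alpha> + 0)\<^sup>2 * (q - p)) / (c - 0)\<^sup>2 + 0) (at_right 0)"
    using c by (intro tendsto_intros) auto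
  moreover have "eventually (\<lambda>e. prob (E \<inter> {\<omega> \<in> space M. c < \<bar>X \<omega>\<bar>}) \<le> ?f e) (at_right 0)"
    unfolding eventually_at_right_field using le c by (intro exI[of _ c]) auto
  ultimately show ?thesis using tendsto_lowerbound[of ?f _ "at_right 0" "prob (E \<inter> {\<omega> \<in> space M. c < \<bar>X \<omega>\<bar>})"]
    by simp
qed

text \<open>The square root dominates the L^2 norm of a function bounded by \<alpha> on (p,q] and by
  \<beta> elsewhere, so C acts as a bound of the integral from L^2 to L^1(E).\<close>

definition isint_bound :: "real \<Rightarrow> 'w set \<Rightarrow> real \<Rightarrow> bool" where
  "isint_bound T E C \<longleftrightarrow> E \<in> events \<and> 0 \<le> C \<and> (\<forall>G X p q \<alpha> \<beta>. isint T G X \<longrightarrow> p \<le> q \<longrightarrow> 0 \<le> \<alpha> \<longrightarrow> 0 \<le> \<beta> \<longrightarrow>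
    (\<forall>s\<in>{0<..T}. norm (G s) \<le> \<alpha>) \<longrightarrow> (\<forall>s\<in>{0<..T}. s \<notin> {p<..q} \<longrightarrow> norm (G s) \<le> \<beta>) \<longrightarrow>
    (\<integral>\<^sup>+\<omega>. indicator E \<omega> * ennreal \<bar>X \<omega>\<bar> \<partial>M) \<le> ennreal (C * sqrt (\<beta>\<^sup>2 * T + \<alpha>\<^sup>2 * (q - p))))"

lemma isint_boundD:
  assumes "isint_bound T E C" "isint T G X" "p \<le> q" "0 \<le> \<alpha>" "0 \<le> \<beta>" "\<And>s. s \<in> {0<..T} \<Longrightarrow> norm (G s) \<le> \<alpha>"
    "\<And>s. s \<in> {0<..T} \<Longrightarrow> s \<notin> {p<..q} \<Longrightarrow> norm (G s) \<le> \<beta>"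
  shows "(\<integral>\<^sup>+\<omega>. indicator E \<omega> * ennreal \<bar>X \<omega>\<bar> \<partial>M) \<le> ennreal (C * sqrt (\<beta>\<^sup>2 * T + \<alpha>\<^sup>2 * (q - p)))"
  using assms unfolding isint_bound_def by simp

text \<open>The exceptional interval is taken empty, with p = q = 0.\<close>

lemma isint_boundD_sup:
  assumes "isint_bound T E C" "isint T G X" "0 \<le> \<alpha>" "\<And>s. s \<in> {0<..T} \<Longrightarrow> norm (G s) \<le> \<alpha>"
  shows "(\<integral>\<^sup>+\<omega>. indicator E \<omega> * ennreal \<bar>X \<omega>\<bar> \<partial>M) \<le> ennreal (C * sqrt T * \<alpha>)"
  using isint_boundD[OF assms(1,2) order_refl[of 0] assms(3,3,4,4)] assms(3)
  by (simp add: real_sqrt_mult mult_ac)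

lemma isint_bound_exists:
  assumes T: "0 \<le> T" and \<eta>: "0 < \<eta>"
  shows "\<exists>E C. isint_bound T E C \<and> prob (space M - E) \<le> \<eta>"
proof -
  obtain E R where E: "E \<in> events" "0 \<le> R" "prob (space M - E) \<le> \<eta>"
    "\<And>H c. vstep T H \<Longrightarrow> c > 0 \<Longrightarrow> prob (E \<inter> {\<omega> \<in> space M. c < \<bar>sI H \<omega>\<bar>}) \<le> R * sQ T H / c\<^sup>2"
    using sI_weak_L2[OF T \<eta>] by auto
  have "isint_bound T E (3 * sqrt R)"
    unfolding isint_bound_def
  proof (intro conjI allI impI)
    fix G X and p q \<alpha> \<beta> :: real
    assume a: "isint T G X" "p \<le> q" "0 \<le> \<alpha>" "0 \<le> \<beta>" "\<forall>s\<in>{0<..T}. norm (G s) \<le> \<alpha>"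
      "\<forall>s\<in>{0<..T}. s \<notin> {p<..q} \<longrightarrow> norm (G s) \<le> \<beta>"
    have nn: "0 \<le> \<beta>\<^sup>2 * T + \<alpha>\<^sup>2 * (q - p)" using T a by (intro add_nonneg_nonneg mult_nonneg_nonneg) auto
    have "(\<integral>\<^sup>+\<omega>. indicator E \<omega> * ennreal \<bar>X \<omega>\<bar> \<partial>M) \<le> ennreal (3 * sqrt (R * (\<beta>\<^sup>2 * T + \<alpha>\<^sup>2 * (q - p))))"
      by (rule weak_L2_imp_L1[OF isint_measurable[OF a(1)] E(1)], use nn E(2) in simp)
        (rule isint_weak_L2[OF T a(1) E(1,2,4) a(2)], use a in auto)
    then show "(\<integral>\<^sup>+\<omega>. indicator E \<omega> * ennreal \<bar>X \<omega>\<bar> \<partial>M) \<le> ennreal (3 * sqrt R * sqrt (\<beta>\<^sup>2 * T + \<alpha>\<^sup>2 * (q - p)))"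
      by (simp add: real_sqrt_mult mult.assoc)
  qed (use E in auto)
  then show ?thesis using E by blast
qed

text \<open>Markov's inequality on E; whatever happens off E is paid for by its probability.\<close>

lemma ptail_le_large_event:
  assumes [measurable]: "X \<in> borel_measurable M" "E \<in> events" and c: "c > 0" and b: "0 \<le> b"
    and bd: "(\<integral>\<^sup>+\<omega>. indicator E \<omega> * ennreal \<bar>X \<omega>\<bar> \<partial>M) \<le> ennreal b"
  shows "ptail X c \<le> prob (space M - E) + b / c"
proof -
  let ?A = "E \<inter> {\<omega> \<in> space M. c < \<bar>X \<omega>\<bar>}"
  have "ennreal (c * prob ?A) = (\<integral>\<^sup>+\<omega>. ennreal c * indicator ?A \<omega> \<partial>M)"
    using c by (subst nn_integral_cmult_indicator) (auto simp: emeasure_eq_measure ennreal_mult)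
  also have "\<dots> \<le> (\<integral>\<^sup>+\<omega>. indicator E \<omega> * ennreal \<bar>X \<omega>\<bar> \<partial>M)"
    by (intro nn_integral_mono) (auto simp: indicator_def intro!: ennreal_leI)
  also note bd
  finally have "prob ?A \<le> b / c" using c b by (simp add: field_simps)
  moreover have "ptail X c \<le> prob ((space M - E) \<union> ?A)"
    unfolding ptail_def by (intro finite_measure_mono) auto
  moreover have "\<dots> \<le> prob (space M - E) + prob ?A" by (intro measure_Un_le) auto
  ultimately show ?thesis by simp
qed

text \<open>Continuity of the integral at 0, from the sup norm to convergence in probability;
  uniqueness, existence and independence of the approximating sequence all follow from it.\<close>

lemma isint_small:
  assumes T: "0 \<le> T" and e: "0 < e"
  shows "\<exists>d>0. \<forall>G X. isint T G X \<longrightarrow> (\<forall>s\<in>{0<..T}. norm (G s) \<le> d) \<longrightarrow> ptail X e \<le> e"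
proof -
  obtain E C where EC: "isint_bound T E C" "prob (space M - E) \<le> e / 2"
    using isint_bound_exists[OF T, of "e / 2"] e by auto
  have C: "0 \<le> C" "E \<in> events" using EC(1) by (auto simp: isint_bound_def)
  \<comment> \<open>With this d the L^1 bound divided by the level e is at most e/2; the summand 1
    covers C = 0 and T = 0.\<close>
  define d where "d = e\<^sup>2 / (2 * (C * sqrt T + 1))"
  have C1: "C * sqrt T + 1 > 0" using C T by (simp add: add_nonneg_pos)
  have d: "d > 0" using e C1 by (simp add: d_def)
  have "ptail X e \<le> e" if "isint T G X" "\<forall>s\<in>{0<..T}. norm (G s) \<le> d" for G X
  proof -
    have "ptail X e \<le> prob (space M - E) + (C * sqrt T * d) / e"
      using isint_boundD_sup[OF EC(1) that(1), of d] that d C T e isint_measurable[OF that(1)]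
      by (intro ptail_le_large_event) auto
    also have "(C * sqrt T * d) / e \<le> ((C * sqrt T + 1) * d) / e"
      using d e by (intro divide_right_mono mult_right_mono) auto
    also have "\<dots> = e / 2"
    proof -
      have "k * (e\<^sup>2 / (2 * k)) / e = e / 2" if "k > 0" for k using that e by (simp add: power2_eq_square)
      from this[OF C1] show ?thesis unfolding d_def .
    qed
    finally show ?thesis using EC(2) by simp
  qed
  then show ?thesis using d by blast
qed

lemma isint_step: "vstep T H \<Longrightarrow> isint T (sf H) (sI H)"
  unfolding isint_def step_unif_def by (intro conjI exI[of _ "\<lambda>_. H"]) (auto simp: conv_in_prob_def)

lemma isint_zero_AE:
  assumes T: "0 \<le> T" and int: "isint T G X" and G: "\<And>s. s \<in> {0<..T} \<Longrightarrow> G s = 0"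
  shows "AE \<omega> in M. X \<omega> = 0"
proof (rule ptail_eq_0_AE[OF isint_measurable[OF int]])
  fix e :: real assume e: "e > 0"
  have "ptail X e \<le> e'" if e': "0 < e'" for e'
  proof -
    obtain d where d: "d > 0" "\<forall>G X. isint T G X \<longrightarrow> (\<forall>s\<in>{0<..T}. norm (G s) \<le> d) \<longrightarrow> ptail X (min e e') \<le> min e e'"
      using isint_small[OF T, of "min e e'"] e e' by auto
    have "ptail X (min e e') \<le> min e e'" using d int G by simp
    moreover have "ptail X e \<le> ptail X (min e e')" by (rule ptail_mono[OF isint_measurable[OF int]]) simp
    ultimately show ?thesis by simp
  qed
  then have "ptail X e \<le> 0" by (rule field_le_epsilon[of _ 0, simplified])
  then show "ptail X e = 0" using ptail_nonneg[of X e] by simp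
qed

lemma isint_unique:
  assumes T: "0 \<le> T" and "isint T G X" "isint T G' X'" "\<And>s. s \<in> {0<..T} \<Longrightarrow> G s = G' s"
  shows "AE \<omega> in M. X \<omega> = X' \<omega>"
proof -
  have "AE \<omega> in M. 1 * X \<omega> + (-1) * X' \<omega> = 0"
    by (rule isint_zero_AE[OF T isint_linear[OF assms(2,3)]]) (use assms(4) in simp)
  then show ?thesis by eventually_elim simp
qed

lemma isint_exists:
  assumes T: "0 \<le> T" and H: "step_unif T H G"
  shows "\<exists>X. isint T G X \<and> conv_in_prob M (\<lambda>n. sI (H n)) X"
proof -
  have "\<exists>X. X \<in> borel_measurable M \<and> conv_in_prob M (\<lambda>n. sI (H n)) X"
  proof (rule Cauchy_in_prob_convergent)
    fix e :: real assume e: "e > 0"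
    obtain d where d: "d > 0" "\<forall>G X. isint T G X \<longrightarrow> (\<forall>s\<in>{0<..T}. norm (G s) \<le> d) \<longrightarrow> ptail X e \<le> e"
      using isint_small[OF T e] by auto
    obtain N where N: "\<And>n s. n \<ge> N \<Longrightarrow> s \<in> {0<..T} \<Longrightarrow> norm (G s - sf (H n) s) < d / 2"
      by (rule step_unifE[OF H half_gt_zero[OF d(1)]]) blast
    have "ptail (\<lambda>\<omega>. sI (H m) \<omega> - sI (H n) \<omega>) e \<le> e" if "m \<ge> N" "n \<ge> N" for m n
    proof -
      have "isint T (\<lambda>s. 1 *\<^sub>R sf (H m) s + (-1) *\<^sub>R sf (H n) s) (\<lambda>\<omega>. 1 * sI (H m) \<omega> + (-1) * sI (H n) \<omega>)"
        by (intro isint_linear isint_step step_unifD(1)[OF H])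
      moreover have "norm (1 *\<^sub>R sf (H m) s + (-1) *\<^sub>R sf (H n) s) \<le> d" if s: "s \<in> {0<..T}" for s
      proof -
        have "1 *\<^sub>R sf (H m) s + (-1) *\<^sub>R sf (H n) s = (G s - sf (H n) s) - (G s - sf (H m) s)" by simp
        then show ?thesis
          using norm_triangle_ineq4[of "G s - sf (H n) s" "G s - sf (H m) s"] N[OF \<open>m \<ge> N\<close> s] N[OF \<open>n \<ge> N\<close> s] by simp
      qed
      ultimately have "ptail (\<lambda>\<omega>. 1 * sI (H m) \<omega> + (-1) * sI (H n) \<omega>) e \<le> e" using d(2) by blast
      then show ?thesis by simp
    qed
    then show "\<exists>N. \<forall>m\<ge>N. \<forall>n\<ge>N. ptail (\<lambda>\<omega>. sI (H m) \<omega> - sI (H n) \<omega>) e \<le> e" by blast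
  qed simp
  then show ?thesis using H unfolding isint_def by blast
qed

text \<open>Any uniformly convergent sequence of steps computes the integral, so the grid can be
  adapted to the purpose at hand.\<close>

lemma isint_conv:
  assumes T: "0 \<le> T" and int: "isint T G X" and H: "step_unif T H G"
  shows "conv_in_prob M (\<lambda>n. sI (H n)) X"
proof -
  obtain X' where X': "isint T G X'" "conv_in_prob M (\<lambda>n. sI (H n)) X'" using isint_exists[OF T H] by blast
  have "AE \<omega> in M. X' \<omega> = X \<omega>" by (rule isint_unique[OF T X'(1) int]) simp
  then show ?thesis
    using X' isint_measurable[OF int] isint_measurable[OF X'(1)] by (intro conv_in_prob_cong_AE[OF X'(2)]) auto
qed

section \<open>Relation to the integral of the definition\<close>

text \<open>\<open>cyl_int\<close> admits only step values with such a measure. Their supply comes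
  from the stochastic integrability hypothesis and is enlarged by closure under sums.\<close>

definition has_random_measure :: "real \<Rightarrow> 'u set" where
  "has_random_measure T = {u. \<exists>\<mu>. levy_random_measure M T (\<lambda>t. L t u) \<mu>}"

lemma levy_random_measureD:
  assumes "levy_random_measure M T l \<mu>"
  shows "A \<in> sets borel \<Longrightarrow> A \<subseteq> {0..T} \<Longrightarrow> \<mu> A \<in> borel_measurable M"
    "0 \<le> a \<Longrightarrow> a \<le> b \<Longrightarrow> b \<le> T \<Longrightarrow> AE \<omega> in M. \<mu> {a<..b} \<omega> = l b \<omega> - l a \<omega>"
    "AE \<omega> in M. \<mu> {0} \<omega> = 0"
    "(\<forall>k. F k \<in> sets borel \<and> F k \<subseteq> {0..T}) \<and> disjoint_family F \<Longrightarrow>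
      conv_in_prob M (\<lambda>n \<omega>. \<Sum>k<n. \<mu> (F k) \<omega>) (\<mu> (\<Union>k. F k))"
  using assms by (simp_all add: levy_random_measure_def)

lemma cyl_intE:
  assumes "cyl_int M L T g A X"
  obtains n :: "nat \<Rightarrow> nat" and a b :: "nat \<Rightarrow> nat \<Rightarrow> real" and u :: "nat \<Rightarrow> nat \<Rightarrow> 'u" and Z :: "nat \<Rightarrow> nat \<Rightarrow> 'w \<Rightarrow> real"
    where "X \<in> borel_measurable M" "\<forall>j. \<forall>k<n j. 0 \<le> a j k \<and> a j k \<le> b j k \<and> b j k \<le> T"
    "\<forall>e>0. \<exists>N. \<forall>j\<ge>N. \<forall>s\<in>{0<..T}. norm (g s - (\<Sum>k<n j. indicator {a j k<..b j k} s *\<^sub>R u j k)) < e"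
    "\<forall>j. \<forall>k<n j. levy_set_int M T (\<lambda>t. L t (u j k)) (A \<inter> {a j k<..b j k}) (Z j k)"
    "conv_in_prob M (\<lambda>j \<omega>. \<Sum>k<n j. Z j k \<omega>) X"
  using assms unfolding cyl_int_def
  apply (elim conjE exE)
  subgoal for n a b u Z by (rule that[of n a b u Z])
  done

lemma zero_has_random_measure: "0 \<in> has_random_measure T"
proof -
  have "levy_random_measure M T (\<lambda>t. L t 0) (\<lambda>_ _. 0)"
    unfolding levy_random_measure_def
  proof (intro conjI allI impI)
    fix a b :: real
    show "AE \<omega> in M. 0 = L b 0 \<omega> - L a 0 \<omega>" using L_zero[of a] L_zero[of b] by eventually_elim simp
  qed (auto simp: conv_in_prob_def)
  then show ?thesis unfolding has_random_measure_def by blast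
qed

lemma add_has_random_measure:
  assumes "u \<in> has_random_measure T" "w \<in> has_random_measure T"
  shows "u + w \<in> has_random_measure T"
proof -
  obtain \<mu> \<nu> where \<mu>: "levy_random_measure M T (\<lambda>t. L t u) \<mu>" and \<nu>: "levy_random_measure M T (\<lambda>t. L t w) \<nu>"
    using assms by (auto simp: has_random_measure_def)
  have m: "\<mu> A \<in> borel_measurable M" "\<nu> A \<in> borel_measurable M" if "A \<in> sets borel" "A \<subseteq> {0..T}" for A
    by (rule levy_random_measureD(1)[OF \<mu> that], rule levy_random_measureD(1)[OF \<nu> that])
  have "levy_random_measure M T (\<lambda>t. L t (u + w)) (\<lambda>A \<omega>. \<mu> A \<omega> + \<nu> A \<omega>)"
    unfolding levy_random_measure_def
  proof (intro conjI allI impI)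
    fix a b :: real assume ab: "0 \<le> a \<and> a \<le> b \<and> b \<le> T"
    have "AE \<omega> in M. \<mu> {a<..b} \<omega> = L b u \<omega> - L a u \<omega>" "AE \<omega> in M. \<nu> {a<..b} \<omega> = L b w \<omega> - L a w \<omega>"
      by (rule levy_random_measureD(2)[OF \<mu>], use ab in auto) (rule levy_random_measureD(2)[OF \<nu>], use ab in auto)
    then show "AE \<omega> in M. \<mu> {a<..b} \<omega> + \<nu> {a<..b} \<omega> = L b (u + w) \<omega> - L a (u + w) \<omega>"
      using L_add[of a u w] L_add[of b u w] by eventually_elim simp
  next
    have "AE \<omega> in M. \<mu> {0} \<omega> = 0" "AE \<omega> in M. \<nu> {0} \<omega> = 0"
      by (rule levy_random_measureD(3)[OF \<mu>], rule levy_random_measureD(3)[OF \<nu>])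
    then show "AE \<omega> in M. \<mu> {0} \<omega> + \<nu> {0} \<omega> = 0" by eventually_elim simp
  next
    fix A :: "nat \<Rightarrow> real set" assume A: "(\<forall>k. A k \<in> sets borel \<and> A k \<subseteq> {0..T}) \<and> disjoint_family A"
    have "conv_in_prob M (\<lambda>n \<omega>. \<Sum>k<n. \<mu> (A k) \<omega>) (\<mu> (\<Union>k. A k))" "conv_in_prob M (\<lambda>n \<omega>. \<Sum>k<n. \<nu> (A k) \<omega>) (\<nu> (\<Union>k. A k))"
      by (rule levy_random_measureD(4)[OF \<mu> A], rule levy_random_measureD(4)[OF \<nu> A])
    moreover have "\<mu> (\<Union>k. A k) \<in> borel_measurable M" "\<nu> (\<Union>k. A k) \<in> borel_measurable M"
      by (rule m(1), use A in auto) (rule m(2), use A in auto)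
    moreover have "\<mu> (A k) \<in> borel_measurable M" "\<nu> (A k) \<in> borel_measurable M" for k
      by (rule m(1), use A in auto) (rule m(2), use A in auto)
    ultimately have "conv_in_prob M (\<lambda>n \<omega>. (\<Sum>k<n. \<mu> (A k) \<omega>) + (\<Sum>k<n. \<nu> (A k) \<omega>)) (\<lambda>\<omega>. \<mu> (\<Union>k. A k) \<omega> + \<nu> (\<Union>k. A k) \<omega>)"
      by (intro conv_in_prob_add) auto
    then show "conv_in_prob M (\<lambda>n \<omega>. \<Sum>k<n. \<mu> (A k) \<omega> + \<nu> (A k) \<omega>) (\<lambda>\<omega>. \<mu> (\<Union>k. A k) \<omega> + \<nu> (\<Union>k. A k) \<omega>)"
      by (simp add: sum.distrib)
  next
    fix A assume "A \<in> sets borel \<and> A \<subseteq> {0..T}"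
    then show "(\<lambda>\<omega>. \<mu> A \<omega> + \<nu> A \<omega>) \<in> borel_measurable M" using m[of A] by (intro borel_measurable_add) auto
  qed
  then show ?thesis unfolding has_random_measure_def by blast
qed

lemma sum_has_random_measure:
  "finite F \<Longrightarrow> (\<And>i. i \<in> F \<Longrightarrow> u i \<in> has_random_measure T) \<Longrightarrow> (\<Sum>i\<in>F. u i) \<in> has_random_measure T"
  by (induction F rule: finite_induct) (auto intro: zero_has_random_measure add_has_random_measure)

text \<open>The set is the interval from min a t to min b t, on which every admissible random
  measure is an increment of \<open>L\<close>; the choice of the measure therefore drops
  out.\<close>

lemma levy_set_int_interval:
  assumes Z: "levy_set_int M T (\<lambda>t. L t u) ({0..t} \<inter> {a<..b}) Z" and t: "0 \<le> t" "t \<le> T" and ab: "0 \<le> a" "a \<le> b" "b \<le> T"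
  shows "AE \<omega> in M. Z \<omega> = L (min b t) u \<omega> - L (min a t) u \<omega>"
proof -
  obtain \<mu> where \<mu>: "levy_random_measure M T (\<lambda>t. L t u) \<mu>" "AE \<omega> in M. Z \<omega> = \<mu> ({0..t} \<inter> {a<..b}) \<omega>"
    using Z by (auto simp: levy_set_int_def)
  have eq: "{0..t} \<inter> {a<..b} = {min a t<..min b t}" using t ab by auto
  have "0 \<le> min a t \<and> min a t \<le> min b t \<and> min b t \<le> T" using t ab by auto
  then have "AE \<omega> in M. \<mu> {min a t<..min b t} \<omega> = L (min b t) u \<omega> - L (min a t) u \<omega>"
    by (intro levy_random_measureD(2)[OF \<mu>(1)]) auto
  then show ?thesis using \<mu>(2) unfolding eq by eventually_elim simp
qed

text \<open>Clipping all intervals at t turns the integral over [0,t] of the definition into a limit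
  of plain step integrals.\<close>

lemma cyl_int_isint:
  assumes X: "cyl_int M L T g {0..t} X" and t: "0 \<le> t" "t \<le> T"
  shows "isint T (\<lambda>s. indicator {0..t} s *\<^sub>R g s) X"
proof -
  obtain n :: "nat \<Rightarrow> nat" and a b :: "nat \<Rightarrow> nat \<Rightarrow> real" and u :: "nat \<Rightarrow> nat \<Rightarrow> 'u" and Z :: "nat \<Rightarrow> nat \<Rightarrow> 'w \<Rightarrow> real"
    where Xm: "X \<in> borel_measurable M"
    and c1: "\<forall>j. \<forall>k<n j. 0 \<le> a j k \<and> a j k \<le> b j k \<and> b j k \<le> T"
    and c2: "\<forall>e>0. \<exists>N. \<forall>j\<ge>N. \<forall>s\<in>{0<..T}. norm (g s - (\<Sum>k<n j. indicator {a j k<..b j k} s *\<^sub>R u j k)) < e"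
    and c3: "\<forall>j. \<forall>k<n j. levy_set_int M T (\<lambda>t. L t (u j k)) ({0..t} \<inter> {a j k<..b j k}) (Z j k)"
    and c4: "conv_in_prob M (\<lambda>j \<omega>. \<Sum>k<n j. Z j k \<omega>) X"
    by (rule cyl_intE[OF X])
  define H where "H j = map (\<lambda>k. (min (a j k) t, min (b j k) t, u j k)) [0..<n j]" for j :: nat
  have sfH: "sf (H j) s = indicator {0..t} s *\<^sub>R (\<Sum>k<n j. indicator {a j k<..b j k} s *\<^sub>R u j k)" if "s \<in> {0<..T}" for j s
  proof -
    have "indicator {min x t<..min y t} s = (indicator {0..t} s * indicator {x<..y} s :: real)" for x y
    proof -
      have "s \<in> {min x t<..min y t} \<longleftrightarrow> s \<in> {0..t} \<and> s \<in> {x<..y}" using that by auto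
      then show ?thesis by (simp add: indicator_def)
    qed
    then show ?thesis unfolding H_def sf_map_upt scaleR_sum_right by simp
  qed
  have "step_unif T H (\<lambda>s. indicator {0..t} s *\<^sub>R g s)"
    unfolding step_unif_def
  proof (intro conjI allI impI)
    show "vstep T (H j)" for j using c1 t by (force simp: vstep_def H_def)
    fix e :: real assume "e > 0"
    then obtain N where N: "\<And>j s. j \<ge> N \<Longrightarrow> s \<in> {0<..T} \<Longrightarrow> norm (g s - (\<Sum>k<n j. indicator {a j k<..b j k} s *\<^sub>R u j k)) < e"
      using c2 by blast
    have "norm (indicator {0..t} s *\<^sub>R g s - sf (H j) s) < e" if "j \<ge> N" "s \<in> {0<..T}" for j s
      unfolding sfH[OF that(2)] scaleR_diff_right[symmetric]
      using N[OF that] \<open>e > 0\<close> by (cases "s \<in> {0..t}") auto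
    then show "\<exists>N. \<forall>j\<ge>N. \<forall>s\<in>{0<..T}. norm (indicator {0..t} s *\<^sub>R g s - sf (H j) s) < e" by blast
  qed
  moreover have "conv_in_prob M (\<lambda>j. sI (H j)) X"
  proof (rule conv_in_prob_cong_AE[OF c4])
    have Zm: "Z j k \<in> borel_measurable M" if "k < n j" for j k using c3 that by (simp add: levy_set_int_def)
    then show "(\<lambda>\<omega>. \<Sum>k<n j. Z j k \<omega>) \<in> borel_measurable M" for j by (intro borel_measurable_sum) auto
    fix j
    have "AE \<omega> in M. \<forall>k. k < n j \<longrightarrow> Z j k \<omega> = L (min (b j k) t) (u j k) \<omega> - L (min (a j k) t) (u j k) \<omega>"
      unfolding AE_all_countable
    proof
      fix k show "AE \<omega> in M. k < n j \<longrightarrow> Z j k \<omega> = L (min (b j k) t) (u j k) \<omega> - L (min (a j k) t) (u j k) \<omega>"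
        using levy_set_int_interval[OF c3[rule_format] t] c1 by (cases "k < n j") auto
    qed
    moreover have "sI (H j) \<omega> = (\<Sum>k<n j. L (min (b j k) t) (u j k) \<omega> - L (min (a j k) t) (u j k) \<omega>)" for \<omega>
      unfolding H_def sI_def by (simp add: comp_def interv_sum_list_conv_sum_set_nat atLeast0LessThan)
    ultimately show "AE \<omega> in M. (\<Sum>k<n j. Z j k \<omega>) = sI (H j) \<omega>" by (auto elim!: eventually_mono)
  qed (use Xm in auto)
  ultimately show ?thesis using Xm unfolding isint_def by blast
qed

text \<open>At the point s the approximating step function takes a finite sum of values that all
  carry random measures, and such vectors are closed under sums. Positivity of s matters because
  approximation is known on (0,T] only.\<close>

lemma cyl_int_approximable:
  assumes X: "cyl_int M L T g A X" and s: "s \<in> {0<..T}" and e: "e > 0"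
  shows "\<exists>u\<in>has_random_measure T. norm (g s - u) < e"
proof -
  obtain n :: "nat \<Rightarrow> nat" and a b :: "nat \<Rightarrow> nat \<Rightarrow> real" and u :: "nat \<Rightarrow> nat \<Rightarrow> 'u" and Z :: "nat \<Rightarrow> nat \<Rightarrow> 'w \<Rightarrow> real"
    where c2: "\<forall>e>0. \<exists>N. \<forall>j\<ge>N. \<forall>s\<in>{0<..T}. norm (g s - (\<Sum>k<n j. indicator {a j k<..b j k} s *\<^sub>R u j k)) < e"
    and c3: "\<forall>j. \<forall>k<n j. levy_set_int M T (\<lambda>t. L t (u j k)) (A \<inter> {a j k<..b j k}) (Z j k)"
    by (rule cyl_intE[OF X]) (rule that)
  obtain j where "norm (g s - (\<Sum>k<n j. indicator {a j k<..b j k} s *\<^sub>R u j k)) < e"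
    using c2 e s by blast
  moreover have "(\<Sum>k<n j. indicator {a j k<..b j k} s *\<^sub>R u j k) \<in> has_random_measure T"
  proof (rule sum_has_random_measure)
    fix k assume "k \<in> {..<n j}"
    then have "u j k \<in> has_random_measure T" using c3 by (auto simp: levy_set_int_def has_random_measure_def)
    then show "indicator {a j k<..b j k} s *\<^sub>R u j k \<in> has_random_measure T"
      by (auto simp: indicator_def zero_has_random_measure)
  qed simp
  ultimately show ?thesis by blast
qed

text \<open>The converse passage: when the step values carry random measures, increments over the
  cells are values of these measures, and the plain integral becomes one in the sense of the
  definition.\<close>

lemma cyl_int_grid:
  assumes t: "0 \<le> t" "t \<le> T" and u: "\<And>n j. j < Suc n \<Longrightarrow> u n j \<in> has_random_measure T"
    and unif: "step_unif T (grid t u) G" and int: "isint T G X"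
  shows "cyl_int M L T G {0..t} X"
proof -
  let ?a = "\<lambda>n j. t * real j / real (Suc n)"
  let ?Z = "\<lambda>n j \<omega>. L (?a n (Suc j)) (u n j) \<omega> - L (?a n j) (u n j) \<omega>"
  have ab: "0 \<le> ?a n j" "?a n j \<le> ?a n (Suc j)" for n j
    using t by (auto intro!: divide_right_mono mult_left_mono)
  have bt: "?a n (Suc j) \<le> t" if "j < Suc n" for n j
  proof -
    have "?a n (Suc j) \<le> t * 1"
      unfolding times_divide_eq_right[symmetric] using that t(1) by (intro mult_left_mono) auto
    then show ?thesis by simp
  qed
  have set_int: "levy_set_int M T (\<lambda>t. L t (u n j)) ({0..t} \<inter> {?a n j<..?a n (Suc j)}) (?Z n j)" if j: "j < Suc n" for n j
  proof -
    obtain \<mu> where \<mu>: "levy_random_measure M T (\<lambda>t. L t (u n j)) \<mu>" using u[OF j] by (auto simp: has_random_measure_def)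
    have eq: "{0..t} \<inter> {?a n j<..?a n (Suc j)} = {?a n j<..?a n (Suc j)}" using order_le_less_trans[OF ab(1)] bt[OF j] by (force simp del: of_nat_Suc)
    have "0 \<le> ?a n j \<and> ?a n j \<le> ?a n (Suc j) \<and> ?a n (Suc j) \<le> T" using ab bt[OF j] t by (meson order_trans)
    then have "AE \<omega> in M. \<mu> {?a n j<..?a n (Suc j)} \<omega> = ?Z n j \<omega>"
      by (intro levy_random_measureD(2)[OF \<mu>]) auto
    then have "AE \<omega> in M. ?Z n j \<omega> = \<mu> {?a n j<..?a n (Suc j)} \<omega>" by eventually_elim simp
    then show ?thesis using \<mu> unfolding levy_set_int_def eq by auto
  qed
  have conv: "conv_in_prob M (\<lambda>n \<omega>. \<Sum>j<Suc n. ?Z n j \<omega>) X"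
  proof -
    have "sI (grid t u n) = (\<lambda>\<omega>. \<Sum>j<Suc n. ?Z n j \<omega>)" for n
      unfolding grid_def sI_def fun_eq_iff
      by (simp add: comp_def interv_sum_list_conv_sum_set_nat atLeast0LessThan del: upt_Suc sum.lessThan_Suc)
    then show ?thesis using isint_conv[OF _ int unif] t by simp
  qed
  have un: "\<forall>e>0. \<exists>N. \<forall>n\<ge>N. \<forall>s\<in>{0<..T}. norm (G s - (\<Sum>k<Suc n. indicator {?a n k<..?a n (Suc k)} s *\<^sub>R u n k)) < e"
    using unif unfolding step_unif_def sf_grid by blast
  have bd: "\<forall>n. \<forall>k<Suc n. 0 \<le> ?a n k \<and> ?a n k \<le> ?a n (Suc k) \<and> ?a n (Suc k) \<le> T"
  proof (intro allI impI)
    fix n k assume "k < Suc n"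
    then show "0 \<le> ?a n k \<and> ?a n k \<le> ?a n (Suc k) \<and> ?a n (Suc k) \<le> T"
      using ab bt[of k n] t by (meson order_trans)
  qed
  show ?thesis
    unfolding cyl_int_def
    apply (rule conjI, rule isint_measurable[OF int])
    apply (rule exI[of _ Suc], rule exI[of _ ?a], rule exI[of _ "\<lambda>n k. ?a n (Suc k)"], rule exI[of _ u], rule exI[of _ ?Z])
    apply (rule conjI[OF bd conjI[OF un conjI[OF _ conv]]])
    using set_int by blast
qed

end

section \<open>The stochastic convolution\<close>

text \<open>Setting the sequence to 0 off its measurable set of Cauchy points makes it converge
  everywhere.\<close>

lemma borel_measurable_Cauchy_lim:
  fixes f :: "nat \<Rightarrow> 'a \<Rightarrow> 'b::{real_normed_vector,complete_space,second_countable_topology}"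
  assumes [measurable]: "\<And>i. f i \<in> borel_measurable N"
  shows "(\<lambda>x. if Cauchy (\<lambda>i. f i x) then lim (\<lambda>i. f i x) else 0) \<in> borel_measurable N"
proof (rule borel_measurable_LIMSEQ_metric)
  show "(\<lambda>x. if Cauchy (\<lambda>i. f i x) then f n x else 0) \<in> borel_measurable N" for n
    by (intro measurable_If_set[where A = "{x. Cauchy (\<lambda>i. f i x)}", unfolded mem_Collect_eq])
      (use sets_Collect_Cauchy[OF assms] in \<open>auto simp: Int_def conj_commute\<close>)
  fix x
  show "(\<lambda>n. if Cauchy (\<lambda>i. f i x) then f n x else 0) \<longlonglongrightarrow> (if Cauchy (\<lambda>i. f i x) then lim (\<lambda>i. f i x) else 0)"
    using Cauchy_convergent[of "\<lambda>i. f i x"] by (auto simp: convergent_LIMSEQ_iff)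
qed

locale levy_convolution = cylindrical_levy M L
  for M :: "'w measure"
    and L :: "real \<Rightarrow> 'u::{real_inner,complete_space,second_countable_topology} \<Rightarrow> 'w \<Rightarrow> real" +
  fixes S :: "real \<Rightarrow> ('v::{real_inner,complete_space,second_countable_topology} \<Rightarrow>\<^sub>L 'v)"
    and B :: "'u \<Rightarrow>\<^sub>L 'v" and T :: real
  assumes S: "c0_semigroup S" and stoch_int: "stoch_integrable M L T (\<lambda>s. S s o\<^sub>L B)" and T: "0 \<le> T"
begin

definition g :: "'v \<Rightarrow> real \<Rightarrow> 'u" where "g v r = adj (S r o\<^sub>L B) v"

text \<open>The kernel of the convolution tested with v. Its value \<open>g v 0 = adj B v\<close> at
  s = t is the boundary value that yields the noise term of the equation.\<close>

definition kf :: "real \<Rightarrow> 'v \<Rightarrow> real \<Rightarrow> 'u" where "kf t v s = (if s \<le> t then g v (t - s) else 0)"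

lemma inner_g: "inner x (g v r) = inner (S r (B x)) v"
  unfolding g_def inner_adj[symmetric] by simp

lemma g_linear: "g (a *\<^sub>R v + b *\<^sub>R w) r = a *\<^sub>R g v r + b *\<^sub>R g w r"
  unfolding g_def by (rule adj_linear)

lemma kf_linear: "kf t (a *\<^sub>R v + b *\<^sub>R w) s = a *\<^sub>R kf t v s + b *\<^sub>R kf t w s"
  by (simp add: kf_def g_linear)

lemma g_bound: "\<exists>K>0. \<forall>r\<in>{0..T}. \<forall>v. norm (g v r) \<le> K * norm v"
proof -
  obtain K where K: "K > 0" "\<And>t. t \<in> {0..T} \<Longrightarrow> norm (S t) \<le> K" using c0_semigroup_bounded[OF S] by blast
  have "norm (g v r) \<le> (K * (norm B + 1)) * norm v" if r: "r \<in> {0..T}" for r v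
  proof -
    have "norm (g v r) \<le> norm (S r o\<^sub>L B) * norm v" unfolding g_def by (rule norm_adj_le)
    also have "\<dots> \<le> (norm (S r) * norm B) * norm v" by (intro mult_right_mono norm_blinfun_compose) simp
    also have "\<dots> \<le> (K * (norm B + 1)) * norm v" using K(1) K(2)[OF r] by (intro mult_right_mono mult_mono) auto
    finally show ?thesis .
  qed
  then show ?thesis using K(1) by (intro exI[of _ "K * (norm B + 1)"]) (auto intro!: mult_pos_pos add_nonneg_pos)
qed

text \<open>Weak continuity identifies the one-sided limits of the regulated function \<open>g v\<close>, so that
  \<open>g v\<close> is norm continuous.\<close>

lemma g_continuous: "continuous_on {0..T} (g v)"
proof -
  have reg: "regulated T (g v)" using stoch_int unfolding stoch_integrable_def g_def by blast
  have weak: "((\<lambda>s. inner z (g v s)) \<longlongrightarrow> inner z (g v t)) (at t within A)" if "t \<in> {0..T}" "A \<subseteq> {0..T}" for z t A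
  proof -
    have "continuous_on {0..} (\<lambda>s. inner (S s (B z)) v)" by (intro continuous_intros c0_semigroup_continuous[OF S])
    then have "((\<lambda>s. inner (S s (B z)) v) \<longlongrightarrow> inner (S t (B z)) v) (at t within {0..})"
      using that by (auto simp: continuous_on_def)
    then show ?thesis unfolding inner_g by (rule tendsto_within_subset) (use that in auto)
  qed
  have lim: "(g v \<longlongrightarrow> g v t) (at t within A)"
    if l: "(g v \<longlongrightarrow> l) (at t within A)" and "t \<in> {0..T}" "A \<subseteq> {0..T}" "at t within A \<noteq> bot" for t A l
  proof -
    have "l = g v t"
    proof (rule inner_eqI)
      fix z
      have "((\<lambda>s. inner z (g v s)) \<longlongrightarrow> inner z l) (at t within A)" by (intro tendsto_intros l)
      then show "inner z l = inner z (g v t)" using weak[OF that(2,3)] that(4) tendsto_unique by blast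
    qed
    then show ?thesis using l by simp
  qed
  show ?thesis
    unfolding continuous_on_iff
  proof (intro ballI allI impI)
    fix t e :: real assume t: "t \<in> {0..T}" and e: "0 < e"
    have "\<exists>d>0. \<forall>s\<in>{t<..T}. dist s t < d \<longrightarrow> dist (g v s) (g v t) < e"
    proof (cases "t < T")
      case True
      then obtain l where "(g v \<longlongrightarrow> l) (at t within {t<..T})"
        using reg t unfolding regulated_def by (metis atLeastAtMost_iff atLeastLessThan_iff)
      moreover have "at t within {t<..T} \<noteq> bot" 
        unfolding trivial_limit_within islimpt_approachable_real not_not
      proof (intro allI impI)
        fix e :: real assume "0 < e"
        then show "\<exists>x'\<in>{t<..T}. x' \<noteq> t \<and> \<bar>x' - t\<bar> < e"
          using True by (intro bexI[of _ "t + min (e / 2) (T - t)"]) auto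
      qed
      ultimately have "(g v \<longlongrightarrow> g v t) (at t within {t<..T})" using t by (intro lim) auto
      then have "eventually (\<lambda>s. dist (g v s) (g v t) < e) (at t within {t<..T})" using e by (rule tendstoD)
      then show ?thesis unfolding eventually_at by fastforce
    next
      case False then show ?thesis by (intro exI[of _ 1]) auto
    qed
    then obtain d1 where d1: "d1 > 0" "\<And>s. s \<in> {t<..T} \<Longrightarrow> dist s t < d1 \<Longrightarrow> dist (g v s) (g v t) < e" by blast
    have "\<exists>d>0. \<forall>s\<in>{0..<t}. dist s t < d \<longrightarrow> dist (g v s) (g v t) < e"
    proof (cases "0 < t")
      case True
      then obtain l where "(g v \<longlongrightarrow> l) (at t within {0..<t})"
        using reg t unfolding regulated_def by (metis atLeastAtMost_iff greaterThanAtMost_iff)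
      moreover have "at t within {0..<t} \<noteq> bot" 
        unfolding trivial_limit_within islimpt_approachable_real not_not
      proof (intro allI impI)
        fix e :: real assume "0 < e"
        then show "\<exists>x'\<in>{0..<t}. x' \<noteq> t \<and> \<bar>x' - t\<bar> < e"
          using True by (intro bexI[of _ "t - min (e / 2) t"]) auto
      qed
      ultimately have "(g v \<longlongrightarrow> g v t) (at t within {0..<t})" using t by (intro lim) auto
      then have "eventually (\<lambda>s. dist (g v s) (g v t) < e) (at t within {0..<t})" using e by (rule tendstoD)
      then show ?thesis unfolding eventually_at by fastforce
    next
      case False then show ?thesis by (intro exI[of _ 1]) auto
    qed
    then obtain d2 where d2: "d2 > 0" "\<And>s. s \<in> {0..<t} \<Longrightarrow> dist s t < d2 \<Longrightarrow> dist (g v s) (g v t) < e" by blast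
    have "dist (g v s) (g v t) < e" if "s \<in> {0..T}" "dist s t < min d1 d2" for s
    proof (cases s t rule: linorder_cases)
      case less then show ?thesis using d2(2)[of s] that by simp
    next
      case equal then show ?thesis using e by simp
    next
      case greater then show ?thesis using d1(2)[of s] that by simp
    qed
    then show "\<exists>d>0. \<forall>s\<in>{0..T}. dist s t < d \<longrightarrow> dist (g v s) (g v t) < e"
      using d1 d2 by (intro exI[of _ "min d1 d2"]) auto
  qed
qed

lemma g_uniform:
  assumes "0 < e"
  shows "\<exists>d>0. \<forall>r\<in>{0..T}. \<forall>r'\<in>{0..T}. \<bar>r - r'\<bar> < d \<longrightarrow> norm (g v r - g v r') < e"
proof -
  have "uniformly_continuous_on {0..T} (g v)" by (rule compact_uniformly_continuous[OF g_continuous]) simp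
  then show ?thesis using assms unfolding uniformly_continuous_on_def dist_norm by (metis real_norm_def)
qed

lemma grid_point_bounds:
  assumes "0 \<le> t" "j \<le> Suc n"
  shows "0 \<le> t * real j / real (Suc n)" "t * real j / real (Suc n) \<le> t"
proof -
  have "t * real j / real (Suc n) \<le> t * 1"
    unfolding times_divide_eq_right[symmetric] using assms by (intro mult_left_mono) auto
  then show "t * real j / real (Suc n) \<le> t" by simp
qed (use assms in simp)

lemma grid_cell_width: "t * real (Suc j) / real (Suc n) - t * real j / real (Suc n) = t / real (Suc n)"
  unfolding diff_divide_distrib[symmetric] right_diff_distrib[symmetric] by simp

lemma grid_mesh_small:
  assumes "0 < d"
  shows "\<exists>N. \<forall>n\<ge>N. t / real (Suc n) < d"
proof -
  obtain N where N: "t / d < real N" using reals_Archimedean2 by blast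
  have "t / real (Suc n) < d" if "n \<ge> N" for n
  proof -
    have "t / d < real (Suc n)" using N that by linarith
    then show ?thesis using assms by (simp add: field_simps)
  qed
  then show ?thesis by blast
qed

text \<open>The kernel is sampled at the left end of each cell, which keeps the argument of
  \<open>g v\<close> positive, and the tolerance 1/(n+1) leaves room to replace a sample by a nearby
  vector that carries a random measure. The guard 0 < t excludes the only case without positive
  arguments.\<close>

lemma kf_step_unif:
  assumes t: "0 \<le> t" "t \<le> T"
    and u: "\<And>n j. 0 < t \<Longrightarrow> j < Suc n \<Longrightarrow> norm (g v (t - t * real j / real (Suc n)) - u n j) < inverse (real (Suc n))"
  shows "step_unif T (grid t u) (kf t v)"
proof (rule step_unif_grid[OF t])
  show "kf t v s = 0" if "t < s" for s using that by (simp add: kf_def)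
  fix e :: real assume e: "e > 0"
  obtain d where d: "d > 0" "\<And>r r'. r \<in> {0..T} \<Longrightarrow> r' \<in> {0..T} \<Longrightarrow> \<bar>r - r'\<bar> < d \<Longrightarrow> norm (g v r - g v r') < e / 2"
    using g_uniform[of "e / 2" v] e by auto
  obtain N1 where N1: "\<And>n. n \<ge> N1 \<Longrightarrow> t / real (Suc n) < d" using grid_mesh_small[OF d(1)] by blast
  obtain N2 where N2: "\<And>n. n \<ge> N2 \<Longrightarrow> 1 / real (Suc n) < e / 2" using grid_mesh_small[of "e / 2" 1] e by auto
  have "norm (kf t v s - u n j) < e"
    if n: "n \<ge> max N1 N2" and j: "j < Suc n" and s: "s \<in> {t * real j / real (Suc n)<..t * real (Suc j) / real (Suc n)}" for n j s
  proof -
    let ?a = "t * real j / real (Suc n)"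
    have a: "0 \<le> ?a" "?a \<le> t" using grid_point_bounds[OF t(1), of j n] j by auto
    have st: "?a < s" "s \<le> t" using s grid_point_bounds[OF t(1), of "Suc j" n] j by (auto simp del: of_nat_Suc)
    have t0: "0 < t" using a st by linarith
    have "s - ?a \<le> t / real (Suc n)" using s grid_cell_width[of t j n] by (auto simp del: of_nat_Suc)
    then have "\<bar>(t - s) - (t - ?a)\<bar> < d" using N1[of n] n st by (simp del: of_nat_Suc)
    moreover have "t - s \<in> {0..T}" "t - ?a \<in> {0..T}"
      unfolding atLeastAtMost_iff using a st t by linarith+
    ultimately have "norm (g v (t - s) - g v (t - ?a)) < e / 2" by (intro d(2))
    moreover have "norm (g v (t - ?a) - u n j) < e / 2"
      using u[OF t0 j] N2[of n] n by (simp add: inverse_eq_divide del: of_nat_Suc)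
    ultimately have "norm ((g v (t - s) - g v (t - ?a)) + (g v (t - ?a) - u n j)) < e"
      using norm_triangle_ineq[of "g v (t - s) - g v (t - ?a)" "g v (t - ?a) - u n j"] by linarith
    then show ?thesis using st by (simp add: kf_def)
  qed
  then show "\<exists>N. \<forall>n\<ge>N. \<forall>j<Suc n. \<forall>s\<in>{t * real j / real (Suc n)<..t * real (Suc j) / real (Suc n)}. norm (kf t v s - u n j) < e"
    by blast
qed

text \<open>Here the right ends are sampled, so that reversing the order of the cells carries these
  values into those of the convolution kernel.\<close>

lemma forward_step_unif:
  assumes t: "0 \<le> t" "t \<le> T"
  shows "step_unif T (grid t (\<lambda>n j. g v (t * real (Suc j) / real (Suc n)))) (\<lambda>s. indicator {0..t} s *\<^sub>R g v s)"
proof (rule step_unif_grid[OF t])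
  show "indicator {0..t} s *\<^sub>R g v s = 0" if "t < s" for s using that by simp
  fix e :: real assume e: "e > 0"
  obtain d where d: "d > 0" "\<And>r r'. r \<in> {0..T} \<Longrightarrow> r' \<in> {0..T} \<Longrightarrow> \<bar>r - r'\<bar> < d \<Longrightarrow> norm (g v r - g v r') < e"
    using g_uniform[OF e, of v] by auto
  obtain N1 where N1: "\<And>n. n \<ge> N1 \<Longrightarrow> t / real (Suc n) < d" using grid_mesh_small[OF d(1)] by blast
  have "norm (indicator {0..t} s *\<^sub>R g v s - g v (t * real (Suc j) / real (Suc n))) < e"
    if n: "n \<ge> N1" and j: "j < Suc n" and s: "s \<in> {t * real j / real (Suc n)<..t * real (Suc j) / real (Suc n)}" for n j s
  proof -
    let ?a = "t * real j / real (Suc n)" and ?b = "t * real (Suc j) / real (Suc n)"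
    have a: "0 \<le> ?a" "?b \<le> t" using grid_point_bounds[OF t(1), of j n] grid_point_bounds[OF t(1), of "Suc j" n] j by (auto simp del: of_nat_Suc)
    have st: "?a < s" "s \<le> ?b" using s by (auto simp del: of_nat_Suc)
    have "\<bar>s - ?b\<bar> < d" using N1[OF n] st grid_cell_width[of t j n] by linarith
    moreover have sm: "s \<in> {0..T}" "?b \<in> {0..T}" "s \<in> {0..t}"
      unfolding atLeastAtMost_iff using a st t by linarith+
    ultimately have "norm (g v s - g v ?b) < e" by (intro d(2))
    moreover note sm(3)
    ultimately show ?thesis by simp
  qed
  then show "\<exists>N. \<forall>n\<ge>N. \<forall>j<Suc n. \<forall>s\<in>{t * real j / real (Suc n)<..t * real (Suc j) / real (Suc n)}.
      norm (indicator {0..t} s *\<^sub>R g v s - g v (t * real (Suc j) / real (Suc n))) < e" by blast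
qed

lemma kf_grid: "0 \<le> t \<Longrightarrow> t \<le> T \<Longrightarrow> step_unif T (grid t (\<lambda>n j. g v (t - t * real j / real (Suc n)))) (kf t v)"
  by (rule kf_step_unif) auto

lemma isint_kf_exists: "0 \<le> t \<Longrightarrow> t \<le> T \<Longrightarrow> \<exists>X. isint T (kf t v) X"
  using isint_exists[OF T kf_grid] by blast

lemma adj_indicator: "adj (indicator {0..t} s *\<^sub>R (S (t - s) o\<^sub>L B)) v = indicator {0..t} s *\<^sub>R g v (t - s)"
  by (simp add: adj_scaleR g_def)

text \<open>The exact samples may fail to carry random measures. Within 1/(n+1) of each there is a
  vector that does, by approximability at positive arguments, and the perturbed grid still converges
  uniformly.\<close>

lemma cyl_int_kf:
  assumes t: "0 \<le> t" "t \<le> T" and int: "isint T (kf t v) X"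
  shows "cyl_int M L T (\<lambda>s. adj (indicator {0..t} s *\<^sub>R (S (t - s) o\<^sub>L B)) v) {0..t} X"
proof -
  have "\<forall>n j. \<exists>u\<in>has_random_measure T. 0 < t \<longrightarrow> j < Suc n \<longrightarrow> norm (g v (t - t * real j / real (Suc n)) - u) < inverse (real (Suc n))"
  proof (intro allI)
    fix n j
    show "\<exists>u\<in>has_random_measure T. 0 < t \<longrightarrow> j < Suc n \<longrightarrow> norm (g v (t - t * real j / real (Suc n)) - u) < inverse (real (Suc n))"
    proof (cases "0 < t \<and> j < Suc n")
      case True
      obtain I where "stoch_int_set M L T (\<lambda>s. S s o\<^sub>L B) {0..T} I"
        using stoch_int unfolding stoch_integrable_def by (metis atLeastAtMost_borel order_refl)
      then have ci: "cyl_int M L T (g v) {0..T} (\<lambda>\<omega>. inner (I \<omega>) v)"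
        unfolding stoch_int_set_def g_def by blast
      have "t * real j / real (Suc n) < t * 1"
        unfolding times_divide_eq_right[symmetric] using True by (intro mult_strict_left_mono) auto
      then have "t - t * real j / real (Suc n) \<in> {0<..T}"
        using t grid_point_bounds(1)[OF t(1), of j n] True unfolding greaterThanAtMost_iff by linarith
      from cyl_int_approximable[OF ci this, of "inverse (real (Suc n))"] show ?thesis by auto
    next
      case False then show ?thesis using zero_has_random_measure by blast
    qed
  qed
  then obtain u where u: "\<And>n j. u n j \<in> has_random_measure T"
    "\<And>n j. 0 < t \<Longrightarrow> j < Suc n \<Longrightarrow> norm (g v (t - t * real j / real (Suc n)) - u n j) < inverse (real (Suc n))" by metis
  have eq: "kf t v s = adj (indicator {0..t} s *\<^sub>R (S (t - s) o\<^sub>L B)) v" if "s \<in> {0<..T}" for s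
    using that by (simp add: adj_indicator kf_def)
  show ?thesis
  proof (rule cyl_int_grid[OF t u(1)])
    show "step_unif T (grid t u) (\<lambda>s. adj (indicator {0..t} s *\<^sub>R (S (t - s) o\<^sub>L B)) v)"
      by (rule step_unif_cong[OF kf_step_unif[OF t u(2)] eq])
    show "isint T (\<lambda>s. adj (indicator {0..t} s *\<^sub>R (S (t - s) o\<^sub>L B)) v) X"
      by (rule isint_cong[OF int eq]) (use isint_measurable[OF int] in auto)
  qed
qed

text \<open>On an equidistant grid the factors depend on the step values only, so their product is
  insensitive to the order of the cells.\<close>

lemma cf_sI_grid:
  assumes t: "0 \<le> t"
  shows "cf (sI (grid t u n)) = (\<Prod>j<Suc n. \<phi> (u n j) (t / real (Suc n)))"
proof -
  let ?p = "\<lambda>j. t * real j / real (Suc n)"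
  have "sI (grid t u n) = (\<lambda>\<omega>. \<Sum>j<Suc n. L (?p (Suc j)) (u n j) \<omega> - L (?p j) (u n j) \<omega>)"
    unfolding grid_def sI_def fun_eq_iff
    by (simp add: comp_def interv_sum_list_conv_sum_set_nat atLeast0LessThan del: upt_Suc sum.lessThan_Suc)
  then have "cf (sI (grid t u n)) = (\<Prod>j<Suc n. \<phi> (u n j) (?p (Suc j) - ?p j))"
    using cf_increments[of ?p "Suc n" "u n"] t by (simp add: divide_right_mono mult_left_mono del: prod.lessThan_Suc sum.lessThan_Suc of_nat_Suc)
  then show ?thesis unfolding grid_cell_width .
qed

text \<open>Time reversal: since the increments of \<open>L\<close> are independent and stationary, the convolution
  integral and the forward integral have the same law.\<close>

lemma cf_time_reversal:
  assumes t: "0 \<le> t" "t \<le> T" and X: "isint T (kf t v) X" and Y: "isint T (\<lambda>s. indicator {0..t} s *\<^sub>R g v s) Y"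
  shows "cf X = cf Y"
proof -
  let ?u = "\<lambda>n j. g v (t - t * real j / real (Suc n))" and ?w = "\<lambda>n j. g v (t * real (Suc j) / real (Suc n))"
  have 1: "(\<lambda>n. cf (sI (grid t ?u n))) \<longlonglongrightarrow> cf X"
    using isint_measurable[OF X] by (intro cf_tendsto isint_conv[OF T X] kf_grid t) auto
  have 2: "(\<lambda>n. cf (sI (grid t ?w n))) \<longlonglongrightarrow> cf Y"
    using isint_measurable[OF Y] by (intro cf_tendsto isint_conv[OF T Y] forward_step_unif t) auto
  have "cf (sI (grid t ?u n)) = cf (sI (grid t ?w n))" for n
  proof -
    \<comment> \<open>Cell j of the convolution carries the value of cell n - j of the forward
      integrand.\<close>
    have "?u n j = ?w n (Suc n - Suc j)" if "j < Suc n" for j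
    proof -
      have "Suc (Suc n - Suc j) = Suc n - j" using that by simp
      moreover have "real (Suc n - j) = real (Suc n) - real j" using that by (subst of_nat_diff) auto
      ultimately have "t * real (Suc (Suc n - Suc j)) / real (Suc n) = (t * real (Suc n) - t * real j) / real (Suc n)"
        by (simp only: right_diff_distrib)
      also have "\<dots> = t - t * real j / real (Suc n)" by (simp add: diff_divide_distrib)
      finally show ?thesis by simp
    qed
    then have "(\<Prod>j<Suc n. \<phi> (?u n j) (t / real (Suc n))) = (\<Prod>j<Suc n. \<phi> (?w n (Suc n - Suc j)) (t / real (Suc n)))"
      by (intro prod.cong) auto
    also have "\<dots> = (\<Prod>j<Suc n. \<phi> (?w n j) (t / real (Suc n)))"
      by (rule prod.nat_diff_reindex[of "\<lambda>j. \<phi> (?w n j) (t / real (Suc n))"])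
    finally show ?thesis unfolding cf_sI_grid[OF t(1)] .
  qed
  then show ?thesis using 1 2 LIMSEQ_unique by simp
qed

section \<open>The convolution as a random variable in V\<close>

lemma forward_integral:
  assumes t: "0 \<le> t" "t \<le> T"
  shows "\<exists>J. J \<in> borel_measurable M \<and> (\<forall>v. isint T (\<lambda>s. indicator {0..t} s *\<^sub>R g v s) (\<lambda>\<omega>. inner (J \<omega>) v))"
proof -
  have "{0..t} \<in> sets borel \<and> {0..t} \<subseteq> {0..T}" using t by auto
  then obtain J where J: "stoch_int_set M L T (\<lambda>s. S s o\<^sub>L B) {0..t} J"
    using stoch_int unfolding stoch_integrable_def by blast
  have "isint T (\<lambda>s. indicator {0..t} s *\<^sub>R g v s) (\<lambda>\<omega>. inner (J \<omega>) v)" for v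
    using J t unfolding stoch_int_set_def g_def by (intro cyl_int_isint) auto
  then show ?thesis using J unfolding stoch_int_set_def by blast
qed

lemma isint_kf_scale: "isint T (kf t v) X \<Longrightarrow> isint T (kf t (x *\<^sub>R v)) (\<lambda>\<omega>. x * X \<omega>)"
proof -
  assume X: "isint T (kf t v) X"
  have "kf t (x *\<^sub>R v) = (\<lambda>s. x *\<^sub>R kf t v s)" using kf_linear[of t x v 0 v] by (simp add: fun_eq_iff)
  then show ?thesis using isint_linear[OF X X, of x 0] by simp
qed

lemma isint_kf_sum:
  assumes "finite F" "\<And>k. k \<in> F \<Longrightarrow> isint T (kf t (e k)) (X k)"
  shows "isint T (kf t (\<Sum>k\<in>F. c k *\<^sub>R e k)) (\<lambda>\<omega>. \<Sum>k\<in>F. c k * X k \<omega>)"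
proof -
  have "kf t (\<Sum>k\<in>F. c k *\<^sub>R e k) s = (\<Sum>k\<in>F. c k *\<^sub>R kf t (e k) s)" for s
    using assms(1)
  proof (induction F)
    case empty then show ?case using kf_linear[of t 0 0 0 0 s] by simp
  next
    case (insert k F) then show ?case using kf_linear[of t "c k" "e k" 1 "\<Sum>k\<in>F. c k *\<^sub>R e k" s] by simp
  qed
  then have eq: "kf t (\<Sum>k\<in>F. c k *\<^sub>R e k) = (\<lambda>s. \<Sum>k\<in>F. c k *\<^sub>R kf t (e k) s)" by (simp add: fun_eq_iff)
  show ?thesis unfolding eq by (rule isint_sum[OF assms T])
qed

text \<open>All arguments x of the characteristic function are covered by scaling v, and Levy's
  uniqueness theorem does the rest. For signed sums of coordinates only the test vector
  changes.\<close>

lemma law_time_reversal: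
  assumes t: "0 \<le> t" "t \<le> T" and X: "isint T (kf t v) X"
    and J [measurable]: "J \<in> borel_measurable M" and Ji: "\<And>v. isint T (\<lambda>s. indicator {0..t} s *\<^sub>R g v s) (\<lambda>\<omega>. inner (J \<omega>) v)"
  shows "distr M borel X = distr M borel (\<lambda>\<omega>. inner (J \<omega>) v)"
proof (rule Levy_uniqueness)
  have Xm [measurable]: "X \<in> borel_measurable M" by (rule isint_measurable[OF X])
  show "real_distribution (distr M borel X)" "real_distribution (distr M borel (\<lambda>\<omega>. inner (J \<omega>) v))"
    by (auto intro!: real_distribution_distr)
  show "char (distr M borel X) = char (distr M borel (\<lambda>\<omega>. inner (J \<omega>) v))"
  proof
    fix x
    have "cf (\<lambda>\<omega>. x * X \<omega>) = cf (\<lambda>\<omega>. inner (J \<omega>) (x *\<^sub>R v))"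
      by (rule cf_time_reversal[OF t isint_kf_scale[OF X] Ji])
    then show "char (distr M borel X) x = char (distr M borel (\<lambda>\<omega>. inner (J \<omega>) v)) x"
      by (simp add: char_distr_cf)
  qed
qed

lemma norm_tail_small:
  fixes J :: "'w \<Rightarrow> 'v"
  assumes [measurable]: "J \<in> borel_measurable M" and "\<eta> > 0"
  shows "\<exists>R>0. prob {\<omega> \<in> space M. R < norm (J \<omega>)} \<le> \<eta>"
proof -
  let ?A = "\<lambda>n. {\<omega> \<in> space M. real n < norm (J \<omega>)}"
  have "(\<lambda>n. prob (?A n)) \<longlonglongrightarrow> prob (\<Inter>n. ?A n)"
    by (rule finite_Lim_measure_decseq) (auto simp: decseq_def)
  moreover have "(\<Inter>n. ?A n) = {}"
  proof -
    have "\<exists>n. \<not> real n < norm (J \<omega>)" for \<omega> using reals_Archimedean2[of "norm (J \<omega>)"] by (meson less_asym)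
    then show ?thesis by blast
  qed
  ultimately have "(\<lambda>n. prob (?A n)) \<longlonglongrightarrow> 0" by simp
  then have "eventually (\<lambda>n. prob (?A n) < \<eta>) sequentially" using assms(2) by (rule order_tendstoD)
  then obtain N where "\<And>n. n \<ge> N \<Longrightarrow> prob (?A n) < \<eta>" by (auto simp: eventually_sequentially)
  from this[of "Suc N"] show ?thesis by (intro exI[of _ "real (Suc N)"]) auto
qed

text \<open>The factor 16/3 inverts the fraction 3/16 of good signs. Each signed sum has the law of
  the pairing of J with a signed sum of the e k; where norm J \<le> K, the mean square of these
  pairings over the signs is at most K^2 by Bessel, and Chebyshev at level R/2 gives 4 K^2 /
  R^2.\<close>

lemma prob_coords_le:
  assumes t: "0 \<le> t" "t \<le> T" and e: "onsys e" and Z: "\<And>k. isint T (kf t (e k)) (Z k)"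
    and J [measurable]: "J \<in> borel_measurable M" and Ji: "\<And>v. isint T (\<lambda>s. indicator {0..t} s *\<^sub>R g v s) (\<lambda>\<omega>. inner (J \<omega>) v)"
    and R: "0 < R" "0 < K"
  shows "prob {\<omega> \<in> space M. R\<^sup>2 < (\<Sum>k<m. (Z k \<omega>)\<^sup>2)} \<le> 16 / 3 * (prob {\<omega> \<in> space M. K < norm (J \<omega>)} + 4 * K\<^sup>2 / R\<^sup>2)"
proof -
  have Zm [measurable]: "Z k \<in> borel_measurable M" for k by (rule isint_measurable[OF Z])
  let ?A = "{\<omega> \<in> space M. K < norm (J \<omega>)}"
  let ?y = "\<lambda>S \<omega>. \<Sum>k<m. rsign S k *\<^sub>R inner (J \<omega>) (e k)"
  have law: "prob {\<omega> \<in> space M. R / 2 \<le> \<bar>\<Sum>k<m. rsign S k *\<^sub>R Z k \<omega>\<bar>} = prob {\<omega> \<in> space M. R / 2 \<le> \<bar>?y S \<omega>\<bar>}" for S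
  proof -
    have "isint T (kf t (\<Sum>k<m. rsign S k *\<^sub>R e k)) (\<lambda>\<omega>. \<Sum>k<m. rsign S k * Z k \<omega>)"
      by (intro isint_kf_sum Z) simp
    from law_time_reversal[OF t this J Ji]
    have eq: "distr M borel (\<lambda>\<omega>. \<Sum>k<m. rsign S k * Z k \<omega>) = distr M borel (\<lambda>\<omega>. inner (J \<omega>) (\<Sum>k<m. rsign S k *\<^sub>R e k))" .
    have "prob {\<omega> \<in> space M. R / 2 \<le> \<bar>X \<omega>\<bar>} = measure (distr M borel X) {x. R / 2 \<le> \<bar>x\<bar>}" if [measurable]: "X \<in> borel_measurable M" for X
      by (subst measure_distr) (auto intro!: arg_cong[where f = prob])
    from this[of "\<lambda>\<omega>. \<Sum>k<m. rsign S k * Z k \<omega>"] this[of "\<lambda>\<omega>. inner (J \<omega>) (\<Sum>k<m. rsign S k *\<^sub>R e k)"] eq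
    show ?thesis by (simp add: inner_sum_right)
  qed
  have pw: "(\<Sum>S\<in>Pow {..<m}. indicator {\<omega> \<in> space M. R / 2 \<le> \<bar>?y S \<omega>\<bar>} \<omega>) \<le> 2 ^ m * indicator ?A \<omega> + 2 ^ m * (4 * K\<^sup>2 / R\<^sup>2)"
    if \<omega>: "\<omega> \<in> space M" for \<omega>
  proof (cases "K < norm (J \<omega>)")
    case True
    have "(\<Sum>S\<in>Pow {..<m}. indicator {\<omega> \<in> space M. R / 2 \<le> \<bar>?y S \<omega>\<bar>} \<omega>) \<le> (\<Sum>S\<in>Pow {..<m}. 1 :: real)"
      by (intro sum_mono) (auto simp: indicator_def)
    also have "\<dots> = 2 ^ m" by (simp add: card_Pow)
    also have "\<dots> \<le> 2 ^ m * indicator ?A \<omega> + 2 ^ m * (4 * K\<^sup>2 / R\<^sup>2)" using True \<omega> by simp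
    finally show ?thesis .
  next
    case False
    have "(\<Sum>S\<in>Pow {..<m}. indicator {\<omega> \<in> space M. R / 2 \<le> \<bar>?y S \<omega>\<bar>} \<omega>) \<le> (\<Sum>S\<in>Pow {..<m}. 4 / R\<^sup>2 * (?y S \<omega>)\<^sup>2)"
    proof (rule sum_mono)
      fix S
      show "indicator {\<omega> \<in> space M. R / 2 \<le> \<bar>?y S \<omega>\<bar>} \<omega> \<le> 4 / R\<^sup>2 * (?y S \<omega>)\<^sup>2"
      proof (cases "R / 2 \<le> \<bar>?y S \<omega>\<bar>")
        case True
        then have "(R / 2)\<^sup>2 \<le> (?y S \<omega>)\<^sup>2" using R(1) by (simp add: abs_le_square_iff[symmetric])
        then have "1 \<le> 4 / R\<^sup>2 * (?y S \<omega>)\<^sup>2" using R(1) by (simp add: power_divide field_simps)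
        then show ?thesis using True \<omega> by simp
      qed simp
    qed
    also have "\<dots> = 4 / R\<^sup>2 * (2 ^ m * (\<Sum>k<m. (inner (J \<omega>) (e k))\<^sup>2))"
      unfolding sum_distrib_left[symmetric] using rsign_second_moment[where m = m and x = "\<lambda>k. inner (J \<omega>) (e k)"] by simp
    also have "\<dots> \<le> 4 / R\<^sup>2 * (2 ^ m * K\<^sup>2)"
    proof -
      have "(\<Sum>k<m. (inner (J \<omega>) (e k))\<^sup>2) \<le> (norm (J \<omega>))\<^sup>2" by (rule onsys_Bessel[OF e])
      also have "\<dots> \<le> K\<^sup>2" using False by (intro power_mono) auto
      finally show ?thesis by (intro mult_left_mono) auto
    qed
    also have "\<dots> = 2 ^ m * indicator ?A \<omega> + 2 ^ m * (4 * K\<^sup>2 / R\<^sup>2)" using False by simp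
    finally show ?thesis .
  qed
  have meas: "{\<omega> \<in> space M. R / 2 \<le> \<bar>?y S \<omega>\<bar>} \<in> events" for S by measurable
  have int: "integrable M (indicator A :: _ \<Rightarrow> real)" if "A \<in> events" for A
    using that by (intro integrable_real_indicator) (auto simp: less_top[symmetric])
  have Am: "?A \<in> events" by measurable
  have "(\<Sum>S\<in>Pow {..<m}. prob {\<omega> \<in> space M. R / 2 \<le> \<bar>?y S \<omega>\<bar>})
      = (\<Sum>S\<in>Pow {..<m}. expectation (indicator {\<omega> \<in> space M. R / 2 \<le> \<bar>?y S \<omega>\<bar>}))"
    using sets.sets_into_space[OF meas] by (intro sum.cong refl) (simp only: Bochner_Integration.integral_indicator Int_absorb2)
  also have "\<dots> = expectation (\<lambda>\<omega>. \<Sum>S\<in>Pow {..<m}. indicator {\<omega> \<in> space M. R / 2 \<le> \<bar>?y S \<omega>\<bar>} \<omega>)"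
    by (rule Bochner_Integration.integral_sum[symmetric]) (rule int[OF meas])
  also have "\<dots> \<le> expectation (\<lambda>\<omega>. 2 ^ m * indicator ?A \<omega> + 2 ^ m * (4 * K\<^sup>2 / R\<^sup>2))"
    by (intro integral_mono pw Bochner_Integration.integrable_sum Bochner_Integration.integrable_add
        integrable_mult_right int meas Am integrable_const)
  also have "\<dots> = 2 ^ m * prob ?A + 2 ^ m * (4 * K\<^sup>2 / R\<^sup>2)"
    using sets.sets_into_space[OF Am]
    by (subst Bochner_Integration.integral_add) (simp_all only: integrable_mult_right int Am integrable_const
        integral_mult_right_zero Bochner_Integration.integral_indicator Int_absorb2 lebesgue_integral_const prob_space scaleR_one)
  finally have 1: "(\<Sum>S\<in>Pow {..<m}. prob {\<omega> \<in> space M. R / 2 \<le> \<bar>?y S \<omega>\<bar>}) \<le> 2 ^ m * (prob ?A + 4 * K\<^sup>2 / R\<^sup>2)"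
    by (simp only: distrib_left)
  have "3 * 2 ^ m * prob {\<omega> \<in> space M. R\<^sup>2 < (\<Sum>k<m. (Z k \<omega>)\<^sup>2)}
      \<le> 16 * (\<Sum>S\<in>Pow {..<m}. prob {\<omega> \<in> space M. R / 2 \<le> \<bar>\<Sum>k<m. rsign S k *\<^sub>R Z k \<omega>\<bar>})"
    using R(1) by (intro prob_sum_squares_le) auto
  also have "\<dots> \<le> 16 * (2 ^ m * (prob ?A + 4 * K\<^sup>2 / R\<^sup>2))" unfolding law using 1 by (rule mult_left_mono) simp
  finally have "2 ^ m * (3 * prob {\<omega> \<in> space M. R\<^sup>2 < (\<Sum>k<m. (Z k \<omega>)\<^sup>2)}) \<le> 2 ^ m * (16 * (prob ?A + 4 * K\<^sup>2 / R\<^sup>2))"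
    by (simp only: mult.assoc mult.left_commute)
  then have "3 * prob {\<omega> \<in> space M. R\<^sup>2 < (\<Sum>k<m. (Z k \<omega>)\<^sup>2)} \<le> 16 * (prob ?A + 4 * K\<^sup>2 / R\<^sup>2)"
    by (subst (asm) mult_le_cancel_left_pos) auto
  then show ?thesis by linarith
qed

lemma AE_coords_bounded:
  assumes t: "0 \<le> t" "t \<le> T" and e: "onsys e" and Z: "\<And>k. isint T (kf t (e k)) (Z k)"
  shows "AE \<omega> in M. \<exists>R. \<forall>m. (\<Sum>k<m. (Z k \<omega>)\<^sup>2) \<le> R"
proof (rule AE_from_large_events)
  fix \<eta> :: real assume \<eta>: "\<eta> > 0"
  have Zm [measurable]: "Z k \<in> borel_measurable M" for k by (rule isint_measurable[OF Z])
  obtain J where J [measurable]: "J \<in> borel_measurable M" and Ji: "\<And>v. isint T (\<lambda>s. indicator {0..t} s *\<^sub>R g v s) (\<lambda>\<omega>. inner (J \<omega>) v)"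
    using forward_integral[OF t] by blast
  \<comment> \<open>3/32 is half of 3/16: the tail of J and the Chebyshev term each take half of
    \<eta>.\<close>
  obtain K where K: "K > 0" "prob {\<omega> \<in> space M. K < norm (J \<omega>)} \<le> \<eta> * (3/32)"
    using norm_tail_small[OF J, of "\<eta> * (3/32)"] \<eta> by auto
  define R where "R = sqrt (4 * K\<^sup>2 * 32 / (3 * \<eta>))"
  have R: "R > 0" "R\<^sup>2 = 4 * K\<^sup>2 * 32 / (3 * \<eta>)" using K \<eta> by (auto simp: R_def)
  let ?A = "\<lambda>m. {\<omega> \<in> space M. R\<^sup>2 < (\<Sum>k<m. (Z k \<omega>)\<^sup>2)}"
  have "prob (?A m) \<le> \<eta>" for m
  proof -
    have "prob (?A m) \<le> 16 / 3 * (prob {\<omega> \<in> space M. K < norm (J \<omega>)} + 4 * K\<^sup>2 / R\<^sup>2)"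
      by (rule prob_coords_le[OF t e Z J Ji R(1) K(1)])
    also have "4 * K\<^sup>2 / R\<^sup>2 = \<eta> * (3/32)" unfolding R(2) using K \<eta> by simp
    finally show ?thesis using K(2) by simp
  qed
  moreover have "(\<lambda>m. prob (?A m)) \<longlonglongrightarrow> prob (\<Union>m. ?A m)"
  proof (rule finite_Lim_measure_incseq)
    show "incseq ?A"
    proof (rule incseq_SucI)
      fix m show "?A m \<subseteq> ?A (Suc m)" by (auto intro: less_le_trans)
    qed
  qed auto
  ultimately have le: "prob (\<Union>m. ?A m) \<le> \<eta>" using LIMSEQ_le_const2[of "\<lambda>m. prob (?A m)"] by blast
  let ?E = "space M - (\<Union>m. ?A m)"
  have "space M - ?E = (\<Union>m. ?A m)" by auto
  moreover have "\<exists>R. \<forall>m. (\<Sum>k<m. (Z k \<omega>)\<^sup>2) \<le> R" if "\<omega> \<in> ?E" for \<omega>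
    using that by (intro exI[of _ "R\<^sup>2"]) (auto simp: not_less)
  moreover have "?E \<in> events" by measurable
  ultimately show "\<exists>E\<in>events. prob (space M - E) \<le> \<eta> \<and> (AE \<omega> in M. \<omega> \<in> E \<longrightarrow> (\<exists>R. \<forall>m. (\<Sum>k<m. (Z k \<omega>)\<^sup>2) \<le> R))"
    using le by (intro bexI[of _ ?E]) auto
qed

lemma kf_norm_le:
  assumes "\<And>r v. r \<in> {0..T} \<Longrightarrow> norm (g v r) \<le> K * norm v" "K > 0" "t \<le> T" "0 < s"
  shows "norm (kf t v s) \<le> K * norm v"
  using assms(1)[of "t - s" v] assms by (auto simp: kf_def)

text \<open>By linearity and the bound of \<open>g\<close> the kernels converge uniformly, and the
  integral is continuous for the sup norm.\<close>

lemma isint_kf_conv: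
  assumes t: "0 \<le> t" "t \<le> T" and v: "vs \<longlonglongrightarrow> v" and X: "\<And>n. isint T (kf t (vs n)) (X n)" and Y: "isint T (kf t v) Y"
  shows "conv_in_prob M X Y"
proof (rule conv_in_probI)
  fix e :: real assume e: "e > 0"
  obtain d where d: "d > 0" "\<forall>G X. isint T G X \<longrightarrow> (\<forall>s\<in>{0<..T}. norm (G s) \<le> d) \<longrightarrow> ptail X e \<le> e"
    using isint_small[OF T e] by blast
  obtain K where K: "K > 0" "\<And>r v. r \<in> {0..T} \<Longrightarrow> norm (g v r) \<le> K * norm v" using g_bound by blast
  obtain N where N: "\<And>n. n \<ge> N \<Longrightarrow> norm (vs n - v) < d / K"
    using LIMSEQ_D[OF v, of "d / K"] d K by auto
  have "ptail (\<lambda>\<omega>. X n \<omega> - Y \<omega>) e \<le> e" if "n \<ge> N" for n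
  proof -
    have i: "isint T (\<lambda>s. 1 *\<^sub>R kf t (vs n) s + (-1) *\<^sub>R kf t v s) (\<lambda>\<omega>. 1 * X n \<omega> + (-1) * Y \<omega>)"
      by (intro isint_linear X Y)
    have "norm (1 *\<^sub>R kf t (vs n) s + (-1) *\<^sub>R kf t v s) \<le> d" if s: "s \<in> {0<..T}" for s
    proof -
      have "1 *\<^sub>R kf t (vs n) s + (-1) *\<^sub>R kf t v s = kf t (vs n - v) s"
        using kf_linear[of t 1 "vs n" "-1" v s] by simp
      moreover have "norm (kf t (vs n - v) s) \<le> K * norm (vs n - v)"
        using s t by (intro kf_norm_le K) auto
      moreover have "K * norm (vs n - v) \<le> d" using N[OF \<open>n \<ge> N\<close>] K(1) by (simp add: field_simps)
      ultimately show ?thesis by simp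
    qed
    then have "ptail (\<lambda>\<omega>. 1 * X n \<omega> + (-1) * Y \<omega>) e \<le> e" using d(2) i by blast
    then show ?thesis by simp
  qed
  then show "\<exists>N. \<forall>n\<ge>N. ptail (\<lambda>\<omega>. X n \<omega> - Y \<omega>) e \<le> e" by blast
qed (use isint_measurable[OF X] isint_measurable[OF Y] in auto)

text \<open>The coordinate series converges almost surely because the square sum of its coefficients
  is bounded. The pairing with v and the integral of the kernel for v are limits in probability of
  the same finite sums, so they agree.\<close>

lemma convolution_integral_exists:
  assumes t: "0 \<le> t" "t \<le> T"
  shows "\<exists>I. I \<in> borel_measurable M \<and> (\<forall>v. isint T (kf t v) (\<lambda>\<omega>. inner (I \<omega>) v))"
proof -
  obtain e :: "nat \<Rightarrow> 'v" where e: "onbasis e" using onbasis_exists by blast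
  then have ons: "onsys e" by (simp add: onbasis_def)
  have "\<forall>k. \<exists>X. isint T (kf t (e k)) X" using isint_kf_exists[OF t] by blast
  then obtain Z where Z: "\<And>k. isint T (kf t (e k)) (Z k)" by metis
  have Zm [measurable]: "Z k \<in> borel_measurable M" for k by (rule isint_measurable[OF Z])
  let ?P = "\<lambda>n \<omega>. \<Sum>k<n. Z k \<omega> *\<^sub>R e k"
  define I where "I \<omega> = (if Cauchy (\<lambda>n. ?P n \<omega>) then lim (\<lambda>n. ?P n \<omega>) else 0)" for \<omega>
  have Im [measurable]: "I \<in> borel_measurable M"
    unfolding I_def by (rule borel_measurable_Cauchy_lim) measurable
  have lim: "AE \<omega> in M. (\<lambda>n. ?P n \<omega>) \<longlonglongrightarrow> I \<omega>"
    using AE_coords_bounded[OF t ons Z]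
  proof eventually_elim
    case (elim \<omega>)
    then obtain R where "\<And>m. (\<Sum>k<m. (Z k \<omega>)\<^sup>2) \<le> R" by blast
    then have "convergent (\<lambda>n. ?P n \<omega>)" by (rule onsys_convergent[OF ons])
    then show ?case unfolding I_def using convergent_Cauchy convergent_LIMSEQ_iff by fastforce
  qed
  have "isint T (kf t v) (\<lambda>\<omega>. inner (I \<omega>) v)" for v
  proof -
    obtain X where X: "isint T (kf t v) X" using isint_kf_exists[OF t] by blast
    have "conv_in_prob M (\<lambda>n \<omega>. \<Sum>k<n. inner v (e k) * Z k \<omega>) X"
    proof (rule isint_kf_conv[OF t _ _ X])
      show "(\<lambda>n. \<Sum>k<n. inner v (e k) *\<^sub>R e k) \<longlonglongrightarrow> v" using e by (simp add: onbasis_def)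
      show "isint T (kf t (\<Sum>k<n. inner v (e k) *\<^sub>R e k)) (\<lambda>\<omega>. \<Sum>k<n. inner v (e k) * Z k \<omega>)" for n
        by (intro isint_kf_sum Z) simp
    qed
    moreover have "conv_in_prob M (\<lambda>n \<omega>. \<Sum>k<n. inner v (e k) * Z k \<omega>) (\<lambda>\<omega>. inner (I \<omega>) v)"
    proof (rule AE_tendsto_conv_in_prob)
      show "AE \<omega> in M. (\<lambda>n. \<Sum>k<n. inner v (e k) * Z k \<omega>) \<longlonglongrightarrow> inner (I \<omega>) v"
        using lim
      proof eventually_elim
        case (elim \<omega>)
        have "(\<lambda>n. inner (?P n \<omega>) v) \<longlonglongrightarrow> inner (I \<omega>) v" by (intro tendsto_intros elim)
        then show ?case by (simp add: inner_sum_left inner_commute[of v] mult.commute)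
      qed
    qed auto
    ultimately have "AE \<omega> in M. X \<omega> = inner (I \<omega>) v"
      by (rule conv_in_prob_unique) (use isint_measurable[OF X] in auto)
    then show ?thesis by (intro isint_cong[OF X]) auto
  qed
  then show ?thesis using Im by blast
qed

lemma stoch_int_set_convolution:
  assumes t: "0 \<le> t" "t \<le> T" and I: "I \<in> borel_measurable M" "\<And>v. isint T (kf t v) (\<lambda>\<omega>. inner (I \<omega>) v)"
  shows "stoch_int_set M L T (\<lambda>s. indicator {0..t} s *\<^sub>R (S (t - s) o\<^sub>L B)) {0..t} I"
  unfolding stoch_int_set_def using I by (auto intro!: cyl_int_kf[OF t])

text \<open>For each v the pairings agree almost surely; a countable basis collects the exceptional
  sets into one.\<close>

lemma stoch_int_set_convolution_unique:
  assumes t: "0 \<le> t" "t \<le> T" and I: "\<And>v. isint T (kf t v) (\<lambda>\<omega>. inner (I \<omega>) v)"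
    and I': "stoch_int_set M L T (\<lambda>s. indicator {0..t} s *\<^sub>R (S (t - s) o\<^sub>L B)) {0..t} I'"
  shows "AE \<omega> in M. I \<omega> = I' \<omega>"
proof -
  obtain e :: "nat \<Rightarrow> 'v" where e: "onbasis e" using onbasis_exists by blast
  have "AE \<omega> in M. inner (I \<omega>) v = inner (I' \<omega>) v" for v
  proof (rule isint_unique[OF T I])
    show "isint T (\<lambda>s. indicator {0..t} s *\<^sub>R adj (indicator {0..t} s *\<^sub>R (S (t - s) o\<^sub>L B)) v) (\<lambda>\<omega>. inner (I' \<omega>) v)"
      using I' t unfolding stoch_int_set_def by (intro cyl_int_isint) auto
    show "kf t v s = indicator {0..t} s *\<^sub>R adj (indicator {0..t} s *\<^sub>R (S (t - s) o\<^sub>L B)) v" if "s \<in> {0<..T}" for s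
      using that by (simp add: adj_indicator kf_def)
  qed
  then have "AE \<omega> in M. \<forall>k. inner (I \<omega>) (e k) = inner (I' \<omega>) (e k)" by (simp add: AE_all_countable)
  then show ?thesis by eventually_elim (rule onbasis_eqI[OF e], blast)
qed

end

section \<open>Progressively measurable modifications\<close>

text \<open>Uniform continuity in probability allows meshes d n with error 2^-n, so W at the time s
  rounded down to the mesh converges almost surely for each s, by Borel-Cantelli. Rounding down
  keeps the approximations adapted.\<close>

lemma (in prob_space) progressive_modification:
  fixes W :: "real \<Rightarrow> 'a \<Rightarrow> real" and F :: "real \<Rightarrow> 'a measure"
  assumes F: "\<And>t. space (F t) = space M" "\<And>t. sets (F t) \<subseteq> events"
      "\<And>s t. s \<le> t \<Longrightarrow> sets (F s) \<subseteq> sets (F t)"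
    and W: "\<And>t. t \<in> {0..T} \<Longrightarrow> W t \<in> borel_measurable (F t)"
    and cont: "\<And>e. e > 0 \<Longrightarrow> \<exists>d>0. \<forall>s\<in>{0..T}. \<forall>t\<in>{0..T}. \<bar>s - t\<bar> < d \<longrightarrow> ptail (\<lambda>\<omega>. W s \<omega> - W t \<omega>) e \<le> e"
  shows "\<exists>Y. (\<forall>t\<in>{0..T}. (\<lambda>(s, \<omega>). Y s \<omega>) \<in> borel_measurable (restrict_space borel {0..t} \<Otimes>\<^sub>M F t)) \<and>
    (\<forall>t\<in>{0..T}. AE \<omega> in M. Y t \<omega> = W t \<omega>)"
proof -
  have "\<forall>n. \<exists>d>0. \<forall>s\<in>{0..T}. \<forall>t\<in>{0..T}. \<bar>s - t\<bar> < d \<longrightarrow> ptail (\<lambda>\<omega>. W s \<omega> - W t \<omega>) ((1/2) ^ n) \<le> (1/2) ^ n"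
    using cont by simp
  then obtain d where d: "\<And>n. d n > (0::real)"
    "\<And>n s t. s \<in> {0..T} \<Longrightarrow> t \<in> {0..T} \<Longrightarrow> \<bar>s - t\<bar> < d n \<Longrightarrow> ptail (\<lambda>\<omega>. W s \<omega> - W t \<omega>) ((1/2) ^ n) \<le> (1/2) ^ n"
    by metis
  define q where "q n s = d n * of_int \<lfloor>s / d n\<rfloor>" for n s
  have q: "0 \<le> q n s" "q n s \<le> s" "\<bar>q n s - s\<bar> < d n" if "0 \<le> s" for n s
  proof -
    have fl: "of_int \<lfloor>s / d n\<rfloor> \<le> s / d n" "s / d n < of_int \<lfloor>s / d n\<rfloor> + 1" by linarith+
    show "0 \<le> q n s" unfolding q_def using that d(1)[of n] by (intro mult_nonneg_nonneg) auto
    have "d n * of_int \<lfloor>s / d n\<rfloor> \<le> d n * (s / d n)" using d(1)[of n] fl by (intro mult_left_mono) auto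
    then show 1: "q n s \<le> s" unfolding q_def using d(1)[of n] by simp
    have "d n * (s / d n) < d n * (of_int \<lfloor>s / d n\<rfloor> + 1)" using d(1)[of n] fl by (intro mult_strict_left_mono) auto
    then have "s < q n s + d n" unfolding q_def using d(1)[of n] by (simp add: algebra_simps)
    then show "\<bar>q n s - s\<bar> < d n" using 1 by simp
  qed
  have WM: "W t \<in> borel_measurable M" if "t \<in> {0..T}" for t
    using W[OF that] measurable_mono[of borel borel "F t" M] F by auto
  define Y where "Y s \<omega> = lim (\<lambda>n. W (q n s) \<omega>)" for s \<omega>
  have "AE \<omega> in M. Y t \<omega> = W t \<omega>" if t: "t \<in> {0..T}" for t
  proof -
    have qt: "q n t \<in> {0..T}" for n using q(1,2)[of t n] t by auto
    have "AE \<omega> in M. (\<lambda>n. W (q n t) \<omega>) \<longlonglongrightarrow> W t \<omega>"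
      by (rule AE_tendsto_fast) (use WM[OF qt] WM[OF t] d(2)[OF qt t] q(3)[of t] t in auto)
    then show ?thesis unfolding Y_def by eventually_elim (rule limI)
  qed
  moreover have "(\<lambda>(s, \<omega>). Y s \<omega>) \<in> borel_measurable (restrict_space borel {0..t} \<Otimes>\<^sub>M F t)" if t: "t \<in> {0..T}" for t
  proof -
    let ?N = "restrict_space borel {0..t} \<Otimes>\<^sub>M F t"
    have "(\<lambda>x. W (q n (fst x)) (snd x)) \<in> borel_measurable ?N" for n
    proof -
      \<comment> \<open>Only countably many mesh points occur, so joint measurability reduces to
        fixed times. Mesh points outside [0,t] receive the default 0; rounding down never produces
        them.\<close>
      define f where "f k x = (if d n * of_int k \<in> {0..t} then W (d n * of_int k) (snd x) else 0)" for k :: int and x :: "real \<times> 'a"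
      have fm: "f k \<in> borel_measurable ?N" for k
      proof (cases "d n * of_int k \<in> {0..t}")
        case True
        then have "W (d n * of_int k) \<in> borel_measurable (F (d n * of_int k))" using t by (intro W) auto
        then have "W (d n * of_int k) \<in> borel_measurable (F t)"
          using measurable_mono[of borel borel "F (d n * of_int k)" "F t"] F(3)[of "d n * of_int k" t] F(1) True by auto
        then have "(\<lambda>x. W (d n * of_int k) (snd x)) \<in> borel_measurable ?N" by (rule measurable_compose[OF measurable_snd])
        moreover have "f k = (\<lambda>x. W (d n * of_int k) (snd x))" using True by (simp add: f_def fun_eq_iff)
        ultimately show ?thesis by simp
      next
        case False
        then have "f k = (\<lambda>_. 0)" by (auto simp: f_def fun_eq_iff)
        then show ?thesis by simp
      qed
      have fl: "(\<lambda>x. \<lfloor>fst x / d n\<rfloor>) \<in> measurable ?N (count_space UNIV)"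
      proof -
        have "(\<lambda>s. \<lfloor>s / d n\<rfloor>) \<in> measurable (restrict_space borel {0..t}) (count_space UNIV)"
          by (intro measurable_restrict_space1) measurable
        from measurable_compose[OF measurable_fst this] show ?thesis .
      qed
      have "(\<lambda>x. f \<lfloor>fst x / d n\<rfloor> x) \<in> borel_measurable ?N"
        by (rule measurable_compose_countable[OF fm fl])
      moreover have "f \<lfloor>fst x / d n\<rfloor> x = W (q n (fst x)) (snd x)" if "x \<in> space ?N" for x
      proof -
        have "fst x \<in> {0..t}" using that by (auto simp: space_pair_measure space_restrict_space)
        then have "q n (fst x) \<in> {0..t}" using q(1,2)[of "fst x" n] by auto
        then show ?thesis by (simp add: f_def q_def)
      qed
      ultimately show ?thesis by (simp cong: measurable_cong)
    qed
    then have "(\<lambda>x. lim (\<lambda>n. W (q n (fst x)) (snd x))) \<in> borel_measurable ?N" by measurable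
    then show ?thesis by (simp add: Y_def case_prod_beta)
  qed
  ultimately show ?thesis by blast
qed

section \<open>The natural filtration\<close>

context cylindrical_levy
begin

lemma nat_filtration_gen:
  "{L s u -` C \<inter> space M | s u C. s \<in> {0..t} \<and> C \<in> sets borel} \<union> null_sets M \<subseteq> events"
  by (auto simp: measurable_sets[OF L_measurable] null_setsD2)

lemma space_nat_filtration: "space (nat_filtration M L t) = space M"
  unfolding nat_filtration_def
  by (rule space_measure_of) (use nat_filtration_gen sets.space_closed in blast)

lemma sets_nat_filtration: "sets (nat_filtration M L t) = sigma_sets (space M)
    ({L s u -` C \<inter> space M | s u C. s \<in> {0..t} \<and> C \<in> sets borel} \<union> null_sets M)"
  unfolding nat_filtration_def
  by (rule sets_measure_of) (use nat_filtration_gen sets.space_closed in blast)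

lemma nat_filtration_events: "sets (nat_filtration M L t) \<subseteq> events"
  unfolding sets_nat_filtration by (rule sets.sigma_sets_subset[OF nat_filtration_gen])

lemma null_sets_nat_filtration: "null_sets M \<subseteq> sets (nat_filtration M L t)"
  unfolding sets_nat_filtration by (auto intro: sigma_sets.Basic)

lemma nat_filtration_mono: "s \<le> t \<Longrightarrow> sets (nat_filtration M L s) \<subseteq> sets (nat_filtration M L t)"
proof -
  assume "s \<le> t"
  then have "{L r u -` C \<inter> space M | r u C. r \<in> {0..s} \<and> C \<in> sets borel} \<subseteq> {L r u -` C \<inter> space M | r u C. r \<in> {0..t} \<and> C \<in> sets borel}"
    by fastforce
  then show ?thesis unfolding sets_nat_filtration by (intro sigma_sets_mono' Un_mono order_refl)
qed

lemma L_adapted: "0 \<le> s \<Longrightarrow> s \<le> t \<Longrightarrow> L s u \<in> borel_measurable (nat_filtration M L t)"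
proof (rule measurableI)
  fix C :: "real set" assume "0 \<le> s" "s \<le> t" "C \<in> sets borel"
  then have "L s u -` C \<inter> space M \<in> {L s u -` C \<inter> space M | s u C. s \<in> {0..t} \<and> C \<in> sets borel} \<union> null_sets M" by auto
  then show "L s u -` C \<inter> space (nat_filtration M L t) \<in> sets (nat_filtration M L t)"
    unfolding space_nat_filtration sets_nat_filtration by (rule sigma_sets.Basic)
qed simp

lemma sI_adapted: "vstep t H \<Longrightarrow> sI H \<in> borel_measurable (nat_filtration M L t)"
proof (induction H)
  case Nil then show ?case by (simp add: sI_Nil)
next
  case (Cons x H)
  obtain a b u where x: "x = (a, b, u)" by (cases x)
  have "L a u \<in> borel_measurable (nat_filtration M L t)" "L b u \<in> borel_measurable (nat_filtration M L t)"
    using Cons.prems x by (auto intro!: L_adapted)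
  then show ?case using Cons by (simp add: x sI_Cons)
qed

end

text \<open>The L^1 norm on E as an extended real, usable before any integrability is known.\<close>

definition (in prob_space) nE :: "'a set \<Rightarrow> ('a \<Rightarrow> real) \<Rightarrow> ennreal" where
  "nE E X = (\<integral>\<^sup>+\<omega>. indicator E \<omega> * ennreal \<bar>X \<omega>\<bar> \<partial>M)"

context prob_space
begin

lemma nE_cong_AE: "AE \<omega> in M. X \<omega> = Y \<omega> \<Longrightarrow> nE E X = nE E Y"
  unfolding nE_def by (rule nn_integral_cong_AE) auto

lemma nE_add_le:
  assumes [measurable]: "X \<in> borel_measurable M" "Y \<in> borel_measurable M" "E \<in> events"
  shows "nE E (\<lambda>\<omega>. X \<omega> + Y \<omega>) \<le> nE E X + nE E Y"
proof -
  have "nE E (\<lambda>\<omega>. X \<omega> + Y \<omega>) \<le> (\<integral>\<^sup>+\<omega>. indicator E \<omega> * ennreal \<bar>X \<omega>\<bar> + indicator E \<omega> * ennreal \<bar>Y \<omega>\<bar> \<partial>M)"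
    unfolding nE_def
    by (intro nn_integral_mono) (auto simp: indicator_def ennreal_plus[symmetric] simp del: ennreal_plus intro!: ennreal_leI)
  also have "\<dots> = nE E X + nE E Y" unfolding nE_def by (rule nn_integral_add) measurable
  finally show ?thesis .
qed

lemma nE_const_le: "E \<in> events \<Longrightarrow> nE E (\<lambda>_. c) \<le> ennreal \<bar>c\<bar>"
proof -
  assume "E \<in> events"
  have "nE E (\<lambda>_. c) \<le> (\<integral>\<^sup>+\<omega>. ennreal \<bar>c\<bar> \<partial>M)"
    unfolding nE_def by (intro nn_integral_mono) (auto simp: indicator_def)
  then show ?thesis by (simp add: emeasure_space_1)
qed

lemma nE_uminus: "nE E (\<lambda>\<omega>. - X \<omega>) = nE E X" by (simp add: nE_def)

lemma nE_zero_AE: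
  assumes [measurable]: "X \<in> borel_measurable M" "E \<in> events" and "nE E X = 0"
  shows "AE \<omega> in M. \<omega> \<in> E \<longrightarrow> X \<omega> = 0"
proof -
  have "AE \<omega> in M. indicator E \<omega> * ennreal \<bar>X \<omega>\<bar> = 0"
    using assms(3) unfolding nE_def by (subst (asm) nn_integral_0_iff_AE) auto
  then show ?thesis by eventually_elim (auto simp: indicator_def)
qed

end

section \<open>The mild process and its modulus of continuity\<close>

context levy_convolution
begin

text \<open>A version is chosen for each t separately, without control of joint measurability in
  time and chance; the progressively measurable modification repairs this.\<close>

definition cI :: "real \<Rightarrow> 'w \<Rightarrow> 'v" where
  "cI t = (SOME I. I \<in> borel_measurable M \<and> (\<forall>v. isint T (kf t v) (\<lambda>\<omega>. inner (I \<omega>) v)))"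

lemma cI:
  assumes "t \<in> {0..T}"
  shows "cI t \<in> borel_measurable M" "isint T (kf t v) (\<lambda>\<omega>. inner (cI t \<omega>) v)"
  using someI_ex[OF convolution_integral_exists[of t]] assms unfolding cI_def by auto

text \<open>The grids for time t end at t, so their step integrals are measurable for the filtration
  at t, which contains the null sets and is therefore closed under limits in probability.\<close>

lemma cI_adapted:
  assumes t: "t \<in> {0..T}"
  shows "(\<lambda>\<omega>. inner (cI t \<omega>) v) \<in> borel_measurable (nat_filtration M L t)"
proof (rule measurable_subalgebra_limit[OF space_nat_filtration nat_filtration_events null_sets_nat_filtration])
  let ?H = "grid t (\<lambda>n j. g v (t - t * real j / real (Suc n)))"
  show "conv_in_prob M (\<lambda>n. sI (?H n)) (\<lambda>\<omega>. inner (cI t \<omega>) v)"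
    using t by (intro isint_conv[OF T cI(2)[OF t]] kf_grid) auto
  show "sI (?H n) \<in> borel_measurable (nat_filtration M L t)" for n
    using t by (intro sI_adapted vstep_grid) auto
qed (use cI(1)[OF t] in simp)

text \<open>Before s the two kernels are one shift apart and uniform continuity applies; between s
  and t only one of them is present; after t both vanish.\<close>

lemma kf_diff_bounds:
  assumes K: "K > 0" "\<And>r v. r \<in> {0..T} \<Longrightarrow> norm (g v r) \<le> K * norm v"
    and st: "0 \<le> s" "s \<le> t" "t \<le> T" and w: "0 \<le> w"
    and wd: "\<And>r r'. r \<in> {0..T} \<Longrightarrow> r' \<in> {0..T} \<Longrightarrow> \<bar>r - r'\<bar> \<le> t - s \<Longrightarrow> norm (g v r - g v r') \<le> w"
    and r: "r \<in> {0<..T}"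
  shows "norm (kf t v r - kf s v r) \<le> K * norm v + w" "r \<notin> {s<..t} \<Longrightarrow> norm (kf t v r - kf s v r) \<le> w"
proof -
  have 1: "norm (kf t v r - kf s v r) \<le> w" if "r \<le> s"
  proof -
    have "norm (g v (t - r) - g v (s - r)) \<le> w" by (rule wd) (use that st r in auto)
    then show ?thesis using that st by (simp add: kf_def)
  qed
  have 2: "norm (kf t v r - kf s v r) \<le> K * norm v" if "s < r" "r \<le> t"
    using K(2)[of "t - r" v] that st r by (simp add: kf_def)
  have 3: "norm (kf t v r - kf s v r) = 0" if "t < r" using that st by (simp add: kf_def)
  have 4: "0 \<le> K * norm v" using K by simp
  show "norm (kf t v r - kf s v r) \<le> K * norm v + w"
    by (cases "r \<le> s"; cases "r \<le> t") (use 1 2 3 4 w in auto)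
  show "norm (kf t v r - kf s v r) \<le> w" if "r \<notin> {s<..t}"
    by (cases "r \<le> s") (use 1 3 w that in auto)
qed

lemma cI_modulus:
  assumes E: "isint_bound T E C" and e: "0 < e"
  shows "\<exists>d>0. \<forall>s\<in>{0..T}. \<forall>t\<in>{0..T}. \<bar>s - t\<bar> < d \<longrightarrow> nE E (\<lambda>\<omega>. inner (cI t \<omega>) v - inner (cI s \<omega>) v) \<le> ennreal e"
proof -
  have C: "0 \<le> C" "E \<in> events" using E by (auto simp: isint_bound_def)
  obtain K where K: "K > 0" "\<And>r v. r \<in> {0..T} \<Longrightarrow> norm (g v r) \<le> K * norm v" using g_bound by blast
  \<comment> \<open>w and the second entry of d each use half of e^2 in the square of (C + 1)
    sqrt(w^2 T + \<alpha>^2 (t - s)); C + 1 and T + 1 keep the denominators positive.\<close>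
  define w where "w = e / ((C + 1) * sqrt (2 * (T + 1)))"
  have w: "w > 0" using C T e by (auto simp: w_def intro!: divide_pos_pos mult_pos_pos)
  define \<alpha> where "\<alpha> = K * norm v + w"
  have \<alpha>: "\<alpha> > 0" using w K by (simp add: \<alpha>_def add_nonneg_pos)
  obtain d0 where d0: "d0 > 0" "\<And>r r'. r \<in> {0..T} \<Longrightarrow> r' \<in> {0..T} \<Longrightarrow> \<bar>r - r'\<bar> < d0 \<Longrightarrow> norm (g v r - g v r') < w"
    using g_uniform[OF w, of v] by auto
  define d where "d = min d0 (e\<^sup>2 / (2 * (C + 1)\<^sup>2 * \<alpha>\<^sup>2))"
  have C1: "C + 1 > 0" using C by simp
  have d: "d > 0" using d0 e C1 \<alpha> by (auto simp: d_def)
  have main: "nE E (\<lambda>\<omega>. inner (cI t \<omega>) v - inner (cI s \<omega>) v) \<le> ennreal e"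
    if st: "0 \<le> s" "s \<le> t" "t \<le> T" "t - s < d" for s t
  proof -
    have wd: "norm (g v r - g v r') \<le> w" if "r \<in> {0..T}" "r' \<in> {0..T}" "\<bar>r - r'\<bar> \<le> t - s" for r r'
      using d0(2)[OF that(1,2)] that(3) st by (auto simp: d_def)
    have i: "isint T (\<lambda>r. 1 *\<^sub>R kf t v r + (-1) *\<^sub>R kf s v r) (\<lambda>\<omega>. 1 * inner (cI t \<omega>) v + (-1) * inner (cI s \<omega>) v)"
      by (intro isint_linear cI) (use st in auto)
    have "(\<integral>\<^sup>+\<omega>. indicator E \<omega> * ennreal \<bar>1 * inner (cI t \<omega>) v + (-1) * inner (cI s \<omega>) v\<bar> \<partial>M)
        \<le> ennreal (C * sqrt (w\<^sup>2 * T + \<alpha>\<^sup>2 * (t - s)))"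
      by (rule isint_boundD[OF E i])
        (use st \<alpha> w kf_diff_bounds[OF K st(1,2,3) less_imp_le[OF w] wd] in \<open>auto simp: \<alpha>_def\<close>)
    also have "\<dots> \<le> ennreal e"
    proof (rule ennreal_leI)
      have "(C + 1)\<^sup>2 * (w\<^sup>2 * T + \<alpha>\<^sup>2 * (t - s)) \<le> e\<^sup>2"
      proof -
        have "(C + 1)\<^sup>2 * w\<^sup>2 = e\<^sup>2 / (2 * (T + 1))"
          using C1 T by (simp add: w_def power_divide power_mult_distrib)
        then have "(C + 1)\<^sup>2 * (w\<^sup>2 * T) = e\<^sup>2 * (T / (T + 1)) / 2" by (simp add: mult.assoc[symmetric])
        also have "\<dots> \<le> e\<^sup>2 * 1 / 2" using T by (intro divide_right_mono mult_left_mono) auto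
        finally have 1: "(C + 1)\<^sup>2 * (w\<^sup>2 * T) \<le> e\<^sup>2 / 2" by simp
        have "t - s \<le> e\<^sup>2 / (2 * (C + 1)\<^sup>2 * \<alpha>\<^sup>2)" using st by (simp add: d_def)
        then have "((C + 1)\<^sup>2 * \<alpha>\<^sup>2) * (t - s) \<le> ((C + 1)\<^sup>2 * \<alpha>\<^sup>2) * (e\<^sup>2 / (2 * (C + 1)\<^sup>2 * \<alpha>\<^sup>2))"
          by (rule mult_left_mono) simp
        also have "\<dots> = e\<^sup>2 / 2" using C1 \<alpha> by simp
        finally have 2: "(C + 1)\<^sup>2 * (\<alpha>\<^sup>2 * (t - s)) \<le> e\<^sup>2 / 2" by (simp only: mult.assoc)
        show ?thesis unfolding distrib_left using 1 2 by linarith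
      qed
      then have "sqrt ((C + 1)\<^sup>2 * (w\<^sup>2 * T + \<alpha>\<^sup>2 * (t - s))) \<le> sqrt (e\<^sup>2)" by (rule real_sqrt_le_mono)
      then have le: "(C + 1) * sqrt (w\<^sup>2 * T + \<alpha>\<^sup>2 * (t - s)) \<le> e" using C1 e by (simp add: real_sqrt_mult)
      have "0 \<le> w\<^sup>2 * T + \<alpha>\<^sup>2 * (t - s)" using T st by simp
      then have "C * sqrt (w\<^sup>2 * T + \<alpha>\<^sup>2 * (t - s)) \<le> (C + 1) * sqrt (w\<^sup>2 * T + \<alpha>\<^sup>2 * (t - s))"
        by (intro mult_right_mono) auto
      then show "C * sqrt (w\<^sup>2 * T + \<alpha>\<^sup>2 * (t - s)) \<le> e" using le by linarith
    qed
    finally show ?thesis by (simp add: nE_def)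
  qed
  have "nE E (\<lambda>\<omega>. inner (cI t \<omega>) v - inner (cI s \<omega>) v) \<le> ennreal e"
    if "s \<in> {0..T}" "t \<in> {0..T}" "\<bar>s - t\<bar> < d" for s t
  proof (cases "s \<le> t")
    case True then show ?thesis using main[of s t] that by auto
  next
    case False
    then show ?thesis using main[of t s] that nE_uminus[of E "\<lambda>\<omega>. inner (cI t \<omega>) v - inner (cI s \<omega>) v"] by simp
  qed
  then show ?thesis using d by blast
qed

lemma orbit_uniform:
  assumes "0 < e"
  shows "\<exists>d>0. \<forall>s\<in>{0..T}. \<forall>t\<in>{0..T}. \<bar>s - t\<bar> < d \<longrightarrow> \<bar>inner (S t y) v - inner (S s y) v\<bar> < e"
proof -
  have "continuous_on {0..T} (\<lambda>t. inner (S t y) v)"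
    by (rule continuous_on_subset[of "{0..}"]) (auto intro!: continuous_intros c0_semigroup_continuous[OF S])
  then have "uniformly_continuous_on {0..T} (\<lambda>t. inner (S t y) v)" by (rule compact_uniformly_continuous) simp
  then obtain d where "d > 0" "\<forall>t\<in>{0..T}. \<forall>s\<in>{0..T}. dist s t < d \<longrightarrow> dist (inner (S s y) v) (inner (S t y) v) < e"
    using assms unfolding uniformly_continuous_on_def by blast
  then show ?thesis by (intro exI[of _ d]) (simp add: dist_real_def abs_minus_commute)
qed

definition mild :: "'v \<Rightarrow> real \<Rightarrow> 'w \<Rightarrow> 'v" where "mild y0 t \<omega> = S t y0 + cI t \<omega>"

lemma mild_modulus:
  assumes E: "isint_bound T E C" and e: "0 < e"
  shows "\<exists>d>0. \<forall>s\<in>{0..T}. \<forall>t\<in>{0..T}. \<bar>s - t\<bar> < d \<longrightarrow> nE E (\<lambda>\<omega>. inner (mild y0 t \<omega>) v - inner (mild y0 s \<omega>) v) \<le> ennreal e"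
proof -
  have Ee: "E \<in> events" using E by (auto simp: isint_bound_def)
  obtain d1 where d1: "d1 > 0" "\<And>s t. s \<in> {0..T} \<Longrightarrow> t \<in> {0..T} \<Longrightarrow> \<bar>s - t\<bar> < d1 \<Longrightarrow> nE E (\<lambda>\<omega>. inner (cI t \<omega>) v - inner (cI s \<omega>) v) \<le> ennreal (e / 2)"
    using cI_modulus[OF E, of "e / 2" v] e by auto
  obtain d2 where d2: "d2 > 0" "\<And>s t. s \<in> {0..T} \<Longrightarrow> t \<in> {0..T} \<Longrightarrow> \<bar>s - t\<bar> < d2 \<Longrightarrow> \<bar>inner (S t y0) v - inner (S s y0) v\<bar> < e / 2"
    using orbit_uniform[of "e / 2" y0 v] e by auto
  have "nE E (\<lambda>\<omega>. inner (mild y0 t \<omega>) v - inner (mild y0 s \<omega>) v) \<le> ennreal e"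
    if st: "s \<in> {0..T}" "t \<in> {0..T}" "\<bar>s - t\<bar> < min d1 d2" for s t
  proof -
    have [measurable]: "cI s \<in> borel_measurable M" "cI t \<in> borel_measurable M" using cI(1) st by auto
    let ?c = "inner (S t y0) v - inner (S s y0) v"
    have "nE E (\<lambda>\<omega>. inner (mild y0 t \<omega>) v - inner (mild y0 s \<omega>) v) = nE E (\<lambda>\<omega>. ?c + (inner (cI t \<omega>) v - inner (cI s \<omega>) v))"
      by (simp add: mild_def inner_add_left algebra_simps)
    also have "\<dots> \<le> nE E (\<lambda>_. ?c) + nE E (\<lambda>\<omega>. inner (cI t \<omega>) v - inner (cI s \<omega>) v)"
      by (rule nE_add_le) (use Ee in auto)
    also have "\<dots> \<le> ennreal (e / 2) + ennreal (e / 2)"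
    proof (rule add_mono)
      have "\<bar>?c\<bar> \<le> e / 2" using d2(2)[OF st(1,2)] st(3) by simp
      then show "nE E (\<lambda>_. ?c) \<le> ennreal (e / 2)" by (rule order_trans[OF nE_const_le[OF Ee] ennreal_leI])
      show "nE E (\<lambda>\<omega>. inner (cI t \<omega>) v - inner (cI s \<omega>) v) \<le> ennreal (e / 2)" using d1(2)[OF st(1,2)] st(3) by simp
    qed
    also have "\<dots> = ennreal e" using e by (subst ennreal_plus[symmetric]) auto
    finally show ?thesis .
  qed
  then show ?thesis using d1 d2 by (intro exI[of _ "min d1 d2"]) auto
qed

lemma mild_measurable: "t \<in> {0..T} \<Longrightarrow> mild y0 t \<in> borel_measurable M"
proof -
  assume "t \<in> {0..T}"
  then have [measurable]: "cI t \<in> borel_measurable M" by (rule cI)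
  show ?thesis unfolding mild_def[abs_def] by measurable
qed

lemma mild_stochastically_continuous:
  assumes e: "e > 0"
  shows "\<exists>d>0. \<forall>s\<in>{0..T}. \<forall>t\<in>{0..T}. \<bar>s - t\<bar> < d \<longrightarrow> ptail (\<lambda>\<omega>. inner (mild y0 s \<omega>) v - inner (mild y0 t \<omega>) v) e \<le> e"
proof -
  obtain E C where EC: "isint_bound T E C" "prob (space M - E) \<le> e / 2"
    using isint_bound_exists[OF T, of "e / 2"] e by auto
  have Ee: "E \<in> events" using EC by (auto simp: isint_bound_def)
  obtain d where d: "d > 0" "\<And>s t. s \<in> {0..T} \<Longrightarrow> t \<in> {0..T} \<Longrightarrow> \<bar>s - t\<bar> < d \<Longrightarrow> nE E (\<lambda>\<omega>. inner (mild y0 t \<omega>) v - inner (mild y0 s \<omega>) v) \<le> ennreal (e\<^sup>2 / 2)"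
    using mild_modulus[OF EC(1), of "e\<^sup>2 / 2" y0 v] e by auto
  have "ptail (\<lambda>\<omega>. inner (mild y0 s \<omega>) v - inner (mild y0 t \<omega>) v) e \<le> e"
    if st: "s \<in> {0..T}" "t \<in> {0..T}" "\<bar>s - t\<bar> < d" for s t
  proof -
    have [measurable]: "mild y0 s \<in> borel_measurable M" "mild y0 t \<in> borel_measurable M" using mild_measurable st by auto
    have "\<bar>t - s\<bar> < d" using st by simp
    from d(2)[OF st(2,1) this]
    have "ptail (\<lambda>\<omega>. inner (mild y0 s \<omega>) v - inner (mild y0 t \<omega>) v) e \<le> prob (space M - E) + (e\<^sup>2 / 2) / e"
      using e Ee by (intro ptail_le_large_event) (auto simp: nE_def)
    also have "\<dots> \<le> e" using EC(2) e by (simp add: power2_eq_square)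
    finally show ?thesis .
  qed
  then show ?thesis using d by blast
qed

lemma mild_adapted:
  assumes "t \<in> {0..T}"
  shows "(\<lambda>\<omega>. inner (mild y0 t \<omega>) v) \<in> borel_measurable (nat_filtration M L t)"
  unfolding mild_def inner_add_left using cI_adapted[OF assms, of v] by (intro borel_measurable_add) auto

text \<open>Coordinates are modified one by one and reassembled along a basis. At each t the series
  is almost surely the expansion of the mild process; where it is not Cauchy, the default 0
  preserves measurability.\<close>

lemma mild_progressive:
  "\<exists>Y. prog_measurable M (nat_filtration M L) T Y \<and> (\<forall>t\<in>{0..T}. AE \<omega> in M. Y t \<omega> = mild y0 t \<omega>)"
proof -
  obtain e :: "nat \<Rightarrow> 'v" where e: "onbasis e" using onbasis_exists by blast
  have "\<forall>k. \<exists>Y. (\<forall>t\<in>{0..T}. (\<lambda>(s, \<omega>). Y s \<omega>) \<in> borel_measurable (restrict_space borel {0..t} \<Otimes>\<^sub>M nat_filtration M L t)) \<and>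
    (\<forall>t\<in>{0..T}. AE \<omega> in M. Y t \<omega> = inner (mild y0 t \<omega>) (e k))"
    by (intro allI progressive_modification space_nat_filtration nat_filtration_events nat_filtration_mono mild_adapted mild_stochastically_continuous)
  then obtain Y where Y: "\<forall>k. (\<forall>t\<in>{0..T}. (\<lambda>(s, \<omega>). Y k s \<omega>) \<in> borel_measurable (restrict_space borel {0..t} \<Otimes>\<^sub>M nat_filtration M L t)) \<and>
    (\<forall>t\<in>{0..T}. AE \<omega> in M. Y k t \<omega> = inner (mild y0 t \<omega>) (e k))"
    unfolding choice_iff by (elim exE) (rule that)
  have Y1: "(\<lambda>(s, \<omega>). Y k s \<omega>) \<in> borel_measurable (restrict_space borel {0..t} \<Otimes>\<^sub>M nat_filtration M L t)" if "t \<in> {0..T}" for k t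
    using Y that by blast
  have Y2: "AE \<omega> in M. Y k t \<omega> = inner (mild y0 t \<omega>) (e k)" if "t \<in> {0..T}" for k t
    using Y that by blast
  let ?P = "\<lambda>n s \<omega>. \<Sum>k<n. Y k s \<omega> *\<^sub>R e k"
  define Z where "Z s \<omega> = (if Cauchy (\<lambda>n. ?P n s \<omega>) then lim (\<lambda>n. ?P n s \<omega>) else 0)" for s \<omega>
  have "prog_measurable M (nat_filtration M L) T Z"
    unfolding prog_measurable_def
  proof
    fix t assume t: "t \<in> {0..T}"
    let ?N = "restrict_space borel {0..t} \<Otimes>\<^sub>M nat_filtration M L t"
    have [measurable]: "(\<lambda>x. Y k (fst x) (snd x)) \<in> borel_measurable ?N" for k
      using Y1[OF t, of k] by (simp add: case_prod_beta)
    have "(\<lambda>x. ?P n (fst x) (snd x)) \<in> borel_measurable ?N" for n by measurable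
    from borel_measurable_Cauchy_lim[of "\<lambda>n x. ?P n (fst x) (snd x)", OF this]
    show "(\<lambda>(s, \<omega>). Z s \<omega>) \<in> borel_measurable ?N" by (simp add: Z_def case_prod_beta)
  qed
  moreover have "AE \<omega> in M. Z t \<omega> = mild y0 t \<omega>" if t: "t \<in> {0..T}" for t
  proof -
    have "AE \<omega> in M. \<forall>k. Y k t \<omega> = inner (mild y0 t \<omega>) (e k)"
      unfolding AE_all_countable using Y2[OF t] by blast
    then show ?thesis
    proof eventually_elim
      case (elim \<omega>)
      have "(\<lambda>n. ?P n t \<omega>) \<longlonglongrightarrow> mild y0 t \<omega>" using e elim by (simp add: onbasis_def)
      then show ?case unfolding Z_def using LIMSEQ_imp_Cauchy limI by fastforce
    qed
  qed
  ultimately show ?thesis by blast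
qed

end

section \<open>Path integrals\<close>

context prob_space
begin

lemma nE_cong_on:
  assumes "AE \<omega> in M. \<omega> \<in> E \<longrightarrow> X \<omega> = Y \<omega>"
  shows "nE E X = nE E Y"
  unfolding nE_def by (rule nn_integral_cong_AE) (use assms in eventually_elim, auto simp: indicator_def)

text \<open>Tonelli on E: a bound of the L^1 norms on E, uniform in time, makes almost every path on
  E integrable and controls its integral. Almost every s suffices, which matters because the point 0
  lies in no grid cell.\<close>

lemma path_integral:
  fixes h :: "real \<times> 'a \<Rightarrow> real"
  assumes h [measurable]: "h \<in> borel_measurable (lborel \<Otimes>\<^sub>M M)" and E [measurable]: "E \<in> events"
    and A [measurable]: "A \<in> sets borel" and t: "0 \<le> t" "emeasure lborel A = ennreal t" and b: "0 \<le> b"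
    and bd: "AE s in lborel. s \<in> A \<longrightarrow> nE E (\<lambda>\<omega>. h (s, \<omega>)) \<le> ennreal b"
  shows "AE \<omega> in M. \<omega> \<in> E \<longrightarrow> set_integrable lborel A (\<lambda>s. h (s, \<omega>))"
    "(\<lambda>\<omega>. LINT s:A|lborel. h (s, \<omega>)) \<in> borel_measurable M"
    "nE E (\<lambda>\<omega>. LINT s:A|lborel. h (s, \<omega>)) \<le> ennreal (b * t)"
proof -
  interpret P: pair_sigma_finite lborel M ..
  let ?f = "\<lambda>s \<omega>. indicator E \<omega> * (indicator A s * ennreal \<bar>h (s, \<omega>)\<bar>)"
  have hs [measurable]: "(\<lambda>s. h (s, \<omega>)) \<in> borel_measurable lborel" if "\<omega> \<in> space M" for \<omega>
    by (rule measurable_compose[OF measurable_Pair2'[OF that] h])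
  have fm [measurable]: "(\<lambda>(s, \<omega>). ?f s \<omega>) \<in> borel_measurable (lborel \<Otimes>\<^sub>M M)" by measurable
  have "(\<integral>\<^sup>+\<omega>. indicator E \<omega> * (\<integral>\<^sup>+s. indicator A s * ennreal \<bar>h (s, \<omega>)\<bar> \<partial>lborel) \<partial>M) = (\<integral>\<^sup>+\<omega>. (\<integral>\<^sup>+s. ?f s \<omega> \<partial>lborel) \<partial>M)"
  proof (rule nn_integral_cong)
    fix \<omega> assume \<omega>: "\<omega> \<in> space M"
    note [measurable] = hs[OF \<omega>]
    show "indicator E \<omega> * (\<integral>\<^sup>+s. indicator A s * ennreal \<bar>h (s, \<omega>)\<bar> \<partial>lborel) = (\<integral>\<^sup>+s. ?f s \<omega> \<partial>lborel)"
      by (rule nn_integral_cmult[symmetric]) measurable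
  qed
  also have "\<dots> = (\<integral>\<^sup>+s. (\<integral>\<^sup>+\<omega>. ?f s \<omega> \<partial>M) \<partial>lborel)"
    using P.Fubini'[OF fm] by simp
  also have "\<dots> \<le> (\<integral>\<^sup>+s. ennreal b * indicator A s \<partial>lborel)"
  proof (rule nn_integral_mono_AE, use bd in eventually_elim)
    fix s assume s: "s \<in> A \<longrightarrow> nE E (\<lambda>\<omega>. h (s, \<omega>)) \<le> ennreal b"
    show "(\<integral>\<^sup>+\<omega>. ?f s \<omega> \<partial>M) \<le> ennreal b * indicator A s"
      using s by (cases "s \<in> A") (auto simp: nE_def)
  qed
  also have "\<dots> = ennreal (b * t)"
    using t b by (subst nn_integral_cmult_indicator) (auto simp: ennreal_mult)
  finally have le: "(\<integral>\<^sup>+\<omega>. indicator E \<omega> * (\<integral>\<^sup>+s. indicator A s * ennreal \<bar>h (s, \<omega>)\<bar> \<partial>lborel) \<partial>M) \<le> ennreal (b * t)" .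
  have im: "(\<lambda>\<omega>. \<integral>\<^sup>+s. indicator A s * ennreal \<bar>h (s, \<omega>)\<bar> \<partial>lborel) \<in> borel_measurable M"
    by (rule lborel.borel_measurable_nn_integral) measurable
  have "AE \<omega> in M. indicator E \<omega> * (\<integral>\<^sup>+s. indicator A s * ennreal \<bar>h (s, \<omega>)\<bar> \<partial>lborel) \<noteq> \<infinity>"
    by (rule nn_integral_noteq_infinite) (use im le in \<open>auto simp: top_unique\<close>)
  then show "AE \<omega> in M. \<omega> \<in> E \<longrightarrow> set_integrable lborel A (\<lambda>s. h (s, \<omega>))"
    using AE_space
  proof eventually_elim
    case (elim \<omega>)
    show ?case
    proof
      assume \<omega>E: "\<omega> \<in> E"
      note [measurable] = hs[OF elim(2)]
      have "(\<integral>\<^sup>+s. ennreal (norm (indicator A s *\<^sub>R h (s, \<omega>))) \<partial>lborel) = (\<integral>\<^sup>+s. indicator A s * ennreal \<bar>h (s, \<omega>)\<bar> \<partial>lborel)"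
        by (intro nn_integral_cong) (auto simp: indicator_def)
      also have "\<dots> < \<infinity>" using elim(1) \<omega>E by (simp add: less_top)
      finally show "set_integrable lborel A (\<lambda>s. h (s, \<omega>))"
        unfolding set_integrable_def by (intro integrableI_bounded) measurable
    qed
  qed
  show "(\<lambda>\<omega>. LINT s:A|lborel. h (s, \<omega>)) \<in> borel_measurable M"
    unfolding set_lebesgue_integral_def by (rule lborel.borel_measurable_lebesgue_integral) measurable
  have "nE E (\<lambda>\<omega>. LINT s:A|lborel. h (s, \<omega>)) \<le> (\<integral>\<^sup>+\<omega>. indicator E \<omega> * (\<integral>\<^sup>+s. indicator A s * ennreal \<bar>h (s, \<omega>)\<bar> \<partial>lborel) \<partial>M)"
    unfolding nE_def
  proof (rule nn_integral_mono, rule mult_left_mono)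
    fix \<omega>
    let ?k = "\<lambda>s. indicator A s *\<^sub>R h (s, \<omega>)"
    have "ennreal (norm (LINT s|lborel. ?k s)) \<le> (\<integral>\<^sup>+s. ennreal (norm (?k s)) \<partial>lborel)"
    proof (cases "integrable lborel ?k")
      case True then show ?thesis by (rule integral_norm_bound_ennreal)
    next
      case False then show ?thesis by (simp add: not_integrable_integral_eq)
    qed
    also have "\<dots> = (\<integral>\<^sup>+s. indicator A s * ennreal \<bar>h (s, \<omega>)\<bar> \<partial>lborel)"
      by (intro nn_integral_cong) (auto simp: indicator_def)
    finally show "ennreal \<bar>LINT s:A|lborel. h (s, \<omega>)\<bar> \<le> (\<integral>\<^sup>+s. indicator A s * ennreal \<bar>h (s, \<omega>)\<bar> \<partial>lborel)"
      by (simp add: set_lebesgue_integral_def)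
  qed simp
  also note le
  finally show "nE E (\<lambda>\<omega>. LINT s:A|lborel. h (s, \<omega>)) \<le> ennreal (b * t)" .
qed

end

section \<open>The mild process solves the equation weakly\<close>

context levy_convolution
begin

lemma mild_bound:
  assumes E: "isint_bound T E C"
  shows "\<exists>b\<ge>0. \<forall>t\<in>{0..T}. \<forall>v. nE E (\<lambda>\<omega>. inner (mild y0 t \<omega>) v) \<le> ennreal (b * norm v)"
proof -
  have C: "0 \<le> C" "E \<in> events" using E by (auto simp: isint_bound_def)
  obtain K where K: "K > 0" "\<And>r v. r \<in> {0..T} \<Longrightarrow> norm (g v r) \<le> K * norm v" using g_bound by blast
  obtain KS where KS: "KS > 0" "\<And>t. t \<in> {0..T} \<Longrightarrow> norm (S t) \<le> KS" using c0_semigroup_bounded[OF S] by blast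
  define b where "b = KS * norm y0 + C * sqrt T * K"
  have b: "0 \<le> b" using KS K C T by (simp add: b_def)
  have "nE E (\<lambda>\<omega>. inner (mild y0 t \<omega>) v) \<le> ennreal (b * norm v)" if t: "t \<in> {0..T}" for t v
  proof -
    have [measurable]: "cI t \<in> borel_measurable M" by (rule cI[OF t])
    have "nE E (\<lambda>\<omega>. inner (mild y0 t \<omega>) v) \<le> nE E (\<lambda>_. inner (S t y0) v) + nE E (\<lambda>\<omega>. inner (cI t \<omega>) v)"
      unfolding mild_def inner_add_left by (rule nE_add_le) (use C in auto)
    also have "\<dots> \<le> ennreal (KS * norm y0 * norm v) + ennreal (C * sqrt T * (K * norm v))"
    proof (rule add_mono)
      have "\<bar>inner (S t y0) v\<bar> \<le> norm (S t y0) * norm v" by (rule Cauchy_Schwarz_ineq2)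
      also have "\<dots> \<le> (norm (S t) * norm y0) * norm v" by (intro mult_right_mono norm_blinfun) simp
      also have "\<dots> \<le> (KS * norm y0) * norm v" using KS(2)[OF t] by (intro mult_right_mono) auto
      finally have "\<bar>inner (S t y0) v\<bar> \<le> KS * norm y0 * norm v" .
      then show "nE E (\<lambda>_. inner (S t y0) v) \<le> ennreal (KS * norm y0 * norm v)"
        by (rule order_trans[OF nE_const_le[OF C(2)] ennreal_leI])
      show "nE E (\<lambda>\<omega>. inner (cI t \<omega>) v) \<le> ennreal (C * sqrt T * (K * norm v))"
        unfolding nE_def using t K by (intro isint_boundD_sup[OF E cI(2)[OF t]] kf_norm_le) auto
    qed
    also have "\<dots> = ennreal (b * norm v)"
      using KS K C T by (subst ennreal_plus[symmetric]) (auto simp: b_def algebra_simps)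
    finally show ?thesis .
  qed
  then show ?thesis using b by blast
qed

text \<open>Clamping time to [0,T] extends processes that are measurable on [0,T] to the whole line,
  as needed for products with \<open>lborel\<close>.\<close>

definition \<rho> :: "real \<Rightarrow> real" where "\<rho> s = max 0 (min T s)"

lemma \<rho>: "\<rho> s \<in> {0..T}" "s \<in> {0..T} \<Longrightarrow> \<rho> s = s" "continuous_on UNIV \<rho>"
  using T by (auto simp: \<rho>_def[abs_def] intro!: continuous_intros)

lemma prog_measurable_joint:
  assumes "prog_measurable M (nat_filtration M L) T Y"
  shows "(\<lambda>x. Y (\<rho> (fst x)) (snd x)) \<in> borel_measurable (lborel \<Otimes>\<^sub>M M)"
proof -
  let ?F = "nat_filtration M L T"
  have "(\<lambda>(s, \<omega>). Y s \<omega>) \<in> borel_measurable (restrict_space borel {0..T} \<Otimes>\<^sub>M ?F)"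
    using assms T by (auto simp: prog_measurable_def)
  moreover have "(\<lambda>x. (\<rho> (fst x), snd x)) \<in> measurable (lborel \<Otimes>\<^sub>M M) (restrict_space borel {0..T} \<Otimes>\<^sub>M ?F)"
  proof (rule measurable_Pair)
    have [measurable]: "\<rho> \<in> borel_measurable borel" by (rule borel_measurable_continuous_onI[OF \<rho>(3)])
    have "\<rho> \<in> measurable lborel (restrict_space borel {0..T})"
      by (rule measurable_restrict_space2) (use \<rho>(1) in auto)
    from measurable_compose[OF measurable_fst this]
    show "(\<lambda>x. \<rho> (fst x)) \<in> measurable (lborel \<Otimes>\<^sub>M M) (restrict_space borel {0..T})" .
    have "(\<lambda>\<omega>. \<omega>) \<in> measurable M ?F"
      using nat_filtration_events[of T] sets.sets_into_space[of _ ?F]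
      by (intro measurableI) (auto simp: space_nat_filtration Int_absorb2)
    from measurable_compose[OF measurable_snd[of "lborel :: real measure"] this]
    show "snd \<in> measurable ((lborel :: real measure) \<Otimes>\<^sub>M M) ?F" by simp
  qed
  ultimately show ?thesis by (auto dest: measurable_compose)
qed

text \<open>On a large event the L^1 norm of the path integral is at most b m T, where m bounds the
  test function; this gives integrable paths and, by Markov's inequality, convergence to 0.\<close>

lemma mild_weakly_bochner_regular:
  assumes Yp: "prog_measurable M (nat_filtration M L) T Y" and Ym: "\<And>t. t \<in> {0..T} \<Longrightarrow> AE \<omega> in M. Y t \<omega> = mild y0 t \<omega>"
  shows "weakly_bochner_regular M T Y"
proof -
  have Yj [measurable]: "(\<lambda>x. Y (\<rho> (fst x)) (snd x)) \<in> borel_measurable (lborel \<Otimes>\<^sub>M M)"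
    by (rule prog_measurable_joint[OF Yp])
  have path: "AE \<omega> in M. \<omega> \<in> E \<longrightarrow> set_integrable lborel {0..T} (\<lambda>s. inner (Y s \<omega>) (f s))"
    "(\<lambda>\<omega>. LINT s:{0..T}|lborel. inner (Y s \<omega>) (f s)) \<in> borel_measurable M"
    "nE E (\<lambda>\<omega>. LINT s:{0..T}|lborel. inner (Y s \<omega>) (f s)) \<le> ennreal (b * m * T)"
    if f: "continuous_on {0..T} f" and m: "\<And>s. s \<in> {0..T} \<Longrightarrow> norm (f s) \<le> m" and b: "0 \<le> b" and E: "E \<in> events"
      and bd: "\<And>t v. t \<in> {0..T} \<Longrightarrow> nE E (\<lambda>\<omega>. inner (mild y0 t \<omega>) v) \<le> ennreal (b * norm v)"
    for E b m and f :: "real \<Rightarrow> 'v"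
  proof -
    have "continuous_on UNIV (\<lambda>s. f (\<rho> s))" by (rule continuous_on_compose2[OF f \<rho>(3)]) (use \<rho>(1) in auto)
    then have [measurable]: "(\<lambda>s. f (\<rho> s)) \<in> borel_measurable borel" by (rule borel_measurable_continuous_onI)
    let ?h = "\<lambda>x. inner (Y (\<rho> (fst x)) (snd x)) (f (\<rho> (fst x)))"
    have hm: "?h \<in> borel_measurable (lborel \<Otimes>\<^sub>M M)" by measurable
    have m0: "0 \<le> m" using order_trans[OF norm_ge_zero m[of 0]] T by simp
    have hb: "nE E (\<lambda>\<omega>. ?h (s, \<omega>)) \<le> ennreal (b * m)" if s: "s \<in> {0..T}" for s
    proof -
      have "nE E (\<lambda>\<omega>. ?h (s, \<omega>)) = nE E (\<lambda>\<omega>. inner (mild y0 s \<omega>) (f s))"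
        by (rule nE_cong_AE) (use Ym[OF s] \<rho>(2)[OF s] in auto)
      also have "\<dots> \<le> ennreal (b * norm (f s))" by (rule bd[OF s])
      also have "\<dots> \<le> ennreal (b * m)" using m[OF s] b by (intro ennreal_leI mult_left_mono) auto
      finally show ?thesis .
    qed
    have eq: "set_integrable lborel {0..T} (\<lambda>s. ?h (s, \<omega>)) = set_integrable lborel {0..T} (\<lambda>s. inner (Y s \<omega>) (f s))"
      "(LINT s:{0..T}|lborel. ?h (s, \<omega>)) = (LINT s:{0..T}|lborel. inner (Y s \<omega>) (f s))" for \<omega>
      by (intro set_integrable_cong set_lebesgue_integral_cong; use \<rho>(2) in auto)+
    have bdA: "AE s in lborel. s \<in> {0..T} \<longrightarrow> nE E (\<lambda>\<omega>. ?h (s, \<omega>)) \<le> ennreal (b * m)" using hb by (intro AE_I2) blast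
    have A: "{0..T} \<in> sets borel" "emeasure lborel {0..T} = ennreal T" using T by auto
    note p = path_integral[OF hm E A(1) T A(2) mult_nonneg_nonneg[OF b m0] bdA, unfolded eq]
    show "AE \<omega> in M. \<omega> \<in> E \<longrightarrow> set_integrable lborel {0..T} (\<lambda>s. inner (Y s \<omega>) (f s))" by (rule p(1))
    show "(\<lambda>\<omega>. LINT s:{0..T}|lborel. inner (Y s \<omega>) (f s)) \<in> borel_measurable M" by (rule p(2))
    show "nE E (\<lambda>\<omega>. LINT s:{0..T}|lborel. inner (Y s \<omega>) (f s)) \<le> ennreal (b * m * T)" by (rule p(3))
  qed
  have large: "\<exists>E b. E \<in> events \<and> prob (space M - E) \<le> \<eta> \<and> 0 \<le> b \<and>
      (\<forall>t\<in>{0..T}. \<forall>v. nE E (\<lambda>\<omega>. inner (mild y0 t \<omega>) v) \<le> ennreal (b * norm v))" if \<eta>: "\<eta> > 0" for \<eta>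
  proof -
    obtain E C where EC: "isint_bound T E C" "prob (space M - E) \<le> \<eta>" using isint_bound_exists[OF T \<eta>] by blast
    then have "E \<in> events" by (simp add: isint_bound_def)
    then show ?thesis using mild_bound[OF EC(1), of y0] EC(2) by blast
  qed
  show ?thesis
    unfolding weakly_bochner_regular_def
  proof (intro conjI allI impI)
    fix f :: "real \<Rightarrow> 'v" assume f: "continuous_on {0..T} f"
    have "bounded (f ` {0..T})" by (intro compact_imp_bounded compact_continuous_image f) simp
    then obtain m where m: "\<And>s. s \<in> {0..T} \<Longrightarrow> norm (f s) \<le> m" unfolding bounded_iff by blast
    show "AE \<omega> in M. set_integrable lborel {0..T} (\<lambda>s. inner (Y s \<omega>) (f s))"
    proof (rule AE_from_large_events)
      fix \<eta> :: real assume \<eta>: "\<eta> > 0"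
      obtain E b where E: "E \<in> events" "prob (space M - E) \<le> \<eta>" "0 \<le> b"
        "\<And>t v. t \<in> {0..T} \<Longrightarrow> nE E (\<lambda>\<omega>. inner (mild y0 t \<omega>) v) \<le> ennreal (b * norm v)" using large[OF \<eta>] by (elim exE conjE) blast
      then show "\<exists>E\<in>events. prob (space M - E) \<le> \<eta> \<and> (AE \<omega> in M. \<omega> \<in> E \<longrightarrow> set_integrable lborel {0..T} (\<lambda>s. inner (Y s \<omega>) (f s)))"
        using path(1)[OF f m E(3,1,4)] by (intro bexI[of _ E]) auto
    qed
  next
    fix gs :: "nat \<Rightarrow> real \<Rightarrow> 'v"
    assume "(\<forall>n. continuous_on {0..T} (gs n)) \<and> (\<forall>e>0. \<exists>N. \<forall>n\<ge>N. \<forall>s\<in>{0..T}. norm (gs n s) \<le> e)"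
    then have gc: "\<And>n. continuous_on {0..T} (gs n)" and gu: "\<And>e. e > 0 \<Longrightarrow> \<exists>N. \<forall>n\<ge>N. \<forall>s\<in>{0..T}. norm (gs n s) \<le> e" by auto
    let ?X = "\<lambda>n \<omega>. LINT s:{0..T}|lborel. inner (Y s \<omega>) (gs n s)"
    have meas: "?X n \<in> borel_measurable M" for n
    proof -
      have "bounded (gs n ` {0..T})" by (intro compact_imp_bounded compact_continuous_image gc) simp
      then obtain m where m: "\<And>s. s \<in> {0..T} \<Longrightarrow> norm (gs n s) \<le> m" unfolding bounded_iff by blast
      obtain E b where E: "E \<in> events" "prob (space M - E) \<le> 1" "0 \<le> b"
        "\<And>t v. t \<in> {0..T} \<Longrightarrow> nE E (\<lambda>\<omega>. inner (mild y0 t \<omega>) v) \<le> ennreal (b * norm v)" using large[of 1] by auto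
      show ?thesis by (rule path(2)[OF gc m E(3,1,4)])
    qed
    show "conv_in_prob M ?X (\<lambda>_. 0)"
    proof (rule conv_in_probI)
      fix e :: real assume e: "e > 0"
      obtain E b where E: "E \<in> events" "prob (space M - E) \<le> e / 2" "0 \<le> b"
        "\<And>t v. t \<in> {0..T} \<Longrightarrow> nE E (\<lambda>\<omega>. inner (mild y0 t \<omega>) v) \<le> ennreal (b * norm v)" using large[of "e / 2"] e by auto
      \<comment> \<open>Chosen so that b m T / e is at most e/2.\<close>
      define m where "m = e\<^sup>2 / (2 * (b * T + 1))"
      have bT: "b * T + 1 > 0" using E(3) T by (simp add: add_nonneg_pos)
      have m: "m > 0" using e bT by (simp add: m_def)
      obtain N where N: "\<And>n s. n \<ge> N \<Longrightarrow> s \<in> {0..T} \<Longrightarrow> norm (gs n s) \<le> m" using gu[OF m] by blast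
      have "ptail (\<lambda>\<omega>. ?X n \<omega> - 0) e \<le> e" if n: "n \<ge> N" for n
      proof -
        have "nE E (?X n) \<le> ennreal (b * m * T)" by (rule path(3)[OF gc N[OF n] E(3,1,4)])
        then have "ptail (?X n) e \<le> prob (space M - E) + (b * m * T) / e"
          using e E(1,3) m T by (intro ptail_le_large_event meas) (auto simp: nE_def)
        also have "(b * m * T) / e \<le> ((b * T + 1) * m) / e"
          using m e by (intro divide_right_mono) (auto simp: algebra_simps)
        also have "\<dots> = e / 2"
        proof -
          have "k * (e\<^sup>2 / (2 * k)) / e = e / 2" if "k > 0" for k using that e by (simp add: power2_eq_square)
          from this[OF bT] show ?thesis unfolding m_def .
        qed
        finally show ?thesis using E(2) by simp
      qed
      then show "\<exists>N. \<forall>n\<ge>N. ptail (\<lambda>\<omega>. ?X n \<omega> - 0) e \<le> e" by blast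
    qed (use meas in auto)
  qed
qed

section \<open>The weak equation through Riemann sums\<close>

context
  fixes D :: "'v set" and A :: "'v \<Rightarrow> 'v" and v :: 'v
  assumes gen: "is_generator S D A" and v: "v \<in> adj_dom D A"
begin

abbreviation w :: 'v where "w \<equiv> adj_op D A v"

text \<open>\<open>g w\<close> is the weak derivative of \<open>g v\<close>, because w is the image
  of v under the adjoint of the generator. Testing with z avoids a vector-valued integral of
  \<open>g w\<close>.\<close>

lemma g_increment:
  assumes ab: "0 \<le> a" "a \<le> b" and \<epsilon>: "0 \<le> \<epsilon>"
    and mod: "\<And>s. s \<in> {a..b} \<Longrightarrow> norm (g w s - g w c) \<le> \<epsilon>"
  shows "norm (g v b - g v a - (b - a) *\<^sub>R g w c) \<le> \<epsilon> * (b - a)"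
proof (rule norm_le_innerI)
  fix z
  let ?f = "\<lambda>s. inner (S s (B z)) w"
  have cont: "continuous_on {0..} ?f" by (intro continuous_intros c0_semigroup_continuous[OF S])
  have "\<bar>integral {a..a + (b - a)} ?f - (b - a) * inner z (g w c)\<bar> \<le> (\<epsilon> * norm z) * (b - a)"
  proof (rule integral_near_const[OF cont])
    fix s assume "s \<in> {a..a + (b - a)}"
    then have "norm (g w s - g w c) \<le> \<epsilon>" by (intro mod) auto
    have "\<bar>?f s - inner z (g w c)\<bar> = \<bar>inner z (g w s - g w c)\<bar>" by (simp add: inner_g[symmetric] inner_diff_right)
    also have "\<dots> \<le> norm z * norm (g w s - g w c)" by (rule Cauchy_Schwarz_ineq2)
    also have "\<dots> \<le> norm z * \<epsilon>" by (intro mult_left_mono \<open>norm (g w s - g w c) \<le> \<epsilon>\<close>) simp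
    finally show "\<bar>?f s - inner z (g w c)\<bar> \<le> \<epsilon> * norm z" by (simp add: mult.commute)
  qed (use ab in auto)
  moreover have "inner z (g v b - g v a - (b - a) *\<^sub>R g w c) = integral {a..b} ?f - (b - a) * inner z (g w c)"
    using semigroup_weak_integral[OF S gen v ab, of "B z"] by (simp add: inner_diff_right inner_g)
  ultimately show "inner z (g v b - g v a - (b - a) *\<^sub>R g w c) \<le> norm z * (\<epsilon> * (b - a))"
    by (simp add: mult_ac)
qed (use \<epsilon> ab in simp)

text \<open>\<Phi> s is the integral over times up to s of the kernel for w at r. In a cell that
  contains r the kernel jumps, and the part of the cell before r, where it is 0, costs at most (b -
  a) K.\<close>

lemma kernel_cell:
  assumes ab: "0 \<le> a" "a \<le> b" "b \<le> T" and \<epsilon>: "0 \<le> \<epsilon>" and r: "0 < r"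
    and mod: "\<And>s s'. s \<in> {0..T} \<Longrightarrow> s' \<in> {0..T} \<Longrightarrow> \<bar>s - s'\<bar> \<le> b - a \<Longrightarrow> norm (g w s - g w s') \<le> \<epsilon>"
    and K: "0 \<le> K" "\<And>s. s \<in> {0..T} \<Longrightarrow> norm (g w s) \<le> K"
  defines "\<Phi> \<equiv> \<lambda>s. if r \<le> s then g v (s - r) - g v 0 else 0"
  shows "norm (\<Phi> b - \<Phi> a - (b - a) *\<^sub>R kf b w r) \<le> (b - a) * (\<epsilon> + K * indicator {a<..b} r)"
proof -
  consider "r \<le> a" | "a < r" "r \<le> b" | "b < r" by linarith
  then show ?thesis
  proof cases
    case 1
    have "norm (g v (b - r) - g v (a - r) - ((b - r) - (a - r)) *\<^sub>R g w (b - r)) \<le> \<epsilon> * ((b - r) - (a - r))"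
      by (rule g_increment[OF _ _ \<epsilon> mod]) (use 1 ab r in auto)
    then show ?thesis using 1 ab by (simp add: \<Phi>_def kf_def mult.commute)
  next
    case 2
    have "norm (g v (b - r) - g v 0 - ((b - r) - 0) *\<^sub>R g w (b - r)) \<le> \<epsilon> * ((b - r) - 0)"
      by (rule g_increment[OF _ _ \<epsilon> mod]) (use 2 ab r in auto)
    also have "\<dots> \<le> \<epsilon> * (b - a)" using \<epsilon> 2 by (intro mult_left_mono) auto
    finally have 3: "norm (g v (b - r) - g v 0 - (b - r) *\<^sub>R g w (b - r)) \<le> \<epsilon> * (b - a)" by simp
    have "norm ((r - a) *\<^sub>R g w (b - r)) \<le> (b - a) * K"
      using 2 ab r K by (auto intro!: mult_mono)
    moreover have "\<Phi> b - \<Phi> a - (b - a) *\<^sub>R kf b w r = (g v (b - r) - g v 0 - (b - r) *\<^sub>R g w (b - r)) - (r - a) *\<^sub>R g w (b - r)"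
      using 2 by (simp add: \<Phi>_def kf_def algebra_simps)
    ultimately have "norm (\<Phi> b - \<Phi> a - (b - a) *\<^sub>R kf b w r) \<le> \<epsilon> * (b - a) + (b - a) * K"
      apply (simp only:)
      using norm_triangle_ineq4[of "g v (b - r) - g v 0 - (b - r) *\<^sub>R g w (b - r)" "(r - a) *\<^sub>R g w (b - r)"] 3 by linarith
    then show ?thesis using 2 by (simp add: algebra_simps)
  next
    case 3
    then show ?thesis using ab \<epsilon> by (simp add: \<Phi>_def kf_def)
  qed
qed

text \<open>The deterministic core of the Fubini argument: summing over the cells telescopes the
  time integral of the kernel, and since r lies in at most one cell the jump error is counted
  once.\<close>

lemma kernel_riemann:
  assumes t: "t \<in> {0..T}" and \<epsilon>: "0 \<le> \<epsilon>" and r: "r \<in> {0<..T}"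
    and mod: "\<And>s s'. s \<in> {0..T} \<Longrightarrow> s' \<in> {0..T} \<Longrightarrow> \<bar>s - s'\<bar> \<le> t / real (Suc n) \<Longrightarrow> norm (g w s - g w s') \<le> \<epsilon>"
    and K: "0 \<le> K" "\<And>s. s \<in> {0..T} \<Longrightarrow> norm (g w s) \<le> K"
  shows "norm ((\<Sum>j<Suc n. (t / real (Suc n)) *\<^sub>R kf (t * real (Suc j) / real (Suc n)) w r) - (kf t v r - indicator {0<..t} r *\<^sub>R g v 0))
    \<le> t * \<epsilon> + t / real (Suc n) * K"
proof -
  define p where "p j = t * real j / real (Suc n)" for j
  define \<delta> where "\<delta> = t / real (Suc n)"
  have pd: "p (Suc j) - p j = \<delta>" for j unfolding p_def \<delta>_def by (rule grid_cell_width)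
  have \<delta>: "0 \<le> \<delta>" using t by (simp add: \<delta>_def)
  have pb: "0 \<le> p j" "p j \<le> t" if "j \<le> Suc n" for j
    using grid_point_bounds[of t j n] t that by (auto simp: p_def)
  let ?\<Phi> = "\<lambda>s. if r \<le> s then g v (s - r) - g v 0 else 0"
  have "p (Suc n) = t" by (simp add: p_def)
  then have "kf t v r - indicator {0<..t} r *\<^sub>R g v 0 = ?\<Phi> (p (Suc n)) - ?\<Phi> (p 0)"
    using r by (auto simp: kf_def p_def)
  also have "\<dots> = (\<Sum>j<Suc n. ?\<Phi> (p (Suc j)) - ?\<Phi> (p j))"
    by (rule sum_lessThan_telescope[symmetric])
  finally have eq: "kf t v r - indicator {0<..t} r *\<^sub>R g v 0 = (\<Sum>j<Suc n. ?\<Phi> (p (Suc j)) - ?\<Phi> (p j))" .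
  have "norm ((kf t v r - indicator {0<..t} r *\<^sub>R g v 0) - (\<Sum>j<Suc n. \<delta> *\<^sub>R kf (p (Suc j)) w r))
      = norm (\<Sum>j<Suc n. ?\<Phi> (p (Suc j)) - ?\<Phi> (p j) - \<delta> *\<^sub>R kf (p (Suc j)) w r)"
    unfolding eq sum_subtractf by (simp only:)
  also have "\<dots> \<le> (\<Sum>j<Suc n. \<delta> * (\<epsilon> + K * indicator {p j<..p (Suc j)} r))"
  proof (rule sum_norm_le)
    fix j assume "j \<in> {..<Suc n}"
    then have j: "j \<le> Suc n" "Suc j \<le> Suc n" by auto
    have "norm (?\<Phi> (p (Suc j)) - ?\<Phi> (p j) - (p (Suc j) - p j) *\<^sub>R kf (p (Suc j)) w r)
        \<le> (p (Suc j) - p j) * (\<epsilon> + K * indicator {p j<..p (Suc j)} r)"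
    proof (rule kernel_cell[OF _ _ _ \<epsilon> _ _ K])
      show "0 \<le> p j" "p (Suc j) \<le> T" using pb[OF j(1)] pb[OF j(2)] t by auto
      show "p j \<le> p (Suc j)" using pd[of j] \<delta> by linarith
      show "0 < r" using r by simp
      show "norm (g w s - g w s') \<le> \<epsilon>" if "s \<in> {0..T}" "s' \<in> {0..T}" "\<bar>s - s'\<bar> \<le> p (Suc j) - p j" for s s'
        using that unfolding pd \<delta>_def by (rule mod)
    qed
    then show "norm (?\<Phi> (p (Suc j)) - ?\<Phi> (p j) - \<delta> *\<^sub>R kf (p (Suc j)) w r) \<le> \<delta> * (\<epsilon> + K * indicator {p j<..p (Suc j)} r)"
      unfolding pd .
  qed
  also have "\<dots> = real (Suc n) * \<delta> * \<epsilon> + \<delta> * K * (\<Sum>j<Suc n. indicator {p j<..p (Suc j)} r)"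
    unfolding distrib_left sum.distrib sum_distrib_left by (simp add: mult.assoc del: sum.lessThan_Suc of_nat_Suc)
  also have "real (Suc n) * \<delta> = t" by (simp add: \<delta>_def)
  also have "(\<Sum>j<Suc n. indicator {p j<..p (Suc j)} r) \<le> (1::real)"
  proof -
    \<comment> \<open>The cells are disjoint: the sum is the grid step function with all values
      1.\<close>
    have sum: "(\<Sum>j<Suc n. indicator {p j<..p (Suc j)} r) = sf (grid t (\<lambda>_ _. 1::real) n) r"
      unfolding sf_grid p_def by simp
    show ?thesis
    proof (cases "r \<le> t")
      case True
      then obtain j where "j < Suc n" "r \<in> {t * real j / real (Suc n)<..t * real (Suc j) / real (Suc n)}"
        using grid_cell_exists[of r t n] r unfolding greaterThanAtMost_iff by blast
      then show ?thesis unfolding sum using sf_grid_cell[of r t j n "\<lambda>_ _. 1::real"] t by simp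
    next
      case False then show ?thesis unfolding sum using sf_grid_outside[of t r "\<lambda>_ _. 1::real" n] t by simp
    qed
  qed
  finally have "norm ((kf t v r - indicator {0<..t} r *\<^sub>R g v 0) - (\<Sum>j<Suc n. \<delta> *\<^sub>R kf (p (Suc j)) w r)) \<le> t * \<epsilon> + \<delta> * K * 1"
    using \<delta> K(1) by (simp add: mult_left_mono)
  then show ?thesis unfolding norm_minus_commute[of "sum _ _"] by (simp only: p_def \<delta>_def mult_1_right)
qed

text \<open>The same comparison for the orbit of y, where continuity leaves no jump term.\<close>

lemma orbit_riemann:
  assumes t: "t \<in> {0..T}"
    and mod: "\<And>s s'. s \<in> {0..T} \<Longrightarrow> s' \<in> {0..T} \<Longrightarrow> \<bar>s - s'\<bar> \<le> t / real (Suc n) \<Longrightarrow> \<bar>inner (S s' y) w - inner (S s y) w\<bar> \<le> \<epsilon>"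
  shows "\<bar>(\<Sum>j<Suc n. t / real (Suc n) * inner (S (t * real (Suc j) / real (Suc n)) y) w) - (inner (S t y) v - inner y v)\<bar> \<le> t * \<epsilon>"
proof -
  define p where "p j = t * real j / real (Suc n)" for j
  define \<delta> where "\<delta> = t / real (Suc n)"
  have pd: "p (Suc j) = p j + \<delta>" for j using grid_cell_width[of t j n] by (simp add: p_def \<delta>_def)
  have \<delta>: "0 \<le> \<delta>" using t by (simp add: \<delta>_def)
  have pb: "0 \<le> p j" "p j \<le> t" if "j \<le> Suc n" for j
    using grid_point_bounds[of t j n] t that by (auto simp: p_def)
  have cont: "continuous_on {0..} (\<lambda>s. inner (S s y) w)" by (intro continuous_intros c0_semigroup_continuous[OF S])
  have "inner (S t y) v - inner y v = inner (S (p (Suc n)) y) v - inner (S (p 0) y) v"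
    by (simp add: p_def c0_semigroupD(1)[OF S])
  also have "\<dots> = (\<Sum>j<Suc n. inner (S (p (Suc j)) y) v - inner (S (p j) y) v)"
    by (rule sum_lessThan_telescope[of "\<lambda>j. inner (S (p j) y) v", symmetric])
  finally have "\<bar>(inner (S t y) v - inner y v) - (\<Sum>j<Suc n. \<delta> * inner (S (p (Suc j)) y) w)\<bar>
      = \<bar>\<Sum>j<Suc n. inner (S (p (Suc j)) y) v - inner (S (p j) y) v - \<delta> * inner (S (p (Suc j)) y) w\<bar>"
    unfolding sum_subtractf by (simp only:)
  also have "\<dots> \<le> (\<Sum>j<Suc n. \<epsilon> * \<delta>)"
  proof (rule order_trans[OF sum_abs], rule sum_mono)
    fix j assume "j \<in> {..<Suc n}"
    then have j: "j \<le> Suc n" "Suc j \<le> Suc n" by auto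
    have "inner (S (p (Suc j)) y) v - inner (S (p j) y) v = integral {p j..p j + \<delta>} (\<lambda>s. inner (S s y) w)"
      using semigroup_weak_integral[OF S gen v, of "p j" "p (Suc j)" y] pb[OF j(1)] \<delta> unfolding pd by simp
    moreover have "\<bar>integral {p j..p j + \<delta>} (\<lambda>s. inner (S s y) w) - \<delta> * inner (S (p (Suc j)) y) w\<bar> \<le> \<epsilon> * \<delta>"
    proof (rule integral_near_const[OF cont pb(1)[OF j(1)] \<delta>])
      fix s assume s: "s \<in> {p j..p j + \<delta>}"
      show "\<bar>inner (S s y) w - inner (S (p (Suc j)) y) w\<bar> \<le> \<epsilon>"
        by (rule mod) (use s pb[OF j(1)] pb[OF j(2)] pd[of j] t in \<open>auto simp: \<delta>_def\<close>)
    qed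
    ultimately show "\<bar>inner (S (p (Suc j)) y) v - inner (S (p j) y) v - \<delta> * inner (S (p (Suc j)) y) w\<bar> \<le> \<epsilon> * \<delta>" by simp
  qed
  also have "\<dots> = t * \<epsilon>" by (simp add: \<delta>_def)
  finally show ?thesis unfolding abs_minus_commute[of "sum _ _"] by (simp only: p_def \<delta>_def)
qed

lemma g_0: "g v' 0 = adj B v'"
proof -
  have "S 0 o\<^sub>L B = B" by (rule blinfun_eqI) (simp add: c0_semigroupD(1)[OF S])
  then show ?thesis by (simp add: g_def)
qed

text \<open>The stochastic Fubini theorem for the convolution, through Riemann sums.\<close>

lemma stochastic_riemann:
  assumes E: "isint_bound T E C" and t: "t \<in> {0..T}" and \<epsilon>: "0 \<le> \<epsilon>"
    and mod: "\<And>s s'. s \<in> {0..T} \<Longrightarrow> s' \<in> {0..T} \<Longrightarrow> \<bar>s - s'\<bar> \<le> t / real (Suc n) \<Longrightarrow> norm (g w s - g w s') \<le> \<epsilon>"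
    and K: "0 \<le> K" "\<And>s. s \<in> {0..T} \<Longrightarrow> norm (g w s) \<le> K"
  shows "nE E (\<lambda>\<omega>. (\<Sum>j<Suc n. t / real (Suc n) * inner (cI (t * real (Suc j) / real (Suc n)) \<omega>) w) - (inner (cI t \<omega>) v - L t (adj B v) \<omega>))
    \<le> ennreal (C * sqrt T * (t * \<epsilon> + t / real (Suc n) * K))"
proof -
  let ?s = "\<lambda>j. t * real (Suc j) / real (Suc n)"
  \<comment> \<open>A one-step list whose integral is almost surely \<open>L t (adj B v)\<close>,
    because \<open>g v 0 = adj B v\<close> and \<open>L\<close> starts at 0; it brings the noise
    term under the same linear bound.\<close>
  let ?H = "[(0, t, g v 0)]"
  have sT: "?s j \<in> {0..T}" if "j < Suc n" for j
    using grid_point_bounds[of t "Suc j" n] t that unfolding atLeastAtMost_iff by (meson Suc_leI order_trans)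
  have "isint T (\<lambda>r. \<Sum>j\<in>{..<Suc n}. (t / real (Suc n)) *\<^sub>R kf (?s j) w r) (\<lambda>\<omega>. \<Sum>j\<in>{..<Suc n}. t / real (Suc n) * inner (cI (?s j) \<omega>) w)"
    by (rule isint_sum) (use cI(2)[OF sT] T in auto)
  moreover have "isint T (\<lambda>r. 1 *\<^sub>R kf t v r + (-1) *\<^sub>R sf ?H r) (\<lambda>\<omega>. 1 * inner (cI t \<omega>) v + (-1) * sI ?H \<omega>)"
    by (intro isint_linear cI(2)[OF t] isint_step) (use t in simp)
  ultimately have i: "isint T (\<lambda>r. 1 *\<^sub>R (\<Sum>j\<in>{..<Suc n}. (t / real (Suc n)) *\<^sub>R kf (?s j) w r) + (-1) *\<^sub>R (1 *\<^sub>R kf t v r + (-1) *\<^sub>R sf ?H r))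
      (\<lambda>\<omega>. 1 * (\<Sum>j\<in>{..<Suc n}. t / real (Suc n) * inner (cI (?s j) \<omega>) w) + (-1) * (1 * inner (cI t \<omega>) v + (-1) * sI ?H \<omega>))"
    by (rule isint_linear)
  have "nE E (\<lambda>\<omega>. 1 * (\<Sum>j\<in>{..<Suc n}. t / real (Suc n) * inner (cI (?s j) \<omega>) w) + (-1) * (1 * inner (cI t \<omega>) v + (-1) * sI ?H \<omega>))
      \<le> ennreal (C * sqrt T * (t * \<epsilon> + t / real (Suc n) * K))"
    unfolding nE_def
  proof (rule isint_boundD_sup[OF E i])
    show "0 \<le> t * \<epsilon> + t / real (Suc n) * K" using t \<epsilon> K by simp
    fix r assume r: "r \<in> {0<..T}"
    have "sf ?H r = indicator {0<..t} r *\<^sub>R g v 0" by (simp add: sf_def)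
    then have "1 *\<^sub>R x + (-1) *\<^sub>R (1 *\<^sub>R kf t v r + (-1) *\<^sub>R sf ?H r) = x - (kf t v r - indicator {0<..t} r *\<^sub>R g v 0)" for x
      by simp
    then show "norm (1 *\<^sub>R (\<Sum>j\<in>{..<Suc n}. (t / real (Suc n)) *\<^sub>R kf (?s j) w r) + (-1) *\<^sub>R (1 *\<^sub>R kf t v r + (-1) *\<^sub>R sf ?H r)) \<le> t * \<epsilon> + t / real (Suc n) * K"
      using kernel_riemann[where n = n, OF t \<epsilon> r mod K] by (simp only:)
  qed
  moreover have "AE \<omega> in M. sI ?H \<omega> = L t (adj B v) \<omega>"
    using L_0[of "g v 0"] by eventually_elim (simp add: sI_def g_0)
  then have "nE E (\<lambda>\<omega>. 1 * (\<Sum>j\<in>{..<Suc n}. t / real (Suc n) * inner (cI (?s j) \<omega>) w) + (-1) * (1 * inner (cI t \<omega>) v + (-1) * sI ?H \<omega>))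
    = nE E (\<lambda>\<omega>. (\<Sum>j<Suc n. t / real (Suc n) * inner (cI (?s j) \<omega>) w) - (inner (cI t \<omega>) v - L t (adj B v) \<omega>))"
    by (intro nE_cong_AE) (auto elim!: eventually_mono simp del: sum.lessThan_Suc of_nat_Suc)
  ultimately show ?thesis by simp
qed

text \<open>The Riemann sum is the path integral of a process constant on each cell. The modulus of
  the mild process bounds the difference at every time other than 0, and the path integral bound
  transfers this to the integrals.\<close>

lemma path_riemann:
  assumes Yp: "prog_measurable M (nat_filtration M L) T Y" and Ym: "\<And>t. t \<in> {0..T} \<Longrightarrow> AE \<omega> in M. Y t \<omega> = mild y0 t \<omega>"
    and E: "isint_bound T E C" and t: "t \<in> {0..T}" and \<epsilon>: "0 \<le> \<epsilon>"
    and mod: "\<And>s s'. s \<in> {0..T} \<Longrightarrow> s' \<in> {0..T} \<Longrightarrow> \<bar>s - s'\<bar> \<le> t / real (Suc n) \<Longrightarrow>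
      nE E (\<lambda>\<omega>. inner (mild y0 s' \<omega>) u - inner (mild y0 s \<omega>) u) \<le> ennreal \<epsilon>"
  shows "(\<lambda>\<omega>. LINT s:{0..t}|lborel. inner (Y s \<omega>) u) \<in> borel_measurable M"
    "nE E (\<lambda>\<omega>. (LINT s:{0..t}|lborel. inner (Y s \<omega>) u) - (\<Sum>j<Suc n. t / real (Suc n) * inner (mild y0 (t * real (Suc j) / real (Suc n)) \<omega>) u))
      \<le> ennreal (\<epsilon> * t)"
proof -
  have Ee [measurable]: "E \<in> events" using E by (auto simp: isint_bound_def)
  have Yj [measurable]: "(\<lambda>x. Y (\<rho> (fst x)) (snd x)) \<in> borel_measurable (lborel \<Otimes>\<^sub>M M)"
    by (rule prog_measurable_joint[OF Yp])
  let ?s = "\<lambda>j. t * real (Suc j) / real (Suc n)"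
  let ?c = "\<lambda>j. {t * real j / real (Suc n)<..?s j}"
  have sT: "?s j \<in> {0..T}" if "j < Suc n" for j
    using grid_point_bounds[of t "Suc j" n] t that unfolding atLeastAtMost_iff by (meson Suc_leI order_trans)
  have mm [measurable]: "mild y0 (?s j) \<in> borel_measurable M" if "j < Suc n" for j by (rule mild_measurable[OF sT[OF that]])
  let ?h = "\<lambda>x. inner (Y (\<rho> (fst x)) (snd x)) u"
  let ?q = "\<lambda>x. \<Sum>j<Suc n. indicator (?c j) (fst x) * inner (mild y0 (?s j) (snd x)) u"
  have hm: "?h \<in> borel_measurable (lborel \<Otimes>\<^sub>M M)" by measurable
  have qm: "?q \<in> borel_measurable (lborel \<Otimes>\<^sub>M M)"
  proof (rule borel_measurable_sum)
    fix j assume "j \<in> {..<Suc n}"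
    then have [measurable]: "mild y0 (?s j) \<in> borel_measurable M" by (intro mm) simp
    show "(\<lambda>x. indicator (?c j) (fst x) * inner (mild y0 (?s j) (snd x)) u) \<in> borel_measurable (lborel \<Otimes>\<^sub>M M)" by measurable
  qed
  have t0: "0 \<le> t" and emt: "emeasure lborel {0..t} = ennreal t" and A: "{0..t} \<in> sets borel" using t by auto
  have rho: "\<rho> s = s" if "s \<in> {0..t}" for s using that t by (intro \<rho>(2)) auto
  have eq: "(LINT s:{0..t}|lborel. ?h (s, \<omega>)) = (LINT s:{0..t}|lborel. inner (Y s \<omega>) u)" for \<omega>
    by (intro set_lebesgue_integral_cong) (use rho in auto)
  obtain b where b: "b \<ge> 0" "\<And>t v. t \<in> {0..T} \<Longrightarrow> nE E (\<lambda>\<omega>. inner (mild y0 t \<omega>) v) \<le> ennreal (b * norm v)"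
    using mild_bound[OF E, of y0] by blast
  have nEY: "nE E (\<lambda>\<omega>. ?h (s, \<omega>) - X \<omega>) = nE E (\<lambda>\<omega>. inner (mild y0 s \<omega>) u - X \<omega>)" if "s \<in> {0..t}" for s X
  proof (rule nE_cong_AE)
    have "AE \<omega> in M. Y s \<omega> = mild y0 s \<omega>" using that t by (intro Ym) auto
    then show "AE \<omega> in M. ?h (s, \<omega>) - X \<omega> = inner (mild y0 s \<omega>) u - X \<omega>"
      by eventually_elim (simp add: rho[OF that])
  qed
  have bd1: "AE s in lborel. s \<in> {0..t} \<longrightarrow> nE E (\<lambda>\<omega>. ?h (s, \<omega>)) \<le> ennreal (b * norm u)"
    using nEY[of _ "\<lambda>_. 0"] b(2) t by (intro AE_I2) auto
  note p1 = path_integral[OF hm Ee A t0 emt mult_nonneg_nonneg[OF b(1) norm_ge_zero] bd1]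
  show "(\<lambda>\<omega>. LINT s:{0..t}|lborel. inner (Y s \<omega>) u) \<in> borel_measurable M" using p1(2) unfolding eq .
  have dm: "(\<lambda>x. ?h x - ?q x) \<in> borel_measurable (lborel \<Otimes>\<^sub>M M)" by (rule borel_measurable_diff[OF hm qm])
  have bd2: "AE s in lborel. s \<in> {0..t} \<longrightarrow> nE E (\<lambda>\<omega>. ?h (s, \<omega>) - ?q (s, \<omega>)) \<le> ennreal \<epsilon>"
    using AE_lborel_singleton[of "0::real"]
  proof eventually_elim
    case (elim s)
    show ?case
    proof
      assume s: "s \<in> {0..t}"
      then have "0 < s" "s \<le> t" using elim by auto
      from grid_cell_exists[OF this, of n] obtain i where i: "i < Suc n" "s \<in> ?c i" by blast
      have qi: "?q (s, \<omega>) = inner (mild y0 (?s i) \<omega>) u" for \<omega>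
        using sf_grid_cell[OF i(2,1) t0, of "\<lambda>_ j. inner (mild y0 (?s j) \<omega>) u"] unfolding sf_grid by simp
      have "\<bar>?s i - s\<bar> \<le> t / real (Suc n)" using i(2) grid_cell_width[of t i n] unfolding greaterThanAtMost_iff by linarith
      then have "nE E (\<lambda>\<omega>. inner (mild y0 s \<omega>) u - inner (mild y0 (?s i) \<omega>) u) \<le> ennreal \<epsilon>"
        using s t sT[OF i(1)] by (intro mod) auto
      then show "nE E (\<lambda>\<omega>. ?h (s, \<omega>) - ?q (s, \<omega>)) \<le> ennreal \<epsilon>" unfolding qi nEY[OF s] .
    qed
  qed
  note p2 = path_integral[OF dm Ee A t0 emt \<epsilon> bd2]
  have qint: "set_integrable lborel {0..t} (\<lambda>s. ?q (s, \<omega>))" "(LINT s:{0..t}|lborel. ?q (s, \<omega>)) = (\<Sum>j<Suc n. t / real (Suc n) * inner (mild y0 (?s j) \<omega>) u)" for \<omega>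
  proof -
    have ind: "indicator {0..t} s *\<^sub>R ?q (s, \<omega>) = (\<Sum>j<Suc n. indicator (?c j) s * inner (mild y0 (?s j) \<omega>) u)" for s
    proof -
      have "indicator {0..t} s * (indicator (?c j) s * x) = indicator (?c j) s * x" if "j < Suc n" for j and x :: real
      proof -
        have "?c j \<subseteq> {0..t}"
        proof
          fix x assume "x \<in> ?c j"
          then have "t * real j / real (Suc n) < x" "x \<le> ?s j" unfolding greaterThanAtMost_iff by blast+
          moreover have "0 \<le> t * real j / real (Suc n)" "?s j \<le> t"
            using grid_point_bounds(1)[OF t0, of j n] grid_point_bounds(2)[OF t0, of "Suc j" n] that by (simp_all del: of_nat_Suc)
          ultimately show "x \<in> {0..t}" unfolding atLeastAtMost_iff by linarith
        qed
        then show ?thesis by (auto simp: indicator_def simp del: of_nat_Suc)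
      qed
      then show ?thesis unfolding real_scaleR_def sum_distrib_left fst_conv snd_conv case_prod_conv by (intro sum.cong refl) blast
    qed
    have i: "integrable lborel (\<lambda>s. indicator (?c j) s * x :: real)" for j x
      by (intro integrable_mult_left integrable_real_indicator emeasure_Ioc_finite) simp
    show "set_integrable lborel {0..t} (\<lambda>s. ?q (s, \<omega>))"
      unfolding set_integrable_def ind by (intro Bochner_Integration.integrable_sum i)
    have "(LINT s:{0..t}|lborel. ?q (s, \<omega>)) = (\<Sum>j<Suc n. LINT s|lborel. indicator (?c j) s * inner (mild y0 (?s j) \<omega>) u)"
      unfolding set_lebesgue_integral_def ind by (intro Bochner_Integration.integral_sum i)
    also have "\<dots> = (\<Sum>j<Suc n. t / real (Suc n) * inner (mild y0 (?s j) \<omega>) u)"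
    proof (rule sum.cong[OF refl])
      fix j
      have "t * real j / real (Suc n) \<le> ?s j" using t0 by (intro divide_right_mono mult_left_mono) auto
      then have "measure lborel (?c j) = t / real (Suc n)" using grid_cell_width[of t j n] by simp
      then show "(LINT s|lborel. indicator (?c j) s * inner (mild y0 (?s j) \<omega>) u) = t / real (Suc n) * inner (mild y0 (?s j) \<omega>) u"
        by simp
    qed
    finally show "(LINT s:{0..t}|lborel. ?q (s, \<omega>)) = (\<Sum>j<Suc n. t / real (Suc n) * inner (mild y0 (?s j) \<omega>) u)" .
  qed
  have "AE \<omega> in M. \<omega> \<in> E \<longrightarrow> (LINT s:{0..t}|lborel. ?h (s, \<omega>) - ?q (s, \<omega>)) =
      (LINT s:{0..t}|lborel. inner (Y s \<omega>) u) - (\<Sum>j<Suc n. t / real (Suc n) * inner (mild y0 (?s j) \<omega>) u)"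
    using p1(1)
  proof eventually_elim
    case (elim \<omega>)
    show ?case
    proof
      assume "\<omega> \<in> E"
      with elim have "set_integrable lborel {0..t} (\<lambda>s. ?h (s, \<omega>))" by blast
      from set_integral_diff(2)[OF this qint(1)]
      show "(LINT s:{0..t}|lborel. ?h (s, \<omega>) - ?q (s, \<omega>)) =
          (LINT s:{0..t}|lborel. inner (Y s \<omega>) u) - (\<Sum>j<Suc n. t / real (Suc n) * inner (mild y0 (?s j) \<omega>) u)"
        unfolding eq qint(2) .
    qed
  qed
  from p2(3)[unfolded nE_cong_on[OF this]]
  show "nE E (\<lambda>\<omega>. (LINT s:{0..t}|lborel. inner (Y s \<omega>) u) - (\<Sum>j<Suc n. t / real (Suc n) * inner (mild y0 (?s j) \<omega>) u)) \<le> ennreal (\<epsilon> * t)" .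
qed

lemma mild_weak_equation:
  assumes Yp: "prog_measurable M (nat_filtration M L) T Y" and Ym: "\<And>t. t \<in> {0..T} \<Longrightarrow> AE \<omega> in M. Y t \<omega> = mild y0 t \<omega>"
    and t: "t \<in> {0..T}"
  shows "AE \<omega> in M. inner (Y t \<omega>) v = inner y0 v + (LINT s:{0..t}|lborel. inner (Y s \<omega>) w) + L t (adj B v) \<omega>"
proof -
  \<comment> \<open>The defect of the equation, with the mild process in place of Y at the final
    time so that it splits into orbit and stochastic integral; the modification property restores Y
    at the end.\<close>
  define \<Delta> where "\<Delta> \<omega> = (LINT s:{0..t}|lborel. inner (Y s \<omega>) w) - (inner (mild y0 t \<omega>) v - inner y0 v - L t (adj B v) \<omega>)" for \<omega>
  have cIm [measurable]: "cI s \<in> borel_measurable M" if "s \<in> {0..T}" for s by (rule cI[OF that])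
  obtain K0 where K0: "K0 > 0" "\<And>r v. r \<in> {0..T} \<Longrightarrow> norm (g v r) \<le> K0 * norm v" using g_bound by blast
  define K where "K = K0 * norm w"
  have K: "0 \<le> K" "\<And>s. s \<in> {0..T} \<Longrightarrow> norm (g w s) \<le> K" using K0 by (auto simp: K_def)
  have "AE \<omega> in M. \<Delta> \<omega> = 0"
  proof (rule AE_from_large_events)
    fix \<eta> :: real assume "\<eta> > 0"
    then obtain E C where E: "isint_bound T E C" "prob (space M - E) \<le> \<eta>" using isint_bound_exists[OF T] by blast
    have C: "0 \<le> C" "E \<in> events" using E by (auto simp: isint_bound_def)
    have main: "\<Delta> \<in> borel_measurable M \<and> nE E \<Delta> \<le> ennreal e" if e: "e > 0" for e
    proof -
      \<comment> \<open>c dominates both C sqrt T and 1, so one choice of \<epsilon> serves the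
        stochastic and the deterministic sums.\<close>
      define c where "c = C * sqrt T + 1"
      have c: "c \<ge> 1" using C T by (simp add: c_def)
      define \<epsilon> where "\<epsilon> = e / (4 * (T + 1) * c)"
      have \<epsilon>: "\<epsilon> > 0" using e T c by (simp add: \<epsilon>_def)
      have cancel: "c * (k * (e / (4 * k * c))) = e / 4" if "c \<noteq> 0" "k \<noteq> 0" for k using that by simp
      have \<epsilon>c: "c * (t * \<epsilon>) \<le> e / 4"
      proof -
        have "c * (t * \<epsilon>) \<le> c * ((T + 1) * \<epsilon>)" using t \<epsilon> c by (intro mult_left_mono mult_right_mono) auto
        also have "\<dots> = e / 4"
        proof -
          have "c \<noteq> 0" "T + 1 \<noteq> 0" using c T by auto
          then show ?thesis unfolding \<epsilon>_def by (rule cancel)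
        qed
        finally show ?thesis .
      qed
      have \<epsilon>t: "t * \<epsilon> \<le> e / 4"
      proof -
        have "1 * (t * \<epsilon>) \<le> c * (t * \<epsilon>)" using t \<epsilon> c by (intro mult_right_mono) auto
        then show ?thesis using \<epsilon>c by linarith
      qed
      obtain d1 where d1: "d1 > 0" "\<forall>r\<in>{0..T}. \<forall>r'\<in>{0..T}. \<bar>r - r'\<bar> < d1 \<longrightarrow> norm (g w r - g w r') < \<epsilon>"
        using g_uniform[OF \<epsilon>] by blast
      obtain d2 where d2: "d2 > 0" "\<forall>s\<in>{0..T}. \<forall>t\<in>{0..T}. \<bar>s - t\<bar> < d2 \<longrightarrow> nE E (\<lambda>\<omega>. inner (mild y0 t \<omega>) w - inner (mild y0 s \<omega>) w) \<le> ennreal \<epsilon>"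
        using mild_modulus[OF E(1) \<epsilon>] by blast
      obtain d3 where d3: "d3 > 0" "\<forall>s\<in>{0..T}. \<forall>t\<in>{0..T}. \<bar>s - t\<bar> < d3 \<longrightarrow> \<bar>inner (S t y0) w - inner (S s y0) w\<bar> < \<epsilon>"
        using orbit_uniform[OF \<epsilon>] by blast
      define d4 where "d4 = e / (4 * (K + 1) * c)"
      have d4: "d4 > 0" using e K(1) c by (simp add: d4_def add_nonneg_pos)
      have "min (min d1 d2) (min d3 d4) > 0" using d1 d2 d3 d4 by simp
      then obtain n where n: "t / real (Suc n) < min (min d1 d2) (min d3 d4)" using grid_mesh_small by blast
      have K4: "c * (t / real (Suc n) * K) \<le> e / 4"
      proof -
        have "c * (t / real (Suc n) * K) \<le> c * (d4 * (K + 1))"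
          using n K(1) c d4 t by (intro mult_left_mono mult_mono) auto
        also have "\<dots> = e / 4"
        proof -
          have "c \<noteq> 0" "K + 1 \<noteq> 0" using K(1) c by auto
          then show ?thesis unfolding d4_def mult.commute[of _ "K + 1"] by (rule cancel[unfolded mult.commute[of 4]])
        qed
        finally show ?thesis .
      qed
      let ?s = "\<lambda>j. t * real (Suc j) / real (Suc n)"
      have sT: "?s j \<in> {0..T}" if "j < Suc n" for j
        using grid_point_bounds[of t "Suc j" n] t that unfolding atLeastAtMost_iff by (meson Suc_leI order_trans)
      let ?R1 = "\<lambda>\<omega>. (LINT s:{0..t}|lborel. inner (Y s \<omega>) w) - (\<Sum>j<Suc n. t / real (Suc n) * inner (mild y0 (?s j) \<omega>) w)"
      let ?R2 = "\<lambda>\<omega>. (\<Sum>j<Suc n. t / real (Suc n) * inner (cI (?s j) \<omega>) w) - (inner (cI t \<omega>) v - L t (adj B v) \<omega>)"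
      let ?c3 = "(\<Sum>j<Suc n. t / real (Suc n) * inner (S (?s j) y0) w) - (inner (S t y0) v - inner y0 v)"
      have mod2: "nE E (\<lambda>\<omega>. inner (mild y0 s' \<omega>) w - inner (mild y0 s \<omega>) w) \<le> ennreal \<epsilon>"
        if "s \<in> {0..T}" "s' \<in> {0..T}" "\<bar>s - s'\<bar> \<le> t / real (Suc n)" for s s'
        using d2(2) that n by (meson less_le_trans min.boundedE order.strict_trans1 order_refl)
      note R1 = path_riemann[where n = n, OF Yp Ym E(1) t less_imp_le[OF \<epsilon>] mod2]
      have mod1: "norm (g w s - g w s') \<le> \<epsilon>"
        if "s \<in> {0..T}" "s' \<in> {0..T}" "\<bar>s - s'\<bar> \<le> t / real (Suc n)" for s s'
        using d1(2) that n by (meson less_imp_le less_le_trans min.boundedE order.strict_trans1 order_refl)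
      have R2: "nE E ?R2 \<le> ennreal (C * sqrt T * (t * \<epsilon> + t / real (Suc n) * K))"
        by (rule stochastic_riemann[OF E(1) t less_imp_le[OF \<epsilon>] mod1 K])
      have mod3: "\<bar>inner (S s' y0) w - inner (S s y0) w\<bar> \<le> \<epsilon>"
        if "s \<in> {0..T}" "s' \<in> {0..T}" "\<bar>s - s'\<bar> \<le> t / real (Suc n)" for s s'
        using d3(2) that n by (meson less_imp_le less_le_trans min.boundedE order.strict_trans1 order_refl)
      have R3: "\<bar>?c3\<bar> \<le> t * \<epsilon>" by (rule orbit_riemann[OF t mod3])
      \<comment> \<open>The Riemann sum of the mild process splits into those of the orbit and of
        the convolution, so the defect is the sum of three errors: of the path integral, of the
        stochastic sum and of the orbit sum. They are bounded by e/4, e/2 and e/4.\<close>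
      have dec: "\<Delta> \<omega> = (?R1 \<omega> + ?R2 \<omega>) + ?c3" for \<omega>
        unfolding \<Delta>_def mild_def inner_add_left distrib_left sum.distrib by linarith
      have cIs [measurable]: "cI t \<in> borel_measurable M" by (rule cIm[OF t])
      have m2: "?R2 \<in> borel_measurable M"
        by (intro borel_measurable_diff borel_measurable_sum borel_measurable_times borel_measurable_inner borel_measurable_const L_measurable cIm t sT) simp
      have mms: "(\<lambda>\<omega>. \<Sum>j<Suc n. t / real (Suc n) * inner (mild y0 (?s j) \<omega>) w) \<in> borel_measurable M"
        by (intro borel_measurable_sum borel_measurable_times borel_measurable_inner borel_measurable_const mild_measurable sT) simp
      have m1: "?R1 \<in> borel_measurable M" by (rule borel_measurable_diff[OF R1(1) mms])
      have "nE E \<Delta> \<le> (nE E ?R1 + nE E ?R2) + nE E (\<lambda>_. ?c3)"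
      proof -
        have "nE E \<Delta> = nE E (\<lambda>\<omega>. (?R1 \<omega> + ?R2 \<omega>) + ?c3)" by (rule nE_cong_AE, rule AE_I2, rule dec)
        also have "\<dots> \<le> nE E (\<lambda>\<omega>. ?R1 \<omega> + ?R2 \<omega>) + nE E (\<lambda>_. ?c3)"
          by (intro nE_add_le borel_measurable_add m1 m2 C borel_measurable_const)
        also have "\<dots> \<le> (nE E ?R1 + nE E ?R2) + nE E (\<lambda>_. ?c3)"
          by (intro add_right_mono nE_add_le m1 m2 C)
        finally show ?thesis .
      qed
      also have "\<dots> \<le> (ennreal (e / 4) + ennreal (e / 2)) + ennreal (e / 4)"
      proof (intro add_mono)
        show "nE E ?R1 \<le> ennreal (e / 4)" using order_trans[OF R1(2) ennreal_leI] \<epsilon>t unfolding mult.commute[of t] by blast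
        show "nE E ?R2 \<le> ennreal (e / 2)"
        proof (rule order_trans[OF R2 ennreal_leI])
          have "C * sqrt T * (t * \<epsilon> + t / real (Suc n) * K) \<le> c * (t * \<epsilon> + t / real (Suc n) * K)"
            using t \<epsilon> K(1) by (intro mult_right_mono) (auto simp: c_def)
          then show "C * sqrt T * (t * \<epsilon> + t / real (Suc n) * K) \<le> e / 2"
            using \<epsilon>c K4 unfolding distrib_left[of c] by linarith
        qed
        show "nE E (\<lambda>_. ?c3) \<le> ennreal (e / 4)"
          by (rule order_trans[OF nE_const_le[OF C(2)] ennreal_leI]) (use R3 \<epsilon>t in linarith)
      qed
      also have "\<dots> = ennreal e" using e by (simp flip: ennreal_plus)
      finally have "nE E \<Delta> \<le> ennreal e" .
      moreover have "\<Delta> = (\<lambda>\<omega>. (?R1 \<omega> + ?R2 \<omega>) + ?c3)" by (rule ext) (rule dec)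
      then have "\<Delta> \<in> borel_measurable M" by (simp only:) (intro borel_measurable_add m1 m2 borel_measurable_const)
      ultimately show ?thesis by blast
    qed
    have "nE E \<Delta> \<le> 0 + ennreal e" if "e > 0" for e using main[OF that] by simp
    then have "nE E \<Delta> = 0" using ennreal_le_epsilon[of 0 "nE E \<Delta>"] by simp
    then have "AE \<omega> in M. \<omega> \<in> E \<longrightarrow> \<Delta> \<omega> = 0" using main[of 1] C by (intro nE_zero_AE) auto
    then show "\<exists>E\<in>events. prob (space M - E) \<le> \<eta> \<and> (AE \<omega> in M. \<omega> \<in> E \<longrightarrow> \<Delta> \<omega> = 0)" using E C by blast
  qed
  then show ?thesis using Ym[OF t] by eventually_elim (simp add: \<Delta>_def)
qed

end

end

theorem theorem4p3:
  fixes M :: "'w measure"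
    and L :: "real \<Rightarrow> 'u::{real_inner,complete_space,second_countable_topology} \<Rightarrow> 'w \<Rightarrow> real"
    and S :: "real \<Rightarrow> ('v::{real_inner,complete_space,second_countable_topology} \<Rightarrow>\<^sub>L 'v)"
    and D :: "'v set" and A :: "'v \<Rightarrow> 'v"
    and B :: "'u \<Rightarrow>\<^sub>L 'v" and y0 :: 'v and T :: real
  assumes "prob_space M"
    and "cyl_levy M L"
    and "c0_semigroup S"
    and "is_generator S D A"
    and "stoch_integrable M L T (\<lambda>s. S s o\<^sub>L B)"
  shows "\<exists>Y. weak_solution M L T D A B y0 Y \<and>
           (\<forall>t\<in>{0..T}.
              (\<exists>I. stoch_int_set M L T (\<lambda>s. indicator {0..t} s *\<^sub>R (S (t - s) o\<^sub>L B)) {0..t} I) \<and>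
              (\<forall>I. stoch_int_set M L T (\<lambda>s. indicator {0..t} s *\<^sub>R (S (t - s) o\<^sub>L B)) {0..t} I \<longrightarrow>
                  (AE \<omega> in M. Y t \<omega> = blinfun_apply (S t) y0 + I \<omega>)))"
proof (cases "0 \<le> T")
  \<comment> \<open>For T < 0 the time interval is empty, and the zero process meets the conditions
    vacuously or with zero integrals.\<close>
  case False
  then have "{0..T} = {}" by simp
  then have "weak_solution M L T D A B y0 (\<lambda>_ _. 0)"
    by (simp add: weak_solution_def prog_measurable_def weakly_bochner_regular_def conv_in_prob_def set_integrable_def set_lebesgue_integral_def)
  then show ?thesis using \<open>{0..T} = {}\<close> by auto
next
  case True
  interpret levy_convolution M L S B T
    using assms True by (simp add: levy_convolution_def levy_convolution_axioms_def cylindrical_levy_def cylindrical_levy_axioms_def)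
  obtain Y where Yp: "prog_measurable M (nat_filtration M L) T Y"
    and Ym: "\<And>t. t \<in> {0..T} \<Longrightarrow> AE \<omega> in M. Y t \<omega> = mild y0 t \<omega>"
    using mild_progressive[of y0] by blast
  have "weak_solution M L T D A B y0 Y"
    unfolding weak_solution_def
    using Yp mild_weakly_bochner_regular[OF Yp Ym] mild_weak_equation[OF assms(4) _ Yp Ym] by blast
  moreover have "(\<exists>I. stoch_int_set M L T (\<lambda>s. indicator {0..t} s *\<^sub>R (S (t - s) o\<^sub>L B)) {0..t} I) \<and>
      (\<forall>I. stoch_int_set M L T (\<lambda>s. indicator {0..t} s *\<^sub>R (S (t - s) o\<^sub>L B)) {0..t} I \<longrightarrow>
        (AE \<omega> in M. Y t \<omega> = blinfun_apply (S t) y0 + I \<omega>))" if t: "t \<in> {0..T}" for t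
  \<comment> \<open>Y agrees with S t y0 + cI t, and any version I of the integral agrees almost
    surely with cI t, so the choice hidden in \<open>cI\<close> is immaterial.\<close>
  proof (intro conjI exI allI impI)
    have t': "0 \<le> t" "t \<le> T" using t by auto
    show "stoch_int_set M L T (\<lambda>s. indicator {0..t} s *\<^sub>R (S (t - s) o\<^sub>L B)) {0..t} (cI t)"
      by (rule stoch_int_set_convolution[OF t' cI(1)[OF t] cI(2)[OF t]])
    fix I assume "stoch_int_set M L T (\<lambda>s. indicator {0..t} s *\<^sub>R (S (t - s) o\<^sub>L B)) {0..t} I"
    from stoch_int_set_convolution_unique[OF t' cI(2)[OF t] this] Ym[OF t]
    show "AE \<omega> in M. Y t \<omega> = blinfun_apply (S t) y0 + I \<omega>" by eventually_elim (simp add: mild_def)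
  qed
  ultimately show ?thesis by blast
qed

end
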